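(* Let $\Omega\subset\mathbb R^2$ be a bounded domain, let $U[X]=\int_\Omega\big(\tfrac{\varrho^2}2-\varrho b\big)dx$ on $\mathsf{Diff}_{\varrho_0,\rm GN}(\Omega)$, and let $\mathcal M=\{X:\varrho_X-b=\bar H\}$ be its critical set, $\bar H=\frac1{|\Omega|}\int_\Omega(\varrho_0-b)\,dx$. If $X$ solves the geodesic equation on $\mathcal M$ (with respect to the metric $(\cdot,\cdot)_{\varrho_0,\rm GN}$), then $u=\dot X\circ X^{-1}$, $\varrho=\bar H+b$ and $v=A_\varrho u$ solve the Great Lake equations $$\begin{cases}\partial_tv+\nabla_uv+(\nabla u)v-\frac12\nabla|u|^2=\nabla\tilde\varphi,\\ v=u+\frac16\varrho^2\nabla\,\mathrm{div}\,u,\\ \mathrm{div}(\varrho u)=0,\\ \varrho=\bar H+b,\end{cases}$$ for some (time-dependent) function $\tilde\varphi$. The homogenized potential of $U$ is constant on $\mathcal M$, so the Takens limit system agrees with these equations.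
   Context: $b$ is a fixed smooth positive function on $\Omega$, $\varrho_0$ a smooth positive function. $\mathsf{Diff}(\Omega)$ is the group of smooth diffeomorphisms leaving the boundary invariant, with $T_X\mathsf{Diff}(\Omega)=\{\zeta\circ X:\zeta$ smooth, tangent to the boundary$\}$; $\varrho=\varrho_X=\frac{\varrho_0}{\det\nabla X}\circ X^{-1}$. $\mathsf{Diff}_{\varrho_0,\rm GN}(\Omega)$ is $\mathsf{Diff}(\Omega)$ with the metric $$(\xi\circ X,\eta\circ X)_{\varrho_0,\rm GN}=\int_\Omega\varrho\langle\xi,\eta\rangle+\tfrac13\varrho^3\,\mathrm{div}\xi\,\mathrm{div}\eta+\tfrac12\varrho^2\,\mathrm{div}\xi\,\langle\eta,\nabla b\rangle+\tfrac12\varrho^2\,\mathrm{div}\eta\,\langle\xi,\nabla b\rangle+\varrho\langle\xi,\nabla b\rangle\langle\eta,\nabla b\rangle=\int_\Omega\varrho\langle\xi,A_\varrho\eta\rangle,$$ $$A_\varrho\eta=\eta-\frac13\frac{\nabla(\varrho^3\mathrm{div}\eta)}\varrho-\frac12\frac{\nabla(\varrho^2\langle\eta,\nabla b\rangle)}\varrho+\frac12\varrho\,\mathrm{div}\eta\,\nabla b+\langle\eta,\nabla b\rangle\nabla b,$$ and $A_\varrho$ is regarded as invertible on smooth vector fields tangent to the boundary. $\nabla_{\dot X}\dot X$ denotes the covariant acceleration for the Levi-Civita connection of this metric (not the pointwise one). $T_X\mathcal M=\{\xi\circ X:\mathrm{div}(\varrho\xi)=0\}$, $N_X\mathcal M=\{\eta\circ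 X:A_\varrho\eta=\nabla\varphi$ for some function $\varphi\}$. The geodesic equation on $\mathcal M$ is $\nabla_{\dot X}\dot X\in N_X\mathcal M$, $X\in\mathcal M$. $(\nabla u)v$ is the vector field with components $((\nabla u)v)_j=\sum_i(\partial_ju_i)v_i$. A homogenized potential of $U$ is $V[X]=\sum_ic_i\sqrt{\lambda_i[X]}$ on $\mathcal M$, with constants $c_i\ge0$ and $\lambda_i[X]$ the eigenvalues of $\operatorname{Hess}U[X]|_{N_X\mathcal M}$ (sum formal); the Takens limit system of $\nabla_{\dot X}\dot X=-\varepsilon^{-2}\operatorname{grad}U[X]$ is $X\in\mathcal M$, $\nabla_{\dot X}\dot X+\operatorname{grad}V[X]\in N_X\mathcal M$. "The homogenized potential is constant" means the eigenvalues $\lambda_i[X]$ do not depend on $X\in\mathcal M$. *)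

theory Defs
  imports "HOL-Analysis.Analysis"
begin

section \<open>Smooth functions\<close>

type_synonym vec2 = "real ^ 2"
type_synonym vmap = "vec2 \<Rightarrow> vec2"

primrec Ck_on :: "nat \<Rightarrow> 'a::real_normed_vector set \<Rightarrow> ('a \<Rightarrow> 'b::real_normed_vector) \<Rightarrow> bool" where
  "Ck_on 0 S f \<longleftrightarrow> continuous_on S f"
| "Ck_on (Suc k) S f \<longleftrightarrow> (\<forall>x\<in>S. f differentiable (at x)) \<and>
     (\<forall>h. Ck_on k S (\<lambda>x. frechet_derivative f (at x) h))"

text \<open>Meant for open sets \<open>S\<close>.\<close>
definition smooth_on :: "'a::real_normed_vector set \<Rightarrow> ('a \<Rightarrow> 'b::real_normed_vector) \<Rightarrow> bool" where
  "smooth_on S f \<longleftrightarrow> (\<forall>k. Ck_on k S f)"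

text \<open>Smoothness up to the boundary: existence of a smooth extension. Configurations, vector
  fields and densities are total functions whose values outside the closed domain are irrelevant;
  their space derivatives below matter only at points of the open domain.\<close>
definition smooth_upto :: "vec2 set \<Rightarrow> (vec2 \<Rightarrow> 'b::real_normed_vector) \<Rightarrow> bool" where
  "smooth_upto \<Omega> f \<longleftrightarrow> (\<exists>F. smooth_on UNIV F \<and> (\<forall>x\<in>closure \<Omega>. F x = f x))"

definition smooth_time_upto ::
  "real set \<Rightarrow> vec2 set \<Rightarrow> (real \<Rightarrow> vec2 \<Rightarrow> 'b::real_normed_vector) \<Rightarrow> bool" where
  "smooth_time_upto J \<Omega> f \<longleftrightarrow>
     (\<exists>F. smooth_on (J \<times> UNIV) F \<and> (\<forall>t\<in>J. \<forall>x\<in>closure \<Omega>. F (t, x) = f t x))"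

definition grad :: "(vec2 \<Rightarrow> real) \<Rightarrow> vmap" where
  "grad f x = (\<chi> i. frechet_derivative f (at x) (axis i 1))"

definition divg :: "vmap \<Rightarrow> vec2 \<Rightarrow> real" where
  "divg \<xi> x = trace (jacobian \<xi> (at x))"

section \<open>The domain\<close>

definition defining_function :: "vec2 set \<Rightarrow> (vec2 \<Rightarrow> real) \<Rightarrow> bool" where
  "defining_function \<Omega> r \<longleftrightarrow>
     smooth_on UNIV r \<and> \<Omega> = {x. r x < 0} \<and> (\<forall>x. r x = 0 \<longrightarrow> grad r x \<noteq> 0)"

definition smooth_bounded_domain :: "vec2 set \<Rightarrow> bool" where
  "smooth_bounded_domain \<Omega> \<longleftrightarrow>
     \<Omega> \<noteq> {} \<and> open \<Omega> \<and> connected \<Omega> \<and> bounded \<Omega> \<and> (\<exists>r. defining_function \<Omega> r)"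

text \<open>On the boundary the gradient of any defining function is a nonzero normal vector, so the
  choice of \<open>r\<close> is immaterial.\<close>
definition tangent_to_boundary :: "vec2 set \<Rightarrow> vmap \<Rightarrow> bool" where
  "tangent_to_boundary \<Omega> \<zeta> \<longleftrightarrow>
     (\<forall>r. defining_function \<Omega> r \<longrightarrow> (\<forall>x\<in>frontier \<Omega>. \<zeta> x \<bullet> grad r x = 0))"

section \<open>The diffeomorphism group and its metric\<close>

definition Diff :: "vec2 set \<Rightarrow> vmap set" where
  "Diff \<Omega> = {X. bij_betw X (closure \<Omega>) (closure \<Omega>) \<and> X ` frontier \<Omega> = frontier \<Omega> \<and>
     smooth_upto \<Omega> X \<and> smooth_upto \<Omega> (the_inv_into (closure \<Omega>) X)}"

text \<open>The Eulerian field \<open>Y \<circ> X\<^sup>-\<^sup>1\<close> of a tangent vector \<open>Y\<close> at \<open>X\<close>.\<close>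
definition eulerian :: "vec2 set \<Rightarrow> vmap \<Rightarrow> vmap \<Rightarrow> vmap" where
  "eulerian \<Omega> X Y = (\<lambda>x. Y (the_inv_into (closure \<Omega>) X x))"

definition T_Diff :: "vec2 set \<Rightarrow> vmap \<Rightarrow> vmap set" where
  "T_Diff \<Omega> X = {Y. \<exists>\<zeta>. smooth_upto \<Omega> \<zeta> \<and> tangent_to_boundary \<Omega> \<zeta> \<and>
     (\<forall>x\<in>closure \<Omega>. Y x = \<zeta> (X x))}"

definition density :: "vec2 set \<Rightarrow> (vec2 \<Rightarrow> real) \<Rightarrow> vmap \<Rightarrow> vec2 \<Rightarrow> real" where
  "density \<Omega> \<rho>0 X x =
     (let a = the_inv_into (closure \<Omega>) X x in \<rho>0 a / det (jacobian X (at a)))"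

definition GN_metric ::
  "vec2 set \<Rightarrow> (vec2 \<Rightarrow> real) \<Rightarrow> (vec2 \<Rightarrow> real) \<Rightarrow> vmap \<Rightarrow> vmap \<Rightarrow> vmap \<Rightarrow> real" where
  "GN_metric \<Omega> b \<rho>0 X Y Z =
     (let \<rho> = density \<Omega> \<rho>0 X; \<xi> = eulerian \<Omega> X Y; \<eta> = eulerian \<Omega> X Z in
      integral \<Omega> (\<lambda>x. \<rho> x * (\<xi> x \<bullet> \<eta> x)
        + 1/3 * \<rho> x ^ 3 * divg \<xi> x * divg \<eta> x
        + 1/2 * \<rho> x ^ 2 * divg \<xi> x * (\<eta> x \<bullet> grad b x)
        + 1/2 * \<rho> x ^ 2 * divg \<eta> x * (\<xi> x \<bullet> grad b x)
        + \<rho> x * (\<xi> x \<bullet> grad b x) * (\<eta> x \<bullet> grad b x)))"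

definition A_op :: "(vec2 \<Rightarrow> real) \<Rightarrow> (vec2 \<Rightarrow> real) \<Rightarrow> vmap \<Rightarrow> vmap" where
  "A_op b \<rho> \<eta> = (\<lambda>x. \<eta> x
     - (1/3 / \<rho> x) *\<^sub>R grad (\<lambda>y. \<rho> y ^ 3 * divg \<eta> y) x
     - (1/2 / \<rho> x) *\<^sub>R grad (\<lambda>y. \<rho> y ^ 2 * (\<eta> y \<bullet> grad b y)) x
     + (1/2 * \<rho> x * divg \<eta> x) *\<^sub>R grad b x
     + (\<eta> x \<bullet> grad b x) *\<^sub>R grad b x)"

section \<open>Curves, gradients and the Levi-Civita connection\<close>

definition curve_in :: "vec2 set \<Rightarrow> vmap set \<Rightarrow> real set \<Rightarrow> (real \<Rightarrow> vmap) \<Rightarrow> bool" where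
  "curve_in \<Omega> S J \<gamma> \<longleftrightarrow> open J \<and> is_interval J \<and> smooth_time_upto J \<Omega> \<gamma> \<and> (\<forall>t\<in>J. \<gamma> t \<in> S)"

definition time_deriv :: "(real \<Rightarrow> vmap) \<Rightarrow> real \<Rightarrow> vmap" where
  "time_deriv Y t = (\<lambda>x. vector_derivative (\<lambda>s. Y s x) (at t))"

definition field_along :: "vec2 set \<Rightarrow> real set \<Rightarrow> (real \<Rightarrow> vmap) \<Rightarrow> (real \<Rightarrow> vmap) \<Rightarrow> bool" where
  "field_along \<Omega> J \<gamma> Y \<longleftrightarrow> smooth_time_upto J \<Omega> Y \<and> (\<forall>t\<in>J. Y t \<in> T_Diff \<Omega> (\<gamma> t))"

text \<open>\<open>\<Gamma>\<close> is the Christoffel map of a connection in the ambient linear space of maps from the closed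
  domain to the plane: the covariant derivative along \<open>\<gamma>\<close> is \<open>\<partial>\<^sub>t Y + \<Gamma>\<^sub>\<gamma>(\<gamma>', Y)\<close>.
  \<open>Diff \<Omega>\<close> is curved at the boundary, so \<open>\<partial>\<^sub>t Y\<close> and \<open>\<Gamma>\<close> need not be tangent separately.\<close>
definition cov_deriv ::
  "(vmap \<Rightarrow> vmap \<Rightarrow> vmap \<Rightarrow> vmap) \<Rightarrow> (real \<Rightarrow> vmap) \<Rightarrow> (real \<Rightarrow> vmap) \<Rightarrow> real \<Rightarrow> vmap" where
  "cov_deriv \<Gamma> \<gamma> Y t = (\<lambda>x. time_deriv Y t x + \<Gamma> (\<gamma> t) (time_deriv \<gamma> t) (Y t) x)"

text \<open>Bilinear and symmetric (torsion-free) Christoffel map, covariant derivatives of smooth fields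
  along curves are again such fields, and compatibility with the metric.\<close>
definition levi_civita ::
  "vec2 set \<Rightarrow> (vec2 \<Rightarrow> real) \<Rightarrow> (vec2 \<Rightarrow> real) \<Rightarrow> (vmap \<Rightarrow> vmap \<Rightarrow> vmap \<Rightarrow> vmap) \<Rightarrow> bool" where
  "levi_civita \<Omega> b \<rho>0 \<Gamma> \<longleftrightarrow>
     (\<forall>X\<in>Diff \<Omega>. \<forall>Y\<in>T_Diff \<Omega> X. \<forall>Y'\<in>T_Diff \<Omega> X. \<forall>Z\<in>T_Diff \<Omega> X. \<forall>a. \<forall>x\<in>closure \<Omega>.
        \<Gamma> X (\<lambda>y. a *\<^sub>R Y y + Y' y) Z x = a *\<^sub>R \<Gamma> X Y Z x + \<Gamma> X Y' Z x \<and>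
        \<Gamma> X Y Z x = \<Gamma> X Z Y x) \<and>
     (\<forall>J \<gamma>. curve_in \<Omega> (Diff \<Omega>) J \<gamma> \<longrightarrow>
        (\<forall>Y. field_along \<Omega> J \<gamma> Y \<longrightarrow> field_along \<Omega> J \<gamma> (cov_deriv \<Gamma> \<gamma> Y)) \<and>
        (\<forall>Y Z. field_along \<Omega> J \<gamma> Y \<and> field_along \<Omega> J \<gamma> Z \<longrightarrow>
          (\<forall>t\<in>J. ((\<lambda>s. GN_metric \<Omega> b \<rho>0 (\<gamma> s) (Y s) (Z s)) has_real_derivative
             GN_metric \<Omega> b \<rho>0 (\<gamma> t) (cov_deriv \<Gamma> \<gamma> Y t) (Z t)
             + GN_metric \<Omega> b \<rho>0 (\<gamma> t) (Y t) (cov_deriv \<Gamma> \<gamma> Z t)) (at t))))"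

text \<open>\<open>G\<close> is the gradient at \<open>X\<close> of the function \<open>F\<close> on the submanifold \<open>S\<close> of \<open>Diff \<Omega>\<close> with
  tangent space \<open>T\<close> at \<open>X\<close>, with respect to the induced metric.\<close>
definition is_gradient ::
  "vec2 set \<Rightarrow> (vec2 \<Rightarrow> real) \<Rightarrow> (vec2 \<Rightarrow> real) \<Rightarrow> vmap set \<Rightarrow> vmap set \<Rightarrow> (vmap \<Rightarrow> real)
     \<Rightarrow> vmap \<Rightarrow> vmap \<Rightarrow> bool" where
  "is_gradient \<Omega> b \<rho>0 S T F X G \<longleftrightarrow> G \<in> T \<and>
     (\<forall>J \<gamma>. 0 \<in> J \<and> curve_in \<Omega> S J \<gamma> \<and> (\<forall>x\<in>closure \<Omega>. \<gamma> 0 x = X x) \<longrightarrow>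
        ((\<lambda>s. F (\<gamma> s)) has_real_derivative GN_metric \<Omega> b \<rho>0 X G (time_deriv \<gamma> 0)) (at 0))"

text \<open>\<open>Z = (Hess F)[X] Y\<close>, where \<open>(Hess F) Y = \<nabla>\<^sub>Y grad F\<close> is evaluated along a curve
  with initial velocity \<open>Y\<close>.\<close>
definition has_hessian ::
  "vec2 set \<Rightarrow> (vec2 \<Rightarrow> real) \<Rightarrow> (vec2 \<Rightarrow> real) \<Rightarrow> (vmap \<Rightarrow> vmap \<Rightarrow> vmap \<Rightarrow> vmap) \<Rightarrow> (vmap \<Rightarrow> real)
     \<Rightarrow> vmap \<Rightarrow> vmap \<Rightarrow> vmap \<Rightarrow> bool" where
  "has_hessian \<Omega> b \<rho>0 \<Gamma> F X Y Z \<longleftrightarrow>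
     (\<exists>J \<gamma> G. 0 \<in> J \<and> curve_in \<Omega> (Diff \<Omega>) J \<gamma> \<and>
        (\<forall>x\<in>closure \<Omega>. \<gamma> 0 x = X x \<and> time_deriv \<gamma> 0 x = Y x) \<and>
        field_along \<Omega> J \<gamma> G \<and>
        (\<forall>t\<in>J. is_gradient \<Omega> b \<rho>0 (Diff \<Omega>) (T_Diff \<Omega> (\<gamma> t)) F (\<gamma> t) (G t)) \<and>
        (\<forall>x\<in>closure \<Omega>. Z x = cov_deriv \<Gamma> \<gamma> G 0 x))"

section \<open>The potential, its critical manifold, and the geodesic equation\<close>

definition U_pot :: "vec2 set \<Rightarrow> (vec2 \<Rightarrow> real) \<Rightarrow> (vec2 \<Rightarrow> real) \<Rightarrow> vmap \<Rightarrow> real" where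
  "U_pot \<Omega> b \<rho>0 X =
     integral \<Omega> (\<lambda>x. (density \<Omega> \<rho>0 X x)\<^sup>2 / 2 - density \<Omega> \<rho>0 X x * b x)"

definition H_mean :: "vec2 set \<Rightarrow> (vec2 \<Rightarrow> real) \<Rightarrow> (vec2 \<Rightarrow> real) \<Rightarrow> real" where
  "H_mean \<Omega> b \<rho>0 = integral \<Omega> (\<lambda>x. \<rho>0 x - b x) / measure lebesgue \<Omega>"

definition M_crit :: "vec2 set \<Rightarrow> (vec2 \<Rightarrow> real) \<Rightarrow> (vec2 \<Rightarrow> real) \<Rightarrow> vmap set" where
  "M_crit \<Omega> b \<rho>0 = {X \<in> Diff \<Omega>. \<forall>x\<in>\<Omega>. density \<Omega> \<rho>0 X x - b x = H_mean \<Omega> b \<rho>0}"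

definition T_M :: "vec2 set \<Rightarrow> (vec2 \<Rightarrow> real) \<Rightarrow> vmap \<Rightarrow> vmap set" where
  "T_M \<Omega> \<rho>0 X = {Y \<in> T_Diff \<Omega> X.
     \<forall>x\<in>\<Omega>. divg (\<lambda>y. density \<Omega> \<rho>0 X y *\<^sub>R eulerian \<Omega> X Y y) x = 0}"

definition N_M :: "vec2 set \<Rightarrow> (vec2 \<Rightarrow> real) \<Rightarrow> (vec2 \<Rightarrow> real) \<Rightarrow> vmap \<Rightarrow> vmap set" where
  "N_M \<Omega> b \<rho>0 X = {Y \<in> T_Diff \<Omega> X. \<exists>\<phi>. smooth_upto \<Omega> \<phi> \<and>
     (\<forall>x\<in>\<Omega>. A_op b (density \<Omega> \<rho>0 X) (eulerian \<Omega> X Y) x = grad \<phi> x)}"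

definition geodesic_on_M ::
  "vec2 set \<Rightarrow> (vec2 \<Rightarrow> real) \<Rightarrow> (vec2 \<Rightarrow> real) \<Rightarrow> (vmap \<Rightarrow> vmap \<Rightarrow> vmap \<Rightarrow> vmap)
     \<Rightarrow> real set \<Rightarrow> (real \<Rightarrow> vmap) \<Rightarrow> bool" where
  "geodesic_on_M \<Omega> b \<rho>0 \<Gamma> J X \<longleftrightarrow> curve_in \<Omega> (M_crit \<Omega> b \<rho>0) J X \<and>
     (\<forall>t\<in>J. cov_deriv \<Gamma> X (time_deriv X) t \<in> N_M \<Omega> b \<rho>0 (X t))"

section \<open>Homogenized potential and Takens limit system\<close>

definition eigenspace ::
  "vec2 set \<Rightarrow> (vec2 \<Rightarrow> real) \<Rightarrow> (vec2 \<Rightarrow> real) \<Rightarrow> (vmap \<Rightarrow> vmap \<Rightarrow> vmap \<Rightarrow> vmap)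
     \<Rightarrow> vmap \<Rightarrow> real \<Rightarrow> vmap set" where
  "eigenspace \<Omega> b \<rho>0 \<Gamma> X \<mu> = {Y \<in> N_M \<Omega> b \<rho>0 X.
     has_hessian \<Omega> b \<rho>0 \<Gamma> (U_pot \<Omega> b \<rho>0) X Y (\<lambda>x. \<mu> *\<^sub>R Y x)}"

text \<open>The dimension of the eigenspace (\<open>0\<close> if \<open>\<mu>\<close> is not an eigenvalue); linear independence is
  that of functions on the closed domain.\<close>
definition eig_mult ::
  "vec2 set \<Rightarrow> (vec2 \<Rightarrow> real) \<Rightarrow> (vec2 \<Rightarrow> real) \<Rightarrow> (vmap \<Rightarrow> vmap \<Rightarrow> vmap \<Rightarrow> vmap)
     \<Rightarrow> vmap \<Rightarrow> real \<Rightarrow> enat" where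
  "eig_mult \<Omega> b \<rho>0 \<Gamma> X \<mu> = Sup {enat n | n. \<exists>e :: nat \<Rightarrow> vmap.
     (\<forall>i<n. e i \<in> eigenspace \<Omega> b \<rho>0 \<Gamma> X \<mu>) \<and>
     (\<forall>a. (\<forall>x\<in>closure \<Omega>. (\<Sum>i<n. a i *\<^sub>R e i x) = 0) \<longrightarrow> (\<forall>i<n. a i = 0))}"

text \<open>\<open>(lam X i)\<close> for \<open>i \<in> I X\<close> lists the eigenvalues of the Hessian restricted to the normal space
  at \<open>X\<close>, repeated according to multiplicity, the labels being attached by a rule that looks only
  at the spectrum (such as increasing order, when the eigenvalues can be so ordered).\<close>
definition eigenvalue_labelling ::
  "vec2 set \<Rightarrow> (vec2 \<Rightarrow> real) \<Rightarrow> (vec2 \<Rightarrow> real) \<Rightarrow> (vmap \<Rightarrow> vmap \<Rightarrow> vmap \<Rightarrow> vmap)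
     \<Rightarrow> (vmap \<Rightarrow> nat set) \<Rightarrow> (vmap \<Rightarrow> nat \<Rightarrow> real) \<Rightarrow> bool" where
  "eigenvalue_labelling \<Omega> b \<rho>0 \<Gamma> I lam \<longleftrightarrow>
     (\<forall>X\<in>M_crit \<Omega> b \<rho>0. \<forall>\<mu>.
        (if finite {i\<in>I X. lam X i = \<mu>} then enat (card {i\<in>I X. lam X i = \<mu>}) else \<infinity>)
          = eig_mult \<Omega> b \<rho>0 \<Gamma> X \<mu>) \<and>
     (\<forall>X\<in>M_crit \<Omega> b \<rho>0. \<forall>Y\<in>M_crit \<Omega> b \<rho>0.
        eig_mult \<Omega> b \<rho>0 \<Gamma> X = eig_mult \<Omega> b \<rho>0 \<Gamma> Y \<longrightarrow>
        I X = I Y \<and> (\<forall>i\<in>I X. lam X i = lam Y i))"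

text \<open>A formal sum: if the series diverges, \<open>infsum\<close> returns a default value.\<close>
definition homogenized_potential ::
  "(vmap \<Rightarrow> nat set) \<Rightarrow> (vmap \<Rightarrow> nat \<Rightarrow> real) \<Rightarrow> (nat \<Rightarrow> real) \<Rightarrow> vmap \<Rightarrow> real" where
  "homogenized_potential I lam c X = infsum (\<lambda>i. c i * sqrt (lam X i)) (I X)"

definition takens_limit ::
  "vec2 set \<Rightarrow> (vec2 \<Rightarrow> real) \<Rightarrow> (vec2 \<Rightarrow> real) \<Rightarrow> (vmap \<Rightarrow> vmap \<Rightarrow> vmap \<Rightarrow> vmap) \<Rightarrow> (vmap \<Rightarrow> real)
     \<Rightarrow> real set \<Rightarrow> (real \<Rightarrow> vmap) \<Rightarrow> bool" where
  "takens_limit \<Omega> b \<rho>0 \<Gamma> V J X \<longleftrightarrow> curve_in \<Omega> (M_crit \<Omega> b \<rho>0) J X \<and>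
     (\<forall>t\<in>J. \<exists>G. is_gradient \<Omega> b \<rho>0 (M_crit \<Omega> b \<rho>0) (T_M \<Omega> \<rho>0 (X t)) V (X t) G \<and>
        (\<lambda>x. cov_deriv \<Gamma> X (time_deriv X) t x + G x) \<in> N_M \<Omega> b \<rho>0 (X t))"

section \<open>The Great Lake equations\<close>

definition great_lake ::
  "vec2 set \<Rightarrow> (vec2 \<Rightarrow> real) \<Rightarrow> real \<Rightarrow> real set \<Rightarrow> (real \<Rightarrow> vmap) \<Rightarrow> (vec2 \<Rightarrow> real)
     \<Rightarrow> (real \<Rightarrow> vmap) \<Rightarrow> bool" where
  "great_lake \<Omega> b H J u \<rho> v \<longleftrightarrow>
     smooth_on (J \<times> \<Omega>) (\<lambda>(t, x). u t x) \<and> smooth_on (J \<times> \<Omega>) (\<lambda>(t, x). v t x) \<and>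
     (\<exists>\<phi> :: real \<Rightarrow> vec2 \<Rightarrow> real. (\<forall>t\<in>J. smooth_upto \<Omega> (\<phi> t)) \<and>
       (\<forall>t\<in>J. \<forall>x\<in>\<Omega>.
          time_deriv v t x + frechet_derivative (v t) (at x) (u t x)
            + transpose (jacobian (u t) (at x)) *v v t x
            - (1/2) *\<^sub>R grad (\<lambda>y. (norm (u t y))\<^sup>2) x = grad (\<phi> t) x \<and>
          v t x = u t x + (1/6 * (\<rho> x)\<^sup>2) *\<^sub>R grad (divg (u t)) x \<and>
          divg (\<lambda>y. \<rho> y *\<^sub>R u t y) x = 0 \<and>
          \<rho> x = H + b x))"

text \<open>The triple \<open>u = X' \<circ> X\<^sup>-\<^sup>1\<close>, \<open>\<rho> = H + b\<close>, \<open>v = A\<^sub>\<rho> u\<close> attached to a curve \<open>X\<close> solves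
  the Great Lake equations.\<close>
definition solves_great_lake ::
  "vec2 set \<Rightarrow> (vec2 \<Rightarrow> real) \<Rightarrow> (vec2 \<Rightarrow> real) \<Rightarrow> real set \<Rightarrow> (real \<Rightarrow> vmap) \<Rightarrow> bool" where
  "solves_great_lake \<Omega> b \<rho>0 J X \<longleftrightarrow>
     (let H = H_mean \<Omega> b \<rho>0;
          u = (\<lambda>t. eulerian \<Omega> (X t) (time_deriv X t));
          \<rho> = (\<lambda>x. H + b x);
          v = (\<lambda>t. A_op b \<rho> (u t))
      in great_lake \<Omega> b H J u \<rho> v)"

end

theory Submission
  imports Defs
begin

text \<open>
  Every field tangent to the boundary generates a smooth flow of diffeomorphisms of the closed domain,
  and these flows supply the test curves. On \<open>M\<close> the gradient of the potential vanishes, so the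
  Hessian there is the plain time derivative of the gradient along a curve and does not involve the
  connection coefficients. Composing on the right with a relabelling that preserves \<open>\<rho>0\<close> is an
  isometry preserving the potential, hence conjugates the Hessians at any two points of \<open>M\<close>, and the
  spectrum is constant. A constant potential has gradient zero, because the flows of tangential fields
  \<open>\<xi>\<close> with \<open>div (\<rho> \<xi>) = 0\<close> stay in \<open>M\<close>. For the equation of motion, pair the covariant
  acceleration with a compactly supported test field: metric compatibility gives the time derivative
  of the momentum, torsion-freeness turns the remaining term into the derivative of the kinetic energy
  along the flow of the test field, and integrating by parts identifies \<open>A\<^sub>\<rho>\<close> of the covariant
  acceleration with the left-hand side of the momentum equation.\<close>

section \<open>Smooth functions\<close>

text \<open>A configuration plus a multiple of a tangent vector is in general no configuration,
  because the boundary must be preserved. Hence test curves have to be flows, and joint smoothness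
  of flows in time and space is a large share of the work. \<open>\<Gamma>\<close> is known only
  through its axioms and acts on total functions, while the geometry sees values on the closed
  domain only; so no formula for \<open>\<Gamma>\<close> can be used, and insensitivity to values
  elsewhere has to be proved. On \<open>M\<close> the potential is minimal along every flow: with b
  = \<rho> - H and conserved mass, its increase is half the integral of (\<sigma> - \<rho>)^2 for
  the new density \<sigma>. Vanishing of a gradient is then read off from the metric, which is
  definite because \<rho> is a density and has no zero; its sign may be negative, as configurations
  may reverse orientation. The kinetic energy varies along a flow through the density and through
  the Eulerian velocity; incompressibility leaves of the former only the |u|^2 term. The factor 1/6
  is 1/2 - 1/3, from the coefficients of the two gradient terms of A.\<close>

lemma has_derivative_cong_open:
  assumes "open S" "x \<in> S" "\<And>y. y \<in> S \<Longrightarrow> f y = g y"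
  shows "(f has_derivative D) (at x) \<longleftrightarrow> (g has_derivative D) (at x)"
  using assms has_derivative_transform_within_open[of f D x UNIV S g]
    has_derivative_transform_within_open[of g D x UNIV S f] by auto

lemma frechet_derivative_cong_open:
  assumes "open S" "x \<in> S" "\<And>y. y \<in> S \<Longrightarrow> f y = g y"
  shows "frechet_derivative f (at x) = frechet_derivative g (at x)"
  unfolding frechet_derivative_def using has_derivative_cong_open[OF assms] by simp

lemma frechet_derivativeI:
  "(f has_derivative D) (at x) \<Longrightarrow> frechet_derivative f (at x) = D"
  using frechet_derivative_at by metis

lemma Ck_on_cong:
  assumes "open S" "\<And>x. x \<in> S \<Longrightarrow> f x = g x"
  shows "Ck_on k S f \<longleftrightarrow> Ck_on k S g"
  using assms(2)
proof (induction k arbitrary: f g)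
  case 0
  then show ?case by (simp cong: continuous_on_cong)
next
  case (Suc k)
  have 1: "frechet_derivative f (at x) = frechet_derivative g (at x)" if "x \<in> S" for x
    using frechet_derivative_cong_open[OF assms(1) that] Suc.prems by blast
  have 2: "f differentiable at x \<longleftrightarrow> g differentiable at x" if "x \<in> S" for x
    unfolding differentiable_def using has_derivative_cong_open[OF assms(1) that] Suc.prems by blast
  have "Ck_on k S (\<lambda>x. frechet_derivative f (at x) h) \<longleftrightarrow>
     Ck_on k S (\<lambda>x. frechet_derivative g (at x) h)" for h
    by (rule Suc.IH) (simp add: 1)
  then show ?case using 2 by simp
qed

text \<open>\<open>Ck_on\<close> speaks of \<open>frechet_derivative\<close>, a chosen value. Here
  an explicit derivative \<open>D\<close> may be exhibited instead, and it is enough that every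
  directional derivative is one class less regular.\<close>

lemma Ck_on_SucI:
  assumes "open S" "\<And>x. x \<in> S \<Longrightarrow> (f has_derivative D x) (at x)" "\<And>h. Ck_on k S (\<lambda>x. D x h)"
  shows "Ck_on (Suc k) S f"
proof -
  have "frechet_derivative f (at x) = D x" if "x \<in> S" for x
    using frechet_derivativeI assms(2) that by blast
  then have "Ck_on k S (\<lambda>x. frechet_derivative f (at x) h) \<longleftrightarrow> Ck_on k S (\<lambda>x. D x h)" for h
    by (intro Ck_on_cong assms) simp
  then show ?thesis using assms by (auto simp: differentiable_def)
qed

lemma Ck_on_has_derivative:
  assumes "Ck_on (Suc k) S f" "x \<in> S"
  shows "(f has_derivative frechet_derivative f (at x)) (at x)"
  using assms frechet_derivative_works by auto

lemma Ck_on_pred: "Ck_on (Suc k) S f \<Longrightarrow> Ck_on k S f"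
proof (induction k arbitrary: f)
  case 0
  then show ?case
    by (auto intro!: continuous_at_imp_continuous_on differentiable_imp_continuous_within)
next
  case (Suc k)
  then show ?case by (metis Ck_on.simps(2))
qed

lemma Ck_on_le: "Ck_on n S f \<Longrightarrow> m \<le> n \<Longrightarrow> Ck_on m S f"
  by (induction n) (auto simp: le_Suc_eq simp del: Ck_on.simps dest: Ck_on_pred)

lemma Ck_on_subset: "Ck_on k S f \<Longrightarrow> T \<subseteq> S \<Longrightarrow> Ck_on k T f"
  by (induction k arbitrary: f) (auto intro: continuous_on_subset)

lemma Ck_on_const: "open S \<Longrightarrow> Ck_on k S (\<lambda>x. c)"
proof (induction k arbitrary: c)
  case (Suc k)
  then show ?case by (intro Ck_on_SucI[where D="\<lambda>x h. 0"]) auto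
qed auto

lemma Ck_on_bounded_linear:
  assumes "bounded_linear L" "open S" "Ck_on k S f"
  shows "Ck_on k S (\<lambda>x. L (f x))"
  using assms(3)
proof (induction k arbitrary: f)
  case 0
  then show ?case using assms(1)
    by (simp add: bounded_linear.continuous_on)
next
  case (Suc k)
  have "Ck_on k S (\<lambda>x. L (frechet_derivative f (at x) h))" for h
    using Suc by simp
  then show ?case
    using bounded_linear.has_derivative[OF assms(1) Ck_on_has_derivative[OF Suc.prems]]
    by (intro Ck_on_SucI[where D="\<lambda>x h. L (frechet_derivative f (at x) h)"] assms(2)) auto
qed

lemma Ck_on_linear:
  assumes "bounded_linear L" "open S" shows "Ck_on k S L"
proof (cases k)
  case 0
  then show ?thesis using assms bounded_linear.continuous_on[OF assms(1) continuous_on_id] by simp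
next
  case (Suc k)
  then show ?thesis
    using assms bounded_linear_imp_has_derivative[OF assms(1)] Ck_on_SucI[OF assms(2), of L "\<lambda>x. L"]
      Ck_on_const[OF assms(2)] by auto
qed

lemma Ck_on_add:
  assumes "open S" "Ck_on k S f" "Ck_on k S g"
  shows "Ck_on k S (\<lambda>x. f x + g x)"
  using assms(2,3)
proof (induction k arbitrary: f g)
  case (Suc k)
  have "Ck_on k S (\<lambda>x. frechet_derivative f (at x) h + frechet_derivative g (at x) h)" for h
    using Suc by simp
  then show ?case
    using Ck_on_has_derivative[OF Suc.prems(1)] Ck_on_has_derivative[OF Suc.prems(2)]
    by (intro Ck_on_SucI[where D="\<lambda>x h. frechet_derivative f (at x) h + frechet_derivative g (at x) h"] assms)
      (auto intro!: derivative_eq_intros)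
qed (auto intro: continuous_intros)

lemma Ck_on_bilinear:
  assumes "bounded_bilinear B" "open S" "Ck_on k S f" "Ck_on k S g"
  shows "Ck_on k S (\<lambda>x. B (f x) (g x))"
  using assms(3,4)
proof (induction k arbitrary: f g)
  case 0
  then show ?case using bounded_bilinear.continuous_on[OF assms(1)] by simp
next
  case (Suc k)
  have "Ck_on k S (\<lambda>x. B (f x) (frechet_derivative g (at x) h) + B (frechet_derivative f (at x) h) (g x))" for h
    using Suc Ck_on_pred[OF Suc.prems(1)] Ck_on_pred[OF Suc.prems(2)]
    by (intro Ck_on_add assms) simp_all
  then show ?case
    using bounded_bilinear.FDERIV[OF assms(1) Ck_on_has_derivative[OF Suc.prems(1)] Ck_on_has_derivative[OF Suc.prems(2)]]
    by (intro Ck_on_SucI[where D="\<lambda>x h. B (f x) (frechet_derivative g (at x) h) + B (frechet_derivative f (at x) h) (g x)"] assms) auto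
qed

lemma Ck_on_sum:
  assumes "open S" "\<And>i. i \<in> I \<Longrightarrow> Ck_on k S (f i)"
  shows "Ck_on k S (\<lambda>x. \<Sum>i\<in>I. f i x)"
  using assms(2) by (induction I rule: infinite_finite_induct) (auto intro: Ck_on_add assms Ck_on_const)

lemma Ck_on_euclidean_iff:
  fixes f :: "'a::real_normed_vector \<Rightarrow> 'b::euclidean_space"
  assumes "open S"
  shows "Ck_on k S f \<longleftrightarrow> (\<forall>i\<in>Basis. Ck_on k S (\<lambda>x. f x \<bullet> i))"
proof
  assume "Ck_on k S f"
  then show "\<forall>i\<in>Basis. Ck_on k S (\<lambda>x. f x \<bullet> i)"
    using Ck_on_bounded_linear[OF bounded_linear_inner_left assms] by blast
next
  assume *: "\<forall>i\<in>Basis. Ck_on k S (\<lambda>x. f x \<bullet> i)"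
  have "Ck_on k S (\<lambda>x. \<Sum>i\<in>Basis. (f x \<bullet> i) *\<^sub>R i)"
    using * by (intro Ck_on_sum assms Ck_on_bounded_linear[OF bounded_linear_scaleR_left assms]) auto
  then show "Ck_on k S f" by (simp add: euclidean_representation)
qed

text \<open>Regularity of an operator-valued map is tested on fixed vectors only. Since the argument
  space is finite-dimensional, expanding \<open>w x\<close> in the basis reduces the varying
  argument to finitely many fixed ones.\<close>

lemma Ck_on_linear_apply:
  fixes w :: "'a::real_normed_vector \<Rightarrow> 'b::euclidean_space"
  assumes "open S" "\<And>x. x \<in> S \<Longrightarrow> linear (A x)" "\<And>v. Ck_on k S (\<lambda>x. A x v)" "Ck_on k S w"
  shows "Ck_on k S (\<lambda>x. A x (w x))"
proof -
  have "A x (w x) = (\<Sum>i\<in>Basis. (w x \<bullet> i) *\<^sub>R A x i)" if "x \<in> S" for x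
    using linear_sum[OF assms(2)[OF that], of "\<lambda>i. (w x \<bullet> i) *\<^sub>R i" Basis] linear_scale[OF assms(2)[OF that]]
    by (simp add: euclidean_representation)
  moreover have "Ck_on k S (\<lambda>x. \<Sum>i\<in>Basis. (w x \<bullet> i) *\<^sub>R A x i)"
    using Ck_on_bounded_linear[OF bounded_linear_inner_left assms(1) assms(4)] assms
    by (intro Ck_on_sum Ck_on_bilinear[OF bounded_bilinear_scaleR]) auto
  ultimately show ?thesis using Ck_on_cong[OF assms(1)] by (metis (no_types, lifting))
qed

text \<open>Induction on \<open>k\<close> over all outer functions: the chain rule produces the
  derivative of \<open>g\<close> at \<open>f x\<close> applied to a direction that itself varies
  with \<open>x\<close>, and \<open>Ck_on_linear_apply\<close> separates the two
  dependences.\<close>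

lemma Ck_on_compose:
  fixes f :: "'a::real_normed_vector \<Rightarrow> 'b::euclidean_space"
  assumes "open S" "Ck_on k S f" "Ck_on k T g" "\<And>x. x \<in> S \<Longrightarrow> f x \<in> T"
  shows "Ck_on k S (\<lambda>x. g (f x))"
  using assms(2,3)
proof (induction k arbitrary: g)
  case 0
  then show ?case using continuous_on_compose2[of T g S f] assms(4) by (simp add: image_subset_iff)
next
  case (Suc k)
  let ?D = "\<lambda>x h. frechet_derivative g (at (f x)) (frechet_derivative f (at x) h)"
  have "Ck_on k S (\<lambda>x. ?D x h)" for h
  proof (rule Ck_on_linear_apply[OF assms(1)])
    show "linear (frechet_derivative g (at (f x)))" if "x \<in> S" for x
      using has_derivative_linear[OF Ck_on_has_derivative[OF Suc.prems(2) assms(4)[OF that]]] .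
    show "Ck_on k S (\<lambda>x. frechet_derivative g (at (f x)) v)" for v
      by (rule Suc.IH[OF Ck_on_pred[OF Suc.prems(1)]]) (use Suc.prems(2) in simp)
    show "Ck_on k S (\<lambda>x. frechet_derivative f (at x) h)"
      using Suc.prems(1) by simp
  qed
  then show ?case
    using diff_chain_at[OF Ck_on_has_derivative[OF Suc.prems(1)] Ck_on_has_derivative[OF Suc.prems(2)]] assms(4)
    by (intro Ck_on_SucI[where D="?D"] assms(1)) (auto simp: o_def)
qed

text \<open>The derivative of 1/f is a product of 1/f, the derivative of f and 1/f again, so the
  induction hypothesis for 1/f covers every factor.\<close>

lemma Ck_on_inverse:
  fixes f :: "'a::real_normed_vector \<Rightarrow> real"
  assumes "open S" "Ck_on k S f" "\<And>x. x \<in> S \<Longrightarrow> f x \<noteq> 0"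
  shows "Ck_on k S (\<lambda>x. inverse (f x))"
  using assms(2)
proof (induction k)
  case 0
  then show ?case using assms(3) by (auto intro!: continuous_intros)
next
  case (Suc k)
  let ?D = "\<lambda>x h. - (inverse (f x) * frechet_derivative f (at x) h * inverse (f x))"
  have "Ck_on k S (\<lambda>x. ?D x h)" for h
    using Suc Ck_on_pred[OF Suc.prems]
    by (intro Ck_on_bounded_linear[OF bounded_linear_minus] Ck_on_bilinear[OF bounded_bilinear_mult] assms
       bounded_linear_ident) auto
  then show ?case
    using Deriv.has_derivative_inverse[OF assms(3) Ck_on_has_derivative[OF Suc.prems]]
    by (intro Ck_on_SucI[where D="?D"] assms(1)) (auto)
qed

section \<open>Closure properties of smooth functions\<close>

lemma smooth_on_cong:
  "open S \<Longrightarrow> (\<And>x. x \<in> S \<Longrightarrow> f x = g x) \<Longrightarrow> smooth_on S f \<longleftrightarrow> smooth_on S g"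
  unfolding smooth_on_def using Ck_on_cong by blast

lemma smooth_on_subset: "smooth_on S f \<Longrightarrow> T \<subseteq> S \<Longrightarrow> smooth_on T f"
  unfolding smooth_on_def using Ck_on_subset by blast

lemma smooth_on_has_derivative:
  "smooth_on S f \<Longrightarrow> x \<in> S \<Longrightarrow> (f has_derivative frechet_derivative f (at x)) (at x)"
  unfolding smooth_on_def using Ck_on_has_derivative by blast

lemma smooth_on_differentiable: "smooth_on S f \<Longrightarrow> x \<in> S \<Longrightarrow> f differentiable (at x)"
  using smooth_on_has_derivative differentiable_def by blast

lemma smooth_on_continuous_on: "smooth_on S f \<Longrightarrow> continuous_on S f"
  unfolding smooth_on_def using Ck_on.simps(1) by blast

lemma smooth_on_derivative_dir: "smooth_on S f \<Longrightarrow> smooth_on S (\<lambda>x. frechet_derivative f (at x) h)"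
  unfolding smooth_on_def using Ck_on.simps(2) by blast

lemma smooth_on_linear_apply:
  fixes w :: "'a::real_normed_vector \<Rightarrow> 'b::euclidean_space"
  assumes "open S" "\<And>x. x \<in> S \<Longrightarrow> linear (A x)" "\<And>v. smooth_on S (\<lambda>x. A x v)" "smooth_on S w"
  shows "smooth_on S (\<lambda>x. A x (w x))"
  unfolding smooth_on_def
proof
  fix k show "Ck_on k S (\<lambda>x. A x (w x))"
    by (rule Ck_on_linear_apply[OF assms(1,2)]) (use assms(3,4) in \<open>simp_all add: smooth_on_def\<close>)
qed

lemma smooth_on_derivative_apply:
  fixes f :: "'a::euclidean_space \<Rightarrow> 'b::real_normed_vector"
  assumes "open S" "smooth_on S f" "smooth_on S w"
  shows "smooth_on S (\<lambda>x. frechet_derivative f (at x) (w x))"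
  by (rule smooth_on_linear_apply[OF assms(1) _ smooth_on_derivative_dir[OF assms(2)] assms(3)])
    (rule has_derivative_linear[OF smooth_on_has_derivative[OF assms(2)]])

lemma smooth_on_compose:
  fixes f :: "'a::real_normed_vector \<Rightarrow> 'b::euclidean_space"
  assumes "open S" "smooth_on S f" "smooth_on T g" "\<And>x. x \<in> S \<Longrightarrow> f x \<in> T"
  shows "smooth_on S (\<lambda>x. g (f x))"
  using assms Ck_on_compose unfolding smooth_on_def by blast

lemma smooth_on_const: "open S \<Longrightarrow> smooth_on S (\<lambda>x. c)"
  by (simp add: smooth_on_def Ck_on_const)

lemma smooth_on_bounded_linear:
  "open S \<Longrightarrow> bounded_linear L \<Longrightarrow> smooth_on S f \<Longrightarrow> smooth_on S (\<lambda>x. L (f x))"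
  by (simp add: smooth_on_def Ck_on_bounded_linear)

lemma smooth_on_linear: "open S \<Longrightarrow> bounded_linear L \<Longrightarrow> smooth_on S L"
  by (simp add: smooth_on_def Ck_on_linear)

lemma smooth_on_id: "open S \<Longrightarrow> smooth_on S (\<lambda>x. x)"
  by (simp add: smooth_on_linear)

lemma smooth_on_fst: "open S \<Longrightarrow> smooth_on S fst"
  by (simp add: smooth_on_linear bounded_linear_fst)

lemma smooth_on_snd: "open S \<Longrightarrow> smooth_on S snd"
  by (simp add: smooth_on_linear bounded_linear_snd)

lemma smooth_on_add:
  "open S \<Longrightarrow> smooth_on S f \<Longrightarrow> smooth_on S g \<Longrightarrow> smooth_on S (\<lambda>x. f x + g x)"
  by (simp add: smooth_on_def Ck_on_add)

lemma smooth_on_minus: "open S \<Longrightarrow> smooth_on S f \<Longrightarrow> smooth_on S (\<lambda>x. - f x)"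
  using smooth_on_bounded_linear[OF _ bounded_linear_minus[OF bounded_linear_ident]] by blast

lemma smooth_on_diff:
  "open S \<Longrightarrow> smooth_on S f \<Longrightarrow> smooth_on S g \<Longrightarrow> smooth_on S (\<lambda>x. f x - g x)"
  using smooth_on_add[of S f "\<lambda>x. - g x"] smooth_on_minus by auto

lemma smooth_on_mult:
  fixes f g :: "'a::real_normed_vector \<Rightarrow> real"
  shows "open S \<Longrightarrow> smooth_on S f \<Longrightarrow> smooth_on S g \<Longrightarrow> smooth_on S (\<lambda>x. f x * g x)"
  by (simp add: smooth_on_def Ck_on_bilinear[OF bounded_bilinear_mult])

lemma smooth_on_scaleR:
  "open S \<Longrightarrow> smooth_on S f \<Longrightarrow> smooth_on S g \<Longrightarrow> smooth_on S (\<lambda>x. f x *\<^sub>R g x)"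
  by (simp add: smooth_on_def Ck_on_bilinear[OF bounded_bilinear_scaleR])

lemma smooth_on_inner:
  "open S \<Longrightarrow> smooth_on S f \<Longrightarrow> smooth_on S g \<Longrightarrow> smooth_on S (\<lambda>x. f x \<bullet> g x)"
  by (simp add: smooth_on_def Ck_on_bilinear[OF bounded_bilinear_inner])

lemma smooth_on_power:
  fixes f :: "'a::real_normed_vector \<Rightarrow> real"
  shows "open S \<Longrightarrow> smooth_on S f \<Longrightarrow> smooth_on S (\<lambda>x. f x ^ n)"
  by (induction n) (auto intro: smooth_on_mult smooth_on_const)

lemma smooth_on_inverse:
  fixes f :: "'a::real_normed_vector \<Rightarrow> real"
  shows "open S \<Longrightarrow> smooth_on S f \<Longrightarrow> (\<And>x. x \<in> S \<Longrightarrow> f x \<noteq> 0) \<Longrightarrow> smooth_on S (\<lambda>x. inverse (f x))"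
  by (simp add: smooth_on_def Ck_on_inverse)

lemma smooth_on_divide:
  fixes f g :: "'a::real_normed_vector \<Rightarrow> real"
  shows "open S \<Longrightarrow> smooth_on S f \<Longrightarrow> smooth_on S g \<Longrightarrow> (\<And>x. x \<in> S \<Longrightarrow> g x \<noteq> 0) \<Longrightarrow>
    smooth_on S (\<lambda>x. f x / g x)"
  unfolding divide_inverse by (intro smooth_on_mult smooth_on_inverse)

lemma smooth_on_vec_nth:
  fixes f :: "'a::real_normed_vector \<Rightarrow> real ^ 'n"
  shows "open S \<Longrightarrow> smooth_on S f \<Longrightarrow> smooth_on S (\<lambda>x. f x $ i)"
  using smooth_on_bounded_linear[OF _ bounded_linear_vec_nth] by blast

lemma smooth_on_euclidean_iff:
  fixes f :: "'a::real_normed_vector \<Rightarrow> 'b::euclidean_space"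
  assumes "open S"
  shows "smooth_on S f \<longleftrightarrow> (\<forall>i\<in>Basis. smooth_on S (\<lambda>x. f x \<bullet> i))"
  using Ck_on_euclidean_iff[OF assms] unfolding smooth_on_def by blast

lemma smooth_on_vec:
  fixes f :: "'a::real_normed_vector \<Rightarrow> real ^ 'n"
  assumes "open S" "\<And>i. smooth_on S (\<lambda>x. f x $ i)"
  shows "smooth_on S f"
  unfolding smooth_on_euclidean_iff[OF assms(1), of f] Basis_vec_def
  using assms(2) by (auto simp: inner_axis)

lemma smooth_on_Pair:
  fixes f :: "'a::real_normed_vector \<Rightarrow> 'b::euclidean_space" and g :: "'a \<Rightarrow> 'c::euclidean_space"
  assumes "open S" "smooth_on S f" "smooth_on S g"
  shows "smooth_on S (\<lambda>x. (f x, g x))"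
proof -
  have "smooth_on S (\<lambda>x. (f x, 0::'c))" "smooth_on S (\<lambda>x. (0::'b, g x))"
    using smooth_on_bounded_linear[OF assms(1) bounded_linear_Pair[OF bounded_linear_ident bounded_linear_zero] assms(2)]
      smooth_on_bounded_linear[OF assms(1) bounded_linear_Pair[OF bounded_linear_zero bounded_linear_ident] assms(3)]
    by simp_all
  from smooth_on_add[OF assms(1) this] show ?thesis by simp
qed

lemmas smooth_intros = smooth_on_const smooth_on_id smooth_on_fst smooth_on_snd smooth_on_add
  smooth_on_minus smooth_on_diff smooth_on_mult smooth_on_scaleR smooth_on_inner smooth_on_power
  smooth_on_inverse smooth_on_divide smooth_on_vec_nth smooth_on_vec smooth_on_Pair

lemma smooth_onI_local:
  assumes "\<And>x. x \<in> S \<Longrightarrow> \<exists>T. open T \<and> x \<in> T \<and> smooth_on T f"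
  shows "smooth_on S f"
proof -
  have "Ck_on k S f" if "\<And>x. x \<in> S \<Longrightarrow> \<exists>T. open T \<and> x \<in> T \<and> Ck_on k T f" for k f
    using that
  proof (induction k arbitrary: f)
    case 0
    have "isCont f x" if "x \<in> S" for x
      using 0[OF that] by (auto simp: continuous_on_eq_continuous_at)
    then show ?case by (simp add: continuous_at_imp_continuous_on)
  next
    case (Suc k)
    have "Ck_on k S (\<lambda>x. frechet_derivative f (at x) h)" for h
      by (rule Suc.IH) (use Suc.prems in fastforce)
    then show ?case using Suc.prems by fastforce
  qed
  then show ?thesis using assms unfolding smooth_on_def by meson
qed

lemma smooth_on_Un_open:
  "open S \<Longrightarrow> open T \<Longrightarrow> smooth_on S f \<Longrightarrow> smooth_on T f \<Longrightarrow> smooth_on (S \<union> T) f"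
  by (rule smooth_onI_local) auto

section \<open>Symmetry of second derivatives\<close>

lemma smooth_on_line_derivative:
  fixes f :: "'a::euclidean_space \<Rightarrow> 'b::real_normed_vector"
  assumes "smooth_on S f" "x + s *\<^sub>R h \<in> S"
  shows "((\<lambda>\<sigma>. f (x + \<sigma> *\<^sub>R h)) has_vector_derivative frechet_derivative f (at (x + s *\<^sub>R h)) h) (at s)"
proof -
  have "((\<lambda>\<sigma>. f (x + \<sigma> *\<^sub>R h)) has_derivative
     (\<lambda>\<sigma>. frechet_derivative f (at (x + s *\<^sub>R h)) (\<sigma> *\<^sub>R h))) (at s)"
    by (rule has_derivative_compose[of "\<lambda>\<sigma>. x + \<sigma> *\<^sub>R h" _ _ _ f, OF _ smooth_on_has_derivative[OF assms]])
      (auto intro!: derivative_eq_intros)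
  then show ?thesis
    using linear_scale[OF has_derivative_linear[OF smooth_on_has_derivative[OF assms]]]
    by (simp add: has_vector_derivative_def)
qed

lemma smooth_on_continuous_compose:
  assumes "smooth_on S f" "continuous_on T g" "\<And>x. x \<in> T \<Longrightarrow> g x \<in> S"
  shows "continuous_on T (\<lambda>x. f (g x))"
  using continuous_on_compose2[OF smooth_on_continuous_on[OF assms(1)] assms(2)] assms(3) by blast

text \<open>The increment f(x + s h + t k) - f(x + t k) is the integral of the h-derivative over
  [0, s]. Differentiating under the integral in t, and then the resulting identity in s at 0,
  produces the two mixed derivatives.\<close>

lemma smooth_on_second_derivative_symmetric:
  fixes f :: "'a::euclidean_space \<Rightarrow> 'b::euclidean_space"
  assumes S: "open S" "x \<in> S" and f: "smooth_on S f"
  shows "frechet_derivative (\<lambda>y. frechet_derivative f (at y) h) (at x) k =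
    frechet_derivative (\<lambda>y. frechet_derivative f (at y) k) (at x) h"
proof -
  define D where "D h y = frechet_derivative f (at y) h" for h y
  have D: "smooth_on S (D h)" for h
    unfolding D_def by (rule smooth_on_derivative_dir[OF f])
  have DD: "smooth_on S (\<lambda>y. frechet_derivative (D h) (at y) k)" for h k
    by (rule smooth_on_derivative_dir[OF D])
  have "continuous (at (0::real,0::real)) (\<lambda>p. x + fst p *\<^sub>R h + snd p *\<^sub>R k)"
    by (intro continuous_intros)
  then have "\<forall>\<^sub>F p in at (0::real,0::real). x + fst p *\<^sub>R h + snd p *\<^sub>R k \<in> S"
    unfolding continuous_at using S by (intro topological_tendstoD) auto
  then obtain d where d: "d > 0" and dS: "\<And>p. dist p (0,0) < d \<Longrightarrow> x + fst p *\<^sub>R h + snd p *\<^sub>R k \<in> S"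
    unfolding eventually_at using S by (metis UNIV_I fst_conv snd_conv add_cancel_right_right scaleR_zero_left)
  \<comment> \<open>The pair (s, t) is at distance at most |s| + |t| from the origin, so |s|, |t|
    \<le> d/3 stays strictly inside the radius d.\<close>
  define e where "e = d / 3"
  have e: "e > 0" using d by (simp add: e_def)
  have inS: "x + s *\<^sub>R h + t *\<^sub>R k \<in> S" if "\<bar>s\<bar> \<le> e" "\<bar>t\<bar> \<le> e" for s t
  proof -
    have "dist (s,t) (0,0) \<le> \<bar>s\<bar> + \<bar>t\<bar>" by (simp add: dist_norm norm_Pair sqrt_sum_squares_le_sum_abs)
    then show ?thesis using dS[of "(s,t)"] that d unfolding e_def by simp
  qed
  have eq: "D k (x + s *\<^sub>R h) - D k x = integral {0..s} (\<lambda>\<sigma>. frechet_derivative (D h) (at (x + \<sigma> *\<^sub>R h)) k)"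
    if s: "0 \<le> s" "s \<le> e" for s
  proof -
    have ftc: "f (x + s *\<^sub>R h + t *\<^sub>R k) - f (x + t *\<^sub>R k) = integral (cbox 0 s) (\<lambda>\<sigma>. D h (x + \<sigma> *\<^sub>R h + t *\<^sub>R k))"
      if t: "t \<in> {-e..e}" for t
    proof -
      have "((\<lambda>\<sigma>. D h (x + \<sigma> *\<^sub>R h + t *\<^sub>R k)) has_integral
          f (x + t *\<^sub>R k + s *\<^sub>R h) - f (x + t *\<^sub>R k + 0 *\<^sub>R h)) {0..s}"
      proof (rule fundamental_theorem_of_calculus)
        show "((\<lambda>s. f (x + t *\<^sub>R k + s *\<^sub>R h)) has_vector_derivative D h (x + \<sigma> *\<^sub>R h + t *\<^sub>R k)) (at \<sigma> within {0..s})"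
          if "\<sigma> \<in> {0..s}" for \<sigma>
        proof -
          have eq: "x + t *\<^sub>R k + \<sigma> *\<^sub>R h = x + \<sigma> *\<^sub>R h + t *\<^sub>R k" by simp
          have m: "x + t *\<^sub>R k + \<sigma> *\<^sub>R h \<in> S" unfolding eq using that s t by (intro inS) auto
          show ?thesis
            using has_vector_derivative_at_within[OF smooth_on_line_derivative[OF f m]]
            unfolding D_def eq .
        qed
      qed (use s in auto)
      then show ?thesis by (simp add: integral_unique algebra_simps)
    qed
    have L: "((\<lambda>t. integral (cbox 0 s) (\<lambda>\<sigma>. D h (x + \<sigma> *\<^sub>R h + t *\<^sub>R k))) has_vector_derivative
       integral (cbox 0 s) (\<lambda>\<sigma>. frechet_derivative (D h) (at (x + \<sigma> *\<^sub>R h + 0 *\<^sub>R k)) k)) (at 0 within {-e..e})"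
    proof (rule leibniz_rule_vector_derivative)
      show "((\<lambda>t. D h (x + \<sigma> *\<^sub>R h + t *\<^sub>R k)) has_vector_derivative frechet_derivative (D h) (at (x + \<sigma> *\<^sub>R h + t *\<^sub>R k)) k) (at t within {-e..e})"
        if "t \<in> {-e..e}" "\<sigma> \<in> cbox 0 s" for t \<sigma>
      proof -
        have m: "x + \<sigma> *\<^sub>R h + t *\<^sub>R k \<in> S" using that s by (intro inS) auto
        show ?thesis by (rule has_vector_derivative_at_within[OF smooth_on_line_derivative[OF D m]])
      qed
      show "(\<lambda>\<sigma>. D h (x + \<sigma> *\<^sub>R h + t *\<^sub>R k)) integrable_on cbox 0 s" if "t \<in> {-e..e}" for t
        by (intro integrable_continuous smooth_on_continuous_compose[OF D] continuous_intros inS) (use that s in auto)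
      show "continuous_on ({-e..e} \<times> cbox 0 s) (\<lambda>(t,\<sigma>). frechet_derivative (D h) (at (x + \<sigma> *\<^sub>R h + t *\<^sub>R k)) k)"
        unfolding split_beta
        by (intro smooth_on_continuous_compose[OF DD] continuous_intros inS) (use s in auto)
    qed (use e in auto)
    have 1: "((\<lambda>t. f (x + s *\<^sub>R h + t *\<^sub>R k) - f (x + t *\<^sub>R k)) has_vector_derivative
       integral (cbox 0 s) (\<lambda>\<sigma>. frechet_derivative (D h) (at (x + \<sigma> *\<^sub>R h)) k)) (at 0 within {-e..e})"
      by (rule has_vector_derivative_transform_within[OF L[unfolded scaleR_zero_left add_0_right] zero_less_one])
        (use ftc e in auto)
    have 2: "((\<lambda>t. f (x + s *\<^sub>R h + t *\<^sub>R k) - f (x + t *\<^sub>R k)) has_vector_derivative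
       D k (x + s *\<^sub>R h) - D k x) (at 0 within {-e..e})"
    proof -
      have m: "x + s *\<^sub>R h + 0 *\<^sub>R k \<in> S" "x + 0 *\<^sub>R k \<in> S"
        using inS[of s 0] S(2) s e by simp_all
      show ?thesis
        using has_vector_derivative_diff[OF smooth_on_line_derivative[OF f m(1)] smooth_on_line_derivative[OF f m(2)]]
        unfolding scaleR_zero_left add_0_right D_def by (rule has_vector_derivative_at_within)
    qed
    show ?thesis
      using vector_derivative_unique_within[OF _ 1 2] e by (simp add: at_within_Icc_at)
  qed
  \<comment> \<open>From here on s is varied to the right of 0 only; a one-sided derivative still
    determines its value.\<close>
  have c: "continuous_on {0..e} (\<lambda>\<sigma>. frechet_derivative (D h) (at (x + \<sigma> *\<^sub>R h)) k)"
    using inS[of _ 0] e by (intro smooth_on_continuous_compose[OF DD] continuous_intros) simp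
  have "((\<lambda>s. integral {0..s} (\<lambda>\<sigma>. frechet_derivative (D h) (at (x + \<sigma> *\<^sub>R h)) k)) has_vector_derivative
      frechet_derivative (D h) (at x) k) (at 0 within {0..e})"
    using integral_has_vector_derivative[OF c, of 0] e by simp
  then have 1: "((\<lambda>s. D k (x + s *\<^sub>R h) - D k x) has_vector_derivative
      frechet_derivative (D h) (at x) k) (at 0 within {0..e})"
    by (rule has_vector_derivative_transform_within[OF _ zero_less_one]) (use eq e in auto)
  have 2: "((\<lambda>s. D k (x + s *\<^sub>R h) - D k x) has_vector_derivative
      frechet_derivative (D k) (at x) h) (at 0 within {0..e})"
  proof -
    have m: "x + 0 *\<^sub>R h \<in> S" using S(2) by simp
    show ?thesis
      using has_vector_derivative_diff[OF smooth_on_line_derivative[OF D m, of k] has_vector_derivative_const[of "D k x"]]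
      unfolding scaleR_zero_left add_0_right diff_0_right by (rule has_vector_derivative_at_within)
  qed
  have "frechet_derivative (D h) (at x) k = frechet_derivative (D k) (at x) h"
  proof (rule vector_derivative_unique_within[OF _ 1 2])
    show "at 0 within {0..e} \<noteq> bot" using e by (simp add: trivial_limit_within islimpt_Icc)
  qed
  then show ?thesis by (simp add: D_def[abs_def])
qed

section \<open>Bump functions\<close>

text \<open>The powers of 1/x are included to close the family under differentiation:
  \<open>flat n\<close> differentiates to a combination of \<open>flat (n + 2)\<close> and
  \<open>flat (n + 1)\<close>. The classical flat function is \<open>flat 0\<close>.\<close>

definition flat :: "nat \<Rightarrow> real \<Rightarrow> real" where
  "flat n x = (if x \<le> 0 then 0 else inverse x ^ n * exp (- inverse x))"

lemma flat_tendsto_0: "(flat n \<longlongrightarrow> 0) (at 0)"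
proof -
  have "((\<lambda>x::real. inverse x ^ n / exp (inverse x)) \<longlongrightarrow> 0) (at_right 0)"
    by (rule filterlim_compose[OF tendsto_power_div_exp_0 filterlim_inverse_at_top_right])
  moreover have "\<forall>\<^sub>F x in at_right 0. inverse x ^ n / exp (inverse x) = flat n x"
    using eventually_at_right_less[of "0::real"]
    by eventually_elim (simp add: flat_def exp_minus divide_inverse)
  ultimately have "(flat n \<longlongrightarrow> 0) (at_right 0)"
    by (rule Lim_transform_eventually)
  moreover have "\<forall>\<^sub>F x in at_left 0. 0 = flat n x"
    unfolding eventually_at_filter by (simp add: flat_def)
  then have "(flat n \<longlongrightarrow> 0) (at_left 0)"
    by (rule Lim_transform_eventually[OF tendsto_const])
  ultimately show ?thesis by (simp add: filterlim_at_split)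
qed

lemma flat_has_derivative:
  "(flat n has_real_derivative (flat (n + 2) x - real n * flat (n + 1) x)) (at x)"
proof (cases x "0::real" rule: linorder_cases)
  case less
  have "((\<lambda>x. 0) has_real_derivative (flat (n + 2) x - real n * flat (n + 1) x)) (at x)"
    using less by (simp add: flat_def)
  then show ?thesis
    by (rule has_field_derivative_transform_within_open[of _ _ _ "{..<0}"]) (use less in \<open>auto simp: flat_def\<close>)
next
  case greater
  have "(inverse has_real_derivative - (inverse x * inverse x)) (at x)"
    using DERIV_inverse[of x] greater by (simp add: power2_eq_square)
  then have "((\<lambda>x. inverse x ^ n * exp (- inverse x)) has_real_derivative
      inverse x ^ n * (exp (- inverse x) * (inverse x * inverse x)) -
      (real n * inverse x ^ (n - 1) * (inverse x * inverse x)) * exp (- inverse x)) (at x)"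
    using greater by (auto intro!: derivative_eq_intros)
  also have "inverse x ^ n * (exp (- inverse x) * (inverse x * inverse x)) -
      (real n * inverse x ^ (n - 1) * (inverse x * inverse x)) * exp (- inverse x) =
      flat (n + 2) x - real n * flat (n + 1) x"
    using greater by (cases n) (simp_all add: flat_def algebra_simps)
  finally have "((\<lambda>x. inverse x ^ n * exp (- inverse x)) has_real_derivative
      (flat (n + 2) x - real n * flat (n + 1) x)) (at x)" .
  then show ?thesis
    by (rule has_field_derivative_transform_within_open[of _ _ _ "{0<..}"]) (use greater in \<open>auto simp: flat_def\<close>)
next
  case equal
  \<comment> \<open>Division by h raises the index by one, so the difference quotient at 0 is again
    a member of the family and tends to 0.\<close>
  have "flat (n + 1) = (\<lambda>h. (flat n (0 + h) - flat n 0) / h)"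
    by (auto simp: flat_def divide_inverse)
  then have "(\<lambda>h. (flat n (0 + h) - flat n 0) / h) \<midarrow>0\<rightarrow> 0"
    using flat_tendsto_0[of "n + 1"] by (simp only:)
  then show ?thesis using equal by (simp add: DERIV_def flat_def)
qed

lemma smooth_flat: "smooth_on UNIV (flat n)"
proof -
  have "Ck_on k UNIV (flat n)" for k
  proof (induction k arbitrary: n)
    case 0
    show ?case
      using flat_has_derivative by (auto intro!: continuous_at_imp_continuous_on DERIV_isCont)
  next
    case (Suc k)
    have "Ck_on k UNIV (\<lambda>x. (flat (n + 2) x + (- real n) * flat (n + 1) x) * h)" for h
      by (intro Ck_on_bilinear[OF bounded_bilinear_mult] Ck_on_add Suc.IH Ck_on_const open_UNIV)
    then show ?case
      using flat_has_derivative[of n]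
      by (intro Ck_on_SucI[where D = "\<lambda>x h. (flat (n + 2) x + (- real n) * flat (n + 1) x) * h"])
        (auto simp: has_field_derivative_def)
  qed
  then show ?thesis by (simp add: smooth_on_def)
qed

lemma flat_pos: "0 < x \<Longrightarrow> 0 < flat n x"
  by (simp add: flat_def)

lemma flat_nonneg: "0 \<le> flat n x"
  by (simp add: flat_def)

lemma smooth_bump:
  fixes x0 :: "'a::euclidean_space"
  assumes e: "\<epsilon> > 0"
  obtains \<eta> :: "'a \<Rightarrow> real" where "smooth_on UNIV \<eta>" "\<And>x. 0 \<le> \<eta> x" "0 < \<eta> x0"
    "\<And>x. \<epsilon> \<le> dist x0 x \<Longrightarrow> \<eta> x = 0"
proof
    let ?\<eta> = "\<lambda>x. flat 0 (\<epsilon>\<^sup>2 - (x - x0) \<bullet> (x - x0))"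
    show "smooth_on UNIV ?\<eta>"
      by (rule smooth_on_compose[OF open_UNIV _ smooth_flat]) (auto intro!: smooth_intros)
    show "0 < ?\<eta> x0" using e by (simp add: flat_pos)
    show "?\<eta> x = 0" if "\<epsilon> \<le> dist x0 x" for x
    proof -
      have "\<epsilon>\<^sup>2 \<le> (norm (x - x0))\<^sup>2"
        using that e by (intro power_mono) (auto simp: dist_norm norm_minus_commute)
      then show ?thesis by (simp add: flat_def power2_norm_eq_inner)
    qed
qed (rule flat_nonneg)

text \<open>A quotient of flat functions in t and 1 - t, with t = R^2 + 1 - |x|^2. One of t and 1 -
  t is positive, so the denominator never vanishes; t \<ge> 1 on the inner ball, and t \<le> 0
  beyond R + 1 because (R + 1)^2 \<ge> R^2 + 1.\<close>

lemma smooth_cutoff: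
  fixes R :: real
  assumes "0 \<le> R"
  obtains \<omega> :: "'a::euclidean_space \<Rightarrow> real" where "smooth_on UNIV \<omega>"
    "\<And>x. norm x \<le> R \<Longrightarrow> \<omega> x = 1" "\<And>x. R + 1 \<le> norm x \<Longrightarrow> \<omega> x = 0"
proof
  let ?t = "\<lambda>x::'a. R\<^sup>2 + 1 - x \<bullet> x"
  let ?\<omega> = "\<lambda>x. flat 0 (?t x) / (flat 0 (?t x) + flat 0 (1 - ?t x))"
  have *: "smooth_on UNIV (\<lambda>x. flat 0 (?t x))" "smooth_on UNIV (\<lambda>x. flat 0 (1 - ?t x))"
    by (rule smooth_on_compose[OF open_UNIV _ smooth_flat]; auto intro!: smooth_intros)+
  have "flat 0 t + flat 0 (1 - t) \<noteq> 0" for t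
    using flat_pos[of t 0] flat_pos[of "1 - t" 0] flat_nonneg[of 0 t] flat_nonneg[of 0 "1 - t"]
    by (cases "t > 0") auto
  then show "smooth_on UNIV ?\<omega>"
    using * by (intro smooth_on_divide smooth_on_add open_UNIV)
  show "?\<omega> x = 1" if "norm x \<le> R" for x
  proof -
    have "(norm x)\<^sup>2 \<le> R\<^sup>2" using that assms by (intro power_mono) auto
    then have "1 \<le> ?t x" by (simp add: power2_norm_eq_inner)
    then show ?thesis using flat_pos[of "?t x" 0] by (simp add: flat_def)
  qed
  show "?\<omega> x = 0" if "R + 1 \<le> norm x" for x
  proof -
    have "(R + 1)\<^sup>2 \<le> (norm x)\<^sup>2" using that assms by (intro power_mono) auto
    then have "?t x \<le> 0" using assms by (simp add: power2_norm_eq_inner power2_sum)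
    then show ?thesis by (simp add: flat_def)
  qed
qed

section \<open>Ordinary differential equations on a short time interval\<close>

lemma vector_derivative_continuous_on:
  assumes "\<And>x. x \<in> S \<Longrightarrow> (f has_vector_derivative f' x) (at x within S)"
  shows "continuous_on S f"
  using assms by (auto simp: continuous_on_eq_continuous_within dest: has_vector_derivative_continuous)

lemma vector_derivative_bound:
  fixes f :: "real \<Rightarrow> 'a::real_normed_vector"
  assumes "convex S" "\<And>x. x \<in> S \<Longrightarrow> (f has_vector_derivative f' x) (at x within S)"
    and "\<And>x. x \<in> S \<Longrightarrow> norm (f' x) \<le> B" "x \<in> S" "y \<in> S"
  shows "norm (f x - f y) \<le> B * \<bar>x - y\<bar>"
proof -
  have "norm (f x - f y) \<le> B * norm (x - y)"
  proof (rule differentiable_bound[OF assms(1)])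
    show "(f has_derivative (\<lambda>h. h *\<^sub>R f' x)) (at x within S)" if "x \<in> S" for x
      using assms(2)[OF that] by (simp add: has_vector_derivative_def)
    show "onorm (\<lambda>h. h *\<^sub>R f' x) \<le> B" if "x \<in> S" for x
    proof (rule onorm_bound)
      show "0 \<le> B" using assms(3)[OF that] norm_ge_zero[of "f' x"] by linarith
      show "norm (h *\<^sub>R f' x) \<le> B * norm h" for h
        using mult_right_mono[OF assms(3)[OF that], of "\<bar>h\<bar>"] by (simp add: mult.commute)
    qed
  qed (use assms in auto)
  then show ?thesis by simp
qed

text \<open>On intervals so short that \<open>\<bar>s\<bar> L \<le> 1/2\<close>, the maximum of \<open>\<bar>d\<bar>\<close> can be absorbed, and this
  replaces Gronwall's inequality.\<close>
lemma short_time_bound: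
  fixes d :: "real \<Rightarrow> 'a::real_normed_vector"
  assumes J: "is_interval J" "0 \<in> J" "s \<in> J"
    and d: "\<And>s. s \<in> J \<Longrightarrow> (d has_vector_derivative d' s) (at s within J)"
    and b: "\<And>s. s \<in> J \<Longrightarrow> norm (d' s) \<le> L * norm (d s) + \<epsilon>"
    and L: "0 \<le> L" "\<bar>s\<bar> * L \<le> 1/2" and e: "0 \<le> \<epsilon>"
  shows "norm (d s) \<le> 2 * norm (d 0) + 2 * \<bar>s\<bar> * \<epsilon>"
proof -
  have conv: "convex J" using J(1) by (simp add: is_interval_convex_1)
  let ?K = "closed_segment 0 s"
  have K: "?K \<subseteq> J" using conv J by (simp add: closed_segment_subset)
  have "continuous_on ?K d"
    using vector_derivative_continuous_on[of J d d'] d K continuous_on_subset by blast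
  then obtain m where m: "m \<in> ?K" "\<And>t. t \<in> ?K \<Longrightarrow> norm (d t) \<le> norm (d m)"
    using continuous_attains_sup[of ?K "\<lambda>t. norm (d t)"] by (auto intro: continuous_intros)
  have ms: "\<bar>m\<bar> \<le> \<bar>s\<bar>" using m(1) by (auto simp: closed_segment_eq_real_ivl split: if_splits)
  have "norm (d m - d 0) \<le> (L * norm (d m) + \<epsilon>) * \<bar>m - 0\<bar>"
  proof (rule vector_derivative_bound)
    show "(d has_vector_derivative d' x) (at x within ?K)" if "x \<in> ?K" for x
      using d K that has_vector_derivative_within_subset by blast
    show "norm (d' x) \<le> L * norm (d m) + \<epsilon>" if "x \<in> ?K" for x
    proof -
      have "norm (d' x) \<le> L * norm (d x) + \<epsilon>" using b K that by blast
      also have "\<dots> \<le> L * norm (d m) + \<epsilon>" using m(2)[OF that] L(1) by (simp add: mult_left_mono)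
      finally show ?thesis .
    qed
  qed (use m in auto)
  also have "\<dots> \<le> (L * norm (d m) + \<epsilon>) * \<bar>s\<bar>"
    using ms L(1) e by (intro mult_left_mono) auto
  also have "\<dots> = (\<bar>s\<bar> * L) * norm (d m) + \<bar>s\<bar> * \<epsilon>" by (simp add: algebra_simps)
  also have "\<dots> \<le> (1/2) * norm (d m) + \<bar>s\<bar> * \<epsilon>"
    using L(2) by (intro add_right_mono mult_right_mono) auto
  finally have "norm (d m - d 0) \<le> (1/2) * norm (d m) + \<bar>s\<bar> * \<epsilon>" .
  moreover have "norm (d m) \<le> norm (d 0) + norm (d m - d 0)"
    by (metis add.commute diff_add_cancel norm_triangle_ineq)
  ultimately have "norm (d m) \<le> 2 * norm (d 0) + 2 * (\<bar>s\<bar> * \<epsilon>)" by linarith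
  then show ?thesis using m(2)[of s] by simp
qed

text \<open>The difference of two solutions starts at 0 and has no source term, so the short-time
  bound makes it vanish.\<close>

lemma ode_unique:
  fixes y z :: "real \<Rightarrow> 'a::real_normed_vector"
  assumes J: "is_interval J" "0 \<in> J" "s \<in> J"
    and y: "\<And>s. s \<in> J \<Longrightarrow> (y has_vector_derivative F s (y s)) (at s within J)"
    and z: "\<And>s. s \<in> J \<Longrightarrow> (z has_vector_derivative F s (z s)) (at s within J)"
    and lip: "\<And>s v w. s \<in> J \<Longrightarrow> norm (F s v - F s w) \<le> L * norm (v - w)"
    and L: "0 \<le> L" "\<bar>s\<bar> * L \<le> 1/2" and 0: "y 0 = z 0"
  shows "y s = z s"
proof -
  have "norm (y s - z s) \<le> 2 * norm (y 0 - z 0) + 2 * \<bar>s\<bar> * 0"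
  proof (rule short_time_bound[OF J _ _ L])
    show "((\<lambda>s. y s - z s) has_vector_derivative F s (y s) - F s (z s)) (at s within J)" if "s \<in> J" for s
      using y[OF that] z[OF that] by (rule has_vector_derivative_diff)
  qed (use lip in auto)
  then show ?thesis using 0 by simp
qed

text \<open>Picard's fixed point argument in the space of bounded continuous functions on the line.
  As T L \<le> 1/2, the integral operator itself contracts by the factor 1/2.\<close>

lemma ode_exists_closed:
  fixes F :: "real \<Rightarrow> 'a::euclidean_space \<Rightarrow> 'a"
  assumes cont: "continuous_on ({-T..T} \<times> UNIV) (\<lambda>(s, y). F s y)"
    and lip: "\<And>s v w. s \<in> {-T..T} \<Longrightarrow> norm (F s v - F s w) \<le> L * norm (v - w)"
    and L: "0 \<le> L" "T * L \<le> 1/2" and T: "0 \<le> T"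
  shows "\<exists>y. y 0 = c \<and> (\<forall>s\<in>{-T..T}. (y has_vector_derivative F s (y s)) (at s within {-T..T}))"
proof -
  \<comment> \<open>Clamping the time to [-T, T] turns functions on the interval into bounded
    continuous functions on the line, whose space is complete.\<close>
  define \<kappa> where "\<kappa> s = max (- T) (min T s)" for s :: real
  have \<kappa>: "\<kappa> s \<in> {-T..T}" for s using T by (auto simp: \<kappa>_def)
  have \<kappa>_id: "\<kappa> s = s" if "s \<in> {-T..T}" for s using that by (auto simp: \<kappa>_def)
  \<comment> \<open>A difference of two integrals from -T gives the oriented integral from 0 to
    \<open>s\<close> without a case distinction on the sign of \<open>s\<close>.\<close>
  define P where "P g s = c + (integral {-T..s} g - integral {-T..0} g)" for g :: "real \<Rightarrow> 'a" and s
  define G where "G y = (\<lambda>\<tau>. F \<tau> (apply_bcontfun y \<tau>))" for y :: "real \<Rightarrow>\<^sub>C 'a"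
  have G: "continuous_on {-T..T} (G y)" for y
  proof -
    have "continuous_on {-T..T} (\<lambda>\<tau>. case (\<tau>, apply_bcontfun y \<tau>) of (s, y) \<Rightarrow> F s y)"
      by (rule continuous_on_compose2[OF cont]) (auto intro!: continuous_intros)
    then show ?thesis by (simp add: G_def)
  qed
  have P': "(P g has_vector_derivative g s) (at s within {-T..T})"
    if "continuous_on {-T..T} g" "s \<in> {-T..T}" for g s
    using integral_has_vector_derivative[OF that] unfolding P_def
    by (auto intro!: derivative_eq_intros)
  have Pcont: "continuous_on {-T..T} (P g)" if "continuous_on {-T..T} g" for g
    using P'[OF that] by (rule vector_derivative_continuous_on)
  have bc: "(\<lambda>s. P (G y) (\<kappa> s)) \<in> bcontfun" for y
  proof -
    have "bounded (P (G y) ` {-T..T})"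
      by (intro compact_imp_bounded compact_continuous_image Pcont G) auto
    moreover have "range (\<lambda>s. P (G y) (\<kappa> s)) \<subseteq> P (G y) ` {-T..T}" using \<kappa> by auto
    ultimately have "bounded (range (\<lambda>s. P (G y) (\<kappa> s)))" using bounded_subset by blast
    moreover have "continuous_on UNIV (\<lambda>s. P (G y) (\<kappa> s))"
    proof (rule continuous_on_compose2[OF Pcont[OF G]])
      show "continuous_on UNIV \<kappa>" unfolding \<kappa>_def by (intro continuous_intros)
    qed (use \<kappa> in auto)
    ultimately show ?thesis by (simp add: bcontfun_def)
  qed
  define \<T> where "\<T> y = Bcontfun (\<lambda>s. P (G y) (\<kappa> s))" for y
  have \<T>: "apply_bcontfun (\<T> y) s = P (G y) (\<kappa> s)" for y s
    unfolding \<T>_def using bc by (simp add: Bcontfun_inverse)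
  have "dist (\<T> y) (\<T> z) \<le> 1/2 * dist y z" for y z
  proof (rule dist_bound)
    fix s
    have "norm ((P (G y) (\<kappa> s) - P (G z) (\<kappa> s)) - (P (G y) 0 - P (G z) 0)) \<le> (L * dist y z) * \<bar>\<kappa> s - 0\<bar>"
    proof (rule vector_derivative_bound[of "{-T..T}"])
      show "((\<lambda>s. P (G y) s - P (G z) s) has_vector_derivative G y \<tau> - G z \<tau>) (at \<tau> within {-T..T})"
        if "\<tau> \<in> {-T..T}" for \<tau>
        by (intro has_vector_derivative_diff P' G that)
      show "norm (G y \<tau> - G z \<tau>) \<le> L * dist y z" if "\<tau> \<in> {-T..T}" for \<tau>
      proof -
        have "norm (G y \<tau> - G z \<tau>) \<le> L * norm (apply_bcontfun y \<tau> - apply_bcontfun z \<tau>)"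
          using lip[OF that] by (simp add: G_def)
        also have "\<dots> \<le> L * dist y z"
          using dist_bounded[of y \<tau> z] L(1) by (intro mult_left_mono) (auto simp: dist_norm)
        finally show ?thesis .
      qed
    qed (use \<kappa> T in auto)
    also have "\<dots> \<le> (L * dist y z) * T"
      using \<kappa>[of s] L(1) by (intro mult_left_mono) auto
    also have "\<dots> \<le> 1/2 * dist y z"
      using mult_right_mono[OF L(2), of "dist y z"] by (simp add: algebra_simps)
    finally show "dist (apply_bcontfun (\<T> y) s) (apply_bcontfun (\<T> z) s) \<le> 1/2 * dist y z"
      by (simp add: \<T> dist_norm P_def)
  qed
  then obtain y where y: "\<T> y = y" using banach_fix_type[of "1/2" \<T>] by auto
  have eq: "apply_bcontfun y s = P (G y) s" if "s \<in> {-T..T}" for s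
    using \<T>[of y s] y \<kappa>_id[OF that] by simp
  show ?thesis
  proof (intro exI conjI ballI)
    show "apply_bcontfun y 0 = c" using eq[of 0] T by (simp add: P_def)
    show "(apply_bcontfun y has_vector_derivative F s (apply_bcontfun y s)) (at s within {-T..T})"
      if "s \<in> {-T..T}" for s
      by (rule has_vector_derivative_transform[OF that eq])
        (use P'[OF G that, of y] in \<open>simp_all add: G_def\<close>)
  qed
qed

text \<open>Solutions on closed subintervals agree on overlaps by uniqueness, and the value at time
  \<open>s\<close> is read from the interval of radius |s|.\<close>

lemma ode_exists_open:
  fixes F :: "real \<Rightarrow> 'a::euclidean_space \<Rightarrow> 'a"
  assumes cont: "continuous_on ({-\<delta><..<\<delta>} \<times> UNIV) (\<lambda>(s, y). F s y)"
    and lip: "\<And>s v w. s \<in> {-\<delta><..<\<delta>} \<Longrightarrow> norm (F s v - F s w) \<le> L * norm (v - w)"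
    and L: "0 \<le> L" "\<delta> * L \<le> 1/2" and \<delta>: "0 < \<delta>"
  shows "\<exists>y. y 0 = c \<and> (\<forall>s\<in>{-\<delta><..<\<delta>}. (y has_vector_derivative F s (y s)) (at s))"
proof -
  have TL: "T * L \<le> 1/2" if "T < \<delta>" for T
    using mult_right_mono[of T \<delta> L] that L by linarith
  have "\<exists>y. y 0 = c \<and> (\<forall>s\<in>{-T..T}. (y has_vector_derivative F s (y s)) (at s within {-T..T}))"
    if "0 \<le> T" "T < \<delta>" for T
    using that by (intro ode_exists_closed[OF continuous_on_subset[OF cont] lip L(1) TL]) auto
  then obtain Y where Y: "\<And>T. 0 \<le> T \<Longrightarrow> T < \<delta> \<Longrightarrow> Y T 0 = c"
    "\<And>T s. 0 \<le> T \<Longrightarrow> T < \<delta> \<Longrightarrow> s \<in> {-T..T} \<Longrightarrow> (Y T has_vector_derivative F s (Y T s)) (at s within {-T..T})"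
    by metis
  have agree: "Y T s = Y T' s" if "0 \<le> T" "T \<le> T'" "T' < \<delta>" "s \<in> {-T..T}" for T T' s
  proof (rule ode_unique[of "{-T..T}" s _ F _ L])
    show "(Y T' has_vector_derivative F s (Y T' s)) (at s within {-T..T})" if "s \<in> {-T..T}" for s
      using Y(2)[of T' s] that \<open>0 \<le> T\<close> \<open>T \<le> T'\<close> \<open>T' < \<delta>\<close>
      by (auto intro: has_vector_derivative_within_subset[of _ _ _ "{-T'..T'}"])
    have "\<bar>s\<bar> < \<delta>" using that by auto
    then show "\<bar>s\<bar> * L \<le> 1/2" by (rule TL)
  qed (use that Y lip L in auto)
  define y where "y s = Y \<bar>s\<bar> s" for s
  have "(y has_vector_derivative F s (y s)) (at s)" if "s \<in> {-\<delta><..<\<delta>}" for s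
  proof -
    \<comment> \<open>Differentiability at \<open>s\<close> needs a neighbourhood: with T halfway
      between |s| and \<delta>, the point \<open>s\<close> is interior and the single solution
      \<open>Y T\<close> represents \<open>y\<close> around it.\<close>
    define T where "T = (\<bar>s\<bar> + \<delta>) / 2"
    have T: "0 \<le> T" "T < \<delta>" "s \<in> {-T<..<T}" using that \<delta> by (auto simp: T_def abs_real_def field_simps)
    have y: "y r = Y T r" if "r \<in> {-T<..<T}" for r
      unfolding y_def using that T by (intro agree) auto
    have "(Y T has_vector_derivative F s (Y T s)) (at s)"
      using Y(2)[OF T(1,2), of s] T(3) at_within_interior[of s "{-T..T}"] by simp
    then show ?thesis
      using y T(3) by (auto intro: has_vector_derivative_transform_within_open[of "Y T" _ _ "{-T<..<T}"])
  qed
  moreover have "y 0 = c" using Y(1)[of 0] \<delta> by (simp add: y_def)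
  ultimately show ?thesis by blast
qed

section \<open>Estimates that are uniform over compact time intervals\<close>

lemma compact_section_uniform:
  fixes g :: "real \<times> 'p::euclidean_space \<Rightarrow> 'b::metric_space"
  assumes g: "continuous_on ({-\<delta><..<\<delta>} \<times> UNIV) g" and T: "T < \<delta>" and e: "0 < \<epsilon>"
  obtains \<eta> where "\<eta> > 0"
    "\<And>s x. \<bar>s\<bar> \<le> T \<Longrightarrow> dist x x0 < \<eta> \<Longrightarrow> dist (g (s, x)) (g (s, x0)) < \<epsilon>"
proof -
  let ?K = "{-T..T} \<times> cball x0 1"
  have "compact ?K" by (intro compact_Times) auto
  moreover have "continuous_on ?K g"
    by (rule continuous_on_subset[OF g]) (use T in auto)
  ultimately have "uniformly_continuous_on ?K g" by (rule compact_uniformly_continuous[rotated])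
  then obtain d where d: "d > 0"
    "\<And>p q. p \<in> ?K \<Longrightarrow> q \<in> ?K \<Longrightarrow> dist q p < d \<Longrightarrow> dist (g q) (g p) < \<epsilon>"
    using e unfolding uniformly_continuous_on_def by metis
  show ?thesis
  proof (rule that[of "min d 1"])
    show "dist (g (s, x)) (g (s, x0)) < \<epsilon>" if "\<bar>s\<bar> \<le> T" "dist x x0 < min d 1" for s x
      using that by (intro d(2)) (auto simp: dist_Pair_Pair dist_commute)
  qed (use d in auto)
qed

lemma linear_continuous_apply:
  fixes A :: "'q::topological_space \<Rightarrow> 'a::euclidean_space \<Rightarrow> 'b::real_normed_vector"
  assumes "\<And>q. q \<in> S \<Longrightarrow> linear (A q)" "\<And>v. continuous_on S (\<lambda>q. A q v)" "continuous_on S w"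
  shows "continuous_on S (\<lambda>q. A q (w q))"
proof -
  have "A q (w q) = (\<Sum>i\<in>Basis. (w q \<bullet> i) *\<^sub>R A q i)" if "q \<in> S" for q
    using linear_sum[OF assms(1)[OF that], of "\<lambda>i. (w q \<bullet> i) *\<^sub>R i" Basis] linear_scale[OF assms(1)[OF that]]
    by (simp add: euclidean_representation)
  moreover have "continuous_on S (\<lambda>q. \<Sum>i\<in>Basis. (w q \<bullet> i) *\<^sub>R A q i)"
    using assms(2,3) by (intro continuous_intros)
  ultimately show ?thesis by (simp cong: continuous_on_cong)
qed

text \<open>This is the mean value estimate for \<open>M\<close> minus its linear part, uniformly in
  time. As only directional derivatives are known to be continuous, the operator norm is bounded by
  a sum over the basis; this is why \<epsilon> is divided by the number of basis vectors.\<close>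

lemma compact_section_linearization:
  fixes M :: "real \<times> 'p::euclidean_space \<Rightarrow> 'b::real_normed_vector"
  assumes D: "\<And>q. q \<in> {-\<delta><..<\<delta>} \<times> UNIV \<Longrightarrow> ((\<lambda>y. M (fst q, y)) has_derivative (\<lambda>h. M' h q)) (at (snd q))"
    and cont: "\<And>h. continuous_on ({-\<delta><..<\<delta>} \<times> UNIV) (M' h)"
    and T: "T < \<delta>" and e: "0 < \<epsilon>"
  obtains \<eta> where "\<eta> > 0"
    "\<And>s h. \<bar>s\<bar> \<le> T \<Longrightarrow> norm h < \<eta> \<Longrightarrow> norm (M (s, x0 + h) - M (s, x0) - M' h (s, x0)) \<le> \<epsilon> * norm h"
proof -
  define \<epsilon>' where "\<epsilon>' = \<epsilon> / real (card (Basis :: 'p set))"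
  have e': "\<epsilon>' > 0" using e by (simp add: \<epsilon>'_def)
  have "\<forall>i\<in>Basis. \<exists>\<eta>>0. \<forall>s x. \<bar>s\<bar> \<le> T \<longrightarrow> dist x x0 < \<eta> \<longrightarrow> dist (M' i (s, x)) (M' i (s, x0)) < \<epsilon>'"
    using compact_section_uniform[OF cont T e', of x0] by metis
  then obtain H where H: "\<And>i. i \<in> Basis \<Longrightarrow> H i > 0"
    "\<And>i s x. i \<in> Basis \<Longrightarrow> \<bar>s\<bar> \<le> T \<Longrightarrow> dist x x0 < H i \<Longrightarrow> dist (M' i (s, x)) (M' i (s, x0)) < \<epsilon>'"
    by metis
  define \<eta> where "\<eta> = Min (H ` Basis)"
  have \<eta>: "\<eta> > 0" "\<And>i. i \<in> Basis \<Longrightarrow> \<eta> \<le> H i" using H(1) by (auto simp: \<eta>_def)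
  show ?thesis
  proof (rule that[OF \<eta>(1)])
    fix s :: real and h :: 'p
    assume s: "\<bar>s\<bar> \<le> T" and h: "norm h < \<eta>"
    have sJ: "(s, y) \<in> {-\<delta><..<\<delta>} \<times> UNIV" for y :: 'p using s T by auto
    have lin: "linear (\<lambda>h. M' h (s, y))" for y
      using has_derivative_linear[OF D[OF sJ]] .
    let ?S = "ball x0 \<eta>"
    let ?f = "\<lambda>y. M (s, y) - M' (y - x0) (s, x0)"
    have "norm (?f (x0 + h) - ?f x0) \<le> \<epsilon> * norm (x0 + h - x0)"
    proof (rule differentiable_bound)
      show "(?f has_derivative (\<lambda>k. M' k (s, y) - M' k (s, x0))) (at y within ?S)" for y
      proof (rule has_derivative_at_withinI[OF has_derivative_diff])
        show "((\<lambda>y. M (s, y)) has_derivative (\<lambda>k. M' k (s, y))) (at y)" using D[OF sJ, of y] by simp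
        have bl: "bounded_linear (\<lambda>h. M' h (s, x0))" using has_derivative_bounded_linear[OF D[OF sJ]] .
        show "((\<lambda>y. M' (y - x0) (s, x0)) has_derivative (\<lambda>k. M' k (s, x0))) (at y)"
          by (rule has_derivative_compose[of "\<lambda>y. y - x0" "\<lambda>k. k" y UNIV, OF _ bounded_linear_imp_has_derivative[OF bl]])
            (auto intro!: derivative_eq_intros)
      qed
      show "onorm (\<lambda>k. M' k (s, y) - M' k (s, x0)) \<le> \<epsilon>" if y: "y \<in> ?S" for y
      proof (rule onorm_bound)
        fix k :: 'p
        have rep: "M' k (s, y) = (\<Sum>i\<in>Basis. (k \<bullet> i) *\<^sub>R M' i (s, y))" for y
          using linear_sum[OF lin[of y], of "\<lambda>i. (k \<bullet> i) *\<^sub>R i" Basis] linear_scale[OF lin]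
          by (simp add: euclidean_representation)
        have "norm (M' k (s, y) - M' k (s, x0)) = norm (\<Sum>i\<in>Basis. (k \<bullet> i) *\<^sub>R (M' i (s, y) - M' i (s, x0)))"
          by (simp add: rep sum_subtractf scaleR_diff_right)
        also have "\<dots> \<le> (\<Sum>i\<in>(Basis::'p set). norm k * \<epsilon>')"
        proof (rule sum_norm_le)
          fix i :: 'p assume i: "i \<in> Basis"
          have "norm (M' i (s, y) - M' i (s, x0)) \<le> \<epsilon>'"
            using H(2)[OF i s, of y] y \<eta>(2)[OF i] by (simp add: dist_norm norm_minus_commute)
          then show "norm ((k \<bullet> i) *\<^sub>R (M' i (s, y) - M' i (s, x0))) \<le> norm k * \<epsilon>'"
            using Basis_le_norm[OF i, of k] by (auto intro!: mult_mono)
        qed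
        also have "\<dots> = \<epsilon> * norm k" by (simp add: \<epsilon>'_def)
        finally show "norm (M' k (s, y) - M' k (s, x0)) \<le> \<epsilon> * norm k" .
      qed (use e in simp)
    qed (use \<eta> h in \<open>auto simp: dist_norm\<close>)
    then show "norm (M (s, x0 + h) - M (s, x0) - M' h (s, x0)) \<le> \<epsilon> * norm h"
      using linear_0[OF lin] by (simp add: algebra_simps)
  qed
qed

text \<open>Differentiability in two variables follows from partial derivatives once one of them is
  continuous; here it is the one in space. In finite dimension, continuity in every direction
  \<open>h\<close> makes the operator-valued derivative continuous.\<close>

lemma joint_has_derivative:
  fixes w :: "real \<times> 'p::euclidean_space \<Rightarrow> 'a::real_normed_vector"
  assumes q: "q \<in> {-\<delta><..<\<delta>} \<times> UNIV"
    and t: "((\<lambda>s. w (s, snd q)) has_vector_derivative v) (at (fst q))"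
    and x: "\<And>q. q \<in> {-\<delta><..<\<delta>} \<times> UNIV \<Longrightarrow> ((\<lambda>x. w (fst q, x)) has_derivative (\<lambda>h. Z h q)) (at (snd q))"
    and cont: "\<And>h. continuous_on ({-\<delta><..<\<delta>} \<times> UNIV) (Z h)"
  shows "(w has_derivative (\<lambda>h. fst h *\<^sub>R v + Z (snd h) q)) (at q)"
proof -
  let ?J = "{-\<delta><..<\<delta>}"
  obtain s y where sy: "q = (s, y)" by (cases q)
  have bl: "bounded_linear (\<lambda>h. Z h q)" if "q \<in> ?J \<times> UNIV" for q
    using has_derivative_bounded_linear[OF x[OF that]] .
  have "continuous_on (?J \<times> UNIV) (\<lambda>q. Blinfun (\<lambda>h. Z h q))"
    using cont by (auto intro!: continuous_on_blinfun_componentwise cong: continuous_on_cong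
      simp: bounded_linear_Blinfun_apply[OF bl])
  then have c: "continuous (at (s, y) within ?J \<times> UNIV) (\<lambda>(s, x). Blinfun (\<lambda>h. Z h (s, x)))"
    using q sy by (simp add: continuous_on_eq_continuous_within split_def)
  have "((\<lambda>(s, x). w (s, x)) has_derivative
      (\<lambda>(ts, tx). ts *\<^sub>R v + blinfun_apply (Blinfun (\<lambda>h. Z h (s, y))) tx)) (at (s, y) within ?J \<times> UNIV)"
  proof (rule has_derivative_partialsI[OF _ _ c])
    show "((\<lambda>s. w (s, y)) has_derivative (\<lambda>t. t *\<^sub>R v)) (at s within ?J)"
      using t sy by (auto simp: has_vector_derivative_def intro: has_derivative_at_withinI)
    show "((\<lambda>y. w (s, y)) has_derivative blinfun_apply (Blinfun (\<lambda>h. Z h (s, y)))) (at y within UNIV)"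
      if "s \<in> ?J" for s y
      using x[of "(s, y)"] bounded_linear_Blinfun_apply[OF bl[of "(s, y)"]] that by simp
  qed auto
  moreover have "open (?J \<times> (UNIV :: 'p set))" by (intro open_Times) auto
  ultimately have "(w has_derivative
      (\<lambda>(ts, tx). ts *\<^sub>R v + blinfun_apply (Blinfun (\<lambda>h. Z h (s, y))) tx)) (at (s, y))"
    using q sy at_within_open[of "(s, y)" "?J \<times> UNIV"] by (simp only: case_prod_eta simp_thms)
  then show ?thesis
    using bounded_linear_Blinfun_apply[OF bl[OF q]] sy by (simp add: split_def)
qed

section \<open>Linear equations depending on a parameter\<close>

locale linear_ode =
  fixes A :: "real \<times> 'p::euclidean_space \<Rightarrow> 'a::euclidean_space \<Rightarrow> 'a" and \<delta> L :: real
  assumes lin: "\<And>q. q \<in> {-\<delta><..<\<delta>} \<times> UNIV \<Longrightarrow> linear (A q)"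
    and bound: "\<And>q v. q \<in> {-\<delta><..<\<delta>} \<times> UNIV \<Longrightarrow> norm (A q v) \<le> L * norm v"
    and \<delta>: "0 < \<delta>" and L: "0 \<le> L" "\<delta> * L \<le> 1/2"
begin

abbreviation "J \<equiv> {-\<delta><..<\<delta>} \<times> (UNIV :: 'p set)"

lemma open_J: "open J" by (intro open_Times) auto

definition solves :: "(real \<times> 'p \<Rightarrow> 'a) \<Rightarrow> ('p \<Rightarrow> 'a) \<Rightarrow> (real \<times> 'p \<Rightarrow> 'a) \<Rightarrow> bool" where
  "solves B c w \<longleftrightarrow> (\<forall>x. w (0, x) = c x) \<and>
     (\<forall>q\<in>J. ((\<lambda>s. w (s, snd q)) has_vector_derivative A q (w q) + B q) (at (fst q)))"

lemma solvesD:
  assumes "solves B c w" "\<bar>s\<bar> < \<delta>"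
  shows "((\<lambda>s. w (s, x)) has_vector_derivative A (s, x) (w (s, x)) + B (s, x)) (at s)"
  using assms unfolding solves_def by (auto simp: abs_less_iff)

lemma solves_0: "solves B c w \<Longrightarrow> w (0, x) = c x"
  by (simp add: solves_def)

lemma TL: "\<bar>s\<bar> < \<delta> \<Longrightarrow> \<bar>s\<bar> * L \<le> 1/2"
  using mult_right_mono[of "\<bar>s\<bar>" \<delta> L] L by linarith

lemma solution_exists:
  assumes A: "\<And>v. continuous_on J (\<lambda>q. A q v)" and B: "continuous_on J B"
  shows "\<exists>w. solves B c w"
proof -
  have "\<exists>y. y 0 = c x \<and> (\<forall>s\<in>{-\<delta><..<\<delta>}. (y has_vector_derivative A (s, x) (y s) + B (s, x)) (at s))" for x
  proof (rule ode_exists_open[OF _ _ L \<delta>])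
    let ?S = "{-\<delta><..<\<delta>} \<times> (UNIV :: 'a set)"
    have "continuous_on ?S (\<lambda>p. A (fst p, x) (snd p))"
    proof (rule linear_continuous_apply[of ?S "\<lambda>q. A (fst q, x)" snd])
      show "continuous_on ?S (\<lambda>q. A (fst q, x) v)" for v
        by (rule continuous_on_compose2[OF A]) (auto intro!: continuous_intros)
      show "linear (A (fst q, x))" if "q \<in> ?S" for q using that by (intro lin) auto
    qed (intro continuous_intros)
    moreover have "continuous_on ?S (\<lambda>p. B (fst p, x))"
      by (rule continuous_on_compose2[OF B]) (auto intro!: continuous_intros)
    ultimately show "continuous_on ?S (\<lambda>(s, y). A (s, x) y + B (s, x))"
      by (auto simp: split_beta intro: continuous_intros)
    show "norm (A (s, x) v + B (s, x) - (A (s, x) w + B (s, x))) \<le> L * norm (v - w)"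
      if "s \<in> {-\<delta><..<\<delta>}" for s v w
      using bound[of "(s, x)" "v - w"] linear_diff[OF lin[of "(s, x)"], of v w] that by simp
  qed
  then obtain Y where "\<And>x. Y x 0 = c x"
    "\<And>x s. s \<in> {-\<delta><..<\<delta>} \<Longrightarrow> (Y x has_vector_derivative A (s, x) (Y x s) + B (s, x)) (at s)"
    by metis
  then have "solves B c (\<lambda>q. Y (snd q) (fst q))" by (auto simp: solves_def)
  then show ?thesis by (intro exI[where x="\<lambda>q. Y (snd q) (fst q)"])
qed

text \<open>Used with \<open>e\<close> a difference of solutions at two parameters, and later with a
  solution minus its linear approximation; the remainder \<open>R\<close> collects the mismatch of
  the coefficients.\<close>

lemma perturbation_bound:
  assumes T: "\<bar>s\<bar> \<le> T" "T < \<delta>"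
    and e: "\<And>s. \<bar>s\<bar> \<le> T \<Longrightarrow> (e has_vector_derivative A (s, x) (e s) + R s) (at s)"
    and R: "\<And>s. \<bar>s\<bar> \<le> T \<Longrightarrow> norm (R s) \<le> \<epsilon>"
  shows "norm (e s) \<le> 2 * norm (e 0) + 2 * \<delta> * \<epsilon>"
proof -
  have e0: "0 \<le> \<epsilon>" using R[of 0] T by (metis abs_zero abs_ge_zero norm_ge_zero order_trans)
  have "norm (e s) \<le> 2 * norm (e 0) + 2 * \<bar>s\<bar> * \<epsilon>"
  proof (rule short_time_bound[of "{-T..T}"])
    show "(e has_vector_derivative A (s, x) (e s) + R s) (at s within {-T..T})" if "s \<in> {-T..T}" for s
      using has_vector_derivative_at_within[OF e[of s]] that by (simp add: abs_le_iff)
    show "norm (A (s, x) (e s) + R s) \<le> L * norm (e s) + \<epsilon>" if "s \<in> {-T..T}" for s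
    proof -
      have "(s, x) \<in> J" "\<bar>s\<bar> \<le> T" using that T by auto
      then show ?thesis using norm_triangle_mono[OF bound R] by blast
    qed
  qed (use T TL[of s] L e0 in auto)
  also have "\<dots> \<le> 2 * norm (e 0) + 2 * \<delta> * \<epsilon>"
    using T e0 by (intro add_left_mono mult_right_mono) auto
  finally show ?thesis .
qed

lemma solution_continuous_fst:
  assumes "solves B c w"
  shows "continuous_on {-\<delta><..<\<delta>} (\<lambda>s. w (s, x))"
  by (rule vector_derivative_continuous_on[where f' = "\<lambda>s. A (s, x) (w (s, x)) + B (s, x)"])
    (use solvesD[OF assms] in \<open>auto intro: has_vector_derivative_at_within\<close>)

text \<open>The solution enters only at the fixed parameter \<open>x\<close>, where its continuity
  in time is known. Remainders are formed from this frozen solution, because continuity in the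
  parameter is what is to be proved.\<close>

lemma frozen_continuous:
  assumes A: "\<And>v. continuous_on J (\<lambda>q. A q v)" and w: "continuous_on {-\<delta><..<\<delta>} (\<lambda>s. w (s, x))"
  shows "continuous_on J (\<lambda>q. A q (w (fst q, x)))"
proof (rule linear_continuous_apply[OF lin A])
  show "continuous_on J (\<lambda>q. w (fst q, x))"
    by (rule continuous_on_compose2[OF w]) (auto intro: continuous_intros)
qed

text \<open>The difference of the solutions at x and x0 solves the equation at x with a remainder
  given by the change of the coefficients along the solution at x0, which is small uniformly on
  compact time intervals.\<close>

lemma solution_continuous:
  assumes A: "\<And>v. continuous_on J (\<lambda>q. A q v)" and B: "continuous_on J B" and c: "continuous_on UNIV c"
    and w: "solves B c w"
  shows "continuous_on J w"
proof -
  have "isCont w (s0, x0)" if s0: "s0 \<in> {-\<delta><..<\<delta>}" for s0 x0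
    unfolding continuous_at_eps_delta
  proof (intro allI impI)
    fix \<epsilon> :: real assume e: "0 < \<epsilon>"
    \<comment> \<open>The perturbation bound yields 2 \<epsilon>' (1 + \<delta>), which is
      \<epsilon>/4 for this choice; half of \<epsilon> is reserved for the variation in
      time.\<close>
    define \<epsilon>' where "\<epsilon>' = \<epsilon> / (8 * (1 + \<delta>))"
    have e': "0 < \<epsilon>'" using e \<delta> by (simp add: \<epsilon>'_def)
    define T where "T = (\<bar>s0\<bar> + \<delta>) / 2"
    have T: "\<bar>s0\<bar> < T" "T < \<delta>" using s0 by (auto simp: T_def abs_real_def)
    let ?R = "\<lambda>q. A q (w (fst q, x0)) + B q"
    have "continuous_on J ?R"
      by (rule continuous_on_add[OF frozen_continuous[OF A solution_continuous_fst[OF w]] B])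
    from compact_section_uniform[OF this T(2) e', of x0] obtain \<eta>1 where \<eta>1: "\<eta>1 > 0"
      "\<And>s x. \<bar>s\<bar> \<le> T \<Longrightarrow> dist x x0 < \<eta>1 \<Longrightarrow> dist (?R (s, x)) (?R (s, x0)) < \<epsilon>'"
      by blast
    obtain \<eta>2 where \<eta>2: "\<eta>2 > 0" "\<And>x. dist x x0 < \<eta>2 \<Longrightarrow> dist (c x) (c x0) < \<epsilon>'"
      using c e' unfolding continuous_on_iff by (metis UNIV_I)
    have "isCont (\<lambda>s. w (s, x0)) s0"
      using solution_continuous_fst[OF w] s0 by (simp add: continuous_on_eq_continuous_at)
    then obtain \<eta>3 where \<eta>3: "\<eta>3 > 0" "\<And>s. dist s s0 < \<eta>3 \<Longrightarrow> dist (w (s, x0)) (w (s0, x0)) < \<epsilon> / 2"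
      using e unfolding continuous_at_eps_delta by (metis half_gt_zero)
    have x: "norm (w (s, x) - w (s, x0)) \<le> \<epsilon> / 2"
      if s: "\<bar>s\<bar> \<le> T" and x: "dist x x0 < \<eta>1" "dist x x0 < \<eta>2" for s x
    proof -
      have "norm (w (s, x) - w (s, x0)) \<le> 2 * norm (w (0, x) - w (0, x0)) + 2 * \<delta> * \<epsilon>'"
      proof (rule perturbation_bound[OF s T(2), where R = "\<lambda>s. ?R (s, x) - ?R (s, x0)"])
        fix s assume s: "\<bar>s\<bar> \<le> T"
        have sJ: "\<bar>s\<bar> < \<delta>" "(s, x) \<in> J" using s T by auto
        have "((\<lambda>s. w (s, x) - w (s, x0)) has_vector_derivative
           (A (s, x) (w (s, x)) + B (s, x)) - (A (s, x0) (w (s, x0)) + B (s, x0))) (at s)"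
          by (intro has_vector_derivative_diff solvesD[OF w] sJ)
        moreover have "(A (s, x) (w (s, x)) + B (s, x)) - (A (s, x0) (w (s, x0)) + B (s, x0)) =
            A (s, x) (w (s, x) - w (s, x0)) + (?R (s, x) - ?R (s, x0))"
          by (simp add: linear_diff[OF lin[OF sJ(2)]])
        ultimately show "((\<lambda>s. w (s, x) - w (s, x0)) has_vector_derivative
            A (s, x) (w (s, x) - w (s, x0)) + (?R (s, x) - ?R (s, x0))) (at s)" by simp
        show "norm (?R (s, x) - ?R (s, x0)) \<le> \<epsilon>'" using \<eta>1(2)[OF s x(1)] by (simp add: dist_norm)
      qed
      also have "\<dots> \<le> 2 * \<epsilon>' + 2 * \<delta> * \<epsilon>'"
        using \<eta>2(2)[OF x(2)] solves_0[OF w] by (simp add: dist_norm)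
      also have "\<dots> = 2 * (\<epsilon>' * (1 + \<delta>))" by (simp add: algebra_simps)
      also have "\<dots> = \<epsilon> / 4"
      proof -
        have "\<epsilon>' * (8 * (1 + \<delta>)) = \<epsilon>" using \<delta> by (simp add: \<epsilon>'_def)
        then show ?thesis by (simp add: algebra_simps)
      qed
      also have "\<dots> \<le> \<epsilon> / 2" using e by simp
      finally show ?thesis .
    qed
    show "\<exists>d>0. \<forall>q. dist q (s0, x0) < d \<longrightarrow> dist (w q) (w (s0, x0)) < \<epsilon>"
    proof (intro exI conjI allI impI)
      show "0 < Min {\<eta>1, \<eta>2, \<eta>3, T - \<bar>s0\<bar>}" using \<eta>1 \<eta>2 \<eta>3 T by simp
      fix q assume q: "dist q (s0, x0) < Min {\<eta>1, \<eta>2, \<eta>3, T - \<bar>s0\<bar>}"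
      obtain s x where sx: "q = (s, x)" by (cases q)
      have d: "dist s s0 \<le> dist q (s0, x0)" "dist x x0 \<le> dist q (s0, x0)"
        using dist_fst_le[of q "(s0, x0)"] dist_snd_le[of q "(s0, x0)"] sx by auto
      have "\<bar>s\<bar> \<le> T" using d(1) q by (auto simp: dist_real_def)
      then have "norm (w (s, x) - w (s, x0)) \<le> \<epsilon> / 2" using d q by (intro x) auto
      moreover have "dist (w (s, x0)) (w (s0, x0)) < \<epsilon> / 2" using d q by (intro \<eta>3) auto
      ultimately show "dist (w q) (w (s0, x0)) < \<epsilon>"
        using dist_triangle[of "w (s, x)" "w (s0, x0)" "w (s, x0)"] sx by (simp add: dist_norm)
    qed
  qed
  then show ?thesis by (auto intro!: continuous_at_imp_continuous_on)
qed

end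

lemma Ck_on_continuous_on: "Ck_on k S f \<Longrightarrow> continuous_on S f"
  using Ck_on_le[of k S f 0] by simp

lemma sum_inner_bound:
  fixes h :: "'p::euclidean_space" and a :: "'p \<Rightarrow> 'b::real_normed_vector"
  shows "norm (\<Sum>i\<in>Basis. (h \<bullet> i) *\<^sub>R a i) \<le> (\<Sum>i\<in>Basis. norm (a i)) * norm h"
proof -
  have "norm (\<Sum>i\<in>Basis. (h \<bullet> i) *\<^sub>R a i) \<le> (\<Sum>i\<in>Basis. norm (a i) * norm h)"
  proof (rule sum_norm_le)
    show "norm ((h \<bullet> i) *\<^sub>R a i) \<le> norm (a i) * norm h" if "i \<in> Basis" for i
      using mult_right_mono[OF Basis_le_norm[OF that, of h], of "norm (a i)"] by (simp add: mult.commute)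
  qed
  then show ?thesis by (simp add: sum_distrib_right)
qed

lemma linear_basis_expansion:
  fixes h :: "'p::euclidean_space"
  assumes "linear F" shows "F h = (\<Sum>i\<in>Basis. (h \<bullet> i) *\<^sub>R F i)"
  using linear_sum[OF assms, of "\<lambda>i. (h \<bullet> i) *\<^sub>R i" Basis] linear_scale[OF assms]
  by (simp add: euclidean_representation)

lemma bounded_linear_inner_sum:
  fixes a :: "'p::euclidean_space \<Rightarrow> 'b::real_normed_vector"
  shows "bounded_linear (\<lambda>h. \<Sum>i\<in>Basis. (h \<bullet> i) *\<^sub>R a i)"
  by (intro bounded_linear_sum bounded_linear_compose[OF bounded_linear_scaleR_left bounded_linear_inner_left])

lemma has_vector_derivative_sum_scaled:
  assumes "\<And>i. i \<in> I \<Longrightarrow> ((\<lambda>s. z i s) has_vector_derivative z' i) F"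
  shows "((\<lambda>s. \<Sum>i\<in>I. a i *\<^sub>R z i s) has_vector_derivative (\<Sum>i\<in>I. a i *\<^sub>R z' i)) F"
proof (rule has_vector_derivative_sum)
  show "((\<lambda>s. a i *\<^sub>R z i s) has_vector_derivative a i *\<^sub>R z' i) F" if "i \<in> I" for i
    using bounded_linear.has_vector_derivative[OF bounded_linear_scaleR_right assms[OF that]] .
qed

context linear_ode
begin

lemma linear_coefficient_derivative:
  assumes q: "q \<in> J" and A: "\<And>v. ((\<lambda>q. A q v) has_derivative D v) (at q)"
  shows "linear (\<lambda>v. frechet_derivative (\<lambda>p. A p v) (at q) h)"
proof -
  have "frechet_derivative (\<lambda>p. A p (a + b)) (at q) = (\<lambda>h. D a h + D b h)" for a b
    by (rule frechet_derivativeI,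
      rule has_derivative_cong_open[OF open_J q, THEN iffD1, OF _ has_derivative_add[OF A A]])
      (simp add: linear_add[OF lin])
  moreover have "frechet_derivative (\<lambda>p. A p (r *\<^sub>R a)) (at q) = (\<lambda>h. r *\<^sub>R D a h)" for r a
    by (rule frechet_derivativeI,
      rule has_derivative_cong_open[OF open_J q, THEN iffD1, OF _ has_derivative_scaleR_right[OF A]])
      (simp add: linear_scale[OF lin])
  moreover have "frechet_derivative (\<lambda>p. A p a) (at q) = D a" for a
    by (rule frechet_derivativeI[OF A])
  ultimately show ?thesis by (auto intro!: linearI)
qed

text \<open>The candidates \<open>z i\<close> solve the equation obtained by formal differentiation
  in direction \<open>i\<close>. The error of the linear approximation then solves the original
  equation with a remainder that is o(|h|) uniformly in time.\<close>

lemma solution_differentiable_snd: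
  assumes A: "\<And>v. Ck_on 1 J (\<lambda>q. A q v)" and B: "Ck_on 1 J B" and c: "Ck_on 1 UNIV c" and w: "solves B c w"
    and z: "\<And>i. i \<in> Basis \<Longrightarrow> solves (\<lambda>q. frechet_derivative (\<lambda>p. A p (w q)) (at q) (0, i) + frechet_derivative B (at q) (0, i))
       (\<lambda>x. frechet_derivative c (at x) i) (z i)"
    and q: "q \<in> J"
  shows "((\<lambda>x. w (fst q, x)) has_derivative (\<lambda>h. \<Sum>i\<in>Basis. (h \<bullet> i) *\<^sub>R z i q)) (at (snd q))"
proof -
  obtain s x where sx: "q = (s, x)" "\<bar>s\<bar> < \<delta>" using q by (cases q) (auto simp: abs_less_iff)
  have Ac: "continuous_on J (\<lambda>q. A q v)" for v using Ck_on_continuous_on[OF A] .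
  have dA: "((\<lambda>q. A q v) has_derivative frechet_derivative (\<lambda>q. A q v) (at q)) (at q)" if "q \<in> J" for q v
    by (rule Ck_on_has_derivative[of 0, OF _ that]) (use A[of v] in simp)
  have dB: "(B has_derivative frechet_derivative B (at q)) (at q)" if "q \<in> J" for q
    by (rule Ck_on_has_derivative[of 0, OF _ that]) (use B in simp)
  have dc: "(c has_derivative frechet_derivative c (at x)) (at x)" for x
    by (rule Ck_on_has_derivative[of 0 UNIV]) (use c in simp_all)
  define DA where "DA h q v = frechet_derivative (\<lambda>p. A p v) (at q) (0, h)" for h q v
  define DB where "DB h q = frechet_derivative B (at q) (0, h)" for h q
  have lin_DA: "linear (DA h q)" if "q \<in> J" for h q
    unfolding DA_def by (rule linear_coefficient_derivative[OF that dA[OF that]])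
  have DA_lin: "linear (\<lambda>h. DA h q v)" if "q \<in> J" for q v
    unfolding DA_def
    using linear_compose[of "\<lambda>h. (0::real, h)", OF _ has_derivative_linear[OF dA[OF that]]]
    by (simp add: o_def linear_iff)
  have DB_lin: "linear (\<lambda>h. DB h q)" if "q \<in> J" for q
    unfolding DB_def
    using linear_compose[of "\<lambda>h. (0::real, h)", OF _ has_derivative_linear[OF dB[OF that]]]
    by (simp add: o_def linear_iff)
  define Z where "Z h q = (\<Sum>i\<in>Basis. (h \<bullet> i) *\<^sub>R z i q)" for h q
  have Z: "((\<lambda>s. Z h (s, x)) has_vector_derivative A (s, x) (Z h (s, x)) + DA h (s, x) (w (s, x)) + DB h (s, x)) (at s)"
    if "\<bar>s\<bar> < \<delta>" for s h
  proof -
    have qJ: "(s, x) \<in> J" using that by (auto simp: abs_less_iff)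
    have "((\<lambda>s. Z h (s, x)) has_vector_derivative
        (\<Sum>i\<in>Basis. (h \<bullet> i) *\<^sub>R (A (s, x) (z i (s, x)) + (DA i (s, x) (w (s, x)) + DB i (s, x))))) (at s)"
      unfolding Z_def
    proof (rule has_vector_derivative_sum_scaled)
      fix i :: 'p assume i: "i \<in> Basis"
      show "((\<lambda>s. z i (s, x)) has_vector_derivative
          A (s, x) (z i (s, x)) + (DA i (s, x) (w (s, x)) + DB i (s, x))) (at s)"
        using solvesD[OF z[OF i] that] unfolding DA_def DB_def .
    qed
    moreover have "(\<Sum>i\<in>Basis. (h \<bullet> i) *\<^sub>R (A (s, x) (z i (s, x)) + (DA i (s, x) (w (s, x)) + DB i (s, x)))) =
        A (s, x) (Z h (s, x)) + DA h (s, x) (w (s, x)) + DB h (s, x)"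
      unfolding Z_def linear_sum[OF lin[OF qJ]] linear_scale[OF lin[OF qJ]]
        linear_basis_expansion[OF DA_lin[OF qJ], of h] linear_basis_expansion[OF DB_lin[OF qJ], of h]
      by (simp add: sum.distrib scaleR_add_right)
    ultimately show ?thesis by simp
  qed
  have "((\<lambda>x. w (s, x)) has_derivative (\<lambda>h. Z h (s, x))) (at x)"
    unfolding has_derivative_at_alt
  proof (intro conjI allI impI)
    show "bounded_linear (\<lambda>h. Z h (s, x))" unfolding Z_def by (rule bounded_linear_inner_sum)
    fix \<epsilon> :: real assume e: "0 < \<epsilon>"
    \<comment> \<open>The initial error contributes 2 \<epsilon>' |h| and the two remainders
      together 4 \<delta> \<epsilon>' |h|, in total at most \<epsilon> |h|.\<close>
    define \<epsilon>' where "\<epsilon>' = \<epsilon> / (4 * (1 + \<delta>))"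
    have e': "0 < \<epsilon>'" using e \<delta> by (simp add: \<epsilon>'_def)
    have ee: "\<epsilon>' * (4 * (1 + \<delta>)) = \<epsilon>" using \<delta> by (simp add: \<epsilon>'_def)
    let ?M = "\<lambda>q. A q (w (fst q, x)) + B q"
    let ?M' = "\<lambda>h q. DA h q (w (fst q, x)) + DB h q"
    let ?N = "\<lambda>q. \<Sum>i\<in>(Basis::'p set). norm (A q (z i (fst q, x)) - A (fst q, x) (z i (fst q, x)))"
    have M1: "((\<lambda>y. ?M (fst q, y)) has_derivative (\<lambda>h. ?M' h q)) (at (snd q))" if "q \<in> J" for q
    proof -
      have pair: "((\<lambda>y. (fst q, y)) has_derivative (\<lambda>h. (0, h))) (at (snd q))"
        by (auto intro!: derivative_eq_intros)
      show ?thesis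
        using has_derivative_add[OF has_derivative_compose[OF pair] has_derivative_compose[OF pair],
          of "\<lambda>p. A p (w (fst q, x))" _ B] dA[OF that] dB[OF that] unfolding DA_def DB_def by simp
    qed
    have wc: "continuous_on J (\<lambda>q. w (fst q, x))"
      by (rule continuous_on_compose2[OF solution_continuous_fst[OF w]]) (auto intro: continuous_intros)
    have M2: "continuous_on J (?M' h)" for h
    proof (intro continuous_on_add linear_continuous_apply[OF lin_DA _ wc])
      show "continuous_on J (\<lambda>q. DA h q v)" for v unfolding DA_def using A[of v] by simp
      show "continuous_on J (DB h)" unfolding DB_def using B by simp
    qed
    have N: "continuous_on J ?N"
    proof (intro continuous_on_sum continuous_on_norm continuous_on_diff)
      fix i :: 'p assume i: "i \<in> Basis"
      have zc: "continuous_on {-\<delta><..<\<delta>} (\<lambda>s. z i (s, x))" by (rule solution_continuous_fst[OF z[OF i]])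
      show 1: "continuous_on J (\<lambda>q. A q (z i (fst q, x)))"
        by (rule frozen_continuous[OF Ac zc])
      show "continuous_on J (\<lambda>q. A (fst q, x) (z i (fst q, x)))"
      proof -
        have "continuous_on J (\<lambda>q. (fst q, x))" by (intro continuous_intros)
        moreover have "(\<lambda>q. (fst q, x)) ` J \<subseteq> J" by auto
        ultimately show ?thesis using continuous_on_compose2[OF 1] by fastforce
      qed
    qed
    from compact_section_linearization[OF M1 M2 sx(2) e', of x] obtain \<eta>1 where \<eta>1: "\<eta>1 > 0"
      "\<And>r h. \<bar>r\<bar> \<le> \<bar>s\<bar> \<Longrightarrow> norm h < \<eta>1 \<Longrightarrow> norm (?M (r, x + h) - ?M (r, x) - ?M' h (r, x)) \<le> \<epsilon>' * norm h"
      by blast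
    from compact_section_uniform[OF N sx(2) e', of x] obtain \<eta>2 where \<eta>2: "\<eta>2 > 0"
      "\<And>r y. \<bar>r\<bar> \<le> \<bar>s\<bar> \<Longrightarrow> dist y x < \<eta>2 \<Longrightarrow> dist (?N (r, y)) (?N (r, x)) < \<epsilon>'"
      by blast
    obtain \<eta>3 where \<eta>3: "\<eta>3 > 0"
      "\<And>y. norm (y - x) < \<eta>3 \<Longrightarrow> norm (c y - c x - frechet_derivative c (at x) (y - x)) \<le> \<epsilon>' * norm (y - x)"
      using dc[of x] e' unfolding has_derivative_at_alt by blast
    show "\<exists>d>0. \<forall>y. norm (y - x) < d \<longrightarrow> norm (w (s, y) - w (s, x) - Z (y - x) (s, x)) \<le> \<epsilon> * norm (y - x)"
    proof (intro exI conjI allI impI)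
      show "0 < Min {\<eta>1, \<eta>2, \<eta>3}" using \<eta>1 \<eta>2 \<eta>3 by simp
      fix y assume y: "norm (y - x) < Min {\<eta>1, \<eta>2, \<eta>3}"
      define h where "h = y - x"
      let ?R = "\<lambda>r. (?M (r, y) - ?M (r, x) - ?M' h (r, x)) + (A (r, y) (Z h (r, x)) - A (r, x) (Z h (r, x)))"
      have "norm (w (s, y) - w (s, x) - Z h (s, x)) \<le>
          2 * norm (w (0, y) - w (0, x) - Z h (0, x)) + 2 * \<delta> * (2 * (\<epsilon>' * norm h))"
      proof (rule perturbation_bound[OF order_refl sx(2), where R = ?R])
        fix r assume r: "\<bar>r\<bar> \<le> \<bar>s\<bar>"
        have rJ: "\<bar>r\<bar> < \<delta>" "(r, y) \<in> J" "(r, x) \<in> J" using r sx(2) by (auto simp: abs_less_iff)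
        have "((\<lambda>r. w (r, y) - w (r, x) - Z h (r, x)) has_vector_derivative
            (A (r, y) (w (r, y)) + B (r, y)) - (A (r, x) (w (r, x)) + B (r, x)) -
            (A (r, x) (Z h (r, x)) + DA h (r, x) (w (r, x)) + DB h (r, x))) (at r)"
          by (intro has_vector_derivative_diff solvesD[OF w] Z rJ)
        moreover have "(A (r, y) (w (r, y)) + B (r, y)) - (A (r, x) (w (r, x)) + B (r, x)) -
            (A (r, x) (Z h (r, x)) + DA h (r, x) (w (r, x)) + DB h (r, x)) =
            A (r, y) (w (r, y) - w (r, x) - Z h (r, x)) + ?R r"
          by (simp add: linear_diff[OF lin[OF rJ(2)]])
        ultimately show "((\<lambda>r. w (r, y) - w (r, x) - Z h (r, x)) has_vector_derivative
            A (r, y) (w (r, y) - w (r, x) - Z h (r, x)) + ?R r) (at r)" by simp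
        have 1: "norm (?M (r, y) - ?M (r, x) - ?M' h (r, x)) \<le> \<epsilon>' * norm h"
          using \<eta>1(2)[OF r, of h] y by (simp add: h_def)
        have "A (r, y) (Z h (r, x)) - A (r, x) (Z h (r, x)) =
            (\<Sum>i\<in>Basis. (h \<bullet> i) *\<^sub>R (A (r, y) (z i (r, x)) - A (r, x) (z i (r, x))))"
          unfolding Z_def linear_sum[OF lin[OF rJ(2)]] linear_sum[OF lin[OF rJ(3)]]
            linear_scale[OF lin[OF rJ(2)]] linear_scale[OF lin[OF rJ(3)]]
          by (simp add: sum_subtractf scaleR_diff_right)
        then have "norm (A (r, y) (Z h (r, x)) - A (r, x) (Z h (r, x))) \<le> ?N (r, y) * norm h"
          using sum_inner_bound[of h "\<lambda>i. A (r, y) (z i (r, x)) - A (r, x) (z i (r, x))"] by simp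
        also have "\<dots> \<le> \<epsilon>' * norm h"
          using \<eta>2(2)[OF r, of y] y by (intro mult_right_mono) (auto simp: dist_norm)
        finally have 2: "norm (A (r, y) (Z h (r, x)) - A (r, x) (Z h (r, x))) \<le> \<epsilon>' * norm h" .
        show "norm (?R r) \<le> 2 * (\<epsilon>' * norm h)"
          using norm_triangle_mono[OF 1 2] by simp
      qed
      also have "norm (w (0, y) - w (0, x) - Z h (0, x)) \<le> \<epsilon>' * norm h"
      proof -
        have "Z h (0, x) = frechet_derivative c (at x) h"
          unfolding Z_def linear_basis_expansion[OF has_derivative_linear[OF dc], of x h]
          using solves_0[OF z] by simp
        then show ?thesis using \<eta>3(2)[of y] y solves_0[OF w] by (simp add: h_def)
      qed
      also have "2 * (\<epsilon>' * norm h) + 2 * \<delta> * (2 * (\<epsilon>' * norm h)) \<le> \<epsilon> * norm h"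
      proof -
        have "2 * (\<epsilon>' * norm h) + 2 * \<delta> * (2 * (\<epsilon>' * norm h)) =
          (\<epsilon>' * (4 * (1 + \<delta>))) * norm h - 2 * (\<epsilon>' * norm h)" by (simp add: algebra_simps)
        also have "\<dots> \<le> \<epsilon> * norm h" unfolding ee using e' by simp
        finally show ?thesis .
      qed
      finally show "norm (w (s, y) - w (s, x) - Z (y - x) (s, x)) \<le> \<epsilon> * norm (y - x)"
        by (simp add: h_def)
    qed
  qed
  then show ?thesis using sx by (simp add: Z_def)
qed

text \<open>The derivative in the parameter solves an equation with the same coefficient
  \<open>A\<close> and an inhomogeneity containing \<open>w\<close>. Hence the induction runs over
  all \<open>B\<close>, \<open>c\<close> and \<open>w\<close>: the hypothesis first gives
  \<open>w\<close> the lower regularity, and then applies again to its derivatives.\<close>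

lemma solution_Ck:
  assumes "\<And>v. Ck_on k J (\<lambda>q. A q v)" "Ck_on k J B" "Ck_on k UNIV c" "solves B c w"
  shows "Ck_on k J w"
  using assms
proof (induction k arbitrary: B c w)
  case 0
  then show ?case using solution_continuous[of B c w] by simp
next
  case (Suc k)
  have A: "Ck_on k J (\<lambda>q. A q v)" "Ck_on 1 J (\<lambda>q. A q v)" for v
    using Ck_on_pred[OF Suc.prems(1)] Ck_on_le[OF Suc.prems(1), of 1] by simp_all
  have B: "Ck_on k J B" "Ck_on 1 J B" and c: "Ck_on 1 UNIV c"
    using Ck_on_pred[OF Suc.prems(2)] Ck_on_le[OF Suc.prems(2), of 1] Ck_on_le[OF Suc.prems(3), of 1] by simp_all
  have w: "Ck_on k J w"
    by (rule Suc.IH[OF A(1) B(1) Ck_on_pred[OF Suc.prems(3)] Suc.prems(4)])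
  define G where "G i q = frechet_derivative (\<lambda>p. A p (w q)) (at q) (0, i) + frechet_derivative B (at q) (0, i)" for i q
  have dA: "((\<lambda>q. A q v) has_derivative frechet_derivative (\<lambda>q. A q v) (at q)) (at q)" if "q \<in> J" for q v
    by (rule Ck_on_has_derivative[OF Suc.prems(1) that])
  have G: "Ck_on k J (G i)" for i
    unfolding G_def
  proof (rule Ck_on_add[OF open_J])
    show "Ck_on k J (\<lambda>q. frechet_derivative (\<lambda>p. A p (w q)) (at q) (0, i))"
    proof (rule Ck_on_linear_apply[OF open_J _ _ w, where A = "\<lambda>q v. frechet_derivative (\<lambda>p. A p v) (at q) (0, i)"])
      show "Ck_on k J (\<lambda>q. frechet_derivative (\<lambda>p. A p v) (at q) (0, i))" for v
        using Suc.prems(1)[of v] by simp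
      show "linear (\<lambda>v. frechet_derivative (\<lambda>p. A p v) (at q) (0, i))" if q: "q \<in> J" for q
        by (rule linear_coefficient_derivative[OF q dA[OF q]])
    qed
    show "Ck_on k J (\<lambda>q. frechet_derivative B (at q) (0, i))" using Suc.prems(2) by simp
  qed
  have "\<exists>z. solves (G i) (\<lambda>x. frechet_derivative c (at x) i) z" for i
    by (rule solution_exists) (use Ck_on_continuous_on[OF A(1)] Ck_on_continuous_on[OF G] in auto)
  then obtain z where z: "\<And>i. solves (G i) (\<lambda>x. frechet_derivative c (at x) i) (z i)" by metis
  have zk: "Ck_on k J (z i)" for i
    by (rule Suc.IH[OF A(1) G _ z]) (use Suc.prems(3) in simp)
  let ?Z = "\<lambda>h q. \<Sum>i\<in>Basis. (h \<bullet> i) *\<^sub>R z i q"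
  have Zk: "Ck_on k J (?Z h)" for h
    by (intro Ck_on_sum Ck_on_bounded_linear[OF bounded_linear_scaleR_right] open_J zk)
  show ?case
  proof (rule Ck_on_SucI[OF open_J])
    fix q assume q: "q \<in> J"
    show "(w has_derivative (\<lambda>h. fst h *\<^sub>R (A q (w q) + B q) + ?Z (snd h) q)) (at q)"
    proof (rule joint_has_derivative[OF q])
      show "((\<lambda>s. w (s, snd q)) has_vector_derivative A q (w q) + B q) (at (fst q))"
        using Suc.prems(4) q unfolding solves_def by blast
      show "((\<lambda>x. w (fst q, x)) has_derivative (\<lambda>h. ?Z h q)) (at (snd q))" if "q \<in> J" for q
        by (rule solution_differentiable_snd[OF A(2) B(2) c Suc.prems(4) _ that])
          (use z in \<open>simp add: G_def[abs_def]\<close>)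
      show "continuous_on J (?Z h)" for h using Ck_on_continuous_on[OF Zk] .
    qed
  next
    fix h :: "real \<times> 'p"
    show "Ck_on k J (\<lambda>q. fst h *\<^sub>R (A q (w q) + B q) + ?Z (snd h) q)"
      by (intro Ck_on_add open_J Zk Ck_on_bounded_linear[OF bounded_linear_scaleR_right] B(1)
        Ck_on_linear_apply[OF open_J lin A(1) w])
  qed
qed

end

section \<open>The flow of a compactly supported vector field\<close>

lemma smooth_on_derivative_bound:
  fixes f :: "'a::euclidean_space \<Rightarrow> 'b::real_normed_vector"
  assumes f: "smooth_on S f" and K: "compact K" "K \<subseteq> S"
  obtains L where "L \<ge> 0" "\<And>x v. x \<in> K \<Longrightarrow> norm (frechet_derivative f (at x) v) \<le> L * norm v"
proof -
  have "\<exists>b\<ge>0. \<forall>x\<in>K. norm (frechet_derivative f (at x) v) \<le> b" for v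
  proof -
    have "bounded ((\<lambda>x. frechet_derivative f (at x) v) ` K)"
      by (intro compact_imp_bounded compact_continuous_image K(1)
        continuous_on_subset[OF smooth_on_continuous_on[OF smooth_on_derivative_dir[OF f]] K(2)])
    then obtain b where "b > 0" "\<And>x. x \<in> K \<Longrightarrow> norm (frechet_derivative f (at x) v) \<le> b"
      unfolding bounded_pos by blast
    then show ?thesis using less_imp_le by blast
  qed
  then obtain b where b: "\<And>v. b v \<ge> 0" "\<And>v x. x \<in> K \<Longrightarrow> norm (frechet_derivative f (at x) v) \<le> b v"
    by metis
  show ?thesis
  proof (rule that)
    show "0 \<le> (\<Sum>i\<in>Basis. b i)" by (intro sum_nonneg b)
    show "norm (frechet_derivative f (at x) v) \<le> (\<Sum>i\<in>Basis. b i) * norm v" if x: "x \<in> K" for x v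
    proof -
      have "norm (frechet_derivative f (at x) v) \<le> (\<Sum>i\<in>Basis. norm (frechet_derivative f (at x) i)) * norm v"
        using sum_inner_bound[of v "frechet_derivative f (at x)"] x K(2)
          linear_basis_expansion[OF has_derivative_linear[OF smooth_on_has_derivative[OF f]], of x v] by auto
      also have "\<dots> \<le> (\<Sum>i\<in>Basis. b i) * norm v" by (intro mult_right_mono sum_mono b x) simp
      finally show ?thesis .
    qed
  qed
qed

text \<open>Compact support makes the field globally Lipschitz, so one time span serves all starting
  points. The linearized equation has coefficients depending on the flow itself, hence regularity is
  gained step by step: a flow of class k gives coefficients of class k, so its space derivative is
  of class k and the flow of class k + 1.\<close>

theorem local_flow:
  fixes f :: "'a::euclidean_space \<Rightarrow> 'a"
  assumes f: "smooth_on UNIV f" and K: "compact K" "\<And>x. x \<notin> K \<Longrightarrow> f x = 0"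
  obtains \<delta> \<Phi> where "\<delta> > 0" "smooth_on ({-\<delta><..<\<delta>} \<times> UNIV) (\<lambda>q. \<Phi> (fst q) (snd q))"
    "\<And>x. \<Phi> 0 x = x"
    "\<And>s x. \<bar>s\<bar> < \<delta> \<Longrightarrow> ((\<lambda>s. \<Phi> s x) has_vector_derivative f (\<Phi> s x)) (at s)"
    "\<And>s x. \<bar>s\<bar> < \<delta> \<Longrightarrow> \<Phi> (- s) (\<Phi> s x) = x"
    "\<And>s x. \<bar>s\<bar> < \<delta> \<Longrightarrow> f x = 0 \<Longrightarrow> \<Phi> s x = x"
proof -
  have df: "(f has_derivative frechet_derivative f (at x)) (at x)" for x
    using smooth_on_has_derivative[OF f] by simp
  obtain L where L0: "0 \<le> L" and L: "\<And>x v. x \<in> K \<Longrightarrow> norm (frechet_derivative f (at x) v) \<le> L * norm v"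
    using smooth_on_derivative_bound[OF f K(1) subset_UNIV] by blast
  have "frechet_derivative f (at x) v = 0" if "x \<notin> K" for x v
    using frechet_derivative_cong_open[of "- K" x f "\<lambda>x. 0"] K that
    by (simp add: open_Compl compact_imp_closed)
  then have DL: "norm (frechet_derivative f (at x) v) \<le> L * norm v" for x v
    using L[of x v] L0 by (cases "x \<in> K") auto
  have lip: "norm (f x - f y) \<le> L * norm (x - y)" for x y
    by (rule differentiable_bound[of UNIV]) (use df DL L0 in \<open>auto intro!: onorm_bound\<close>)
  \<comment> \<open>This gives \<delta> L \<le> 1/2, the smallness asked for by the short-time
    estimates, and stays meaningful for L = 0.\<close>
  define \<delta> where "\<delta> = 1 / (2 * (L + 1))"
  have \<delta>: "0 < \<delta>" "\<delta> * L \<le> 1/2" using L0 by (auto simp: \<delta>_def field_simps)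
  have TL: "\<bar>s\<bar> * L \<le> 1/2" if "\<bar>s\<bar> < \<delta>" for s
    using mult_right_mono[of "\<bar>s\<bar>" \<delta> L] that L0 \<delta> by linarith
  have "\<exists>y. y 0 = x \<and> (\<forall>s\<in>{-\<delta><..<\<delta>}. (y has_vector_derivative f (y s)) (at s))" for x
  proof (rule ode_exists_open[OF _ lip L0 \<delta>(2,1)])
    show "continuous_on ({-\<delta><..<\<delta>} \<times> UNIV) (\<lambda>(s, y). f y)"
      unfolding split_def
      by (rule continuous_on_compose2[OF smooth_on_continuous_on[OF f] continuous_on_snd[OF continuous_on_id]]) simp
  qed
  then obtain Y where Y: "\<And>x. Y x 0 = x"
    "\<And>x s. s \<in> {-\<delta><..<\<delta>} \<Longrightarrow> (Y x has_vector_derivative f (Y x s)) (at s)"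
    by metis
  define \<Phi> where "\<Phi> s x = Y x s" for s x
  have \<Phi>0: "\<Phi> 0 x = x" for x by (simp add: \<Phi>_def Y)
  have \<Phi>': "((\<lambda>s. \<Phi> s x) has_vector_derivative f (\<Phi> s x)) (at s)" if "\<bar>s\<bar> < \<delta>" for s x
    unfolding \<Phi>_def using Y(2)[of s x] that by (auto simp: abs_less_iff)
  define w where "w q = \<Phi> (fst q) (snd q)" for q
  let ?J = "{-\<delta><..<\<delta>} \<times> (UNIV :: 'a set)"
  have open_J: "open ?J" by (intro open_Times) auto
  have lip\<Phi>: "norm (\<Phi> s x - \<Phi> s y) \<le> 2 * norm (x - y)" if s: "\<bar>s\<bar> < \<delta>" for s x y
  proof -
    have "norm (\<Phi> s x - \<Phi> s y) \<le> 2 * norm (\<Phi> 0 x - \<Phi> 0 y) + 2 * \<bar>s\<bar> * 0"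
    proof (rule short_time_bound[of "{-\<delta><..<\<delta>}"])
      show "((\<lambda>s. \<Phi> s x - \<Phi> s y) has_vector_derivative f (\<Phi> s x) - f (\<Phi> s y)) (at s within {-\<delta><..<\<delta>})"
        if "s \<in> {-\<delta><..<\<delta>}" for s
        by (rule has_vector_derivative_at_within[OF has_vector_derivative_diff[OF \<Phi>' \<Phi>']]) (use that in auto)
    qed (use s lip L0 TL in auto)
    then show ?thesis by (simp add: \<Phi>0)
  qed
  have \<Phi>c: "continuous_on {-\<delta><..<\<delta>} (\<lambda>s. \<Phi> s x)" for x
    by (rule vector_derivative_continuous_on[where f' = "\<lambda>s. f (\<Phi> s x)"])
      (auto intro!: has_vector_derivative_at_within \<Phi>')
  have wc: "continuous_on ?J w"
  proof -
    have "isCont w (s, x)" if s: "s \<in> {-\<delta><..<\<delta>}" for s x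
      unfolding continuous_at_eps_delta
    proof (intro allI impI)
      fix \<epsilon> :: real assume e: "0 < \<epsilon>"
      have "isCont (\<lambda>s. \<Phi> s x) s" using \<Phi>c s by (simp add: continuous_on_eq_continuous_at)
      then obtain \<eta> where \<eta>: "\<eta> > 0" "\<And>r. dist r s < \<eta> \<Longrightarrow> dist (\<Phi> r x) (\<Phi> s x) < \<epsilon> / 2"
        using e unfolding continuous_at_eps_delta by (metis half_gt_zero)
      show "\<exists>d>0. \<forall>q. dist q (s, x) < d \<longrightarrow> dist (w q) (w (s, x)) < \<epsilon>"
      proof (intro exI conjI allI impI)
        show "0 < Min {\<eta>, \<delta> - \<bar>s\<bar>, \<epsilon> / 4}" using \<eta> e s by auto
        fix q assume q: "dist q (s, x) < Min {\<eta>, \<delta> - \<bar>s\<bar>, \<epsilon> / 4}"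
        have d: "dist (fst q) s \<le> dist q (s, x)" "dist (snd q) x \<le> dist q (s, x)"
          using dist_fst_le[of q "(s, x)"] dist_snd_le[of q "(s, x)"] by auto
        have "\<bar>fst q\<bar> < \<delta>" using d(1) q by (auto simp: dist_real_def)
        from lip\<Phi>[OF this, of "snd q" x] have "dist (w q) (\<Phi> (fst q) x) \<le> 2 * dist (snd q) x"
          by (simp add: w_def dist_norm)
        moreover have "dist (\<Phi> (fst q) x) (w (s, x)) < \<epsilon> / 2" using \<eta>(2)[of "fst q"] d q by (simp add: w_def)
        ultimately show "dist (w q) (w (s, x)) < \<epsilon>"
          using dist_triangle[of "w q" "w (s, x)" "\<Phi> (fst q) x"] d q by auto
      qed
    qed
    then show ?thesis by (auto intro!: continuous_at_imp_continuous_on)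
  qed
  define A where "A q = frechet_derivative f (at (w q))" for q
  interpret linear_ode A \<delta> L
  proof (rule linear_ode.intro)
    show "linear (A q)" for q unfolding A_def by (rule has_derivative_linear[OF df])
  qed (simp_all only: A_def DL L0 \<delta>)
  have AC: "Ck_on k ?J (\<lambda>q. A q v)" if "Ck_on k ?J w" for k v
    unfolding A_def
    by (rule Ck_on_compose[OF open_J that, of UNIV])
      (use smooth_on_derivative_dir[OF f] in \<open>auto simp: smooth_on_def\<close>)
  have Ac: "continuous_on ?J (\<lambda>q. A q v)" for v using AC[of 0] wc by simp
  have "\<exists>z. solves (\<lambda>q. 0) (\<lambda>x. i) z" for i
    by (rule solution_exists[OF Ac]) simp
  then obtain z where z: "\<And>i. solves (\<lambda>q. 0) (\<lambda>x. i) (z i)" by metis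
  let ?Z = "\<lambda>h q. \<Sum>i\<in>Basis. (h \<bullet> i) *\<^sub>R z i q"
  have zC: "Ck_on k ?J (z i)" if "Ck_on k ?J w" for k i
    by (rule solution_Ck[OF AC[OF that] _ _ z]) (auto intro: Ck_on_const open_J)
  have ZC: "Ck_on k ?J (?Z h)" if "Ck_on k ?J w" for k h
    by (intro Ck_on_sum Ck_on_bounded_linear[OF bounded_linear_scaleR_right] open_J zC that)
  have Zs: "((\<lambda>s. ?Z h (s, x)) has_vector_derivative A (s, x) (?Z h (s, x))) (at s)" if s: "\<bar>s\<bar> < \<delta>" for s x h
  proof -
    have qJ: "(s, x) \<in> ?J" using s by (auto simp: abs_less_iff)
    have "((\<lambda>s. ?Z h (s, x)) has_vector_derivative (\<Sum>i\<in>Basis. (h \<bullet> i) *\<^sub>R A (s, x) (z i (s, x)))) (at s)"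
      by (rule has_vector_derivative_sum_scaled) (use solvesD[OF z s] in simp)
    then show ?thesis
      unfolding linear_sum[OF lin[OF qJ]] linear_scale[OF lin[OF qJ]] .
  qed
  have Z0: "?Z h (0, x) = h" for h x
    using solves_0[OF z] by (simp add: euclidean_representation)
  have wx: "((\<lambda>x. w (fst q, x)) has_derivative (\<lambda>h. ?Z h q)) (at (snd q))" if q: "q \<in> ?J" for q
  proof -
    obtain s x where sx: "q = (s, x)" "\<bar>s\<bar> < \<delta>" using q by (cases q) (auto simp: abs_less_iff)
    have "((\<lambda>x. w (s, x)) has_derivative (\<lambda>h. ?Z h (s, x))) (at x)"
      unfolding has_derivative_at_alt
    proof (intro conjI allI impI)
      show "bounded_linear (\<lambda>h. ?Z h (s, x))" by (rule bounded_linear_inner_sum)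
      fix \<epsilon> :: real assume e: "0 < \<epsilon>"
      \<comment> \<open>The initial error vanishes exactly, as both the flow and its candidate
        derivative start from the identity; only 4 \<delta> \<epsilon>' |h| remains.\<close>
      define \<epsilon>' where "\<epsilon>' = \<epsilon> / (4 * \<delta>)"
      have e': "0 < \<epsilon>'" using e \<delta> by (simp add: \<epsilon>'_def)
      \<comment> \<open>Here the parameter is the increment added to the trajectory from
        \<open>x\<close>; linearizing at increment 0 compares \<open>f\<close> along neighbouring
        trajectories uniformly in time.\<close>
      let ?M = "\<lambda>q. f (\<Phi> (fst q) x + snd q)"
      let ?M' = "\<lambda>h q. frechet_derivative f (at (\<Phi> (fst q) x + snd q)) h"
      have M1: "((\<lambda>y. ?M (fst q, y)) has_derivative (\<lambda>h. ?M' h q)) (at (snd q))" for q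
        unfolding fst_conv snd_conv
        by (rule has_derivative_compose[of "\<lambda>y. \<Phi> (fst q) x + y" "\<lambda>h. h" "snd q" UNIV, OF _ df])
          (auto intro!: derivative_eq_intros)
      have M2: "continuous_on ?J (?M' h)" for h
        by (rule continuous_on_compose2[OF smooth_on_continuous_on[OF smooth_on_derivative_dir[OF f]]])
          (auto intro!: continuous_intros continuous_on_compose2[OF \<Phi>c])
      obtain \<eta> where \<eta>: "\<eta> > 0"
        "\<And>r h. \<bar>r\<bar> \<le> \<bar>s\<bar> \<Longrightarrow> norm h < \<eta> \<Longrightarrow> norm (?M (r, 0 + h) - ?M (r, 0) - ?M' h (r, 0)) \<le> \<epsilon>' * norm h"
        using compact_section_linearization[OF M1 M2 sx(2) e', of 0] by blast
      show "\<exists>d>0. \<forall>y. norm (y - x) < d \<longrightarrow> norm (w (s, y) - w (s, x) - ?Z (y - x) (s, x)) \<le> \<epsilon> * norm (y - x)"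
      proof (intro exI conjI allI impI)
        \<comment> \<open>Trajectories separate by a factor of at most 2 within the time span, so
          starting points closer than \<eta>/2 stay closer than \<eta>.\<close>
        show "0 < \<eta> / 2" using \<eta> by simp
        fix y assume y: "norm (y - x) < \<eta> / 2"
        define h where "h = y - x"
        let ?R = "\<lambda>r. f (\<Phi> r y) - f (\<Phi> r x) - frechet_derivative f (at (\<Phi> r x)) (\<Phi> r y - \<Phi> r x)"
        have "norm (w (s, y) - w (s, x) - ?Z h (s, x)) \<le>
            2 * norm (w (0, y) - w (0, x) - ?Z h (0, x)) + 2 * \<delta> * (2 * \<epsilon>' * norm h)"
        proof (rule perturbation_bound[OF order_refl sx(2), where R = ?R and x = x])
          fix r assume r: "\<bar>r\<bar> \<le> \<bar>s\<bar>"
          have rJ: "\<bar>r\<bar> < \<delta>" "(r, x) \<in> ?J" using r sx(2) by (auto simp: abs_less_iff)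
          have "((\<lambda>r. w (r, y) - w (r, x) - ?Z h (r, x)) has_vector_derivative
              f (\<Phi> r y) - f (\<Phi> r x) - A (r, x) (?Z h (r, x))) (at r)"
            unfolding w_def fst_conv snd_conv by (intro has_vector_derivative_diff \<Phi>' Zs rJ)
          moreover have "f (\<Phi> r y) - f (\<Phi> r x) - A (r, x) (?Z h (r, x)) =
              A (r, x) (w (r, y) - w (r, x) - ?Z h (r, x)) + ?R r"
            unfolding linear_diff[OF lin[OF rJ(2)]] by (simp add: A_def w_def linear_diff[OF has_derivative_linear[OF df]])
          ultimately show "((\<lambda>r. w (r, y) - w (r, x) - ?Z h (r, x)) has_vector_derivative
              A (r, x) (w (r, y) - w (r, x) - ?Z h (r, x)) + ?R r) (at r)" by simp
          have n: "norm (\<Phi> r y - \<Phi> r x) \<le> 2 * norm h" using lip\<Phi>[OF rJ(1)] by (simp add: h_def)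
          then have "norm (?R r) \<le> \<epsilon>' * norm (\<Phi> r y - \<Phi> r x)"
            using \<eta>(2)[OF r, of "\<Phi> r y - \<Phi> r x"] y by (simp add: h_def)
          also have "\<dots> \<le> \<epsilon>' * (2 * norm h)" using n e' by (intro mult_left_mono) auto
          finally show "norm (?R r) \<le> 2 * \<epsilon>' * norm h" by simp
        qed
        also have "\<dots> = \<epsilon> * norm h" using \<delta> Z0 by (simp add: w_def \<Phi>0 h_def \<epsilon>'_def)
        finally show "norm (w (s, y) - w (s, x) - ?Z (y - x) (s, x)) \<le> \<epsilon> * norm (y - x)" by (simp add: h_def)
      qed
    qed
    then show ?thesis using sx by simp
  qed
  have wC: "Ck_on k ?J w" for k
  proof (induction k)
    case 0
    then show ?case using wc by simp
  next
    case (Suc k)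
    show ?case
    proof (rule Ck_on_SucI[OF open_J])
      fix q assume q: "q \<in> ?J"
      show "(w has_derivative (\<lambda>h. fst h *\<^sub>R f (w q) + ?Z (snd h) q)) (at q)"
      proof (rule joint_has_derivative[OF q _ wx])
        show "((\<lambda>s. w (s, snd q)) has_vector_derivative f (w q)) (at (fst q))"
          using \<Phi>'[of "fst q" "snd q"] q unfolding w_def by (auto simp: abs_less_iff)
        show "continuous_on ?J (?Z h)" for h using Ck_on_continuous_on[OF ZC[OF Suc]] .
      qed
    next
      fix h :: "real \<times> 'a"
      have "Ck_on k ?J (\<lambda>q. f (w q))"
        by (rule Ck_on_compose[OF open_J Suc, of UNIV]) (use f in \<open>auto simp: smooth_on_def\<close>)
      then show "Ck_on k ?J (\<lambda>q. fst h *\<^sub>R f (w q) + ?Z (snd h) q)"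
        by (intro Ck_on_add open_J ZC[OF Suc] Ck_on_bounded_linear[OF bounded_linear_scaleR_right])
    qed
  qed
  have inv: "\<Phi> (- s) (\<Phi> s x) = x" if s: "\<bar>s\<bar> < \<delta>" for s x
  proof -
    \<comment> \<open>The times r for which both r and s + r are admissible. This interval contains
      0 and the time -s at which the two trajectories are compared.\<close>
    let ?I = "{-\<delta><..<\<delta>} \<inter> {-\<delta>-s<..<\<delta>-s}"
    have "\<Phi> (s + - s) x = \<Phi> (- s) (\<Phi> s x)"
    proof (rule ode_unique[where J = ?I and F = "\<lambda>s. f" and s = "- s"])
      show "is_interval ?I" by (intro is_interval_Int is_interval_oo)
      show "((\<lambda>r. \<Phi> (s + r) x) has_vector_derivative f (\<Phi> (s + r) x)) (at r within ?I)" if "r \<in> ?I" for r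
      proof (rule has_vector_derivative_at_within)
        have r: "\<bar>s + r\<bar> < \<delta>" using that by auto
        have "((\<lambda>r. s + r) has_vector_derivative 1) (at r)" by (auto intro!: derivative_eq_intros)
        from vector_diff_chain_at[OF this \<Phi>'[OF r]]
        show "((\<lambda>r. \<Phi> (s + r) x) has_vector_derivative f (\<Phi> (s + r) x)) (at r)"
          by (simp add: o_def)
      qed
      show "((\<lambda>r. \<Phi> r (\<Phi> s x)) has_vector_derivative f (\<Phi> r (\<Phi> s x))) (at r within ?I)" if "r \<in> ?I" for r
        by (rule has_vector_derivative_at_within[OF \<Phi>']) (use that in auto)
    qed (use s lip L0 TL in \<open>auto simp: \<Phi>0\<close>)
    then show ?thesis by (simp add: \<Phi>0)
  qed
  have stationary: "\<Phi> s x = x" if s: "\<bar>s\<bar> < \<delta>" and x: "f x = 0" for s x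
  proof (rule ode_unique[where J = "{-\<delta><..<\<delta>}" and F = "\<lambda>s. f" and y = "\<lambda>s. \<Phi> s x" and z = "\<lambda>s. x"])
    show "((\<lambda>s. \<Phi> s x) has_vector_derivative f (\<Phi> s x)) (at s within {-\<delta><..<\<delta>})" if "s \<in> {-\<delta><..<\<delta>}" for s
      by (rule has_vector_derivative_at_within[OF \<Phi>']) (use that in auto)
  qed (use s x lip L0 TL \<delta> \<Phi>0 in auto)
  show ?thesis
    by (rule that[of \<delta> \<Phi>]) (use \<delta> wC \<Phi>0 \<Phi>' inv stationary in \<open>simp_all add: smooth_on_def w_def[abs_def, symmetric]\<close>)
qed

section \<open>Gradient and divergence in the plane\<close>

lemma linear_vec2:
  fixes F :: "vec2 \<Rightarrow> 'b::real_vector"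
  assumes "linear F"
  shows "F h = h $ 1 *\<^sub>R F (axis 1 1) + h $ 2 *\<^sub>R F (axis 2 1)"
proof -
  have "h = h $ 1 *\<^sub>R axis 1 1 + h $ 2 *\<^sub>R axis 2 1"
    by (simp add: vec_eq_iff forall_2 axis_def)
  then have "F h = F (h $ 1 *\<^sub>R axis 1 1 + h $ 2 *\<^sub>R axis 2 1)" by (rule arg_cong)
  then show ?thesis by (simp only: linear_add[OF assms] linear_scale[OF assms])
qed

lemma inner_vec2: "x \<bullet> y = x $ 1 * y $ 1 + x $ 2 * y $ 2" for x y :: vec2
  by (simp add: inner_vec_def sum_2)

lemma grad_nth: "grad f x $ i = frechet_derivative f (at x) (axis i 1)"
  by (simp add: grad_def)

lemma grad_inner:
  assumes "f differentiable (at x)"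
  shows "h \<bullet> grad f x = frechet_derivative f (at x) h"
  using linear_vec2[OF linear_frechet_derivative[OF assms], of h] by (simp add: inner_vec2 grad_nth)

lemma jacobian_nth: "jacobian f (at x) $ i $ j = frechet_derivative f (at x) (axis j 1) $ i"
  by (simp add: jacobian_def matrix_def)

lemma divg_expand:
  "divg \<xi> x = frechet_derivative \<xi> (at x) (axis 1 1) $ 1 + frechet_derivative \<xi> (at x) (axis 2 1) $ 2"
  by (simp add: divg_def trace_def sum_2 jacobian_nth)

lemma det_jacobian:
  "det (jacobian f (at x)) = frechet_derivative f (at x) (axis 1 1) $ 1 * frechet_derivative f (at x) (axis 2 1) $ 2
     - frechet_derivative f (at x) (axis 2 1) $ 1 * frechet_derivative f (at x) (axis 1 1) $ (2::2)" for f :: vmap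
  by (simp add: det_2 jacobian_nth)

lemma smooth_on_grad: "open S \<Longrightarrow> smooth_on S f \<Longrightarrow> smooth_on S (grad f)"
  by (rule smooth_on_vec) (simp_all add: grad_nth smooth_on_derivative_dir)

lemma smooth_on_divg: "open S \<Longrightarrow> smooth_on S \<xi> \<Longrightarrow> smooth_on S (divg \<xi>)"
  unfolding divg_expand[abs_def]
  by (intro smooth_on_add smooth_on_vec_nth smooth_on_derivative_dir)

lemma divg_scaleR:
  assumes "f differentiable (at x)" "\<xi> differentiable (at x)"
  shows "divg (\<lambda>y. f y *\<^sub>R \<xi> y) x = f x * divg \<xi> x + \<xi> x \<bullet> grad f x"
proof -
  have "((\<lambda>y. f y *\<^sub>R \<xi> y) has_derivative
      (\<lambda>h. f x *\<^sub>R frechet_derivative \<xi> (at x) h + frechet_derivative f (at x) h *\<^sub>R \<xi> x)) (at x)"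
    by (rule has_derivative_scaleR[OF assms[unfolded frechet_derivative_works]])
  then show ?thesis
    by (simp add: divg_expand frechet_derivativeI inner_vec2 grad_nth algebra_simps)
qed

section \<open>Flows of tangential fields\<close>

text \<open>A zero of \<open>r\<close> outside the closure would be a local minimum, as
  \<open>r\<close> is nonnegative off the domain, and the gradient would vanish there.\<close>

lemma defining_function_frontier:
  assumes r: "defining_function \<Omega> r"
  shows "r x = 0 \<longleftrightarrow> x \<in> frontier \<Omega>" "x \<in> closure \<Omega> \<Longrightarrow> r x \<le> 0"
proof -
  have s: "smooth_on UNIV r" and \<Omega>: "\<Omega> = {x. r x < 0}" and g: "\<And>x. r x = 0 \<Longrightarrow> grad r x \<noteq> 0"
    using r by (auto simp: defining_function_def)
  have c: "continuous_on UNIV r" by (rule smooth_on_continuous_on[OF s])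
  have op: "open \<Omega>" unfolding \<Omega> by (intro open_Collect_less c continuous_on_const)
  have "closed {x. r x \<le> 0}" by (intro closed_Collect_le c continuous_on_const)
  then have cl: "closure \<Omega> \<subseteq> {x. r x \<le> 0}" by (intro closure_minimal) (auto simp: \<Omega>)
  then show "x \<in> closure \<Omega> \<Longrightarrow> r x \<le> 0" by auto
  have fr: "frontier \<Omega> = closure \<Omega> - \<Omega>" using op by (simp add: frontier_def interior_open)
  show "r x = 0 \<longleftrightarrow> x \<in> frontier \<Omega>"
  proof
    assume "x \<in> frontier \<Omega>"
    then show "r x = 0" using cl unfolding fr by (force simp: \<Omega>)
  next
    assume rx: "r x = 0"
    have "x \<in> closure \<Omega>"
    proof (rule ccontr)
      assume "x \<notin> closure \<Omega>"
      then have "\<forall>\<^sub>F y in nhds x. y \<in> - closure \<Omega>" by (intro eventually_nhds_in_open) auto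
      then have "\<forall>\<^sub>F y in nhds x. r x \<le> r y"
      proof (rule eventually_mono)
        fix y assume "y \<in> - closure \<Omega>"
        then have "y \<notin> \<Omega>" using closure_subset by auto
        then show "r x \<le> r y" using rx by (simp add: \<Omega>)
      qed
      then obtain e where e: "e > 0" "\<And>y. dist y x < e \<Longrightarrow> r x \<le> r y"
        unfolding eventually_nhds_metric by blast
      have d: "(r has_derivative frechet_derivative r (at x)) (at x)" using smooth_on_has_derivative[OF s] by simp
      have "frechet_derivative r (at x) = (\<lambda>v. 0)"
        by (rule differential_zero_maxmin[of x "ball x e", OF _ _ d]) (use e in \<open>auto simp: dist_commute\<close>)
      then have "grad r x = 0" by (simp add: vec_eq_iff grad_nth)
      then show False using g[OF rx] by simp
    qed
    then show "x \<in> frontier \<Omega>" unfolding fr using rx by (auto simp: \<Omega>)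
  qed
qed

text \<open>This works because \<open>r\<close> vanishes only to first order on the frontier.\<close>
lemma vanishing_on_frontier_bound:
  assumes r: "defining_function \<Omega> r" and bd: "bounded \<Omega>"
    and p: "smooth_on UNIV p" and p0: "\<And>x. x \<in> frontier \<Omega> \<Longrightarrow> p x = (0::real)"
  obtains C where "C \<ge> 0" "\<And>x. x \<in> closure \<Omega> \<Longrightarrow> \<bar>p x\<bar> \<le> C * \<bar>r x\<bar>"
proof -
  have s: "smooth_on UNIV r" and g: "\<And>x. r x = 0 \<Longrightarrow> grad r x \<noteq> 0"
    using r by (auto simp: defining_function_def)
  have c: "continuous_on UNIV r" "continuous_on UNIV p" by (intro smooth_on_continuous_on s p)+
  have "\<exists>V C. open V \<and> x0 \<in> V \<and> C \<ge> 0 \<and> (\<forall>x\<in>V \<inter> closure \<Omega>. \<bar>p x\<bar> \<le> C * \<bar>r x\<bar>)" if x0: "x0 \<in> closure \<Omega>" for x0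
  proof (cases "r x0 = 0")
    case False
    then have r0: "0 < \<bar>r x0\<bar>" by simp
    let ?V = "{x. \<bar>r x0\<bar> / 2 < \<bar>r x\<bar>} \<inter> {x. \<bar>p x\<bar> < \<bar>p x0\<bar> + 1}"
    have "open ?V" by (intro open_Int open_Collect_less continuous_intros c)
    moreover have "x0 \<in> ?V" using r0 by auto
    moreover have "\<bar>p x\<bar> \<le> (2 * (\<bar>p x0\<bar> + 1) / \<bar>r x0\<bar>) * \<bar>r x\<bar>" if "x \<in> ?V" for x
    proof -
      have "\<bar>p x\<bar> \<le> (\<bar>p x0\<bar> + 1) * 1" using that by simp
      also have "\<dots> \<le> (\<bar>p x0\<bar> + 1) * (2 * \<bar>r x\<bar> / \<bar>r x0\<bar>)"
        using that r0 by (intro mult_left_mono) (auto simp: field_simps)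
      finally show ?thesis by (simp add: algebra_simps)
    qed
    ultimately show ?thesis by (intro exI[of _ ?V] exI[of _ "2 * (\<bar>p x0\<bar> + 1) / \<bar>r x0\<bar>"]) auto
  next
    case True
    \<comment> \<open>Near a frontier point one walks in the fixed direction \<open>n\<close>, along
      which \<open>r\<close> increases at a rate above \<open>m\<close>. The walk from x meets a
      zero of \<open>r\<close> after time at most |r x|/m, and \<open>p\<close> vanishes
      there.\<close>
    define n where "n = grad r x0"
    define m where "m = (n \<bullet> n) / 2"
    have n: "n \<noteq> 0" using g[OF True] by (simp add: n_def)
    have m: "m > 0" using n by (simp add: m_def)
    have dr: "r differentiable (at x)" for x using smooth_on_differentiable[OF s] by simp
    have "open {x. m < frechet_derivative r (at x) n}"
      by (intro open_Collect_less continuous_intros smooth_on_continuous_on[OF smooth_on_derivative_dir[OF s]])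
    moreover have "m < frechet_derivative r (at x0) n"
    proof -
      have "n \<bullet> n = frechet_derivative r (at x0) n"
        using grad_inner[OF dr, of n x0] unfolding n_def[symmetric] .
      then show ?thesis using m unfolding m_def by linarith
    qed
    ultimately obtain \<epsilon> where e: "\<epsilon> > 0" "\<And>y. y \<in> ball x0 \<epsilon> \<Longrightarrow> m < frechet_derivative r (at y) n"
      unfolding open_contains_ball by blast
    obtain L where L: "L \<ge> 0" "\<And>x v. x \<in> cball x0 \<epsilon> \<Longrightarrow> norm (frechet_derivative p (at x) v) \<le> L * norm v"
      using smooth_on_derivative_bound[OF p, of "cball x0 \<epsilon>"] by auto
    \<comment> \<open>Half of the radius is for the starting point, the other half for the length of
      the walk.\<close>
    let ?V = "ball x0 (\<epsilon> / 2) \<inter> {x. \<bar>r x\<bar> / m * norm n < \<epsilon> / 2}"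
    have "open ?V" by (intro open_Int open_ball open_Collect_less continuous_intros c) (use m in auto)
    moreover have "x0 \<in> ?V" using e True by auto
    moreover have "\<bar>p x\<bar> \<le> (L * norm n / m) * \<bar>r x\<bar>" if x: "x \<in> ?V" "x \<in> closure \<Omega>" for x
    proof -
      have rx: "r x \<le> 0" by (rule defining_function_frontier(2)[OF r x(2)])
      define t where "t = \<bar>r x\<bar> / m"
      have t: "0 \<le> t" "t * norm n < \<epsilon> / 2" using m x by (auto simp: t_def)
      have ball: "x + s *\<^sub>R n \<in> ball x0 \<epsilon>" if "0 \<le> s" "s \<le> t" for s
      proof -
        have "s * norm n \<le> t * norm n" using that by (intro mult_right_mono) auto
        then have "norm (s *\<^sub>R n) < \<epsilon> / 2" using that t by simp
        then have "dist x0 (x + s *\<^sub>R n) < \<epsilon>"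
          using x norm_triangle_lt[of "x - x0" "s *\<^sub>R n" \<epsilon>] by (simp add: dist_norm norm_minus_commute algebra_simps)
        then show ?thesis by simp
      qed
      have der: "((\<lambda>s. r (x + s *\<^sub>R n)) has_real_derivative frechet_derivative r (at (x + s *\<^sub>R n)) n) (at s)" for s
        using smooth_on_line_derivative[OF s, of x s n] by (simp add: has_real_derivative_iff_has_vector_derivative)
      have "0 \<le> r (x + t *\<^sub>R n)"
      proof (cases "t = 0")
        case False
        then obtain z where "0 < z" "z < t"
          "r (x + t *\<^sub>R n) - r (x + 0 *\<^sub>R n) = (t - 0) * frechet_derivative r (at (x + z *\<^sub>R n)) n"
          using MVT2[of 0 t "\<lambda>s. r (x + s *\<^sub>R n)" "\<lambda>s. frechet_derivative r (at (x + s *\<^sub>R n)) n"] der t by auto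
        moreover have "t * m \<le> t * frechet_derivative r (at (x + z *\<^sub>R n)) n"
          using e(2)[OF ball[of z]] calculation t by (intro mult_left_mono) auto
        moreover have "t * m = - r x" using m rx by (simp add: t_def)
        ultimately show ?thesis by simp
      qed (use m rx in \<open>auto simp: t_def\<close>)
      moreover have "continuous_on {0..t} (\<lambda>s. r (x + s *\<^sub>R n))"
        by (rule continuous_on_compose2[OF c(1)]) (auto intro!: continuous_intros)
      ultimately obtain z where z: "0 \<le> z" "z \<le> t" "r (x + z *\<^sub>R n) = 0"
        using IVT'[of "\<lambda>s. r (x + s *\<^sub>R n)" 0 0 t] rx t by auto
      have "p (x + z *\<^sub>R n) = 0" using p0 z(3) defining_function_frontier(1)[OF r] by blast
      moreover have "norm (p x - p (x + z *\<^sub>R n)) \<le> L * norm (x - (x + z *\<^sub>R n))"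
      proof (rule differentiable_bound[of "cball x0 \<epsilon>"])
        show "(p has_derivative frechet_derivative p (at y)) (at y within cball x0 \<epsilon>)" for y
          using smooth_on_has_derivative[OF p, of y] by (simp add: has_derivative_at_withinI)
        show "onorm (frechet_derivative p (at y)) \<le> L" if "y \<in> cball x0 \<epsilon>" for y
          by (rule onorm_bound[OF L(1) L(2)[OF that]])
      qed (use ball[of z] ball[of 0] z t in \<open>auto simp: less_imp_le\<close>)
      moreover have "z * norm n \<le> t * norm n" using z by (intro mult_right_mono) auto
      then have "L * (z * norm n) \<le> L * (t * norm n)" using L by (intro mult_left_mono)
      ultimately show ?thesis using z by (simp add: t_def field_simps)
    qed
    ultimately show ?thesis using L m by (intro exI[of _ ?V] exI[of _ "L * norm n / m"]) auto
  qed
  then obtain V C where V: "\<And>x. x \<in> closure \<Omega> \<Longrightarrow> open (V x) \<and> x \<in> V x \<and> C x \<ge> 0"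
    and VC: "\<And>x0 x. x0 \<in> closure \<Omega> \<Longrightarrow> x \<in> V x0 \<Longrightarrow> x \<in> closure \<Omega> \<Longrightarrow> \<bar>p x\<bar> \<le> C x0 * \<bar>r x\<bar>"
    by (metis IntI)
  have "compact (closure \<Omega>)" using bd by simp
  then obtain D where D: "D \<subseteq> closure \<Omega>" "finite D" "closure \<Omega> \<subseteq> (\<Union>x\<in>D. V x)"
    using compactE_image[of "closure \<Omega>" "closure \<Omega>" V] V by (metis UN_I subsetI)
  show ?thesis
  proof (rule that)
    show "0 \<le> (\<Sum>x\<in>D. C x)" using V D by (intro sum_nonneg) auto
    fix x assume x: "x \<in> closure \<Omega>"
    then obtain y where y: "y \<in> D" "x \<in> V y" using D by auto
    have "\<bar>p x\<bar> \<le> C y * \<bar>r x\<bar>" using VC y D x by blast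
    also have "\<dots> \<le> (\<Sum>x\<in>D. C x) * \<bar>r x\<bar>"
      using V D y by (intro mult_right_mono member_le_sum) auto
    finally show "\<bar>p x\<bar> \<le> (\<Sum>x\<in>D. C x) * \<bar>r x\<bar>" .
  qed
qed

text \<open>While the curve is inside, r changes at a rate of at most C |r|, so r exp(C s) does not
  increase. Being negative at the start, it cannot reach 0 at a first exit time.\<close>

lemma tangential_curve_stays:
  assumes r: "defining_function \<Omega> r" and bd: "bounded \<Omega>"
    and f: "smooth_on UNIV f" and tan: "\<And>x. x \<in> frontier \<Omega> \<Longrightarrow> f x \<bullet> grad r x = 0"
    and \<gamma>: "\<And>s. s \<in> {0..T} \<Longrightarrow> (\<gamma> has_vector_derivative f (\<gamma> s)) (at s)" and 0: "\<gamma> 0 \<in> \<Omega>" and T: "0 \<le> T"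
  shows "\<gamma> T \<in> \<Omega>"
proof (rule ccontr)
  assume nT: "\<gamma> T \<notin> \<Omega>"
  have s: "smooth_on UNIV r" and \<Omega>: "\<Omega> = {x. r x < 0}" using r by (auto simp: defining_function_def)
  define p where "p x = frechet_derivative r (at x) (f x)" for x
  have p: "smooth_on UNIV p" unfolding p_def by (rule smooth_on_derivative_apply[OF open_UNIV s f])
  have "p x = 0" if "x \<in> frontier \<Omega>" for x
    using tan[OF that] grad_inner[OF smooth_on_differentiable[OF s], of x "f x"] by (simp add: p_def)
  then obtain C where C: "C \<ge> 0" "\<And>x. x \<in> closure \<Omega> \<Longrightarrow> \<bar>p x\<bar> \<le> C * \<bar>r x\<bar>"
    using vanishing_on_frontier_bound[OF r bd p] by blast
  define \<phi> where "\<phi> s = r (\<gamma> s)" for s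
  have \<phi>': "(\<phi> has_real_derivative p (\<gamma> s)) (at s)" if "s \<in> {0..T}" for s
    using vector_derivative_diff_chain_within[OF \<gamma>[OF that], of r "frechet_derivative r (at (\<gamma> s))"]
      smooth_on_has_derivative[OF s, of "\<gamma> s"]
    by (auto simp: o_def \<phi>_def[abs_def] p_def has_real_derivative_iff_has_vector_derivative
      intro: has_derivative_at_withinI)
  have \<phi>c: "continuous_on {0..T} \<phi>"
    by (intro continuous_at_imp_continuous_on ballI DERIV_isCont[OF \<phi>'])
  let ?S = "{s \<in> {0..T}. \<phi> s = 0}"
  have "?S \<noteq> {}"
    using IVT'[of \<phi> 0 0 T] nT 0 T \<phi>c by (auto simp: \<phi>_def \<Omega>)
  moreover have "compact ?S"
    using continuous_closed_preimage_constant[OF \<phi>c closed_atLeastAtMost, of 0] compact_Icc[of 0 T]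
    by (metis (no_types, lifting) Collect_cong compact_eq_bounded_closed mem_Collect_eq subsetI bounded_subset)
  ultimately obtain s0 where s0: "s0 \<in> ?S" "\<And>s. s \<in> ?S \<Longrightarrow> s0 \<le> s"
    using continuous_attains_inf[of ?S "\<lambda>s. s"] by auto
  have neg: "\<phi> s < 0" if st: "0 \<le> s" "s < s0" for s
  proof (rule ccontr)
    assume "\<not> \<phi> s < 0"
    moreover have "continuous_on {0..s} \<phi>" by (rule continuous_on_subset[OF \<phi>c]) (use st s0 in auto)
    ultimately obtain z where "0 \<le> z" "z \<le> s" "\<phi> z = 0"
      using IVT'[of \<phi> 0 0 s] 0 st by (auto simp: \<phi>_def \<Omega>)
    then show False using s0(2)[of z] s0(1) st by auto
  qed
  define g where "g s = \<phi> s * exp (C * s)" for s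
  have "g s0 \<le> g 0"
  proof (rule DERIV_nonpos_imp_decreasing_open[of 0 s0 g])
    show "0 \<le> s0" using s0 by simp
    show "continuous_on {0..s0} g" unfolding g_def
      using s0 by (intro continuous_intros continuous_on_subset[OF \<phi>c]) auto
    fix s assume s: "0 < s" "s < s0"
    have "(g has_real_derivative (p (\<gamma> s) + C * \<phi> s) * exp (C * s)) (at s)"
      unfolding g_def using \<phi>'[of s] s s0 by (auto intro!: derivative_eq_intros simp: algebra_simps)
    moreover have "\<gamma> s \<in> \<Omega>" using neg[of s] s by (simp add: \<phi>_def \<Omega>)
    then have "\<bar>p (\<gamma> s)\<bar> \<le> C * \<bar>\<phi> s\<bar>" using C(2)[of "\<gamma> s"] closure_subset[of \<Omega>] by (auto simp: \<phi>_def)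
    then have "p (\<gamma> s) + C * \<phi> s \<le> 0" using neg[of s] s by simp
    ultimately show "\<exists>y. (g has_real_derivative y) (at s) \<and> y \<le> 0"
      by (intro exI[of _ "(p (\<gamma> s) + C * \<phi> s) * exp (C * s)"] conjI) (simp_all add: mult_nonpos_nonneg)
  qed
  then show False using s0 0 by (simp add: g_def \<phi>_def \<Omega>)
qed

section \<open>Functions smooth up to the boundary\<close>

lemma smooth_upto_smooth_on:
  assumes "open \<Omega>" "smooth_upto \<Omega> f" shows "smooth_on \<Omega> f"
proof -
  obtain F where F: "smooth_on UNIV F" "\<And>x. x \<in> closure \<Omega> \<Longrightarrow> F x = f x"
    using assms(2) by (auto simp: smooth_upto_def)
  have "smooth_on \<Omega> F" using smooth_on_subset[OF F(1)] by simp
  then show ?thesis using smooth_on_cong[OF assms(1), of F f] F(2) closure_subset by blast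
qed

lemma smooth_upto_cong:
  "smooth_upto \<Omega> f \<Longrightarrow> (\<And>x. x \<in> closure \<Omega> \<Longrightarrow> f x = g x) \<Longrightarrow> smooth_upto \<Omega> g"
  unfolding smooth_upto_def by metis

lemma smooth_on_UNIV_upto: "smooth_on UNIV f \<Longrightarrow> smooth_upto \<Omega> f"
  unfolding smooth_upto_def by blast

lemma smooth_upto_compose:
  assumes "smooth_upto \<Omega> g" "smooth_upto \<Omega> f" "\<And>x. x \<in> closure \<Omega> \<Longrightarrow> f x \<in> closure \<Omega>"
  shows "smooth_upto \<Omega> (\<lambda>x. g (f x))"
proof -
  obtain F where F: "smooth_on UNIV F" "\<And>x. x \<in> closure \<Omega> \<Longrightarrow> F x = f x"
    using assms(2) by (auto simp: smooth_upto_def)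
  obtain G where G: "smooth_on UNIV G" "\<And>x. x \<in> closure \<Omega> \<Longrightarrow> G x = g x"
    using assms(1) by (auto simp: smooth_upto_def)
  have "smooth_on UNIV (\<lambda>x. G (F x))" by (rule smooth_on_compose[OF open_UNIV F(1) G(1)]) simp
  moreover have "\<forall>x\<in>closure \<Omega>. G (F x) = g (f x)" using F(2) G(2) assms(3) by simp
  ultimately show ?thesis unfolding smooth_upto_def by blast
qed

lemma smooth_time_upto_slice:
  assumes "open J" "t \<in> J" "smooth_time_upto J \<Omega> f" shows "smooth_upto \<Omega> (f t)"
proof -
  obtain F where F: "smooth_on (J \<times> UNIV) F" "\<And>t x. t \<in> J \<Longrightarrow> x \<in> closure \<Omega> \<Longrightarrow> F (t, x) = f t x"
    using assms(3) by (auto simp: smooth_time_upto_def)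
  have "smooth_on UNIV (\<lambda>x. F (t, x))"
    by (rule smooth_on_compose[OF open_UNIV _ F(1)]) (use assms in \<open>auto intro!: smooth_intros\<close>)
  then show ?thesis using F(2) assms(2) unfolding smooth_upto_def by blast
qed

lemma smooth_upto_bounded:
  fixes f :: "vec2 \<Rightarrow> 'b::real_normed_vector"
  assumes "bounded \<Omega>" "smooth_upto \<Omega> f"
  obtains B where "\<And>x. x \<in> closure \<Omega> \<Longrightarrow> norm (f x) \<le> B"
proof -
  obtain F where F: "smooth_on UNIV F" "\<And>x. x \<in> closure \<Omega> \<Longrightarrow> F x = f x"
    using assms(2) by (auto simp: smooth_upto_def)
  have "bounded (F ` closure \<Omega>)"
    by (intro compact_imp_bounded compact_continuous_image continuous_on_subset[OF smooth_on_continuous_on[OF F(1)]])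
      (use assms in auto)
  then show ?thesis using that F(2) unfolding bounded_iff by force
qed

lemma smooth_upto_derivative_bounded:
  fixes f :: "vec2 \<Rightarrow> 'b::real_normed_vector"
  assumes "open \<Omega>" "bounded \<Omega>" "smooth_upto \<Omega> f"
  obtains B where "\<And>x. x \<in> \<Omega> \<Longrightarrow> norm (frechet_derivative f (at x) h) \<le> B"
proof -
  obtain F where F: "smooth_on UNIV F" "\<And>x. x \<in> closure \<Omega> \<Longrightarrow> F x = f x"
    using assms(3) by (auto simp: smooth_upto_def)
  have "smooth_upto \<Omega> (\<lambda>x. frechet_derivative F (at x) h)"
    by (intro smooth_on_UNIV_upto smooth_on_derivative_dir F)
  then obtain B where B: "\<And>x. x \<in> closure \<Omega> \<Longrightarrow> norm (frechet_derivative F (at x) h) \<le> B"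
    using smooth_upto_bounded[OF assms(2)] by blast
  have "norm (frechet_derivative f (at x) h) \<le> B" if "x \<in> \<Omega>" for x
  proof -
    have "x \<in> closure \<Omega>" using that closure_subset by auto
    moreover have "frechet_derivative F (at x) = frechet_derivative f (at x)"
      by (rule frechet_derivative_cong_open[OF assms(1) that]) (use F(2) closure_subset in auto)
    ultimately show ?thesis using B by metis
  qed
  then show ?thesis using that by blast
qed

section \<open>Diffeomorphisms of the domain\<close>

locale smooth_domain =
  fixes \<Omega> :: "vec2 set"
  assumes dom: "smooth_bounded_domain \<Omega>"
begin

lemma open_domain: "open \<Omega>" and bounded_domain: "bounded \<Omega>" and connected_domain: "connected \<Omega>"
  and domain_nonempty: "\<Omega> \<noteq> {}"
  using dom by (auto simp: smooth_bounded_domain_def)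

lemma in_closure: "x \<in> \<Omega> \<Longrightarrow> x \<in> closure \<Omega>"
  using closure_subset by auto

lemma compact_closure_domain: "compact (closure \<Omega>)"
  using bounded_domain by simp

lemma frontier_eq: "frontier \<Omega> = closure \<Omega> - \<Omega>"
  using open_domain by (simp add: frontier_def interior_open)

definition Inv :: "vmap \<Rightarrow> vmap" where
  "Inv X = the_inv_into (closure \<Omega>) X"

lemma Diff_inv:
  assumes "X \<in> Diff \<Omega>"
  shows "x \<in> closure \<Omega> \<Longrightarrow> X x \<in> closure \<Omega>" "x \<in> closure \<Omega> \<Longrightarrow> Inv X x \<in> closure \<Omega>"
    "x \<in> closure \<Omega> \<Longrightarrow> Inv X (X x) = x" "x \<in> closure \<Omega> \<Longrightarrow> X (Inv X x) = x"
proof -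
  have b: "bij_betw X (closure \<Omega>) (closure \<Omega>)" using assms by (simp add: Diff_def)
  then have inj: "inj_on X (closure \<Omega>)" and im: "X ` closure \<Omega> = closure \<Omega>" by (auto simp: bij_betw_def)
  show "x \<in> closure \<Omega> \<Longrightarrow> X x \<in> closure \<Omega>" using im by auto
  show "x \<in> closure \<Omega> \<Longrightarrow> Inv X (X x) = x" unfolding Inv_def by (rule the_inv_into_f_f[OF inj])
  show "x \<in> closure \<Omega> \<Longrightarrow> Inv X x \<in> closure \<Omega>" unfolding Inv_def
    using the_inv_into_into[OF inj, of x "closure \<Omega>"] im by simp
  show "x \<in> closure \<Omega> \<Longrightarrow> X (Inv X x) = x" unfolding Inv_def
    using f_the_inv_into_f[OF inj, of x] im by simp
qed

lemma Diff_interior: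
  assumes "X \<in> Diff \<Omega>" "x \<in> \<Omega>"
  shows "X x \<in> \<Omega>" "Inv X x \<in> \<Omega>"
proof -
  have fr: "X ` frontier \<Omega> = frontier \<Omega>" using assms by (simp add: Diff_def)
  note i = Diff_inv[OF assms(1)] and c = in_closure[OF assms(2)]
  show "X x \<in> \<Omega>"
  proof (rule ccontr)
    assume "X x \<notin> \<Omega>"
    then have "X x \<in> X ` frontier \<Omega>" using i(1)[OF c] fr by (simp add: frontier_eq)
    then obtain y where "y \<in> frontier \<Omega>" "X y = X x" by auto
    then show False using i(3)[of x] i(3)[of y] c assms(2) by (auto simp: frontier_eq)
  qed
  show "Inv X x \<in> \<Omega>"
  proof (rule ccontr)
    assume "Inv X x \<notin> \<Omega>"
    then have "Inv X x \<in> frontier \<Omega>" using i(2)[OF c] by (simp add: frontier_eq)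
    then have "X (Inv X x) \<in> frontier \<Omega>" using fr by blast
    then show False using i(4)[OF c] assms(2) by (simp add: frontier_eq)
  qed
qed

lemma Diff_frontier:
  assumes "X \<in> Diff \<Omega>" "x \<in> frontier \<Omega>" shows "X x \<in> frontier \<Omega>" "Inv X x \<in> frontier \<Omega>"
proof -
  show "X x \<in> frontier \<Omega>" using assms by (auto simp: Diff_def)
  show "Inv X x \<in> frontier \<Omega>"
    using assms Diff_inv(2,4)[OF assms(1), of x] Diff_interior(1)[OF assms(1), of "Inv X x"]
    by (auto simp: frontier_eq)
qed

lemma Diff_smooth:
  assumes "X \<in> Diff \<Omega>"
  shows "smooth_upto \<Omega> X" "smooth_upto \<Omega> (Inv X)" "smooth_on \<Omega> X" "smooth_on \<Omega> (Inv X)"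
  using assms smooth_upto_smooth_on[OF open_domain] by (auto simp: Diff_def Inv_def)

lemma Inv_eqI:
  assumes "\<And>x. x \<in> closure \<Omega> \<Longrightarrow> W (Z x) = x" "x \<in> closure \<Omega>" "W x \<in> closure \<Omega>" "Z (W x) = x"
  shows "Inv Z x = W x"
  unfolding Inv_def
  by (rule the_inv_into_f_eq) (use assms in \<open>auto intro: inj_on_inverseI\<close>)

text \<open>A smooth inverse that also maps the interior into the interior forces the frontier onto
  the frontier.\<close>

lemma DiffI:
  assumes "\<And>x. x \<in> closure \<Omega> \<Longrightarrow> Z x \<in> closure \<Omega>" "\<And>x. x \<in> closure \<Omega> \<Longrightarrow> W x \<in> closure \<Omega>"
    and "\<And>x. x \<in> closure \<Omega> \<Longrightarrow> W (Z x) = x" "\<And>x. x \<in> closure \<Omega> \<Longrightarrow> Z (W x) = x"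
    and "\<And>x. x \<in> \<Omega> \<Longrightarrow> Z x \<in> \<Omega>" "\<And>x. x \<in> \<Omega> \<Longrightarrow> W x \<in> \<Omega>"
    and "smooth_upto \<Omega> Z" "smooth_upto \<Omega> W"
  shows "Z \<in> Diff \<Omega>"
proof -
  have "bij_betw Z (closure \<Omega>) (closure \<Omega>)"
    by (rule bij_betw_byWitness[where f' = W]) (use assms in auto)
  moreover have "Z ` frontier \<Omega> = frontier \<Omega>"
  proof
    show "Z ` frontier \<Omega> \<subseteq> frontier \<Omega>"
      using assms(1,3,6) by (auto simp: frontier_eq) (metis)
    show "frontier \<Omega> \<subseteq> Z ` frontier \<Omega>"
    proof
      fix x assume x: "x \<in> frontier \<Omega>"
      then have "W x \<in> frontier \<Omega>" using assms(2,4,5) by (auto simp: frontier_eq) (metis)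
      moreover have "Z (W x) = x" using assms(4) x by (simp add: frontier_eq)
      ultimately show "x \<in> Z ` frontier \<Omega>" by force
    qed
  qed
  moreover have "smooth_upto \<Omega> (Inv Z)"
    by (rule smooth_upto_cong[OF assms(8)]) (use Inv_eqI[of W Z] assms in auto)
  ultimately show ?thesis using assms(7) by (simp add: Diff_def Inv_def)
qed

lemma Diff_derivative_inverse:
  assumes X: "X \<in> Diff \<Omega>" and a: "a \<in> \<Omega>"
  shows "frechet_derivative (Inv X) (at (X a)) (frechet_derivative X (at a) h) = h"
    and "frechet_derivative X (at a) (frechet_derivative (Inv X) (at (X a)) h) = h"
proof -
  have Xa: "X a \<in> \<Omega>" by (rule Diff_interior(1)[OF X a])
  have dX: "(X has_derivative frechet_derivative X (at a)) (at a)"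
    by (rule smooth_on_has_derivative[OF Diff_smooth(3)[OF X] a])
  have dI: "(Inv X has_derivative frechet_derivative (Inv X) (at (X a))) (at (X a))"
    by (rule smooth_on_has_derivative[OF Diff_smooth(4)[OF X] Xa])
  have IX: "Inv X (X a) = a" using Diff_inv(3)[OF X] in_closure[OF a] by simp
  have "((\<lambda>x. Inv X (X x)) has_derivative (\<lambda>h. frechet_derivative (Inv X) (at (X a)) (frechet_derivative X (at a) h))) (at a)"
    by (rule has_derivative_compose[OF dX dI])
  moreover have "((\<lambda>x. Inv X (X x)) has_derivative (\<lambda>h. h)) (at a)"
    by (subst has_derivative_cong_open[OF open_domain a, of _ "\<lambda>x. x"]) (use Diff_inv(3)[OF X] in_closure in auto)
  ultimately show "frechet_derivative (Inv X) (at (X a)) (frechet_derivative X (at a) h) = h"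
    using has_derivative_unique by metis
  have "((\<lambda>x. X (Inv X x)) has_derivative (\<lambda>h. frechet_derivative X (at a) (frechet_derivative (Inv X) (at (X a)) h))) (at (X a))"
    by (rule has_derivative_compose[OF dI]) (simp add: IX dX)
  moreover have "((\<lambda>x. X (Inv X x)) has_derivative (\<lambda>h. h)) (at (X a))"
    by (subst has_derivative_cong_open[OF open_domain Xa, of _ "\<lambda>x. x"]) (use Diff_inv(4)[OF X] in_closure in auto)
  ultimately show "frechet_derivative X (at a) (frechet_derivative (Inv X) (at (X a)) h) = h"
    using has_derivative_unique by metis
qed

lemma det_jacobian_compose:
  fixes f g :: vmap
  assumes "f differentiable (at (g x))" "g differentiable (at x)"
  shows "det (jacobian (\<lambda>x. f (g x)) (at x)) = det (jacobian f (at (g x))) * det (jacobian g (at x))"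
proof -
  have "frechet_derivative (\<lambda>x. f (g x)) (at x) = frechet_derivative f (at (g x)) \<circ> frechet_derivative g (at x)"
    using frechet_derivative_compose[OF assms(2,1)] by (simp add: o_def)
  then have "jacobian (\<lambda>x. f (g x)) (at x) = jacobian f (at (g x)) ** jacobian g (at x)"
    unfolding jacobian_def
    using matrix_compose[OF linear_frechet_derivative[OF assms(2)] linear_frechet_derivative[OF assms(1)]] by simp
  then show ?thesis by (simp add: det_mul)
qed

lemma Diff_det_nonzero:
  assumes X: "X \<in> Diff \<Omega>" and a: "a \<in> \<Omega>"
  shows "det (jacobian X (at a)) \<noteq> 0"
proof -
  have Xa: "X a \<in> \<Omega>" by (rule Diff_interior(1)[OF X a])
  have "det (jacobian (\<lambda>x. Inv X (X x)) (at a)) = det (jacobian (Inv X) (at (X a))) * det (jacobian X (at a))"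
    by (rule det_jacobian_compose) (intro smooth_on_differentiable[OF Diff_smooth(4)[OF X] Xa]
      smooth_on_differentiable[OF Diff_smooth(3)[OF X] a])+
  moreover have "jacobian (\<lambda>x. Inv X (X x)) (at a) = jacobian (\<lambda>x. x) (at a)"
    unfolding jacobian_def
    using frechet_derivative_cong_open[OF open_domain a, of "\<lambda>x. Inv X (X x)" "\<lambda>x. x"] Diff_inv(3)[OF X] in_closure
    by auto
  moreover have "det (jacobian (\<lambda>x::vec2. x) (at a)) = 1"
    by (simp add: jacobian_def matrix_id_mat_1[unfolded id_def])
  ultimately show ?thesis by auto
qed

section \<open>Curves of diffeomorphisms\<close>

lemma time_deriv:
  assumes J: "open J" "t \<in> J" and Y: "smooth_time_upto J \<Omega> Y" and x: "x \<in> closure \<Omega>"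
  shows "((\<lambda>s. Y s x) has_vector_derivative time_deriv Y t x) (at t)"
proof -
  obtain F where F: "smooth_on (J \<times> UNIV) F" "\<And>t x. t \<in> J \<Longrightarrow> x \<in> closure \<Omega> \<Longrightarrow> F (t, x) = Y t x"
    using Y by (auto simp: smooth_time_upto_def)
  have "((\<lambda>s. F (s, x)) has_derivative (\<lambda>h. frechet_derivative F (at (t, x)) (h, 0))) (at t)"
    by (rule has_derivative_compose[of "\<lambda>s. (s, x)" "\<lambda>h. (h, 0)" t UNIV, OF _ smooth_on_has_derivative[OF F(1)]])
      (use J in \<open>auto intro!: derivative_eq_intros\<close>)
  then have "(\<lambda>s. F (s, x)) differentiable (at t)" by (auto simp: differentiable_def)
  then have "((\<lambda>s. F (s, x)) has_vector_derivative vector_derivative (\<lambda>s. F (s, x)) (at t)) (at t)"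
    by (simp add: vector_derivative_works)
  then have *: "((\<lambda>s. Y s x) has_vector_derivative vector_derivative (\<lambda>s. F (s, x)) (at t)) (at t)"
    by (rule has_vector_derivative_transform_within_open[OF _ J]) (use F(2) x in auto)
  then show ?thesis using vector_derivative_at[OF *] by (simp add: time_deriv_def)
qed

lemma smooth_time_upto_time_deriv:
  fixes Y :: "real \<Rightarrow> vmap"
  assumes J: "open J" and Y: "smooth_time_upto J \<Omega> Y"
  shows "smooth_time_upto J \<Omega> (time_deriv Y)"
proof -
  obtain F where F: "smooth_on (J \<times> UNIV) F" "\<And>t x. t \<in> J \<Longrightarrow> x \<in> closure \<Omega> \<Longrightarrow> F (t, x) = Y t x"
    using Y by (auto simp: smooth_time_upto_def)
  have "frechet_derivative F (at (t, x)) (1, 0) = time_deriv Y t x" if tx: "t \<in> J" "x \<in> closure \<Omega>" for t x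
  proof -
    have m: "(t, x) \<in> J \<times> UNIV" using tx by simp
    have "((\<lambda>s. (s, x)) has_vector_derivative (1, 0)) (at t)"
      unfolding has_vector_derivative_def by (auto intro!: derivative_eq_intros)
    from vector_derivative_diff_chain_within[OF this has_derivative_at_withinI[OF smooth_on_has_derivative[OF F(1) m]]]
    have "((\<lambda>s. F (s, x)) has_vector_derivative frechet_derivative F (at (t, x)) (1, 0)) (at t)"
      by (simp add: o_def)
    then have "((\<lambda>s. Y s x) has_vector_derivative frechet_derivative F (at (t, x)) (1, 0)) (at t)"
      by (rule has_vector_derivative_transform_within_open[OF _ J tx(1)]) (use F(2) tx in auto)
    then show ?thesis using vector_derivative_at[of "\<lambda>s. Y s x"] by (simp add: time_deriv_def)
  qed
  then show ?thesis
    unfolding smooth_time_upto_def using smooth_on_derivative_dir[OF F(1), of "(1, 0)"] by blast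
qed

lemma curve_inD:
  assumes "curve_in \<Omega> S J \<gamma>" shows "open J" "is_interval J" "smooth_time_upto J \<Omega> \<gamma>" "t \<in> J \<Longrightarrow> \<gamma> t \<in> S"
  using assms by (auto simp: curve_in_def)

text \<open>Tangency is tested at the image point \<open>X x\<close>, since this is where the
  Eulerian field takes the value \<open>Y x\<close>.\<close>

lemma T_DiffI:
  assumes X: "X \<in> Diff \<Omega>" and Y: "smooth_upto \<Omega> Y"
    and tan: "\<And>r x. defining_function \<Omega> r \<Longrightarrow> x \<in> frontier \<Omega> \<Longrightarrow> Y x \<bullet> grad r (X x) = 0"
  shows "Y \<in> T_Diff \<Omega> X"
proof -
  have "smooth_upto \<Omega> (\<lambda>x. Y (Inv X x))"
    by (rule smooth_upto_compose[OF Y Diff_smooth(2)[OF X] Diff_inv(2)[OF X]])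
  moreover have "tangent_to_boundary \<Omega> (\<lambda>x. Y (Inv X x))"
    unfolding tangent_to_boundary_def
  proof (intro allI impI ballI)
    fix r x assume r: "defining_function \<Omega> r" and x: "x \<in> frontier \<Omega>"
    have "X (Inv X x) = x" using Diff_inv(4)[OF X, of x] x by (simp add: frontier_eq)
    then show "Y (Inv X x) \<bullet> grad r x = 0"
      using tan[OF r Diff_frontier(2)[OF X x]] by simp
  qed
  moreover have "\<forall>x\<in>closure \<Omega>. Y x = Y (Inv X (X x))" using Diff_inv(3)[OF X] by simp
  ultimately show ?thesis unfolding T_Diff_def by blast
qed

lemma T_Diff_smooth:
  assumes X: "X \<in> Diff \<Omega>" and Y: "Y \<in> T_Diff \<Omega> X"
  shows "smooth_upto \<Omega> (eulerian \<Omega> X Y)" "tangent_to_boundary \<Omega> (eulerian \<Omega> X Y)"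
proof -
  obtain \<zeta> where z: "smooth_upto \<Omega> \<zeta>" "tangent_to_boundary \<Omega> \<zeta>" "\<And>x. x \<in> closure \<Omega> \<Longrightarrow> Y x = \<zeta> (X x)"
    using Y by (auto simp: T_Diff_def)
  have e: "eulerian \<Omega> X Y x = \<zeta> x" if "x \<in> closure \<Omega>" for x
    using z(3)[OF Diff_inv(2)[OF X that]] Diff_inv(4)[OF X that] by (simp add: eulerian_def Inv_def)
  show "smooth_upto \<Omega> (eulerian \<Omega> X Y)" by (rule smooth_upto_cong[OF z(1)]) (simp add: e)
  show "tangent_to_boundary \<Omega> (eulerian \<Omega> X Y)"
    using z(2) e by (auto simp: tangent_to_boundary_def frontier_eq)
qed

lemma T_Diff_cong:
  assumes "Y \<in> T_Diff \<Omega> X" "\<And>x. x \<in> closure \<Omega> \<Longrightarrow> Y x = Y' x" "\<And>x. x \<in> closure \<Omega> \<Longrightarrow> X x = X' x"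
  shows "Y' \<in> T_Diff \<Omega> X'"
  using assms unfolding T_Diff_def by auto

text \<open>A boundary point moves along the boundary, so a defining function stays 0 on its
  trajectory; differentiating in time gives tangency.\<close>

lemma time_deriv_T_Diff:
  assumes c: "curve_in \<Omega> (Diff \<Omega>) J \<gamma>" and t: "t \<in> J"
  shows "time_deriv \<gamma> t \<in> T_Diff \<Omega> (\<gamma> t)"
proof (rule T_DiffI)
  note cD = curve_inD[OF c]
  show "\<gamma> t \<in> Diff \<Omega>" using cD(4)[OF t] .
  show "smooth_upto \<Omega> (time_deriv \<gamma> t)"
    by (rule smooth_time_upto_slice[OF cD(1) t smooth_time_upto_time_deriv[OF cD(1,3)]])
  fix r x assume r: "defining_function \<Omega> r" and x: "x \<in> frontier \<Omega>"
  have sr: "smooth_on UNIV r" using r by (simp add: defining_function_def)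
  have xc: "x \<in> closure \<Omega>" using x by (simp add: frontier_eq)
  have "((\<lambda>s. r (\<gamma> s x)) has_vector_derivative frechet_derivative r (at (\<gamma> t x)) (time_deriv \<gamma> t x)) (at t)"
    using vector_derivative_diff_chain_within[OF time_deriv[OF cD(1) t cD(3) xc]
      has_derivative_at_withinI[OF smooth_on_has_derivative[OF sr UNIV_I]]] by (simp add: o_def)
  moreover have "((\<lambda>s. r (\<gamma> s x)) has_vector_derivative 0) (at t)"
  proof (rule has_vector_derivative_transform_within_open[OF has_vector_derivative_const cD(1) t])
    fix s assume "s \<in> J"
    then have "\<gamma> s x \<in> frontier \<Omega>" using Diff_frontier(1)[OF cD(4) x] by simp
    then show "0 = r (\<gamma> s x)" using defining_function_frontier(1)[OF r] by simp
  qed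
  ultimately have "frechet_derivative r (at (\<gamma> t x)) (time_deriv \<gamma> t x) = 0"
    by (rule vector_derivative_unique_at)
  then show "time_deriv \<gamma> t x \<bullet> grad r (\<gamma> t x) = 0"
    using grad_inner[OF smooth_on_differentiable[OF sr UNIV_I]] by simp
qed

lemma field_along_time_deriv:
  assumes "curve_in \<Omega> (Diff \<Omega>) J \<gamma>" shows "field_along \<Omega> J \<gamma> (time_deriv \<gamma>)"
  unfolding field_along_def
  using time_deriv_T_Diff[OF assms] smooth_time_upto_time_deriv[OF curve_inD(1,3)[OF assms]] by blast

end

section \<open>Liouville's formula\<close>

lemma slice_derivative:
  fixes F :: "'a::euclidean_space \<times> 'b::euclidean_space \<Rightarrow> 'c::real_normed_vector"
  assumes F: "smooth_on S F" and q: "(t, x) \<in> S"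
  shows "((\<lambda>y. F (t, y)) has_derivative (\<lambda>h. frechet_derivative F (at (t, x)) (0, h))) (at x)"
    "frechet_derivative (\<lambda>y. F (t, y)) (at x) h = frechet_derivative F (at (t, x)) (0, h)"
proof -
  show *: "((\<lambda>y. F (t, y)) has_derivative (\<lambda>h. frechet_derivative F (at (t, x)) (0, h))) (at x)"
    by (rule has_derivative_compose[of "\<lambda>y. (t, y)" "\<lambda>h. (0, h)" x UNIV, OF _ smooth_on_has_derivative[OF F q]])
      (auto intro!: derivative_eq_intros)
  show "frechet_derivative (\<lambda>y. F (t, y)) (at x) h = frechet_derivative F (at (t, x)) (0, h)"
    by (simp add: frechet_derivativeI[OF *])
qed

lemma time_slice_derivative:
  fixes F :: "real \<times> 'b::euclidean_space \<Rightarrow> 'c::real_normed_vector"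
  assumes F: "smooth_on S F" and q: "(t, x) \<in> S"
  shows "((\<lambda>s. F (s, x)) has_vector_derivative frechet_derivative F (at (t, x)) (1, 0)) (at t)"
proof -
  have "((\<lambda>s. (s, x)) has_vector_derivative (1, 0)) (at t)"
    unfolding has_vector_derivative_def by (auto intro!: derivative_eq_intros)
  from vector_derivative_diff_chain_within[OF this has_derivative_at_withinI[OF smooth_on_has_derivative[OF F q]]]
  show ?thesis by (simp add: o_def)
qed

text \<open>Symmetry of second derivatives in the product of time and space, for the directions (1,
  0) and (0, h).\<close>

lemma mixed_time_derivative:
  fixes F :: "real \<times> 'b::euclidean_space \<Rightarrow> 'c::euclidean_space"
  assumes S: "open S" and F: "smooth_on S F" and q: "(t, x) \<in> S"
  shows "((\<lambda>s. frechet_derivative F (at (s, x)) (0, h)) has_vector_derivative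
    frechet_derivative (\<lambda>y. frechet_derivative F (at (t, y)) (1, 0)) (at x) h) (at t)"
proof -
  note D = smooth_on_derivative_dir[OF F]
  have "frechet_derivative (\<lambda>q. frechet_derivative F (at q) (0, h)) (at (t, x)) (1, 0) =
      frechet_derivative (\<lambda>y. frechet_derivative F (at (t, y)) (1, 0)) (at x) h"
    unfolding slice_derivative(2)[OF D q] by (rule smooth_on_second_derivative_symmetric[OF S q F])
  then show ?thesis using time_slice_derivative[OF D q, of "(0, h)"] by simp
qed

text \<open>Each column of the Jacobian matrix satisfies the linear equation with matrix Dg, and the
  product rule for the two by two determinant leaves the trace of Dg.\<close>

lemma det_jacobian_time_derivative:
  fixes F :: "real \<times> vec2 \<Rightarrow> vec2"
  assumes J: "open J" "t \<in> J" and S: "open S" "a \<in> S" and F: "smooth_on (J \<times> S) F"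
    and g: "g differentiable (at (F (t, a)))"
    and eq: "\<And>y. y \<in> S \<Longrightarrow> frechet_derivative F (at (t, y)) (1, 0) = g (F (t, y))"
  shows "((\<lambda>s. det (jacobian (\<lambda>y. F (s, y)) (at a))) has_real_derivative
    divg g (F (t, a)) * det (jacobian (\<lambda>y. F (t, y)) (at a))) (at t)"
proof -
  have op: "open (J \<times> S)" and ta: "(t, a) \<in> J \<times> S" using J S by (auto intro: open_Times)
  define m where "m j s = frechet_derivative F (at (s, a)) (0, axis j 1)" for j s
  let ?G = "frechet_derivative g (at (F (t, a)))"
  have "frechet_derivative (\<lambda>y. frechet_derivative F (at (t, y)) (1, 0)) (at a) h =
      ?G (frechet_derivative F (at (t, a)) (0, h))" for h
  proof -
    have "frechet_derivative (\<lambda>y. frechet_derivative F (at (t, y)) (1, 0)) (at a) =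
        frechet_derivative (\<lambda>y. g (F (t, y))) (at a)"
      by (rule frechet_derivative_cong_open[OF S eq])
    also have "\<dots> = (\<lambda>h. ?G (frechet_derivative F (at (t, a)) (0, h)))"
      by (rule frechet_derivativeI[OF has_derivative_compose[OF slice_derivative(1)[OF F ta]
        g[unfolded frechet_derivative_works]]])
    finally show ?thesis by simp
  qed
  then have m': "(m j has_vector_derivative ?G (m j t)) (at t)" for j
    unfolding m_def using mixed_time_derivative[OF op F ta, of "axis j 1"] by simp
  have mc: "((\<lambda>s. m j s $ i) has_real_derivative ?G (m j t) $ i) (at t)" for i j
    using bounded_linear.has_vector_derivative[OF bounded_linear_vec_nth m']
    by (simp add: has_real_derivative_iff_has_vector_derivative)
  have G: "?G v = v $ 1 *\<^sub>R ?G (axis 1 1) + v $ 2 *\<^sub>R ?G (axis 2 1)" for v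
    by (rule linear_vec2[OF linear_frechet_derivative[OF g]])
  have det: "det (jacobian (\<lambda>y. F (s, y)) (at a)) = m 1 s $ 1 * m 2 s $ 2 - m 2 s $ 1 * m 1 s $ 2" if "s \<in> J" for s
    using slice_derivative(2)[OF F, of s a] that S by (simp add: det_jacobian m_def)
  have "((\<lambda>s. m 1 s $ 1 * m 2 s $ 2 - m 2 s $ 1 * m 1 s $ 2) has_real_derivative
      (?G (m 1 t) $ 1 * m 2 t $ 2 + ?G (m 2 t) $ 2 * m 1 t $ 1) - (?G (m 2 t) $ 1 * m 1 t $ 2 + ?G (m 1 t) $ 2 * m 2 t $ 1)) (at t)"
    by (intro DERIV_diff DERIV_mult mc)
  also have "(?G (m 1 t) $ 1 * m 2 t $ 2 + ?G (m 2 t) $ 2 * m 1 t $ 1) - (?G (m 2 t) $ 1 * m 1 t $ 2 + ?G (m 1 t) $ 2 * m 2 t $ 1) =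
      divg g (F (t, a)) * det (jacobian (\<lambda>y. F (t, y)) (at a))"
    unfolding det[OF J(2)] G[of "m 1 t"] G[of "m 2 t"] divg_expand by (simp add: algebra_simps)
  finally show ?thesis
    by (rule has_field_derivative_transform_within_open[OF _ J]) (simp add: det)
qed

text \<open>The cutoff is 1 on a ball containing the closure; compact support is what the flow
  construction asks for.\<close>

lemma smooth_upto_compact_extension:
  assumes "bounded \<Omega>" "smooth_upto \<Omega> g"
  obtains f K where "smooth_on UNIV f" "compact K" "\<And>x. x \<notin> K \<Longrightarrow> f x = (0::'b::euclidean_space)"
    "\<And>x. x \<in> closure \<Omega> \<Longrightarrow> f x = g x"
proof -
  obtain F where F: "smooth_on UNIV F" "\<And>x. x \<in> closure \<Omega> \<Longrightarrow> F x = g x"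
    using assms(2) by (auto simp: smooth_upto_def)
  obtain R where R: "R \<ge> 0" "\<And>x. x \<in> closure \<Omega> \<Longrightarrow> norm x \<le> R"
    using bounded_closure[OF assms(1)] unfolding bounded_pos by (meson less_imp_le)
  obtain \<omega> :: "vec2 \<Rightarrow> real" where w: "smooth_on UNIV \<omega>" "\<And>x. norm x \<le> R \<Longrightarrow> \<omega> x = 1" "\<And>x. R + 1 \<le> norm x \<Longrightarrow> \<omega> x = 0"
    using smooth_cutoff[OF R(1)] by blast
  show ?thesis
  proof (rule that[of "\<lambda>x. \<omega> x *\<^sub>R F x" "cball 0 (R + 1)"])
    show "smooth_on UNIV (\<lambda>x. \<omega> x *\<^sub>R F x)" by (intro smooth_on_scaleR open_UNIV w F)
  qed (use w R F in auto)
qed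

section \<open>The flow of a tangential field acting on diffeomorphisms\<close>

locale tangential_flow = smooth_domain \<Omega> for \<Omega> +
  fixes f :: vmap and \<delta> :: real and \<Phi> :: "real \<Rightarrow> vmap"
  assumes f: "smooth_on UNIV f" and tan: "tangent_to_boundary \<Omega> f" and \<delta>: "\<delta> > 0"
    and smooth_\<Phi>: "smooth_on ({-\<delta><..<\<delta>} \<times> UNIV) (\<lambda>q. \<Phi> (fst q) (snd q))"
    and \<Phi>_0: "\<And>x. \<Phi> 0 x = x"
    and \<Phi>_deriv: "\<And>s x. \<bar>s\<bar> < \<delta> \<Longrightarrow> ((\<lambda>s. \<Phi> s x) has_vector_derivative f (\<Phi> s x)) (at s)"
    and \<Phi>_inv: "\<And>s x. \<bar>s\<bar> < \<delta> \<Longrightarrow> \<Phi> (- s) (\<Phi> s x) = x"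
    and \<Phi>_fix: "\<And>s x. \<bar>s\<bar> < \<delta> \<Longrightarrow> f x = 0 \<Longrightarrow> \<Phi> s x = x"

lemma (in smooth_domain) tangential_flow_exists:
  assumes "smooth_on UNIV f" "compact K" "\<And>x. x \<notin> K \<Longrightarrow> f x = 0" "tangent_to_boundary \<Omega> f"
  obtains \<delta> \<Phi> where "tangential_flow \<Omega> f \<delta> \<Phi>"
proof (rule local_flow[OF assms(1-3)])
  fix \<delta> \<Phi>
  assume "0 < \<delta>" "smooth_on ({-\<delta><..<\<delta>} \<times> UNIV) (\<lambda>q. \<Phi> (fst q) (snd q))" "\<And>x. \<Phi> 0 x = x"
    "\<And>s x. \<bar>s\<bar> < \<delta> \<Longrightarrow> ((\<lambda>s. \<Phi> s x) has_vector_derivative f (\<Phi> s x)) (at s)"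
    "\<And>s x. \<bar>s\<bar> < \<delta> \<Longrightarrow> \<Phi> (- s) (\<Phi> s x) = x"
    "\<And>s x. \<bar>s\<bar> < \<delta> \<Longrightarrow> f x = 0 \<Longrightarrow> \<Phi> s x = x"
  then have "tangential_flow \<Omega> f \<delta> \<Phi>"
    using assms by unfold_locales
  then show thesis by (rule that)
qed

context tangential_flow
begin

lemma \<Phi>_inv': "\<bar>s\<bar> < \<delta> \<Longrightarrow> \<Phi> s (\<Phi> (- s) x) = x"
  using \<Phi>_inv[of "- s" x] by simp

lemma smooth_slice:
  assumes "\<bar>s\<bar> < \<delta>" shows "smooth_on UNIV (\<Phi> s)"
proof -
  have "smooth_on UNIV (\<lambda>x. \<Phi> (fst (s, x)) (snd (s, x)))"
    by (rule smooth_on_compose[OF open_UNIV _ smooth_\<Phi>]) (use assms in \<open>auto intro!: smooth_intros simp: abs_less_iff\<close>)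
  then show ?thesis by simp
qed

lemma differentiable_\<Phi>: "\<bar>s\<bar> < \<delta> \<Longrightarrow> \<Phi> s differentiable (at x)"
  using smooth_on_differentiable[OF smooth_slice] by simp

lemma \<Phi>_domain:
  assumes s: "\<bar>s\<bar> < \<delta>" and x: "x \<in> \<Omega>" shows "\<Phi> s x \<in> \<Omega>"
proof -
  obtain r where r: "defining_function \<Omega> r" using dom by (auto simp: smooth_bounded_domain_def)
  have ft: "f x \<bullet> grad r x = 0" if "x \<in> frontier \<Omega>" for x
    using tan r that by (auto simp: tangent_to_boundary_def)
  show ?thesis
  proof (cases "0 \<le> s")
    case True
    show ?thesis
      by (rule tangential_curve_stays[OF r bounded_domain f ft, of s "\<lambda>s. \<Phi> s x"])
        (use True s x \<Phi>_deriv \<Phi>_0 in auto)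
  next
    case False
    \<comment> \<open>Reversed time follows the flow of -f, which is tangential as well.\<close>
    have "\<Phi> (- (- s)) x \<in> \<Omega>"
    proof (rule tangential_curve_stays[OF r bounded_domain, of "\<lambda>x. - f x" "- s" "\<lambda>s. \<Phi> (- s) x"])
      show "smooth_on UNIV (\<lambda>x. - f x)" by (intro smooth_on_minus f open_UNIV)
      show "((\<lambda>s. \<Phi> (- s) x) has_vector_derivative - f (\<Phi> (- \<tau>) x)) (at \<tau>)" if "\<tau> \<in> {0..-s}" for \<tau>
      proof -
        have \<tau>: "\<bar>- \<tau>\<bar> < \<delta>" using that s by auto
        have "((\<lambda>s::real. - s) has_vector_derivative - 1) (at \<tau>)" by (auto intro!: derivative_eq_intros)
        from vector_diff_chain_at[OF this \<Phi>_deriv[OF \<tau>]] show ?thesis by (simp add: o_def)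
      qed
    qed (use False s x \<Phi>_0 ft in auto)
    then show ?thesis by simp
  qed
qed

lemma \<Phi>_closure:
  assumes s: "\<bar>s\<bar> < \<delta>" and x: "x \<in> closure \<Omega>" shows "\<Phi> s x \<in> closure \<Omega>"
proof -
  have "continuous_on (closure \<Omega>) (\<Phi> s)"
    using smooth_on_continuous_on[OF smooth_slice[OF s]] continuous_on_subset by blast
  then have "\<Phi> s ` closure \<Omega> \<subseteq> closure \<Omega>"
    by (rule image_closure_subset) (use \<Phi>_domain[OF s] in_closure in auto)
  then show ?thesis using x by auto
qed

lemma flow_Diff:
  assumes X: "X \<in> Diff \<Omega>" and s: "\<bar>s\<bar> < \<delta>"
  shows "(\<lambda>x. \<Phi> s (X x)) \<in> Diff \<Omega>"
    and "x \<in> closure \<Omega> \<Longrightarrow> Inv (\<lambda>x. \<Phi> s (X x)) x = Inv X (\<Phi> (- s) x)"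
proof -
  have s': "\<bar>- s\<bar> < \<delta>" using s by simp
  note XD = Diff_inv[OF X] Diff_interior[OF X] and c = \<Phi>_closure[OF s] \<Phi>_closure[OF s']
    and d = \<Phi>_domain[OF s] \<Phi>_domain[OF s'] and i = \<Phi>_inv[OF s] \<Phi>_inv'[OF s]
  show "(\<lambda>x. \<Phi> s (X x)) \<in> Diff \<Omega>"
  proof (rule DiffI[where W = "\<lambda>x. Inv X (\<Phi> (- s) x)"])
    show "smooth_upto \<Omega> (\<lambda>x. \<Phi> s (X x))"
      by (rule smooth_upto_compose[OF smooth_on_UNIV_upto[OF smooth_slice[OF s]] Diff_smooth(1)[OF X] XD(1)])
    show "smooth_upto \<Omega> (\<lambda>x. Inv X (\<Phi> (- s) x))"
      by (rule smooth_upto_compose[OF Diff_smooth(2)[OF X] smooth_on_UNIV_upto[OF smooth_slice[OF s']] c(2)])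
  qed (simp_all add: XD c d i)
  show "x \<in> closure \<Omega> \<Longrightarrow> Inv (\<lambda>x. \<Phi> s (X x)) x = Inv X (\<Phi> (- s) x)"
    by (rule Inv_eqI) (simp_all add: XD c i)
qed

text \<open>The determinant never vanishes because the flow is invertible; it equals 1 at time 0 and
  varies continuously over an interval of times.\<close>

lemma det_jacobian_\<Phi>_pos:
  assumes s: "\<bar>s\<bar> < \<delta>" shows "det (jacobian (\<Phi> s) (at x)) > 0"
proof -
  have nz: "det (jacobian (\<Phi> s) (at x)) \<noteq> 0" if s: "\<bar>s\<bar> < \<delta>" for s
  proof -
    have s': "\<bar>- s\<bar> < \<delta>" using s by simp
    have "det (jacobian (\<lambda>y. \<Phi> (- s) (\<Phi> s y)) (at x)) =
        det (jacobian (\<Phi> (- s)) (at (\<Phi> s x))) * det (jacobian (\<Phi> s) (at x))"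
      by (rule det_jacobian_compose[OF differentiable_\<Phi>[OF s'] differentiable_\<Phi>[OF s]])
    moreover have "det (jacobian (\<lambda>y. \<Phi> (- s) (\<Phi> s y)) (at x)) = 1"
      by (simp add: \<Phi>_inv[OF s] jacobian_def matrix_id_mat_1[unfolded id_def])
    ultimately show ?thesis by auto
  qed
  let ?d = "\<lambda>s. det (jacobian (\<Phi> s) (at x))"
  have cont: "continuous_on {-\<delta><..<\<delta>} ?d"
  proof -
    have "continuous_on {-\<delta><..<\<delta>} (\<lambda>s. frechet_derivative (\<lambda>q. \<Phi> (fst q) (snd q)) (at (s, x)) h)" for h
      by (rule smooth_on_continuous_compose[OF smooth_on_derivative_dir[OF smooth_\<Phi>]]) (auto intro!: continuous_intros)
    note c = this
    have eq: "frechet_derivative (\<Phi> s) (at x) h = frechet_derivative (\<lambda>q. \<Phi> (fst q) (snd q)) (at (s, x)) (0, h)"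
      if "s \<in> {-\<delta><..<\<delta>}" for s h
      using slice_derivative(2)[OF smooth_\<Phi>, of s x h] that by simp
    have "continuous_on {-\<delta><..<\<delta>} (\<lambda>s. frechet_derivative (\<Phi> s) (at x) h $ i)" for h i
      by (rule continuous_on_eq[OF continuous_on_component[OF c[of "(0, h)"], of i]]) (simp add: eq)
    note cc = this
    show ?thesis unfolding det_jacobian by (intro continuous_on_diff continuous_on_mult cc)
  qed
  have 1: "?d 0 = 1"
  proof -
    have "\<Phi> 0 = (\<lambda>x. x)" using \<Phi>_0 by auto
    then show ?thesis by (simp add: jacobian_def matrix_id_mat_1[unfolded id_def])
  qed
  show ?thesis
  proof (rule ccontr)
    assume neg: "\<not> ?d s > 0"
    have "connected (?d ` {-\<delta><..<\<delta>})" by (intro connected_continuous_image cont) auto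
    moreover have "?d s \<in> ?d ` {-\<delta><..<\<delta>}" "?d 0 \<in> ?d ` {-\<delta><..<\<delta>}" using s \<delta> by (auto simp: abs_less_iff)
    ultimately have "0 \<in> ?d ` {-\<delta><..<\<delta>}"
      by (rule connectedD_interval) (use neg 1 in auto)
    then show False using nz by (auto simp: abs_less_iff)
  qed
qed

lemma curve_flow:
  assumes X: "X \<in> Diff \<Omega>"
  shows "curve_in \<Omega> (Diff \<Omega>) {-\<delta><..<\<delta>} (\<lambda>s x. \<Phi> s (X x))"
proof -
  obtain F where F: "smooth_on UNIV F" "\<And>x. x \<in> closure \<Omega> \<Longrightarrow> F x = X x"
    using Diff_smooth(1)[OF X] by (auto simp: smooth_upto_def)
  have op: "open ({-\<delta><..<\<delta>} \<times> (UNIV :: vec2 set))" by (intro open_Times) auto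
  have "smooth_on ({-\<delta><..<\<delta>} \<times> (UNIV :: vec2 set)) (\<lambda>q. F (snd q))"
    by (rule smooth_on_compose[OF op smooth_on_snd[OF op] F(1)]) simp
  then have "smooth_on ({-\<delta><..<\<delta>} \<times> (UNIV :: vec2 set)) (\<lambda>q. (fst q, F (snd q)))"
    by (intro smooth_on_Pair smooth_on_fst op)
  from smooth_on_compose[OF op this smooth_\<Phi>]
  have "smooth_on ({-\<delta><..<\<delta>} \<times> UNIV) (\<lambda>q. \<Phi> (fst q) (F (snd q)))" by auto
  then have "smooth_time_upto {-\<delta><..<\<delta>} \<Omega> (\<lambda>s x. \<Phi> s (X x))"
    unfolding smooth_time_upto_def using F(2) by (intro exI[of _ "\<lambda>q. \<Phi> (fst q) (F (snd q))"]) simp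
  moreover have "(\<lambda>x. \<Phi> t (X x)) \<in> Diff \<Omega>" if "t \<in> {-\<delta><..<\<delta>}" for t
    using flow_Diff(1)[OF X, of t] that by (auto simp: abs_less_iff)
  ultimately show ?thesis unfolding curve_in_def by (simp add: is_interval_oo)
qed

lemma time_deriv_flow: "\<bar>s\<bar> < \<delta> \<Longrightarrow> time_deriv (\<lambda>s x. \<Phi> s (X x)) s = (\<lambda>x. f (\<Phi> s (X x)))"
  unfolding time_deriv_def using vector_derivative_at[OF \<Phi>_deriv] by auto

end

section \<open>Densities and the metric\<close>

lemma (in smooth_domain) bounded_continuous_integrable:
  fixes h :: "vec2 \<Rightarrow> real"
  assumes "continuous_on \<Omega> h" "\<And>x. x \<in> \<Omega> \<Longrightarrow> \<bar>h x\<bar> \<le> B"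
  shows "h absolutely_integrable_on \<Omega>"
proof -
  have m: "\<Omega> \<in> lmeasurable" by (rule lmeasurable_open[OF bounded_domain open_domain])
  have "g integrable_on \<Omega>" if "continuous_on \<Omega> g" "\<And>x. x \<in> \<Omega> \<Longrightarrow> \<bar>g x\<bar> \<le> B" for g :: "vec2 \<Rightarrow> real"
    by (rule measurable_bounded_by_integrable_imp_integrable[where g = "\<lambda>x. B"])
      (use that m in \<open>auto intro: continuous_imp_measurable_on_sets_lebesgue integrable_on_const\<close>)
  note i = this
  have "h integrable_on \<Omega>" "(\<lambda>x. \<bar>h x\<bar>) integrable_on \<Omega>"
    using assms by (auto intro!: i continuous_intros)
  then show ?thesis by (intro absolutely_integrable_onI) auto
qed

lemma (in smooth_domain) integral_zero_continuous:
  fixes h :: "vec2 \<Rightarrow> real"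
  assumes h: "continuous_on \<Omega> h" "h integrable_on \<Omega>" and nn: "\<And>x. x \<in> \<Omega> \<Longrightarrow> 0 \<le> h x"
    and z: "integral \<Omega> h = 0" and x: "x \<in> \<Omega>"
  shows "h x = 0"
proof -
  obtain a b where ab: "x \<in> box a b" "cbox a b \<subseteq> \<Omega>"
    using open_contains_cbox[OF open_domain x] by metis
  have c: "continuous_on (cbox a b) h" using continuous_on_subset[OF h(1) ab(2)] .
  have "integral (cbox a b) h \<le> integral \<Omega> h"
    by (rule integral_subset_le[OF ab(2) integrable_continuous[OF c] h(2)]) (use nn in auto)
  moreover have "0 \<le> integral (cbox a b) h"
    by (rule integral_nonneg[OF integrable_continuous[OF c]]) (use nn ab in auto)
  ultimately have "integral (cbox a b) h = 0" using z by simp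
  then have hi: "(h has_integral 0) (cbox a b)" using integrable_integral[OF integrable_continuous[OF c]] by simp
  show ?thesis
    by (rule has_integral_0_cbox_imp_0[OF c _ hi]) (use nn ab box_subset_cbox[of a b] in blast)+
qed

text \<open>Isolated with a free density, so that it can be evaluated with the density of any
  configuration as well as with the one profile \<rho> shared by all of \<open>M\<close>.\<close>

definition gn_integrand :: "(vec2 \<Rightarrow> real) \<Rightarrow> (vec2 \<Rightarrow> real) \<Rightarrow> vmap \<Rightarrow> vmap \<Rightarrow> vec2 \<Rightarrow> real" where
  "gn_integrand b \<rho> \<xi> \<eta> x = \<rho> x * (\<xi> x \<bullet> \<eta> x)
        + 1/3 * \<rho> x ^ 3 * divg \<xi> x * divg \<eta> x
        + 1/2 * \<rho> x ^ 2 * divg \<xi> x * (\<eta> x \<bullet> grad b x)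
        + 1/2 * \<rho> x ^ 2 * divg \<eta> x * (\<xi> x \<bullet> grad b x)
        + \<rho> x * (\<xi> x \<bullet> grad b x) * (\<eta> x \<bullet> grad b x)"

lemma GN_metric_integrand:
  "GN_metric \<Omega> b \<rho>0 X Y Z =
     integral \<Omega> (gn_integrand b (density \<Omega> \<rho>0 X) (eulerian \<Omega> X Y) (eulerian \<Omega> X Z))"
  unfolding GN_metric_def gn_integrand_def[abs_def] Let_def ..

lemma divg_cong:
  assumes "open S" "x \<in> S" "\<And>y. y \<in> S \<Longrightarrow> \<xi> y = \<eta> y" shows "divg \<xi> x = divg \<eta> x"
  using frechet_derivative_cong_open[OF assms] by (simp add: divg_expand)

lemma grad_cong:
  assumes "open S" "x \<in> S" "\<And>y. y \<in> S \<Longrightarrow> f y = g y" shows "grad f x = grad g x"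
  using frechet_derivative_cong_open[OF assms] by (simp add: grad_def)

lemma gn_integrand_cong:
  assumes S: "open S" "x \<in> S" and "\<And>y. y \<in> S \<Longrightarrow> \<xi> y = \<xi>' y" "\<And>y. y \<in> S \<Longrightarrow> \<eta> y = \<eta>' y" "\<rho> x = \<rho>' x"
  shows "gn_integrand b \<rho> \<xi> \<eta> x = gn_integrand b \<rho>' \<xi>' \<eta>' x"
  using divg_cong[OF S, of \<xi> \<xi>'] divg_cong[OF S, of \<eta> \<eta>'] assms
  by (simp add: gn_integrand_def)

lemma gn_integrand_commute: "gn_integrand b \<rho> \<xi> \<eta> x = gn_integrand b \<rho> \<eta> \<xi> x"
  by (simp add: gn_integrand_def inner_commute algebra_simps)

text \<open>With p = \<rho> div \<xi> and w = \<xi> . grad b, the terms beyond |\<xi>|^2 are \<rho>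
  times p^2/3 + p w + w^2 = (w + p/2)^2 + p^2/12. The sign factor allows for a negative
  density.\<close>

lemma gn_integrand_coercive:
  assumes "\<rho> x \<noteq> 0" shows "\<bar>\<rho> x\<bar> * (\<xi> x \<bullet> \<xi> x) \<le> sgn (\<rho> x) * gn_integrand b \<rho> \<xi> \<xi> x"
proof -
  define p w where "p = \<rho> x * divg \<xi> x" and "w = \<xi> x \<bullet> grad b x"
  have "gn_integrand b \<rho> \<xi> \<xi> x = \<rho> x * (\<xi> x \<bullet> \<xi> x + (1/3 * p\<^sup>2 + p * w + w\<^sup>2))"
    by (simp add: gn_integrand_def p_def w_def algebra_simps power2_eq_square power3_eq_cube)
  then have "sgn (\<rho> x) * gn_integrand b \<rho> \<xi> \<xi> x = \<bar>\<rho> x\<bar> * (\<xi> x \<bullet> \<xi> x + (1/3 * p\<^sup>2 + p * w + w\<^sup>2))"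
    by (simp add: abs_sgn mult.commute mult.left_commute)
  moreover have "1/3 * p\<^sup>2 + p * w + w\<^sup>2 = (w + p / 2)\<^sup>2 + p\<^sup>2 / 12"
    by (simp add: power2_eq_square field_simps)
  then have "0 \<le> 1/3 * p\<^sup>2 + p * w + w\<^sup>2" by simp
  ultimately show ?thesis by (simp add: mult_left_mono)
qed

section \<open>Configurations, densities and definiteness of the metric\<close>

locale lake = smooth_domain \<Omega> for \<Omega> +
  fixes b \<rho>0 :: "vec2 \<Rightarrow> real"
  assumes b: "smooth_upto \<Omega> b" and \<rho>0: "smooth_upto \<Omega> \<rho>0" and \<rho>0_pos: "\<And>x. x \<in> \<Omega> \<Longrightarrow> 0 < \<rho>0 x"
begin

abbreviation "eul \<equiv> eulerian \<Omega>"
abbreviation "dens \<equiv> density \<Omega> \<rho>0"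
abbreviation "GN \<equiv> GN_metric \<Omega> b \<rho>0"
abbreviation "M \<equiv> M_crit \<Omega> b \<rho>0"

definition "H = H_mean \<Omega> b \<rho>0"
definition "\<rho> = (\<lambda>x. H + b x)"

lemma eul_eq: "eul X Y x = Y (Inv X x)"
  by (simp add: eulerian_def Inv_def)

lemma dens_eq: "dens X x = \<rho>0 (Inv X x) / det (jacobian X (at (Inv X x)))"
  by (simp add: density_def Inv_def Let_def)

lemma M_Diff: "X \<in> M \<Longrightarrow> X \<in> Diff \<Omega>"
  by (simp add: M_crit_def)

lemma dens_M: "X \<in> M \<Longrightarrow> x \<in> \<Omega> \<Longrightarrow> dens X x = \<rho> x"
  by (auto simp: M_crit_def \<rho>_def H_def algebra_simps)

lemma M_I: "X \<in> Diff \<Omega> \<Longrightarrow> (\<And>x. x \<in> \<Omega> \<Longrightarrow> dens X x = \<rho> x) \<Longrightarrow> X \<in> M"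
  by (auto simp: M_crit_def \<rho>_def H_def)

text \<open>On \<open>M\<close> the profile is an actual density, a positive function divided by a
  nonzero Jacobian determinant. Configurations that reverse orientation may give it a negative
  sign.\<close>

lemma \<rho>_nonzero: "X \<in> M \<Longrightarrow> x \<in> \<Omega> \<Longrightarrow> \<rho> x \<noteq> 0"
  using dens_M[of X x] dens_eq[of X x] \<rho>0_pos[of "Inv X x"] Diff_det_nonzero[of X "Inv X x"] Diff_interior[of X x] M_Diff[of X]
  by auto

lemma \<rho>_upto: "smooth_upto \<Omega> \<rho>"
proof -
  obtain F where F: "smooth_on UNIV F" "\<And>x. x \<in> closure \<Omega> \<Longrightarrow> F x = b x"
    using b by (auto simp: smooth_upto_def)
  have "smooth_on UNIV (\<lambda>x. H + F x)" by (intro smooth_on_add smooth_on_const open_UNIV F)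
  from smooth_upto_cong[OF smooth_on_UNIV_upto[OF this]] show ?thesis using F(2) by (simp add: \<rho>_def)
qed

lemma smooth_b: "smooth_on \<Omega> b" and smooth_\<rho>: "smooth_on \<Omega> \<rho>"
  using smooth_upto_smooth_on[OF open_domain] b \<rho>_upto by auto

lemma derivative_\<rho>: "x \<in> \<Omega> \<Longrightarrow> frechet_derivative \<rho> (at x) = frechet_derivative b (at x)"
  unfolding \<rho>_def
  by (rule frechet_derivativeI) (auto intro!: derivative_eq_intros smooth_on_has_derivative[OF smooth_b])

lemma grad_\<rho>: "x \<in> \<Omega> \<Longrightarrow> grad \<rho> x = grad b x"
  by (simp add: grad_def derivative_\<rho>)

text \<open>Configurations are total functions, but test curves are required to start at a
  configuration on the closed domain only. This and the following congruence rules show that values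
  elsewhere have no influence.\<close>

lemma Inv_cong:
  assumes X: "X \<in> Diff \<Omega>" and eq: "\<And>x. x \<in> closure \<Omega> \<Longrightarrow> X x = X' x" and x: "x \<in> closure \<Omega>"
  shows "Inv X' x = Inv X x"
proof (rule Inv_eqI[OF _ x])
  show "Inv X (X' x) = x" if "x \<in> closure \<Omega>" for x using Diff_inv(3)[OF X that] eq[OF that] by simp
  show "Inv X x \<in> closure \<Omega>" "X' (Inv X x) = x"
    using Diff_inv(2,4)[OF X x] eq[of "Inv X x"] by simp_all
qed

lemma Diff_cong:
  assumes X: "X \<in> Diff \<Omega>" and eq: "\<And>x. x \<in> closure \<Omega> \<Longrightarrow> X x = X' x"
  shows "X' \<in> Diff \<Omega>"
proof (rule DiffI[where W = "Inv X"])
  show "smooth_upto \<Omega> X'" by (rule smooth_upto_cong[OF Diff_smooth(1)[OF X] eq])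
  show "X' x \<in> \<Omega>" if "x \<in> \<Omega>" for x using Diff_interior(1)[OF X that] eq[OF in_closure[OF that]] by simp
qed (use Diff_inv[OF X] Diff_interior[OF X] Diff_smooth[OF X] eq in \<open>auto\<close>)

lemma dens_cong:
  assumes X: "X \<in> Diff \<Omega>" and eq: "\<And>x. x \<in> closure \<Omega> \<Longrightarrow> X x = X' x" and x: "x \<in> \<Omega>"
  shows "dens X' x = dens X x"
proof -
  have "jacobian X' (at (Inv X x)) = jacobian X (at (Inv X x))"
    unfolding jacobian_def
    using frechet_derivative_cong_open[OF open_domain Diff_interior(2)[OF X x], of X X'] eq in_closure by auto
  then show ?thesis using Inv_cong[OF X eq in_closure[OF x]] by (simp add: dens_eq)
qed

lemma M_cong:
  assumes X: "X \<in> M" and eq: "\<And>x. x \<in> closure \<Omega> \<Longrightarrow> X x = X' x"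
  shows "X' \<in> M"
  by (rule M_I) (use Diff_cong[OF M_Diff[OF X] eq] dens_cong[OF M_Diff[OF X] eq] dens_M[OF X] in auto)

lemma GN_cong:
  assumes X: "X \<in> Diff \<Omega>" and eq: "\<And>x. x \<in> closure \<Omega> \<Longrightarrow> X x = X' x"
    "\<And>x. x \<in> closure \<Omega> \<Longrightarrow> Y x = Y' x" "\<And>x. x \<in> closure \<Omega> \<Longrightarrow> Z x = Z' x"
  shows "GN X' Y' Z' = GN X Y Z"
  unfolding GN_metric_integrand
proof (rule integral_cong)
  fix x assume x: "x \<in> \<Omega>"
  have e: "eul X' Y' y = eul X Y y" "eul X' Z' y = eul X Z y" if "y \<in> \<Omega>" for y
    using eq(2,3) Diff_inv(2)[OF X] Inv_cong[OF X eq(1)] in_closure[OF that] by (simp_all add: eul_eq)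
  show "gn_integrand b (dens X') (eul X' Y') (eul X' Z') x = gn_integrand b (dens X) (eul X Y) (eul X Z) x"
    using gn_integrand_cong[OF open_domain x e, where \<rho> = "dens X'" and \<rho>' = "dens X"] dens_cong[OF X eq(1) x] by simp
qed

lemma GN_M: "X \<in> M \<Longrightarrow> GN X Y Z = integral \<Omega> (gn_integrand b \<rho> (eul X Y) (eul X Z))"
  unfolding GN_metric_integrand
  by (intro integral_cong gn_integrand_cong[OF open_domain]) (auto simp: dens_M)

lemma GN_commute: "GN X Y Z = GN X Z Y"
  unfolding GN_metric_integrand
  by (rule arg_cong[where f = "integral \<Omega>"]) (rule ext, rule gn_integrand_commute)

lemma smooth_gn_integrand:
  assumes "open S" "S \<subseteq> \<Omega>" "smooth_on S \<sigma>" "smooth_on S \<xi>" "smooth_on S \<eta>"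
  shows "smooth_on S (gn_integrand b \<sigma> \<xi> \<eta>)"
  unfolding gn_integrand_def[abs_def]
  using assms smooth_on_subset[OF smooth_b assms(2)]
  by (intro smooth_on_add smooth_on_mult smooth_on_inner smooth_on_power smooth_on_const smooth_on_divg smooth_on_grad)

text \<open>The divergences and grad b are controlled on the open domain by the derivatives of
  smooth extensions, which are bounded on the compact closure.\<close>

lemma gn_integrand_bounded:
  assumes "smooth_upto \<Omega> \<xi>" "smooth_upto \<Omega> \<eta>"
  obtains B where "\<And>x. x \<in> \<Omega> \<Longrightarrow> \<bar>gn_integrand b \<rho> \<xi> \<eta> x\<bar> \<le> B"
proof -
  have ex: "\<exists>B\<ge>0. \<forall>x\<in>\<Omega>. norm (\<zeta> x) \<le> B \<and> \<bar>divg \<zeta> x\<bar> \<le> B" if \<zeta>: "smooth_upto \<Omega> \<zeta>" for \<zeta> :: vmap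
  proof -
    obtain B0 where B0: "\<And>x. x \<in> closure \<Omega> \<Longrightarrow> norm (\<zeta> x) \<le> B0" using smooth_upto_bounded[OF bounded_domain \<zeta>] by blast
    obtain B1 where B1: "\<And>x. x \<in> \<Omega> \<Longrightarrow> norm (frechet_derivative \<zeta> (at x) (axis 1 1)) \<le> B1"
      using smooth_upto_derivative_bounded[OF open_domain bounded_domain \<zeta>] by blast
    obtain B2 where B2: "\<And>x. x \<in> \<Omega> \<Longrightarrow> norm (frechet_derivative \<zeta> (at x) (axis 2 1)) \<le> B2"
      using smooth_upto_derivative_bounded[OF open_domain bounded_domain \<zeta>] by blast
    have "norm (\<zeta> x) \<le> \<bar>B0\<bar> + \<bar>B1\<bar> + \<bar>B2\<bar> \<and> \<bar>divg \<zeta> x\<bar> \<le> \<bar>B0\<bar> + \<bar>B1\<bar> + \<bar>B2\<bar>" if x: "x \<in> \<Omega>" for x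
      using B0[OF in_closure[OF x]] B1[OF x] B2[OF x]
        component_le_norm_cart[of "frechet_derivative \<zeta> (at x) (axis 1 1)" 1]
        component_le_norm_cart[of "frechet_derivative \<zeta> (at x) (axis 2 1)" 2]
      unfolding divg_expand by linarith
    then show ?thesis by (intro exI[of _ "\<bar>B0\<bar> + \<bar>B1\<bar> + \<bar>B2\<bar>"]) auto
  qed
  obtain B1 where B1: "B1 \<ge> 0" "\<And>x. x \<in> \<Omega> \<Longrightarrow> norm (\<xi> x) \<le> B1" "\<And>x. x \<in> \<Omega> \<Longrightarrow> \<bar>divg \<xi> x\<bar> \<le> B1"
    using ex[OF assms(1)] by blast
  obtain B2 where B2: "B2 \<ge> 0" "\<And>x. x \<in> \<Omega> \<Longrightarrow> norm (\<eta> x) \<le> B2" "\<And>x. x \<in> \<Omega> \<Longrightarrow> \<bar>divg \<eta> x\<bar> \<le> B2"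
    using ex[OF assms(2)] by blast
  obtain R where R: "\<And>x. x \<in> closure \<Omega> \<Longrightarrow> norm (\<rho> x) \<le> R" using smooth_upto_bounded[OF bounded_domain \<rho>_upto] by blast
  obtain G1 where G1: "\<And>x. x \<in> \<Omega> \<Longrightarrow> norm (frechet_derivative b (at x) (axis 1 1)) \<le> G1"
    using smooth_upto_derivative_bounded[OF open_domain bounded_domain b] by blast
  obtain G2 where G2: "\<And>x. x \<in> \<Omega> \<Longrightarrow> norm (frechet_derivative b (at x) (axis 2 1)) \<le> G2"
    using smooth_upto_derivative_bounded[OF open_domain bounded_domain b] by blast
  define C where "C = \<bar>R\<bar> + \<bar>G1\<bar> + \<bar>G2\<bar> + B1 + B2"
  have C: "\<bar>\<rho> x\<bar> \<le> C" "norm (grad b x) \<le> C" "norm (\<xi> x) \<le> C" "norm (\<eta> x) \<le> C" "\<bar>divg \<xi> x\<bar> \<le> C" "\<bar>divg \<eta> x\<bar> \<le> C"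
    if x: "x \<in> \<Omega>" for x
  proof -
    have "norm (grad b x) \<le> \<bar>grad b x $ 1\<bar> + \<bar>grad b x $ 2\<bar>"
      using norm_le_l1_cart[of "grad b x"] by (simp add: sum_2)
    then show "norm (grad b x) \<le> C" using G1[OF x] G2[OF x] B1(1) B2(1) by (simp add: grad_nth C_def)
    show "\<bar>\<rho> x\<bar> \<le> C" using R[OF in_closure[OF x]] B1(1) B2(1) by (simp add: C_def)
  qed (use B1(1) B2(1) B1(2,3)[OF x] B2(2,3)[OF x] in \<open>simp_all add: C_def\<close>)
  have C0: "C \<ge> 0" using B1(1) B2(1) by (simp add: C_def)
  have prod: "\<bar>p * q\<bar> \<le> P * Q" if "\<bar>p\<bar> \<le> P" "\<bar>q\<bar> \<le> Q" for p q P Q :: real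
    unfolding abs_mult using that by (intro mult_mono) auto
  have inn: "\<bar>p \<bullet> q\<bar> \<le> C * C" if "norm p \<le> C" "norm q \<le> C" for p q :: vec2
    using order_trans[OF Cauchy_Schwarz_ineq2 mult_mono[OF that C0 norm_ge_zero]] .
  have pow: "\<bar>p ^ n\<bar> \<le> C ^ n" if "\<bar>p\<bar> \<le> C" for p n
    using power_mono[OF that abs_ge_zero] by (simp add: power_abs)
  have "\<bar>gn_integrand b \<rho> \<xi> \<eta> x\<bar> \<le> C * (C * C) + 1/3 * C ^ 3 * C * C + 1/2 * C ^ 2 * C * (C * C)
      + 1/2 * C ^ 2 * C * (C * C) + C * (C * C) * (C * C)" if x: "x \<in> \<Omega>" for x
    unfolding gn_integrand_def
    by (intro order_trans[OF abs_triangle_ineq] add_mono prod inn pow C[OF x]) simp_all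
  then show ?thesis using that by blast
qed

lemma gn_integrand_integrable:
  assumes "smooth_upto \<Omega> \<xi>" "smooth_upto \<Omega> \<eta>"
  shows "gn_integrand b \<rho> \<xi> \<eta> absolutely_integrable_on \<Omega>"
proof -
  obtain B where B: "\<And>x. x \<in> \<Omega> \<Longrightarrow> \<bar>gn_integrand b \<rho> \<xi> \<eta> x\<bar> \<le> B" using gn_integrand_bounded[OF assms] by blast
  show ?thesis
    by (rule bounded_continuous_integrable[OF smooth_on_continuous_on[OF smooth_gn_integrand] B])
      (use assms open_domain smooth_\<rho> smooth_upto_smooth_on[OF open_domain] in auto)
qed

text \<open>\<rho> has one sign on the connected domain, so coercivity turns the vanishing integral
  into a vanishing integrand. The Eulerian field is then 0 in the interior, and continuity carries
  this to the closure.\<close>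

lemma GN_definite:
  assumes X: "X \<in> M" and Y: "Y \<in> T_Diff \<Omega> X" and z: "GN X Y Y = 0" and x: "x \<in> closure \<Omega>"
  shows "Y x = 0"
proof -
  define \<xi> where "\<xi> = eul X Y"
  have xs: "smooth_upto \<Omega> \<xi>" unfolding \<xi>_def by (rule T_Diff_smooth(1)[OF M_Diff[OF X] Y])
  have so: "smooth_on \<Omega> \<xi>" by (rule smooth_upto_smooth_on[OF open_domain xs])
  obtain x0 where x0: "x0 \<in> \<Omega>" using domain_nonempty by auto
  define \<sigma> where "\<sigma> = sgn (\<rho> x0)"
  have sgn: "sgn (\<rho> y) = \<sigma>" if y: "y \<in> \<Omega>" for y
  proof (rule ccontr)
    assume ne: "sgn (\<rho> y) \<noteq> \<sigma>"
    have con: "connected (\<rho> ` \<Omega>)"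
      by (intro connected_continuous_image smooth_on_continuous_on smooth_\<rho> connected_domain)
    have "\<rho> y < 0 \<and> 0 < \<rho> x0 \<or> \<rho> x0 < 0 \<and> 0 < \<rho> y"
      using ne \<rho>_nonzero[OF X x0] \<rho>_nonzero[OF X y] unfolding \<sigma>_def by (auto simp: sgn_real_def split: if_splits)
    then have "0 \<in> \<rho> ` \<Omega>"
      using connectedD_interval[OF con imageI[OF y] imageI[OF x0], of 0] connectedD_interval[OF con imageI[OF x0] imageI[OF y], of 0]
      by auto
    then show False using \<rho>_nonzero[OF X] by force
  qed
  let ?h = "\<lambda>y. \<sigma> * gn_integrand b \<rho> \<xi> \<xi> y"
  have h: "\<bar>\<rho> y\<bar> * (\<xi> y \<bullet> \<xi> y) \<le> ?h y" if "y \<in> \<Omega>" for y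
    using gn_integrand_coercive[of \<rho> y \<xi> b] \<rho>_nonzero[OF X that] sgn[OF that] by simp
  have hz: "?h y = 0" if "y \<in> \<Omega>" for y
  proof (rule integral_zero_continuous[OF _ _ _ _ that])
    show "continuous_on \<Omega> ?h"
      by (intro continuous_on_mult_left smooth_on_continuous_on smooth_gn_integrand open_domain smooth_\<rho> so order_refl)
    have i: "gn_integrand b \<rho> \<xi> \<xi> integrable_on \<Omega>"
      by (intro set_lebesgue_integral_eq_integral(1) gn_integrand_integrable xs)
    show "?h integrable_on \<Omega>" by (rule integrable_on_mult_right[OF i])
    show "0 \<le> ?h y" if "y \<in> \<Omega>" for y
      by (rule order_trans[OF _ h[OF that]]) simp
    show "integral \<Omega> ?h = 0" using z GN_M[OF X] by (simp add: \<xi>_def)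
  qed
  have "\<bar>\<rho> y\<bar> * (\<xi> y \<bullet> \<xi> y) \<le> 0" if "y \<in> \<Omega>" for y using h[OF that] hz[OF that] by linarith
  then have "\<xi> y = 0" if "y \<in> \<Omega>" for y
    using \<rho>_nonzero[OF X that] that by (metis abs_le_zero_iff inner_eq_zero_iff inner_ge_zero mult_le_0_iff order_antisym abs_ge_zero)
  moreover obtain F where F: "smooth_on UNIV F" "\<And>x. x \<in> closure \<Omega> \<Longrightarrow> F x = \<xi> x"
    using xs by (auto simp: smooth_upto_def)
  ultimately have "F y = 0" if "y \<in> closure \<Omega>" for y
    by (intro continuous_constant_on_closure[OF continuous_on_subset[OF smooth_on_continuous_on[OF F(1)]] _ that])
      (use F in_closure in auto)
  then have "\<xi> (X x) = 0" using F(2) Diff_inv(1)[OF M_Diff[OF X] x] by simp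
  then show ?thesis using Diff_inv(3)[OF M_Diff[OF X] x] by (simp add: \<xi>_def eul_eq)
qed

end

section \<open>Bounded integrands and change of variables\<close>

context smooth_domain
begin

text \<open>A class closed under products and differences, so that the integrands of the potential
  are integrable without separate estimates.\<close>

definition bounded_cont :: "(vec2 \<Rightarrow> real) \<Rightarrow> bool" where
  "bounded_cont h \<longleftrightarrow> continuous_on \<Omega> h \<and> (\<exists>B. \<forall>x\<in>\<Omega>. \<bar>h x\<bar> \<le> B)"

lemma bounded_cont_integrable: "bounded_cont h \<Longrightarrow> h absolutely_integrable_on \<Omega>"
  unfolding bounded_cont_def using bounded_continuous_integrable by blast

lemma bounded_cont_integrable_on: "bounded_cont h \<Longrightarrow> h integrable_on \<Omega>"
  by (intro set_lebesgue_integral_eq_integral(1) bounded_cont_integrable)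

lemma bounded_cont_mult:
  assumes "bounded_cont g" "bounded_cont h" shows "bounded_cont (\<lambda>x. g x * h x)"
proof -
  obtain B C where BC: "\<And>x. x \<in> \<Omega> \<Longrightarrow> \<bar>g x\<bar> \<le> B" "\<And>x. x \<in> \<Omega> \<Longrightarrow> \<bar>h x\<bar> \<le> C"
    using assms unfolding bounded_cont_def by blast
  have "\<bar>g x * h x\<bar> \<le> B * C" if "x \<in> \<Omega>" for x
    unfolding abs_mult by (rule mult_mono[OF BC(1)[OF that] BC(2)[OF that]]) (use BC(1)[OF that] in auto)
  then show ?thesis using assms unfolding bounded_cont_def by (auto intro!: continuous_intros)
qed

lemma bounded_cont_diff:
  assumes "bounded_cont g" "bounded_cont h" shows "bounded_cont (\<lambda>x. g x - h x)"
proof -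
  obtain B C where BC: "\<And>x. x \<in> \<Omega> \<Longrightarrow> \<bar>g x\<bar> \<le> B" "\<And>x. x \<in> \<Omega> \<Longrightarrow> \<bar>h x\<bar> \<le> C"
    using assms unfolding bounded_cont_def by blast
  have "\<bar>g x - h x\<bar> \<le> B + C" if "x \<in> \<Omega>" for x
    using BC(1)[OF that] BC(2)[OF that] by linarith
  then show ?thesis using assms unfolding bounded_cont_def by (auto intro!: continuous_intros)
qed

lemma bounded_cont_const: "bounded_cont (\<lambda>x. c)"
  unfolding bounded_cont_def by auto

lemma bounded_cont_closure:
  assumes "continuous_on (closure \<Omega>) h" shows "bounded_cont h"
proof -
  have "bounded (h ` closure \<Omega>)"
    by (intro compact_imp_bounded compact_continuous_image assms compact_closure_domain)
  then obtain B where "\<And>x. x \<in> closure \<Omega> \<Longrightarrow> \<bar>h x\<bar> \<le> B" unfolding bounded_iff by force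
  then show ?thesis unfolding bounded_cont_def
    using continuous_on_subset[OF assms closure_subset] in_closure by blast
qed

lemma smooth_upto_continuous:
  fixes h :: "vec2 \<Rightarrow> 'b::real_normed_vector"
  assumes "smooth_upto \<Omega> h" shows "continuous_on (closure \<Omega>) h"
proof -
  obtain F where F: "smooth_on UNIV F" "\<And>x. x \<in> closure \<Omega> \<Longrightarrow> F x = h x"
    using assms by (auto simp: smooth_upto_def)
  show ?thesis
    by (rule continuous_on_eq[OF continuous_on_subset[OF smooth_on_continuous_on[OF F(1)] subset_UNIV] F(2)])
qed

lemma real_change_of_variables:
  fixes g :: vmap and h :: "vec2 \<Rightarrow> real"
  assumes g: "\<And>x. x \<in> \<Omega> \<Longrightarrow> g differentiable (at x)" and inj: "inj_on g \<Omega>" and im: "g ` \<Omega> = \<Omega>"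
    and h: "h absolutely_integrable_on \<Omega>"
  shows "integral \<Omega> (\<lambda>x. \<bar>det (jacobian g (at x))\<bar> * h (g x)) = integral \<Omega> h"
proof -
  \<comment> \<open>Real values are carried by the only coordinate of \<open>real ^ 1\<close>, the
    form in which the change of variables rule is applied.\<close>
  let ?e = "\<lambda>c::real. c *\<^sub>R (axis 1 1 :: real ^ 1)"
  let ?D = "\<lambda>x. \<bar>det (jacobian g (at x))\<bar>"
  have bl: "bounded_linear ?e" by (rule bounded_linear_scaleR_left)
  have nth: "bounded_linear (\<lambda>v :: real ^ 1. v $ 1)" by (rule bounded_linear_vec_nth)
  have der: "(g has_derivative frechet_derivative g (at x)) (at x within \<Omega>)" if "x \<in> \<Omega>" for x
    using g[OF that] has_derivative_at_withinI frechet_derivative_works by blast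
  have ei: "(\<lambda>x. ?e (h x)) absolutely_integrable_on \<Omega>"
    using absolutely_integrable_linear[OF h bl] by (simp add: o_def)
  have "(\<lambda>x. ?D x *\<^sub>R ?e (h (g x))) absolutely_integrable_on \<Omega> \<and>
      integral \<Omega> (\<lambda>x. ?D x *\<^sub>R ?e (h (g x))) = integral \<Omega> (\<lambda>x. ?e (h x))"
    using has_absolute_integral_change_of_variables[OF _ der inj, of "\<lambda>x. ?e (h x)" "integral \<Omega> (\<lambda>x. ?e (h x))"]
      ei open_domain unfolding im jacobian_def by auto
  then have a: "(\<lambda>x. ?D x *\<^sub>R ?e (h (g x))) absolutely_integrable_on \<Omega>"
    and eq: "integral \<Omega> (\<lambda>x. ?D x *\<^sub>R ?e (h (g x))) = integral \<Omega> (\<lambda>x. ?e (h x))" by auto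
  have "integral \<Omega> (\<lambda>x. (?D x *\<^sub>R ?e (h (g x))) $ 1) = integral \<Omega> (\<lambda>x. ?e (h x) $ 1)"
    using integral_linear[OF set_lebesgue_integral_eq_integral(1)[OF a] nth]
      integral_linear[OF set_lebesgue_integral_eq_integral(1)[OF ei] nth] eq by (simp add: o_def)
  then show ?thesis by simp
qed

end

section \<open>The critical manifold\<close>

context lake
begin

lemma mass_M:
  assumes X: "X \<in> M" and a: "a \<in> \<Omega>"
  shows "\<rho> (X a) * det (jacobian X (at a)) = \<rho>0 a"
proof -
  note D = M_Diff[OF X]
  have "dens X (X a) = \<rho>0 a / det (jacobian X (at a))"
    using Diff_inv(3)[OF D in_closure[OF a]] by (simp add: dens_eq)
  then show ?thesis
    using dens_M[OF X Diff_interior(1)[OF D a]] Diff_det_nonzero[OF D a] by (simp add: field_simps)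
qed

lemma curve_in_M_Diff: "curve_in \<Omega> M J X \<Longrightarrow> curve_in \<Omega> (Diff \<Omega>) J X"
  using M_Diff by (auto simp: curve_in_def)

lemma eul_smooth:
  assumes c: "curve_in \<Omega> (Diff \<Omega>) J X" and t: "t \<in> J"
  shows "smooth_upto \<Omega> (eul (X t) (time_deriv X t))" "smooth_on \<Omega> (eul (X t) (time_deriv X t))"
proof -
  show "smooth_upto \<Omega> (eul (X t) (time_deriv X t))"
    by (rule T_Diff_smooth(1)[OF curve_inD(4)[OF c t] time_deriv_T_Diff[OF c t]])
  then show "smooth_on \<Omega> (eul (X t) (time_deriv X t))" by (rule smooth_upto_smooth_on[OF open_domain])
qed

text \<open>Along a trajectory the mass \<rho>(X a) det DX(a) equals the constant \<rho>0(a).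
  Differentiating it with Liouville's formula and dividing by the nonzero determinant gives
  incompressibility.\<close>

lemma incompressible_M:
  assumes c: "curve_in \<Omega> M J X" and t: "t \<in> J" and x: "x \<in> \<Omega>"
  defines "u \<equiv> eul (X t) (time_deriv X t)"
  shows "\<rho> x * divg u x + u x \<bullet> grad b x = 0"
proof -
  note cd = curve_in_M_Diff[OF c] and cD = curve_inD[OF c]
  have XD: "X s \<in> Diff \<Omega>" if "s \<in> J" for s using cD(4)[OF that] M_Diff by simp
  define a where "a = Inv (X t) x"
  have a: "a \<in> \<Omega>" "X t a = x" using Diff_interior(2)[OF XD[OF t] x] Diff_inv(4)[OF XD[OF t] in_closure[OF x]]
    by (auto simp: a_def)
  obtain F where F: "smooth_on (J \<times> UNIV) F" "\<And>s y. s \<in> J \<Longrightarrow> y \<in> closure \<Omega> \<Longrightarrow> F (s, y) = X s y"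
    using cD(3) by (auto simp: smooth_time_upto_def)
  have FO: "smooth_on (J \<times> \<Omega>) F" by (rule smooth_on_subset[OF F(1)]) auto
  have us: "smooth_on \<Omega> u" unfolding u_def by (rule eul_smooth(2)[OF cd t])
  have time: "frechet_derivative F (at (t, y)) (1, 0) = u (F (t, y))" if y: "y \<in> \<Omega>" for y
  proof -
    have ty: "(t, y) \<in> J \<times> \<Omega>" using t y by simp
    have "((\<lambda>s. X s y) has_vector_derivative frechet_derivative F (at (t, y)) (1, 0)) (at t)"
      by (rule has_vector_derivative_transform_within_open[OF time_slice_derivative[OF FO ty] cD(1) t])
        (use F(2) in_closure[OF y] in auto)
    then have "frechet_derivative F (at (t, y)) (1, 0) = time_deriv X t y"
      by (simp add: time_deriv_def vector_derivative_at)
    then show ?thesis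
      using F(2)[OF t in_closure[OF y]] Diff_inv(3)[OF XD[OF t] in_closure[OF y]] by (simp add: u_def eul_eq)
  qed
  have Fa: "F (t, a) = x" using F(2)[OF t in_closure[OF a(1)]] a(2) by simp
  have jac: "jacobian (\<lambda>y. F (s, y)) (at a) = jacobian (X s) (at a)" if "s \<in> J" for s
    unfolding jacobian_def
    using frechet_derivative_cong_open[OF open_domain a(1), of "\<lambda>y. F (s, y)" "X s"] F(2)[OF that] in_closure by auto
  have d1: "((\<lambda>s. det (jacobian (\<lambda>y. F (s, y)) (at a))) has_real_derivative
      divg u x * det (jacobian (X t) (at a))) (at t)"
    using det_jacobian_time_derivative[OF cD(1) t open_domain a(1) FO _ time] smooth_on_differentiable[OF us x]
    by (simp add: Fa jac[OF t])
  have "((\<lambda>s. F (s, a)) has_vector_derivative u x) (at t)"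
    using time_slice_derivative[OF FO, of t a] t a time[OF a(1)] Fa by simp
  from vector_derivative_diff_chain_within[OF this has_derivative_at_withinI[OF smooth_on_has_derivative[OF smooth_\<rho>]]]
  have d2: "((\<lambda>s. \<rho> (F (s, a))) has_real_derivative u x \<bullet> grad b x) (at t)"
    using x grad_inner[OF smooth_on_differentiable[OF smooth_b x], of "u x"] derivative_\<rho>[OF x]
    by (simp add: Fa o_def has_real_derivative_iff_has_vector_derivative)
  have "((\<lambda>s. \<rho> (F (s, a)) * det (jacobian (\<lambda>y. F (s, y)) (at a))) has_real_derivative
      (u x \<bullet> grad b x) * det (jacobian (X t) (at a)) + divg u x * det (jacobian (X t) (at a)) * \<rho> x) (at t)"
    using DERIV_mult[OF d2 d1] by (simp add: Fa jac[OF t])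
  moreover have "((\<lambda>s. \<rho> (F (s, a)) * det (jacobian (\<lambda>y. F (s, y)) (at a))) has_real_derivative 0) (at t)"
    by (rule has_field_derivative_transform_within_open[OF DERIV_const cD(1) t, of "\<rho>0 a"])
      (use mass_M[OF cD(4) a(1)] F(2) in_closure[OF a(1)] jac in auto)
  ultimately have "(u x \<bullet> grad b x) * det (jacobian (X t) (at a)) + divg u x * det (jacobian (X t) (at a)) * \<rho> x = 0"
    by (rule DERIV_unique)
  then have "(\<rho> x * divg u x + u x \<bullet> grad b x) * det (jacobian (X t) (at a)) = 0" by (simp add: algebra_simps)
  then show ?thesis using Diff_det_nonzero[OF XD[OF t] a(1)] by simp
qed

end

section \<open>Density and potential along a flow\<close>

locale lake_flow = lake \<Omega> b \<rho>0 + tangential_flow \<Omega> f \<delta> \<Phi> for \<Omega> b \<rho>0 f \<delta> \<Phi>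
begin

lemma dens_flow:
  assumes X: "X \<in> Diff \<Omega>" and s: "\<bar>s\<bar> < \<delta>" and x: "x \<in> \<Omega>"
  shows "dens (\<lambda>a. \<Phi> s (X a)) x = dens X (\<Phi> (- s) x) / det (jacobian (\<Phi> s) (at (\<Phi> (- s) x)))"
proof -
  define y where "y = \<Phi> (- s) x"
  have y: "y \<in> \<Omega>" unfolding y_def by (rule \<Phi>_domain) (use s x in auto)
  define a where "a = Inv X y"
  have a: "a \<in> \<Omega>" "X a = y" using Diff_interior(2)[OF X y] Diff_inv(4)[OF X in_closure[OF y]] by (auto simp: a_def)
  have "det (jacobian (\<lambda>a. \<Phi> s (X a)) (at a)) = det (jacobian (\<Phi> s) (at y)) * det (jacobian X (at a))"
    using det_jacobian_compose[OF differentiable_\<Phi>[OF s] smooth_on_differentiable[OF Diff_smooth(3)[OF X] a(1)]] a(2) by simp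
  moreover have "Inv (\<lambda>a. \<Phi> s (X a)) x = a" using flow_Diff(2)[OF X s in_closure[OF x]] by (simp add: a_def y_def)
  ultimately show ?thesis by (simp add: dens_eq y_def[symmetric] a_def[symmetric])
qed

lemma time_derivative_\<Phi>:
  assumes s: "\<bar>s\<bar> < \<delta>"
  shows "frechet_derivative (\<lambda>q. \<Phi> (fst q) (snd q)) (at (s, x)) (1, 0) = f (\<Phi> s x)"
proof -
  have "(s, x) \<in> {-\<delta><..<\<delta>} \<times> UNIV" using s by (auto simp: abs_less_iff)
  from time_slice_derivative[OF smooth_\<Phi> this]
  have "((\<lambda>s. \<Phi> s x) has_vector_derivative frechet_derivative (\<lambda>q. \<Phi> (fst q) (snd q)) (at (s, x)) (1, 0)) (at s)"
    by simp
  then show ?thesis using \<Phi>_deriv[OF s] by (rule vector_derivative_unique_at)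
qed

lemma det_\<Phi>_deriv:
  assumes s: "\<bar>s\<bar> < \<delta>"
  shows "((\<lambda>s. det (jacobian (\<Phi> s) (at y))) has_real_derivative
    divg f (\<Phi> s y) * det (jacobian (\<Phi> s) (at y))) (at s)"
  using det_jacobian_time_derivative[OF open_greaterThanLessThan _ open_UNIV UNIV_I smooth_\<Phi>, where t = s and a = y and g = f]
    s time_derivative_\<Phi>[OF s] smooth_on_differentiable[OF f] by (simp add: abs_less_iff)

text \<open>The derivative of \<rho>(\<Phi> s y) det D\<Phi> s(y) in s is (\<rho> div f + f . grad
  b) det D\<Phi>, hence 0, so the product keeps its initial value \<rho>(y): the flow transports the
  profile to itself.\<close>

lemma flow_M:
  assumes X: "X \<in> M" and f0: "\<And>x. x \<in> \<Omega> \<Longrightarrow> \<rho> x * divg f x + f x \<bullet> grad b x = 0" and s: "\<bar>s\<bar> < \<delta>"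
  shows "(\<lambda>a. \<Phi> s (X a)) \<in> M"
proof (rule M_I[OF flow_Diff(1)[OF M_Diff[OF X] s]])
  fix x assume x: "x \<in> \<Omega>"
  define y where "y = \<Phi> (- s) x"
  have y: "y \<in> \<Omega>" unfolding y_def by (rule \<Phi>_domain) (use s x in auto)
  let ?k = "\<lambda>s. \<rho> (\<Phi> s y) * det (jacobian (\<Phi> s) (at y))"
  have "(?k has_real_derivative 0) (at r within {-\<delta><..<\<delta>})" if r: "r \<in> {-\<delta><..<\<delta>}" for r
  proof -
    have r': "\<bar>r\<bar> < \<delta>" using r by (auto simp: abs_less_iff)
    have z: "\<Phi> r y \<in> \<Omega>" by (rule \<Phi>_domain[OF r' y])
    from vector_derivative_diff_chain_within[OF \<Phi>_deriv[OF r', of y] has_derivative_at_withinI[OF smooth_on_has_derivative[OF smooth_\<rho> z]]]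
    have "((\<lambda>s. \<rho> (\<Phi> s y)) has_real_derivative f (\<Phi> r y) \<bullet> grad b (\<Phi> r y)) (at r)"
      using grad_inner[OF smooth_on_differentiable[OF smooth_b z], of "f (\<Phi> r y)"] derivative_\<rho>[OF z]
      by (simp add: o_def has_real_derivative_iff_has_vector_derivative)
    from DERIV_mult[OF this det_\<Phi>_deriv[OF r', of y]]
    have "(?k has_real_derivative (\<rho> (\<Phi> r y) * divg f (\<Phi> r y) + f (\<Phi> r y) \<bullet> grad b (\<Phi> r y)) * det (jacobian (\<Phi> r) (at y))) (at r)"
      by (simp add: algebra_simps)
    then show ?thesis using f0[OF z] by (simp add: has_field_derivative_at_within)
  qed
  then obtain c where c: "\<And>r. r \<in> {-\<delta><..<\<delta>} \<Longrightarrow> ?k r = c"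
    using has_field_derivative_zero_constant[of "{-\<delta><..<\<delta>}" ?k] by auto
  have "\<Phi> 0 = (\<lambda>x. x)" using \<Phi>_0 by auto
  then have "?k 0 = \<rho> y" by (simp add: jacobian_def matrix_id_mat_1[unfolded id_def])
  then have "?k s = \<rho> y" using c[of 0] c[of s] s \<delta> by (simp add: abs_less_iff)
  then have "\<rho> x * det (jacobian (\<Phi> s) (at y)) = \<rho> y" using \<Phi>_inv'[OF s] by (simp add: y_def)
  then have "\<rho> y / det (jacobian (\<Phi> s) (at y)) = \<rho> x"
    using det_jacobian_\<Phi>_pos[OF s, of y] by (simp add: field_simps)
  then show "dens (\<lambda>a. \<Phi> s (X a)) x = \<rho> x"
    using dens_flow[OF M_Diff[OF X] s x] dens_M[OF X y] by (simp add: y_def)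
qed

text \<open>Since b = \<rho> - H, replacing \<rho> by the transported density \<sigma> raises the
  potential by the integral of (\<sigma> - \<rho>)^2/2 + H (\<sigma> - \<rho>), and the linear term
  integrates to 0 by conservation of mass.\<close>

lemma U_flow_ge:
  assumes X: "X \<in> M" and s: "\<bar>s\<bar> < \<delta>"
  shows "U_pot \<Omega> b \<rho>0 X \<le> U_pot \<Omega> b \<rho>0 (\<lambda>a. \<Phi> s (X a))"
proof -
  have s': "\<bar>- s\<bar> < \<delta>" using s by simp
  define \<sigma> where "\<sigma> x = \<rho> (\<Phi> (- s) x) / det (jacobian (\<Phi> s) (at (\<Phi> (- s) x)))" for x
  have \<sigma>: "dens (\<lambda>a. \<Phi> s (X a)) x = \<sigma> x" if "x \<in> \<Omega>" for x
    using dens_flow[OF M_Diff[OF X] s that] dens_M[OF X \<Phi>_domain[OF s' that]] by (simp add: \<sigma>_def)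
  have c\<Phi>: "continuous_on (closure \<Omega>) (\<Phi> (- s))"
    using smooth_on_continuous_on[OF smooth_slice[OF s']] continuous_on_subset by blast
  have "continuous_on UNIV (\<lambda>y. det (jacobian (\<Phi> s) (at y)))"
    unfolding det_jacobian
    by (intro smooth_on_continuous_on smooth_on_diff smooth_on_mult smooth_on_vec_nth
      smooth_on_derivative_dir smooth_slice[OF s] open_UNIV)
  then have "continuous_on (closure \<Omega>) \<sigma>"
    unfolding \<sigma>_def using det_jacobian_\<Phi>_pos[OF s] \<Phi>_closure[OF s']
    by (intro continuous_on_divide continuous_on_compose2[OF smooth_upto_continuous[OF \<rho>_upto] c\<Phi>]
      continuous_on_compose2[of UNIV "\<lambda>y. det (jacobian (\<Phi> s) (at y))", OF _ c\<Phi>]) (auto simp: less_le)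
  then have b\<sigma>: "bounded_cont \<sigma>" by (rule bounded_cont_closure)
  have b\<rho>: "bounded_cont \<rho>" by (rule bounded_cont_closure[OF smooth_upto_continuous[OF \<rho>_upto]])
  have bb: "bounded_cont b" by (rule bounded_cont_closure[OF smooth_upto_continuous[OF b]])
  have "integral \<Omega> \<sigma> = integral \<Omega> (\<lambda>x. \<bar>det (jacobian (\<Phi> s) (at x))\<bar> * \<sigma> (\<Phi> s x))"
  proof (rule real_change_of_variables[symmetric])
    show "inj_on (\<Phi> s) \<Omega>" by (rule inj_on_inverseI[of _ "\<Phi> (- s)"]) (rule \<Phi>_inv[OF s])
    show "\<Phi> s ` \<Omega> = \<Omega>"
    proof
      show "\<Omega> \<subseteq> \<Phi> s ` \<Omega>"
        using \<Phi>_domain[OF s'] \<Phi>_inv'[OF s] by (metis imageI subsetI)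
    qed (use \<Phi>_domain[OF s] in auto)
  qed (use differentiable_\<Phi>[OF s] bounded_cont_integrable[OF b\<sigma>] in auto)
  also have "\<dots> = integral \<Omega> \<rho>"
  proof (rule integral_cong)
    show "\<bar>det (jacobian (\<Phi> s) (at x))\<bar> * \<sigma> (\<Phi> s x) = \<rho> x" for x
      using det_jacobian_\<Phi>_pos[OF s, of x] by (simp add: \<sigma>_def \<Phi>_inv[OF s])
  qed
  finally have eq: "integral \<Omega> \<sigma> = integral \<Omega> \<rho>" .
  let ?U = "\<lambda>\<rho> x. \<rho> x * \<rho> x * (1/2) - \<rho> x * b x"
  have bU: "bounded_cont (?U \<sigma>)" "bounded_cont (?U \<rho>)"
    by (intro bounded_cont_diff bounded_cont_mult b\<sigma> b\<rho> bb bounded_cont_const)+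
  have bq: "bounded_cont (\<lambda>x. (\<sigma> x - \<rho> x) * (\<sigma> x - \<rho> x) * (1/2))"
    by (intro bounded_cont_diff bounded_cont_mult b\<sigma> b\<rho> bounded_cont_const)
  have bl: "bounded_cont (\<lambda>x. (\<sigma> x - \<rho> x) * H)"
    by (intro bounded_cont_diff bounded_cont_mult b\<sigma> b\<rho> bounded_cont_const)
  note io = bounded_cont_integrable_on
  have "U_pot \<Omega> b \<rho>0 (\<lambda>a. \<Phi> s (X a)) = integral \<Omega> (?U \<sigma>)" "U_pot \<Omega> b \<rho>0 X = integral \<Omega> (?U \<rho>)"
    unfolding U_pot_def
    by (rule integral_cong; simp add: \<sigma> dens_M[OF X] power2_eq_square)+
  then have "U_pot \<Omega> b \<rho>0 (\<lambda>a. \<Phi> s (X a)) - U_pot \<Omega> b \<rho>0 X = integral \<Omega> (\<lambda>x. ?U \<sigma> x - ?U \<rho> x)"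
    using integral_diff[OF io[OF bU(1)] io[OF bU(2)]] by simp
  also have "\<dots> = integral \<Omega> (\<lambda>x. (\<sigma> x - \<rho> x) * (\<sigma> x - \<rho> x) * (1/2) + (\<sigma> x - \<rho> x) * H)"
    by (intro integral_cong) (simp add: \<rho>_def algebra_simps)
  also have "\<dots> = integral \<Omega> (\<lambda>x. (\<sigma> x - \<rho> x) * (\<sigma> x - \<rho> x) * (1/2)) + integral \<Omega> (\<lambda>x. (\<sigma> x - \<rho> x) * H)"
    by (rule integral_add[OF io[OF bq] io[OF bl]])
  also have "integral \<Omega> (\<lambda>x. (\<sigma> x - \<rho> x) * H) = 0"
    using integral_diff[OF io[OF b\<sigma>] io[OF b\<rho>]] eq by simp
  also have "integral \<Omega> (\<lambda>x. (\<sigma> x - \<rho> x) * (\<sigma> x - \<rho> x) * (1/2)) + 0 \<ge> 0"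
    using integral_nonneg[OF io[OF bq]] by simp
  finally show ?thesis by simp
qed

end

section \<open>Gradients on the critical manifold\<close>

context lake
begin

text \<open>Supplies the test curves: the Eulerian form of a tangent vector is extended to a
  compactly supported field of the plane, whose flow has that vector as initial velocity.\<close>

lemma flow_with_velocity:
  assumes X: "X \<in> Diff \<Omega>" and Y: "Y \<in> T_Diff \<Omega> X"
  obtains f \<delta> \<Phi> where "lake_flow \<Omega> b \<rho>0 f \<delta> \<Phi>" "\<And>x. x \<in> closure \<Omega> \<Longrightarrow> f x = eul X Y x"
    "\<And>x. x \<in> closure \<Omega> \<Longrightarrow> f (X x) = Y x"
proof -
  note sm = T_Diff_smooth[OF X Y]
  obtain f K where f: "smooth_on UNIV f" "compact K" "\<And>x. x \<notin> K \<Longrightarrow> f x = 0" "\<And>x. x \<in> closure \<Omega> \<Longrightarrow> f x = eul X Y x"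
    using smooth_upto_compact_extension[OF bounded_domain sm(1)] by metis
  have "tangent_to_boundary \<Omega> f"
    using sm(2) f(4) by (auto simp: tangent_to_boundary_def frontier_eq)
  then obtain \<delta> \<Phi> where "tangential_flow \<Omega> f \<delta> \<Phi>" using tangential_flow_exists[OF f(1-3)] by blast
  then have "lake_flow \<Omega> b \<rho>0 f \<delta> \<Phi>" by (intro lake_flow.intro lake_axioms)
  then show ?thesis
  proof (rule that)
    show "f (X x) = Y x" if "x \<in> closure \<Omega>" for x
      using f(4)[OF Diff_inv(1)[OF X that]] Diff_inv(3)[OF X that] by (simp add: eul_eq)
  qed (rule f(4))
qed

lemma is_gradientD:
  assumes "is_gradient \<Omega> b \<rho>0 S T F X G" "0 \<in> J" "curve_in \<Omega> S J \<gamma>" "\<And>x. x \<in> closure \<Omega> \<Longrightarrow> \<gamma> 0 x = X x"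
  shows "((\<lambda>s. F (\<gamma> s)) has_real_derivative GN X G (time_deriv \<gamma> 0)) (at 0)"
  using assms unfolding is_gradient_def by blast

text \<open>The gradient is tested on the flow that it generates itself: there the derivative of the
  potential is the squared length of \<open>G\<close>, and it vanishes at a minimum.\<close>

lemma gradient_U_M:
  assumes X: "X \<in> M" and G: "is_gradient \<Omega> b \<rho>0 (Diff \<Omega>) (T_Diff \<Omega> X) (U_pot \<Omega> b \<rho>0) X G" and x: "x \<in> closure \<Omega>"
  shows "G x = 0"
proof -
  note D = M_Diff[OF X]
  have T: "G \<in> T_Diff \<Omega> X" using G by (simp add: is_gradient_def)
  obtain f \<delta> \<Phi> where fl: "lake_flow \<Omega> b \<rho>0 f \<delta> \<Phi>" and fG: "\<And>x. x \<in> closure \<Omega> \<Longrightarrow> f (X x) = G x"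
    using flow_with_velocity[OF D T] by metis
  interpret lake_flow \<Omega> b \<rho>0 f \<delta> \<Phi> by (rule fl)
  have "((\<lambda>s. U_pot \<Omega> b \<rho>0 (\<lambda>x. \<Phi> s (X x))) has_real_derivative
      GN X G (time_deriv (\<lambda>s x. \<Phi> s (X x)) 0)) (at 0)"
    by (rule is_gradientD[OF G _ curve_flow[OF D]]) (use \<delta> \<Phi>_0 in auto)
  moreover have "GN X G (time_deriv (\<lambda>s x. \<Phi> s (X x)) 0) = GN X G G"
    using time_deriv_flow[of 0 X] \<delta> \<Phi>_0 fG by (intro GN_cong[OF D]) auto
  ultimately have "((\<lambda>s. U_pot \<Omega> b \<rho>0 (\<lambda>x. \<Phi> s (X x))) has_real_derivative GN X G G) (at 0)" by simp
  from DERIV_local_min[OF this \<delta>] have "GN X G G = 0"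
    using U_flow_ge[OF X] \<Phi>_0 by simp
  then show ?thesis by (rule GN_definite[OF X T _ x])
qed

lemma divg_\<rho>:
  assumes "smooth_on \<Omega> \<xi>" "x \<in> \<Omega>"
  shows "divg (\<lambda>y. \<rho> y *\<^sub>R \<xi> y) x = \<rho> x * divg \<xi> x + \<xi> x \<bullet> grad b x"
  using divg_scaleR[OF smooth_on_differentiable[OF smooth_\<rho> assms(2)] smooth_on_differentiable[OF assms]]
  by (simp add: grad_\<rho>[OF assms(2)])

text \<open>As for the potential, \<open>G\<close> is tested on its own flow; membership in
  \<open>T_M\<close> is what keeps that flow in \<open>M\<close>.\<close>

lemma gradient_constant_M:
  assumes X: "X \<in> M" and V: "\<And>Y Z. Y \<in> M \<Longrightarrow> Z \<in> M \<Longrightarrow> V Y = (V Z :: real)"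
    and G: "is_gradient \<Omega> b \<rho>0 M (T_M \<Omega> \<rho>0 X) V X G" and x: "x \<in> closure \<Omega>"
  shows "G x = 0"
proof -
  note D = M_Diff[OF X]
  have TM: "G \<in> T_M \<Omega> \<rho>0 X" using G by (simp add: is_gradient_def)
  then have T: "G \<in> T_Diff \<Omega> X" by (simp add: T_M_def)
  obtain f \<delta> \<Phi> where fl: "lake_flow \<Omega> b \<rho>0 f \<delta> \<Phi>" and fe: "\<And>x. x \<in> closure \<Omega> \<Longrightarrow> f x = eul X G x"
    and fG: "\<And>x. x \<in> closure \<Omega> \<Longrightarrow> f (X x) = G x"
    using flow_with_velocity[OF D T] by metis
  interpret lake_flow \<Omega> b \<rho>0 f \<delta> \<Phi> by (rule fl)
  have "\<rho> y * divg f y + f y \<bullet> grad b y = 0" if y: "y \<in> \<Omega>" for y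
  proof -
    have "divg (\<lambda>y. \<rho> y *\<^sub>R f y) y = divg (\<lambda>y. dens X y *\<^sub>R eul X G y) y"
      by (rule divg_cong[OF open_domain y]) (simp add: dens_M[OF X] fe in_closure)
    then show ?thesis
      using TM y divg_\<rho>[OF smooth_on_subset[OF f] y] by (simp add: T_M_def)
  qed
  note fM = flow_M[OF X this]
  have c: "curve_in \<Omega> M {-\<delta><..<\<delta>} (\<lambda>s x. \<Phi> s (X x))"
    using curve_flow[OF D] fM by (auto simp: curve_in_def abs_less_iff)
  have "((\<lambda>s. V (\<lambda>x. \<Phi> s (X x))) has_real_derivative GN X G (time_deriv (\<lambda>s x. \<Phi> s (X x)) 0)) (at 0)"
    by (rule is_gradientD[OF G _ c]) (use \<delta> \<Phi>_0 in auto)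
  moreover have "((\<lambda>s. V (\<lambda>x. \<Phi> s (X x))) has_real_derivative 0) (at 0)"
    by (rule has_field_derivative_transform_within_open[OF DERIV_const[of "V X"] open_greaterThanLessThan[of "-\<delta>" \<delta>]])
      (use \<delta> V[OF X fM] in \<open>auto simp: abs_less_iff\<close>)
  ultimately have "GN X G (time_deriv (\<lambda>s x. \<Phi> s (X x)) 0) = 0" by (rule DERIV_unique)
  moreover have "GN X G (time_deriv (\<lambda>s x. \<Phi> s (X x)) 0) = GN X G G"
    using time_deriv_flow[of 0 X] \<delta> \<Phi>_0 fG by (intro GN_cong[OF D]) auto
  ultimately show ?thesis using GN_definite[OF X T _ x] by simp
qed

end

section \<open>The Hessian on the critical manifold and relabelling symmetry\<close>

lemma A_op_cong:
  assumes S: "open S" "x \<in> S" and eq: "\<And>y. y \<in> S \<Longrightarrow> \<rho> y = \<rho>' y" "\<And>y. y \<in> S \<Longrightarrow> \<eta> y = \<eta>' y"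
  shows "A_op b \<rho> \<eta> x = A_op b \<rho>' \<eta>' x"
proof -
  have d: "divg \<eta> y = divg \<eta>' y" if "y \<in> S" for y by (rule divg_cong[OF S(1) that eq(2)])
  have "grad (\<lambda>y. \<rho> y ^ 3 * divg \<eta> y) x = grad (\<lambda>y. \<rho>' y ^ 3 * divg \<eta>' y) x"
    by (rule grad_cong[OF S]) (simp add: d eq(1))
  moreover have "grad (\<lambda>y. \<rho> y ^ 2 * (\<eta> y \<bullet> grad b y)) x = grad (\<lambda>y. \<rho>' y ^ 2 * (\<eta>' y \<bullet> grad b y)) x"
    by (rule grad_cong[OF S]) (simp add: eq)
  ultimately show ?thesis using eq(1)[OF S(2)] eq(2)[OF S(2)] d[OF S(2)] by (simp add: A_op_def)
qed

context lake
begin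

lemma GN_zero_left:
  assumes X: "X \<in> Diff \<Omega>" and Y: "\<And>x. x \<in> closure \<Omega> \<Longrightarrow> Y x = 0"
  shows "GN X Y Z = 0"
proof -
  have "GN X Y Z = GN X (\<lambda>x. 0) Z" by (rule GN_cong[OF X]) (simp_all add: Y)
  also have "\<dots> = 0"
    by (simp add: GN_metric_integrand gn_integrand_def[abs_def] eulerian_def divg_expand)
  finally show ?thesis .
qed

end

section \<open>Consequences of the Levi-Civita axioms\<close>

locale lake_connection = lake +
  fixes \<Gamma> :: "vmap \<Rightarrow> vmap \<Rightarrow> vmap \<Rightarrow> vmap"
  assumes lc: "levi_civita \<Omega> b \<rho>0 \<Gamma>"
begin

lemma cov_deriv_field:
  "curve_in \<Omega> (Diff \<Omega>) J \<gamma> \<Longrightarrow> field_along \<Omega> J \<gamma> Y \<Longrightarrow> field_along \<Omega> J \<gamma> (cov_deriv \<Gamma> \<gamma> Y)"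
  using lc unfolding levi_civita_def by blast

lemma metric_compatible:
  assumes "curve_in \<Omega> (Diff \<Omega>) J \<gamma>" "field_along \<Omega> J \<gamma> Y" "field_along \<Omega> J \<gamma> Z" "t \<in> J"
  shows "((\<lambda>s. GN (\<gamma> s) (Y s) (Z s)) has_real_derivative
    GN (\<gamma> t) (cov_deriv \<Gamma> \<gamma> Y t) (Z t) + GN (\<gamma> t) (Y t) (cov_deriv \<Gamma> \<gamma> Z t)) (at t)"
  using lc assms unfolding levi_civita_def by blast

lemma torsion_free:
  assumes "X \<in> Diff \<Omega>" "Y \<in> T_Diff \<Omega> X" "Z \<in> T_Diff \<Omega> X" "x \<in> closure \<Omega>"
  shows "\<Gamma> X Y Z x = \<Gamma> X Z Y x"
  using lc assms unfolding levi_civita_def by blast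

text \<open>\<open>\<Gamma>\<close> acts on total functions, so its vanishing on fields that are zero only on the closed
  domain has to be derived from compatibility with the (definite) metric.\<close>
lemma Christoffel_zero_field:
  assumes c: "curve_in \<Omega> (Diff \<Omega>) J \<gamma>" and t: "t \<in> J" "\<gamma> t \<in> M"
    and Y: "\<And>x. x \<in> closure \<Omega> \<Longrightarrow> Y x = 0" and x: "x \<in> closure \<Omega>"
  shows "\<Gamma> (\<gamma> t) (time_deriv \<gamma> t) Y x = 0"
proof -
  note cD = curve_inD[OF c]
  have "tangent_to_boundary \<Omega> (\<lambda>x. 0)" by (simp add: tangent_to_boundary_def)
  then have T: "Y \<in> T_Diff \<Omega> (\<gamma> s)" for s
    unfolding T_Diff_def using Y smooth_on_UNIV_upto[OF smooth_on_const[OF open_UNIV, of "0::vec2"]] by auto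
  have "smooth_time_upto J \<Omega> (\<lambda>s. Y)"
    unfolding smooth_time_upto_def using Y smooth_on_const[OF open_Times[OF cD(1) open_UNIV], of "0::vec2"] by fastforce
  then have fY: "field_along \<Omega> J \<gamma> (\<lambda>s. Y)" using T by (simp add: field_along_def)
  \<comment> \<open>The zero field is paired with its own covariant derivative: the pairing is
    constantly 0, and compatibility leaves the squared length of \<open>W\<close>.\<close>
  define W where "W = cov_deriv \<Gamma> \<gamma> (\<lambda>s. Y)"
  have fW: "field_along \<Omega> J \<gamma> W" unfolding W_def by (rule cov_deriv_field[OF c fY])
  have "((\<lambda>s. GN (\<gamma> s) Y (W s)) has_real_derivative
    GN (\<gamma> t) (W t) (W t) + GN (\<gamma> t) Y (cov_deriv \<Gamma> \<gamma> W t)) (at t)"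
    using metric_compatible[OF c fY fW t(1)] by (simp add: W_def)
  moreover have "((\<lambda>s. GN (\<gamma> s) Y (W s)) has_real_derivative 0) (at t)"
    by (rule has_field_derivative_transform_within_open[OF DERIV_const[of 0] cD(1) t(1)])
      (use GN_zero_left[OF cD(4) Y] in auto)
  ultimately have "GN (\<gamma> t) (W t) (W t) + GN (\<gamma> t) Y (cov_deriv \<Gamma> \<gamma> W t) = 0" by (rule DERIV_unique)
  moreover have "GN (\<gamma> t) Y (cov_deriv \<Gamma> \<gamma> W t) = 0" by (rule GN_zero_left[OF cD(4)[OF t(1)] Y])
  ultimately have "W t x = 0"
    using fW t(1) by (intro GN_definite[OF t(2) _ _ x]) (auto simp: field_along_def)
  then show ?thesis by (simp add: W_def cov_deriv_def time_deriv_def)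
qed

text \<open>The right-hand side is free of \<open>\<Gamma>\<close>, which is what allows transport
  by a relabelling: the axioms contain no equivariance of \<open>\<Gamma>\<close>, but at a point of
  \<open>M\<close> the gradient is 0 on the closure and the Christoffel term drops out.\<close>

lemma has_hessian_M:
  assumes X: "X \<in> M"
  shows "has_hessian \<Omega> b \<rho>0 \<Gamma> (U_pot \<Omega> b \<rho>0) X Y Z \<longleftrightarrow>
    (\<exists>J \<gamma> G. 0 \<in> J \<and> curve_in \<Omega> (Diff \<Omega>) J \<gamma> \<and>
        (\<forall>x\<in>closure \<Omega>. \<gamma> 0 x = X x \<and> time_deriv \<gamma> 0 x = Y x) \<and>
        field_along \<Omega> J \<gamma> G \<and>
        (\<forall>t\<in>J. is_gradient \<Omega> b \<rho>0 (Diff \<Omega>) (T_Diff \<Omega> (\<gamma> t)) (U_pot \<Omega> b \<rho>0) (\<gamma> t) (G t)) \<and>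
        (\<forall>x\<in>closure \<Omega>. Z x = time_deriv G 0 x))"
proof -
  have eq: "Z x = cov_deriv \<Gamma> \<gamma> G 0 x \<longleftrightarrow> Z x = time_deriv G 0 x"
    if c: "0 \<in> J" "curve_in \<Omega> (Diff \<Omega>) J \<gamma>" "\<forall>x\<in>closure \<Omega>. \<gamma> 0 x = X x \<and> time_deriv \<gamma> 0 x = Y x"
      and G: "\<forall>t\<in>J. is_gradient \<Omega> b \<rho>0 (Diff \<Omega>) (T_Diff \<Omega> (\<gamma> t)) (U_pot \<Omega> b \<rho>0) (\<gamma> t) (G t)"
      and x: "x \<in> closure \<Omega>" for J \<gamma> G x
  proof -
    have m: "\<gamma> 0 \<in> M" by (rule M_cong[OF X]) (use c(3) in simp)
    have "G 0 y = 0" if "y \<in> closure \<Omega>" for y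
      using gradient_U_M[OF m _ that] G c(1) by blast
    then show ?thesis using Christoffel_zero_field[OF c(2,1) m _ x] by (simp add: cov_deriv_def)
  qed
  show ?thesis
    unfolding has_hessian_def by (intro ex_cong1 conj_cong refl ball_cong) (rule eq; assumption)
qed

end

text \<open>The mass condition says that \<psi> preserves \<rho>0 dx with the signed determinant, so
  that composing on the right leaves densities unchanged, including their sign.\<close>

locale relabelling = lake +
  fixes \<psi> \<psi>' :: vmap
  assumes \<psi>_closure: "\<And>x. x \<in> closure \<Omega> \<Longrightarrow> \<psi> x \<in> closure \<Omega>" "\<And>x. x \<in> closure \<Omega> \<Longrightarrow> \<psi>' x \<in> closure \<Omega>"
    and \<psi>_inv: "\<And>x. x \<in> closure \<Omega> \<Longrightarrow> \<psi>' (\<psi> x) = x" "\<And>x. x \<in> closure \<Omega> \<Longrightarrow> \<psi> (\<psi>' x) = x"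
    and \<psi>_domain: "\<And>x. x \<in> \<Omega> \<Longrightarrow> \<psi> x \<in> \<Omega>" "\<And>x. x \<in> \<Omega> \<Longrightarrow> \<psi>' x \<in> \<Omega>"
    and \<psi>_smooth: "smooth_upto \<Omega> \<psi>" "smooth_upto \<Omega> \<psi>'"
    and \<psi>_mass: "\<And>x. x \<in> \<Omega> \<Longrightarrow> \<rho>0 (\<psi> x) * det (jacobian \<psi> (at x)) = \<rho>0 x"
begin

lemma relabel_Diff:
  assumes X: "X \<in> Diff \<Omega>"
  shows "(\<lambda>x. X (\<psi> x)) \<in> Diff \<Omega>" "x \<in> closure \<Omega> \<Longrightarrow> Inv (\<lambda>x. X (\<psi> x)) x = \<psi>' (Inv X x)"
proof -
  note XD = Diff_inv[OF X] Diff_interior[OF X] \<psi>_closure \<psi>_inv \<psi>_domain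
  show "(\<lambda>x. X (\<psi> x)) \<in> Diff \<Omega>"
  proof (rule DiffI[where W = "\<lambda>x. \<psi>' (Inv X x)"])
    show "smooth_upto \<Omega> (\<lambda>x. X (\<psi> x))" by (rule smooth_upto_compose[OF Diff_smooth(1)[OF X] \<psi>_smooth(1) \<psi>_closure(1)])
    show "smooth_upto \<Omega> (\<lambda>x. \<psi>' (Inv X x))"
      by (rule smooth_upto_compose[OF \<psi>_smooth(2) Diff_smooth(2)[OF X] XD(2)])
  qed (simp_all add: XD)
  show "x \<in> closure \<Omega> \<Longrightarrow> Inv (\<lambda>x. X (\<psi> x)) x = \<psi>' (Inv X x)"
    by (rule Inv_eqI) (simp_all add: XD)
qed

lemma relabel_dens:
  assumes X: "X \<in> Diff \<Omega>" and x: "x \<in> \<Omega>"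
  shows "dens (\<lambda>x. X (\<psi> x)) x = dens X x"
proof -
  define a where "a = Inv X x"
  have a: "a \<in> \<Omega>" unfolding a_def by (rule Diff_interior(2)[OF X x])
  note a' = \<psi>_domain(2)[OF a] and i = \<psi>_inv(2)[OF in_closure[OF a]]
  have "det (jacobian (\<lambda>x. X (\<psi> x)) (at (\<psi>' a))) = det (jacobian X (at a)) * det (jacobian \<psi> (at (\<psi>' a)))"
    using det_jacobian_compose[of X \<psi> "\<psi>' a"] smooth_on_differentiable[OF Diff_smooth(3)[OF X] a]
      smooth_on_differentiable[OF smooth_upto_smooth_on[OF open_domain \<psi>_smooth(1)] a'] i by simp
  moreover have "\<rho>0 a * det (jacobian \<psi> (at (\<psi>' a))) = \<rho>0 (\<psi>' a)" using \<psi>_mass[OF a'] i by simp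
  moreover have "det (jacobian \<psi> (at (\<psi>' a))) \<noteq> 0" using calculation(2) \<rho>0_pos[OF a'] by auto
  ultimately show ?thesis
    using relabel_Diff(2)[OF X in_closure[OF x]] Diff_det_nonzero[OF X a]
    by (simp add: dens_eq a_def[symmetric] field_simps)
qed

text \<open>Relabelling moves only the particle labels, so Eulerian fields remain the same functions
  of position; together with the invariance of the density this makes it an isometry.\<close>

lemma relabel_eul:
  assumes X: "X \<in> Diff \<Omega>" and x: "x \<in> closure \<Omega>"
  shows "eul (\<lambda>x. X (\<psi> x)) (\<lambda>x. Y (\<psi> x)) x = eul X Y x"
  using relabel_Diff(2)[OF X x] \<psi>_inv(2)[OF Diff_inv(2)[OF X x]] by (simp add: eul_eq)

lemma relabel_GN:
  assumes X: "X \<in> Diff \<Omega>"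
  shows "GN (\<lambda>x. X (\<psi> x)) (\<lambda>x. Y (\<psi> x)) (\<lambda>x. Z (\<psi> x)) = GN X Y Z"
  unfolding GN_metric_integrand
  by (intro integral_cong gn_integrand_cong[OF open_domain] relabel_eul[OF X] relabel_dens[OF X] in_closure)

lemma relabel_U: "X \<in> Diff \<Omega> \<Longrightarrow> U_pot \<Omega> b \<rho>0 (\<lambda>x. X (\<psi> x)) = U_pot \<Omega> b \<rho>0 X"
  unfolding U_pot_def by (intro integral_cong) (simp add: relabel_dens)

lemma relabel_T_Diff: "Y \<in> T_Diff \<Omega> X \<Longrightarrow> (\<lambda>x. Y (\<psi> x)) \<in> T_Diff \<Omega> (\<lambda>x. X (\<psi> x))"
  using \<psi>_closure(1) unfolding T_Diff_def by auto

lemma relabel_smooth_time: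
  fixes f :: "real \<Rightarrow> vmap"
  assumes J: "open J" and f: "smooth_time_upto J \<Omega> f" shows "smooth_time_upto J \<Omega> (\<lambda>t x. f t (\<psi> x))"
proof -
  obtain F where F: "smooth_on (J \<times> UNIV) F" "\<And>t x. t \<in> J \<Longrightarrow> x \<in> closure \<Omega> \<Longrightarrow> F (t, x) = f t x"
    using f by (auto simp: smooth_time_upto_def)
  obtain P where P: "smooth_on UNIV P" "\<And>x. x \<in> closure \<Omega> \<Longrightarrow> P x = \<psi> x"
    using \<psi>_smooth(1) by (auto simp: smooth_upto_def)
  have op: "open (J \<times> (UNIV :: vec2 set))" by (intro open_Times J open_UNIV)
  have "smooth_on (J \<times> (UNIV :: vec2 set)) (\<lambda>q. P (snd q))"
    by (rule smooth_on_compose[OF op smooth_on_snd[OF op] P(1)]) simp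
  then have "smooth_on (J \<times> (UNIV :: vec2 set)) (\<lambda>q. (fst q, P (snd q)))"
    by (intro smooth_on_Pair smooth_on_fst op)
  then have "smooth_on (J \<times> UNIV) (\<lambda>q. F (fst q, P (snd q)))"
    by (rule smooth_on_compose[OF op _ F(1)]) auto
  then show ?thesis unfolding smooth_time_upto_def
    using F(2) P(2) \<psi>_closure(1) by (intro exI[of _ "\<lambda>q. F (fst q, P (snd q))"]) simp
qed

lemma relabel_curve:
  "curve_in \<Omega> (Diff \<Omega>) J \<gamma> \<Longrightarrow> curve_in \<Omega> (Diff \<Omega>) J (\<lambda>t x. \<gamma> t (\<psi> x))"
  unfolding curve_in_def using relabel_smooth_time relabel_Diff(1) by blast

lemma relabel_field:
  "open J \<Longrightarrow> field_along \<Omega> J \<gamma> Y \<Longrightarrow> field_along \<Omega> J (\<lambda>t x. \<gamma> t (\<psi> x)) (\<lambda>t x. Y t (\<psi> x))"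
  unfolding field_along_def using relabel_smooth_time relabel_T_Diff by blast

text \<open>A test curve through the relabelled configuration is carried back by \<psi>' to a curve
  through \<open>X\<close>, where \<open>G\<close> is known to be the gradient; this is the use of
  the inverse relabelling \<open>bwd\<close>.\<close>

lemma relabel_gradient:
  assumes bwd: "relabelling \<Omega> b \<rho>0 \<psi>' \<psi>" and X: "X \<in> Diff \<Omega>"
    and G: "is_gradient \<Omega> b \<rho>0 (Diff \<Omega>) (T_Diff \<Omega> X) (U_pot \<Omega> b \<rho>0) X G"
  shows "is_gradient \<Omega> b \<rho>0 (Diff \<Omega>) (T_Diff \<Omega> (\<lambda>x. X (\<psi> x))) (U_pot \<Omega> b \<rho>0) (\<lambda>x. X (\<psi> x)) (\<lambda>x. G (\<psi> x))"
proof -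
  interpret bwd: relabelling \<Omega> b \<rho>0 \<psi>' \<psi> by (rule bwd)
  have "((\<lambda>s. U_pot \<Omega> b \<rho>0 (\<gamma> s)) has_real_derivative GN (\<lambda>x. X (\<psi> x)) (\<lambda>x. G (\<psi> x)) (time_deriv \<gamma> 0)) (at 0)"
    if 0: "0 \<in> J" and c: "curve_in \<Omega> (Diff \<Omega>) J \<gamma>" and X0: "\<forall>x\<in>closure \<Omega>. \<gamma> 0 x = X (\<psi> x)" for J \<gamma>
  proof -
    note cD = curve_inD[OF c]
    have "((\<lambda>s. U_pot \<Omega> b \<rho>0 (\<lambda>x. \<gamma> s (\<psi>' x))) has_real_derivative
        GN X G (time_deriv (\<lambda>s x. \<gamma> s (\<psi>' x)) 0)) (at 0)"
      by (rule is_gradientD[OF G 0 bwd.relabel_curve[OF c]]) (use X0 \<psi>_closure \<psi>_inv in simp)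
    also have "GN X G (time_deriv (\<lambda>s x. \<gamma> s (\<psi>' x)) 0) =
        GN (\<lambda>x. X (\<psi> x)) (\<lambda>x. G (\<psi> x)) (\<lambda>x. time_deriv \<gamma> 0 (\<psi>' (\<psi> x)))"
      by (subst relabel_GN[OF X, symmetric]) (simp add: time_deriv_def)
    also have "\<dots> = GN (\<lambda>x. X (\<psi> x)) (\<lambda>x. G (\<psi> x)) (time_deriv \<gamma> 0)"
      by (rule GN_cong[OF relabel_Diff(1)[OF X]]) (simp_all add: \<psi>_inv)
    finally show ?thesis
      by (rule has_field_derivative_transform_within_open[OF _ cD(1) 0]) (use bwd.relabel_U[OF cD(4)] in auto)
  qed
  moreover have "(\<lambda>x. G (\<psi> x)) \<in> T_Diff \<Omega> (\<lambda>x. X (\<psi> x))"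
    by (rule relabel_T_Diff) (use G in \<open>simp add: is_gradient_def\<close>)
  ultimately show ?thesis unfolding is_gradient_def by blast
qed

end

text \<open>With \<psi> the map Y followed by the inverse of X, one has X \<psi> = Y. The mass
  identities of X and Y contain the same profile at the same position, and comparing them gives
  preservation of \<rho>0.\<close>

lemma (in lake) relabelling_M:
  assumes X: "X \<in> M" and Y: "Y \<in> M"
  shows "relabelling \<Omega> b \<rho>0 (\<lambda>x. Inv X (Y x)) (\<lambda>x. Inv Y (X x))"
proof -
  note XD = Diff_inv[OF M_Diff[OF X]] Diff_interior[OF M_Diff[OF X]]
    and YD = Diff_inv[OF M_Diff[OF Y]] Diff_interior[OF M_Diff[OF Y]]
  note XS = Diff_smooth[OF M_Diff[OF X]] and YS = Diff_smooth[OF M_Diff[OF Y]]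
  show ?thesis
  proof (intro relabelling.intro relabelling_axioms.intro lake_axioms)
    show "smooth_upto \<Omega> (\<lambda>x. Inv X (Y x))" by (rule smooth_upto_compose[OF XS(2) YS(1) YD(1)])
    show "smooth_upto \<Omega> (\<lambda>x. Inv Y (X x))" by (rule smooth_upto_compose[OF YS(2) XS(1) XD(1)])
    fix x assume x: "x \<in> \<Omega>"
    define a where "a = Inv X (Y x)"
    have a: "a \<in> \<Omega>" "X a = Y x" using x XD YD in_closure by (auto simp: a_def)
    have "det (jacobian (\<lambda>z. X (Inv X (Y z))) (at x)) = det (jacobian X (at a)) * det (jacobian (\<lambda>z. Inv X (Y z)) (at x))"
      unfolding a_def
    proof (rule det_jacobian_compose)
      show "X differentiable at (Inv X (Y x))" using smooth_on_differentiable[OF XS(3) a(1)] by (simp add: a_def)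
      show "(\<lambda>z. Inv X (Y z)) differentiable at x"
        by (rule smooth_on_differentiable[OF smooth_on_compose[OF open_domain YS(3) XS(4)] x]) (rule YD(5))
    qed
    moreover have "jacobian (\<lambda>z. X (Inv X (Y z))) (at x) = jacobian Y (at x)"
      unfolding jacobian_def
      using frechet_derivative_cong_open[OF open_domain x, of "\<lambda>z. X (Inv X (Y z))" Y] XD(4) YD(1) in_closure by simp
    moreover have "\<rho> (Y x) * det (jacobian X (at a)) = \<rho>0 a" using mass_M[OF X a(1)] a(2) by simp
    ultimately show "\<rho>0 (Inv X (Y x)) * det (jacobian (\<lambda>x. Inv X (Y x)) (at x)) = \<rho>0 x"
      using mass_M[OF Y x] by (metis a_def mult.assoc)
  qed (simp_all add: XD YD)
qed

section \<open>Invariance of the spectrum\<close>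

context lake_connection
begin

text \<open>Normality survives because the Eulerian field and the density on \<open>M\<close> are
  unchanged. The Hessian relation survives because the curve and the gradient field along it can
  both be composed with \<psi>, and time derivatives commute with this composition.\<close>

lemma eigenspace_relabel:
  assumes X: "X \<in> M" and Y: "Y \<in> M" and e: "e \<in> eigenspace \<Omega> b \<rho>0 \<Gamma> X \<mu>"
  shows "(\<lambda>x. e (Inv X (Y x))) \<in> eigenspace \<Omega> b \<rho>0 \<Gamma> Y \<mu>"
proof -
  define \<psi> where "\<psi> x = Inv X (Y x)" for x
  define \<psi>' where "\<psi>' x = Inv Y (X x)" for x
  interpret relabelling \<Omega> b \<rho>0 \<psi> \<psi>'
    unfolding \<psi>_def[abs_def] \<psi>'_def[abs_def] by (rule relabelling_M[OF X Y])
  have bwd: "relabelling \<Omega> b \<rho>0 \<psi>' \<psi>"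
    unfolding \<psi>_def[abs_def] \<psi>'_def[abs_def] by (rule relabelling_M[OF Y X])
  note XD = M_Diff[OF X]
  have Y_eq: "X (\<psi> x) = Y x" if "x \<in> closure \<Omega>" for x
    using Diff_inv(4)[OF XD Diff_inv(1)[OF M_Diff[OF Y] that]] by (simp add: \<psi>_def)
  have eN: "e \<in> N_M \<Omega> b \<rho>0 X" and eH: "has_hessian \<Omega> b \<rho>0 \<Gamma> (U_pot \<Omega> b \<rho>0) X e (\<lambda>x. \<mu> *\<^sub>R e x)"
    using e by (auto simp: eigenspace_def)
  have eT: "e \<in> T_Diff \<Omega> X" using eN by (simp add: N_M_def)
  obtain \<phi> where \<phi>: "smooth_upto \<Omega> \<phi>" "\<And>x. x \<in> \<Omega> \<Longrightarrow> A_op b (dens X) (eul X e) x = grad \<phi> x"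
    using eN by (auto simp: N_M_def)
  have "A_op b (dens Y) (eul Y (\<lambda>x. e (\<psi> x))) x = A_op b (dens X) (eul X e) x" if x: "x \<in> \<Omega>" for x
  proof (rule A_op_cong[OF open_domain x])
    fix y assume y: "y \<in> \<Omega>"
    show "dens Y y = dens X y" using dens_M[OF X y] dens_M[OF Y y] by simp
    have "eul Y (\<lambda>x. e (\<psi> x)) y = e (\<psi> (Inv (\<lambda>x. X (\<psi> x)) y))"
      using Inv_cong[OF relabel_Diff(1)[OF XD] Y_eq in_closure[OF y]] by (simp add: eul_eq)
    also have "\<dots> = eul X e y"
      using relabel_Diff(2)[OF XD in_closure[OF y]] \<psi>_inv(2)[OF Diff_inv(2)[OF XD in_closure[OF y]]] by (simp add: eul_eq)
    finally show "eul Y (\<lambda>x. e (\<psi> x)) y = eul X e y" .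
  qed
  moreover have "(\<lambda>x. e (\<psi> x)) \<in> T_Diff \<Omega> Y"
    by (rule T_Diff_cong[OF relabel_T_Diff[OF eT]]) (simp_all add: Y_eq)
  ultimately have N: "(\<lambda>x. e (\<psi> x)) \<in> N_M \<Omega> b \<rho>0 Y"
    unfolding N_M_def using \<phi> by auto
  obtain J \<gamma> G where h: "0 \<in> J" "curve_in \<Omega> (Diff \<Omega>) J \<gamma>"
    "\<And>x. x \<in> closure \<Omega> \<Longrightarrow> \<gamma> 0 x = X x \<and> time_deriv \<gamma> 0 x = e x" "field_along \<Omega> J \<gamma> G"
    "\<And>t. t \<in> J \<Longrightarrow> is_gradient \<Omega> b \<rho>0 (Diff \<Omega>) (T_Diff \<Omega> (\<gamma> t)) (U_pot \<Omega> b \<rho>0) (\<gamma> t) (G t)"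
    "\<And>x. x \<in> closure \<Omega> \<Longrightarrow> \<mu> *\<^sub>R e x = time_deriv G 0 x"
    using eH unfolding has_hessian_M[OF X] by blast
  have "has_hessian \<Omega> b \<rho>0 \<Gamma> (U_pot \<Omega> b \<rho>0) Y (\<lambda>x. e (\<psi> x)) (\<lambda>x. \<mu> *\<^sub>R e (\<psi> x))"
    unfolding has_hessian_M[OF Y]
  proof (intro exI conjI ballI)
    show "curve_in \<Omega> (Diff \<Omega>) J (\<lambda>t x. \<gamma> t (\<psi> x))" by (rule relabel_curve[OF h(2)])
    show "field_along \<Omega> J (\<lambda>t x. \<gamma> t (\<psi> x)) (\<lambda>t x. G t (\<psi> x))" by (rule relabel_field[OF curve_inD(1)[OF h(2)] h(4)])
    show "is_gradient \<Omega> b \<rho>0 (Diff \<Omega>) (T_Diff \<Omega> (\<lambda>x. \<gamma> t (\<psi> x))) (U_pot \<Omega> b \<rho>0) (\<lambda>x. \<gamma> t (\<psi> x)) (\<lambda>x. G t (\<psi> x))" if "t \<in> J" for t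
      by (rule relabel_gradient[OF bwd curve_inD(4)[OF h(2) that] h(5)[OF that]])
    fix x assume x: "x \<in> closure \<Omega>"
    show "\<gamma> 0 (\<psi> x) = Y x" using h(3)[OF \<psi>_closure(1)[OF x]] Y_eq[OF x] by simp
    show "time_deriv (\<lambda>t x. \<gamma> t (\<psi> x)) 0 x = e (\<psi> x)" using h(3)[OF \<psi>_closure(1)[OF x]] by (simp add: time_deriv_def)
    show "\<mu> *\<^sub>R e (\<psi> x) = time_deriv (\<lambda>t x. G t (\<psi> x)) 0 x" using h(6)[OF \<psi>_closure(1)[OF x]] by (simp add: time_deriv_def)
  qed (rule h(1))
  then show ?thesis using N unfolding eigenspace_def \<psi>_def by simp
qed

text \<open>Relabelling maps an independent family of eigenvectors to one of the same size.
  Independence is preserved because the relabelling maps the closure onto itself.\<close>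

lemma eig_mult_le:
  assumes X: "X \<in> M" and Y: "Y \<in> M"
  shows "eig_mult \<Omega> b \<rho>0 \<Gamma> X \<mu> \<le> eig_mult \<Omega> b \<rho>0 \<Gamma> Y \<mu>"
  unfolding eig_mult_def
proof (rule Sup_subset_mono, safe)
  fix n and e :: "nat \<Rightarrow> vmap"
  assume e: "\<forall>i<n. e i \<in> eigenspace \<Omega> b \<rho>0 \<Gamma> X \<mu>"
    and ind: "\<forall>a. (\<forall>x\<in>closure \<Omega>. (\<Sum>i<n. a i *\<^sub>R e i x) = 0) \<longrightarrow> (\<forall>i<n. a i = 0)"
  let ?e = "\<lambda>i x. e i (Inv X (Y x))"
  have "\<forall>i<n. ?e i \<in> eigenspace \<Omega> b \<rho>0 \<Gamma> Y \<mu>" using eigenspace_relabel[OF X Y] e by blast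
  moreover have "\<forall>i<n. a i = 0" if z: "\<forall>x\<in>closure \<Omega>. (\<Sum>i<n. a i *\<^sub>R ?e i x) = 0" for a
  proof -
    have "(\<Sum>i<n. a i *\<^sub>R e i x) = 0" if x: "x \<in> closure \<Omega>" for x
    proof -
      have "Inv Y (X x) \<in> closure \<Omega>" "Inv X (Y (Inv Y (X x))) = x"
        using Diff_inv[OF M_Diff[OF X]] Diff_inv[OF M_Diff[OF Y]] x by auto
      then show ?thesis using z by metis
    qed
    then show ?thesis using ind by blast
  qed
  ultimately show "\<exists>m. enat n = enat m \<and> (\<exists>e. (\<forall>i<m. e i \<in> eigenspace \<Omega> b \<rho>0 \<Gamma> Y \<mu>) \<and>
      (\<forall>a. (\<forall>x\<in>closure \<Omega>. (\<Sum>i<m. a i *\<^sub>R e i x) = 0) \<longrightarrow> (\<forall>i<m. a i = 0)))"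
    by (intro exI[of _ n] exI[of _ ?e] conjI refl) auto
qed

lemma eig_mult_M: "X \<in> M \<Longrightarrow> Y \<in> M \<Longrightarrow> eig_mult \<Omega> b \<rho>0 \<Gamma> X \<mu> = eig_mult \<Omega> b \<rho>0 \<Gamma> Y \<mu>"
  by (intro antisym eig_mult_le)

end

section \<open>Integrals of compactly supported functions\<close>

context smooth_domain
begin

text \<open>The domain and the complement of the support are open and cover the plane, so continuity
  is checked on each of them.\<close>

lemma zero_extension_continuous:
  fixes g :: "vec2 \<Rightarrow> 'b::real_normed_vector"
  assumes "continuous_on \<Omega> g" "compact K" "\<And>x. x \<in> \<Omega> - K \<Longrightarrow> g x = 0" "K \<subseteq> \<Omega>"
  shows "continuous_on UNIV (\<lambda>x. if x \<in> \<Omega> then g x else 0)"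
proof -
  have "continuous_on (\<Omega> \<union> - K) (\<lambda>x. if x \<in> \<Omega> then g x else 0)"
  proof (rule continuous_on_open_Un[OF open_domain])
    show "open (- K)" using assms(2) by (simp add: open_Compl compact_imp_closed)
    show "continuous_on \<Omega> (\<lambda>x. if x \<in> \<Omega> then g x else 0)" by (rule continuous_on_eq[OF assms(1)]) simp
    show "continuous_on (- K) (\<lambda>x. if x \<in> \<Omega> then g x else 0)"
      by (rule continuous_on_eq[OF continuous_on_const[of _ 0]]) (use assms(3) in auto)
  qed
  moreover have "\<Omega> \<union> - K = UNIV" using assms(4) by auto
  ultimately show ?thesis by simp
qed

lemma zero_extension_smooth:
  fixes g :: "vec2 \<Rightarrow> 'b::real_normed_vector"
  assumes "smooth_on \<Omega> g" "compact K" "\<And>x. x \<in> \<Omega> - K \<Longrightarrow> g x = 0" "K \<subseteq> \<Omega>"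
  shows "smooth_on UNIV (\<lambda>x. if x \<in> \<Omega> then g x else 0)"
proof -
  have op: "open (- K)" using assms(2) by (simp add: open_Compl compact_imp_closed)
  have "smooth_on (\<Omega> \<union> - K) (\<lambda>x. if x \<in> \<Omega> then g x else 0)"
  proof (rule smooth_on_Un_open[OF open_domain op])
    show "smooth_on \<Omega> (\<lambda>x. if x \<in> \<Omega> then g x else 0)"
      using smooth_on_cong[OF open_domain, of "\<lambda>x. if x \<in> \<Omega> then g x else 0" g] assms(1) by simp
    show "smooth_on (- K) (\<lambda>x. if x \<in> \<Omega> then g x else 0)"
      using smooth_on_cong[OF op, of "\<lambda>x. if x \<in> \<Omega> then g x else 0" "\<lambda>x. 0"] smooth_on_const[OF op] assms(3) by force
  qed
  moreover have "\<Omega> \<union> - K = UNIV" using assms(4) by auto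
  ultimately show ?thesis by simp
qed

lemma zero_extension_integral:
  fixes g :: "vec2 \<Rightarrow> real"
  assumes g: "continuous_on \<Omega> g" "compact K" "\<And>x. x \<in> \<Omega> - K \<Longrightarrow> g x = 0" "K \<subseteq> \<Omega>" and B: "K \<subseteq> cbox a b"
  shows "(g has_integral integral (cbox a b) (\<lambda>x. if x \<in> \<Omega> then g x else 0)) \<Omega>"
proof -
  let ?g = "\<lambda>x. if x \<in> \<Omega> then g x else 0"
  have "(?g has_integral integral (cbox a b) ?g) (cbox a b)"
    by (rule integrable_integral[OF integrable_continuous[OF continuous_on_subset[OF zero_extension_continuous[OF g] subset_UNIV]]])
  then have "(?g has_integral integral (cbox a b) ?g) UNIV"
    by (rule has_integral_on_superset[OF _ _ subset_UNIV]) (use g(3) B in auto)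
  then show ?thesis by (simp add: has_integral_restrict_UNIV)
qed

lemma compact_in_cbox:
  assumes "compact K" obtains a b :: vec2 where "K \<subseteq> cbox a b"
  using bounded_subset_cbox_symmetric[OF compact_imp_bounded[OF assms]] by blast

lemma compact_support_integrable:
  fixes g :: "vec2 \<Rightarrow> real"
  assumes "continuous_on \<Omega> g" "compact K" "\<And>x. x \<in> \<Omega> - K \<Longrightarrow> g x = 0" "K \<subseteq> \<Omega>"
  shows "g integrable_on \<Omega>"
proof -
  obtain a b where "K \<subseteq> cbox a b" using compact_in_cbox[OF assms(2)] .
  from zero_extension_integral[OF assms this] show ?thesis by blast
qed

text \<open>Only the difference to the value at time t is differentiated: it is supported in
  \<open>K\<close>, so extended by 0 it is continuous on a box and the parameter rule applies. The
  part at time t need only be integrable, which admits energies that do not vanish near the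
  boundary.\<close>

lemma leibniz_compact:
  fixes e :: "real \<times> vec2 \<Rightarrow> real"
  assumes I: "open I" "t \<in> I" and e: "smooth_on (I \<times> \<Omega>) e" and K: "compact K" "K \<subseteq> \<Omega>"
    and off: "\<And>s x. s \<in> I \<Longrightarrow> x \<in> \<Omega> - K \<Longrightarrow> e (s, x) = e (t, x)" and int: "(\<lambda>x. e (t, x)) integrable_on \<Omega>"
  shows "((\<lambda>s. integral \<Omega> (\<lambda>x. e (s, x))) has_real_derivative
    integral \<Omega> (\<lambda>x. frechet_derivative e (at (t, x)) (1, 0))) (at t)"
proof -
  obtain \<eta> where \<eta>: "\<eta> > 0" "cball t \<eta> \<subseteq> I" using I open_contains_cball by blast
  let ?U = "{t - \<eta>..t + \<eta>}"
  have U: "s \<in> I" if "s \<in> ?U" for s using \<eta>(2) that by (auto simp: cball_eq_atLeastAtMost)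
  obtain a b where B: "K \<subseteq> cbox a b" using compact_in_cbox[OF K(1)] .
  define D where "D q = frechet_derivative e (at q) (1, 0)" for q
  have Dc: "continuous_on (I \<times> \<Omega>) D" unfolding D_def by (rule smooth_on_continuous_on[OF smooth_on_derivative_dir[OF e]])
  have e': "((\<lambda>s. e (s, x)) has_vector_derivative D (s, x)) (at s)" if "s \<in> I" "x \<in> \<Omega>" for s x
    unfolding D_def by (rule time_slice_derivative[OF e]) (use that in simp)
  have D0: "D (s, x) = 0" if sx: "s \<in> I" "x \<in> \<Omega> - K" for s x
  proof -
    have "((\<lambda>s. e (s, x)) has_vector_derivative 0) (at s)"
      by (rule has_vector_derivative_transform_within_open[OF has_vector_derivative_const I(1) sx(1), of "e (t, x)"])
        (use off sx in auto)
    then show ?thesis using vector_derivative_unique_at[OF e'] sx by blast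
  qed
  have slice: "continuous_on \<Omega> (\<lambda>x. g (s, x))" if "s \<in> I" "continuous_on (I \<times> \<Omega>) g" for s and g :: "real \<times> vec2 \<Rightarrow> real"
    by (rule continuous_on_compose2[OF that(2)]) (use that(1) in \<open>auto intro!: continuous_intros\<close>)
  have ec: "continuous_on (I \<times> \<Omega>) e" by (rule smooth_on_continuous_on[OF e])
  let ?f = "\<lambda>s x. e (s, x) - e (t, x)"
  let ?F = "\<lambda>s x. if x \<in> \<Omega> then ?f s x else 0"
  let ?F' = "\<lambda>s x. if x \<in> \<Omega> then D (s, x) else 0"
  have f: "(?f s has_integral integral (cbox a b) (?F s)) \<Omega>" if "s \<in> I" for s
    by (rule zero_extension_integral[OF _ K(1) _ K(2) B])
      (use off[OF that] slice[OF that ec] slice[OF I(2) ec] in \<open>auto intro: continuous_intros\<close>)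
  have D: "((\<lambda>x. D (s, x)) has_integral integral (cbox a b) (?F' s)) \<Omega>" if "s \<in> I" for s
    by (rule zero_extension_integral[OF slice[OF that Dc] K(1) D0[OF that] K(2) B])
  have "((\<lambda>s. integral (cbox a b) (?F s)) has_vector_derivative integral (cbox a b) (?F' t)) (at t within ?U)"
  proof (rule leibniz_rule_vector_derivative)
    show "((\<lambda>s. ?F s x) has_vector_derivative ?F' s x) (at s within ?U)" if "s \<in> ?U" for s x
    proof (cases "x \<in> \<Omega>")
      case True
      then show ?thesis
        using has_vector_derivative_at_within[OF has_vector_derivative_diff[OF e'[OF U[OF that] True] has_vector_derivative_const[of "e (t, x)"]]]
        by simp
    qed simp
    show "?F s integrable_on cbox a b" if "s \<in> ?U" for s
      by (rule integrable_continuous[OF continuous_on_subset[OF zero_extension_continuous[OF _ K(1) _ K(2)] subset_UNIV]])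
        (use off[OF U[OF that]] slice[OF U[OF that] ec] slice[OF I(2) ec] in \<open>auto intro: continuous_intros\<close>)
    have "continuous_on (I \<times> \<Omega> \<union> I \<times> - K) (\<lambda>(s, x). ?F' s x)"
    proof (rule continuous_on_open_Un)
      show "open (I \<times> \<Omega>)" "open (I \<times> - K)"
        using I open_domain K(1) by (auto intro!: open_Times simp: open_Compl compact_imp_closed)
      show "continuous_on (I \<times> \<Omega>) (\<lambda>(s, x). ?F' s x)" by (rule continuous_on_eq[OF Dc]) auto
      show "continuous_on (I \<times> - K) (\<lambda>(s, x). ?F' s x)"
        by (rule continuous_on_eq[OF continuous_on_const[of _ 0]]) (use D0 in auto)
    qed
    then show "continuous_on (?U \<times> cbox a b) (\<lambda>(s, x). ?F' s x)"
      by (rule continuous_on_subset) (use U K in auto)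
  qed (use \<eta> in auto)
  then have "((\<lambda>s. integral \<Omega> (?f s)) has_vector_derivative integral \<Omega> (\<lambda>x. D (t, x))) (at t within ?U)"
    unfolding integral_unique[OF D[OF I(2)]]
    by (rule has_vector_derivative_transform[rotated 2]) (use integral_unique[OF f[OF U]] \<eta> in auto)
  moreover have "at t within ?U = at t" using \<eta>(1) by (intro at_within_interior) auto
  ultimately have "((\<lambda>s. integral \<Omega> (?f s)) has_real_derivative integral \<Omega> (\<lambda>x. D (t, x))) (at t)"
    by (simp add: has_real_derivative_iff_has_vector_derivative)
  then have "((\<lambda>s. integral \<Omega> (?f s) + integral \<Omega> (\<lambda>x. e (t, x))) has_real_derivative integral \<Omega> (\<lambda>x. D (t, x))) (at t)"
    using DERIV_add[OF _ DERIV_const] by fastforce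
  then have "((\<lambda>s. integral \<Omega> (\<lambda>x. e (s, x))) has_real_derivative integral \<Omega> (\<lambda>x. D (t, x))) (at t)"
  proof (rule has_field_derivative_transform_within_open[OF _ I])
    fix s assume s: "s \<in> I"
    show "integral \<Omega> (?f s) + integral \<Omega> (\<lambda>x. e (t, x)) = integral \<Omega> (\<lambda>x. e (s, x))"
      using integral_add[OF has_integral_integrable[OF f[OF s]] int] by simp
  qed
  then show ?thesis by (simp add: D_def)
qed

end

text \<open>The integral of a translate does not depend on the translation; differentiating under
  the integral at translation 0 gives the claim.\<close>

lemma integral_directional_derivative_zero:
  fixes \<phi> :: "vec2 \<Rightarrow> real"
  assumes s: "smooth_on UNIV \<phi>" and K: "compact K" "\<And>x. x \<notin> K \<Longrightarrow> \<phi> x = 0"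
  shows "((\<lambda>x. frechet_derivative \<phi> (at x) h) has_integral 0) UNIV"
proof -
  define D where "D x = frechet_derivative \<phi> (at x) h" for x
  have \<phi>c: "continuous_on UNIV \<phi>" and Dc: "continuous_on UNIV D"
    unfolding D_def by (intro smooth_on_continuous_on smooth_on_derivative_dir s)+
  have "bounded ((\<lambda>p. fst p - snd p *\<^sub>R h) ` (K \<times> {-1..1}))"
    by (intro compact_imp_bounded compact_continuous_image compact_Times K continuous_intros) simp
  \<comment> \<open>One box large enough to contain the translates of the support for all |s| \<le>
    1.\<close>
  then obtain a where a: "(\<lambda>p. fst p - snd p *\<^sub>R h) ` (K \<times> {-1..1}) \<subseteq> cbox (- a) a"
    using bounded_subset_cbox_symmetric by blast
  have sh: "x + s *\<^sub>R h \<notin> K" if "x \<notin> cbox (- a) a" "s \<in> {-1..1}" for x s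
  proof
    assume "x + s *\<^sub>R h \<in> K"
    then have "x + s *\<^sub>R h - s *\<^sub>R h \<in> (\<lambda>p. fst p - snd p *\<^sub>R h) ` (K \<times> {-1..1})"
      using that(2) by (intro image_eqI[where x = "(x + s *\<^sub>R h, s)"]) auto
    then show False using a that(1) by auto
  qed
  obtain p q where pq: "K \<subseteq> cbox p q" using bounded_subset_cbox_symmetric[OF compact_imp_bounded[OF K(1)]] by blast
  let ?B = "cbox (- a) a"
  let ?c = "integral (cbox p q) \<phi>"
  have const: "integral ?B (\<lambda>x. \<phi> (x + s *\<^sub>R h)) = ?c" if s: "s \<in> {-1..1}" for s
  proof -
    have "(\<phi> has_integral ?c) (cbox p q)"
      by (intro integrable_integral integrable_continuous continuous_on_subset[OF \<phi>c]) simp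
    from has_integral_affinity[OF this, of 1 "s *\<^sub>R h"]
    have "((\<lambda>x. \<phi> (x + s *\<^sub>R h)) has_integral ?c) ((\<lambda>x. x - s *\<^sub>R h) ` cbox p q)" by simp
    then have 1: "((\<lambda>x. \<phi> (x + s *\<^sub>R h)) has_integral ?c) UNIV"
    proof (rule has_integral_on_superset)
      fix x assume "x \<notin> (\<lambda>x. x - s *\<^sub>R h) ` cbox p q"
      then have "x + s *\<^sub>R h \<notin> cbox p q" by (metis add_diff_cancel image_eqI)
      then show "\<phi> (x + s *\<^sub>R h) = 0" using pq K(2) by auto
    qed simp
    have "((\<lambda>x. \<phi> (x + s *\<^sub>R h)) has_integral integral ?B (\<lambda>x. \<phi> (x + s *\<^sub>R h))) ?B"
      by (intro integrable_integral integrable_continuous continuous_on_compose2[OF \<phi>c] continuous_intros) simp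
    then have "((\<lambda>x. \<phi> (x + s *\<^sub>R h)) has_integral integral ?B (\<lambda>x. \<phi> (x + s *\<^sub>R h))) UNIV"
      by (rule has_integral_on_superset) (use sh[OF _ s] K(2) in auto)
    then show ?thesis using 1 has_integral_unique by blast
  qed
  have "((\<lambda>s. integral ?B (\<lambda>x. \<phi> (x + s *\<^sub>R h))) has_vector_derivative integral ?B (\<lambda>x. D (x + 0 *\<^sub>R h))) (at 0 within {-1..1})"
  proof (rule leibniz_rule_vector_derivative)
    show "((\<lambda>s. \<phi> (x + s *\<^sub>R h)) has_vector_derivative D (x + s *\<^sub>R h)) (at s within {-1..1})" for s x
      unfolding D_def by (rule has_vector_derivative_at_within[OF smooth_on_line_derivative[OF s UNIV_I]])
    show "(\<lambda>x. \<phi> (x + s *\<^sub>R h)) integrable_on ?B" for s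
      by (intro integrable_continuous continuous_on_compose2[OF \<phi>c] continuous_intros) simp
    show "continuous_on ({-1..1} \<times> ?B) (\<lambda>(s, x). D (x + s *\<^sub>R h))"
      unfolding split_def by (intro continuous_on_compose2[OF Dc] continuous_intros) simp
  qed auto
  moreover have "((\<lambda>s. integral ?B (\<lambda>x. \<phi> (x + s *\<^sub>R h))) has_vector_derivative 0) (at 0 within {-1..1})"
    by (rule has_vector_derivative_transform[OF _ _ has_vector_derivative_const[of ?c]]) (use const in auto)
  moreover have "at (0::real) within {-1..1} = at 0" by (intro at_within_interior) auto
  ultimately have z: "integral ?B D = 0" using vector_derivative_unique_at by fastforce
  have D0: "D x = 0" if "x \<notin> ?B" for x
  proof -
    have "x \<notin> K" using sh[OF that, of 0] by simp
    then have "frechet_derivative \<phi> (at x) = frechet_derivative (\<lambda>x. 0) (at x)"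
      using K by (intro frechet_derivative_cong_open[of "- K"]) (auto simp: open_Compl compact_imp_closed)
    then show ?thesis by (simp add: D_def)
  qed
  have "(D has_integral 0) ?B"
    using integrable_integral[OF integrable_continuous[OF continuous_on_subset[OF Dc subset_UNIV]], of "- a" a] z by simp
  then have "(D has_integral 0) UNIV" by (rule has_integral_on_superset[OF _ D0 subset_UNIV])
  then show ?thesis by (simp add: D_def[abs_def])
qed

context smooth_domain
begin

lemma integral_divergence_zero:
  assumes w: "smooth_on \<Omega> w" and K: "compact K" "K \<subseteq> \<Omega>" and off: "\<And>x. x \<in> \<Omega> - K \<Longrightarrow> w x = 0"
  shows "(divg w has_integral 0) \<Omega>"
proof -
  let ?w = "\<lambda>x. if x \<in> \<Omega> then w x else 0"
  have ws: "smooth_on UNIV ?w" by (rule zero_extension_smooth[OF w K(1) off K(2)])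
  have nth: "frechet_derivative (\<lambda>x. ?w x $ i) (at x) h = frechet_derivative ?w (at x) h $ i" for i x h
    using frechet_derivativeI[OF bounded_linear.has_derivative[OF bounded_linear_vec_nth smooth_on_has_derivative[OF ws UNIV_I]]] by simp
  have "((\<lambda>x. frechet_derivative ?w (at x) (axis i 1) $ i) has_integral 0) UNIV" for i
    using integral_directional_derivative_zero[of "\<lambda>x. ?w x $ i" K "axis i 1"] smooth_on_vec_nth[OF open_UNIV ws] K off
    unfolding nth by auto
  from has_integral_add[OF this this]
  have "(divg ?w has_integral 0) UNIV" by (simp add: divg_expand[abs_def])
  moreover have "divg ?w = (\<lambda>x. if x \<in> \<Omega> then divg w x else 0)"
  proof
    fix x
    show "divg ?w x = (if x \<in> \<Omega> then divg w x else 0)"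
  proof (cases "x \<in> \<Omega>")
    case True
    then show ?thesis using divg_cong[OF open_domain True, of ?w w] by simp
  next
    case False
    have op: "open (- K)" using K(1) by (simp add: open_Compl compact_imp_closed)
    have "divg ?w x = divg (\<lambda>x. 0) x" by (rule divg_cong[OF op]) (use False K(2) off in auto)
    then show ?thesis using False by (simp add: divg_expand)
  qed
  qed
  ultimately have "((\<lambda>x. if x \<in> \<Omega> then divg w x else 0) has_integral 0) UNIV" by (simp only:)
  then show ?thesis by (simp only: has_integral_restrict_UNIV)
qed

text \<open>Tested with a bump times the constant vector \<open>c x0\<close>: the product with
  \<open>c\<close> is nonnegative on the support of the bump, and positive at \<open>x0\<close> if
  \<open>c x0\<close> is nonzero.\<close>

lemma fundamental_lemma:
  fixes c :: vmap
  assumes c: "continuous_on \<Omega> c" and x0: "x0 \<in> \<Omega>"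
    and z: "\<And>\<zeta> K. smooth_on UNIV \<zeta> \<Longrightarrow> compact K \<Longrightarrow> K \<subseteq> \<Omega> \<Longrightarrow> (\<And>x. x \<notin> K \<Longrightarrow> \<zeta> x = 0) \<Longrightarrow>
      integral \<Omega> (\<lambda>x. c x \<bullet> \<zeta> x) = 0"
  shows "c x0 = 0"
proof (rule ccontr)
  assume n: "c x0 \<noteq> 0"
  have "isCont (\<lambda>x. c x \<bullet> c x0) x0"
    using c x0 open_domain by (intro continuous_intros) (simp add: continuous_on_eq_continuous_at)
  moreover have "0 < c x0 \<bullet> c x0" using n by simp
  ultimately have "\<forall>\<^sub>F x in at x0. 0 < c x \<bullet> c x0"
    unfolding isCont_def by (rule order_tendstoD)
  then obtain e1 where e1: "e1 > 0" "\<And>x. dist x x0 < e1 \<Longrightarrow> 0 \<le> c x \<bullet> c x0"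
    unfolding eventually_at using n by (metis UNIV_I inner_ge_zero less_imp_le)
  obtain e2 where e2: "e2 > 0" "cball x0 e2 \<subseteq> \<Omega>" using open_domain x0 open_contains_cball by blast
  define \<epsilon> where "\<epsilon> = min e1 e2"
  have e: "\<epsilon> > 0" using e1 e2 by (simp add: \<epsilon>_def)
  obtain \<eta> :: "vec2 \<Rightarrow> real" where \<eta>: "smooth_on UNIV \<eta>" "\<And>x. 0 \<le> \<eta> x" "0 < \<eta> x0" "\<And>x. \<epsilon> \<le> dist x0 x \<Longrightarrow> \<eta> x = 0"
    using smooth_bump[OF e] by blast
  let ?h = "\<lambda>x. c x \<bullet> (\<eta> x *\<^sub>R c x0)"
  have Ksub: "cball x0 \<epsilon> \<subseteq> \<Omega>" using e2 by (auto simp: \<epsilon>_def)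
  have \<eta>0: "\<eta> x *\<^sub>R c x0 = 0" if "x \<notin> cball x0 \<epsilon>" for x using \<eta>(4)[of x] that by simp
  have hc: "continuous_on \<Omega> ?h"
    by (intro continuous_intros c continuous_on_subset[OF smooth_on_continuous_on[OF \<eta>(1)]]) simp
  have "?h x0 = 0"
  proof (rule integral_zero_continuous[OF hc _ _ _ x0])
    show "?h integrable_on \<Omega>"
    proof (rule compact_support_integrable[OF hc compact_cball _ Ksub])
      fix x assume "x \<in> \<Omega> - cball x0 \<epsilon>"
      then have "\<eta> x *\<^sub>R c x0 = 0" by (intro \<eta>0) simp
      then show "?h x = 0" by (simp only: inner_zero_right)
    qed
    show "0 \<le> ?h x" for x
    proof (cases "dist x0 x < \<epsilon>")
      case True
      then have "0 \<le> c x \<bullet> c x0" using e1(2)[of x] by (simp add: dist_commute \<epsilon>_def)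
      then show ?thesis using \<eta>(2)[of x] by simp
    next
      case False
      then show ?thesis using \<eta>(4)[of x] by simp
    qed
    show "integral \<Omega> ?h = 0"
    proof (rule z[OF _ compact_cball Ksub \<eta>0])
      show "smooth_on UNIV (\<lambda>x. \<eta> x *\<^sub>R c x0)" by (intro smooth_on_scaleR smooth_on_const open_UNIV \<eta>(1))
    qed
  qed
  then show False using \<eta>(3) n by simp
qed

section \<open>Smooth dependence of the inverse\<close>

text \<open>Compactness takes the place of an implicit function argument. If the inverse points fail
  to converge, a subsequence tends to some other \<open>l\<close> in the closure; continuity of the
  joint map forces X l to be the limit position, so \<open>l\<close> is the inverse point after
  all.\<close>

lemma Inv_continuous:
  assumes c: "curve_in \<Omega> (Diff \<Omega>) J X"
  shows "continuous_on (J \<times> \<Omega>) (\<lambda>q. Inv (X (fst q)) (snd q))"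
proof -
  note cD = curve_inD[OF c]
  let ?g = "\<lambda>q. Inv (X (fst q)) (snd q)"
  obtain F where F: "smooth_on (J \<times> UNIV) F" "\<And>t x. t \<in> J \<Longrightarrow> x \<in> closure \<Omega> \<Longrightarrow> F (t, x) = X t x"
    using cD(3) by (auto simp: smooth_time_upto_def)
  have "((\<lambda>n. ?g (q n)) \<longlongrightarrow> ?g p) sequentially"
    if q: "\<And>n. q n \<in> J \<times> \<Omega>" "p \<in> J \<times> \<Omega>" "q \<longlonglongrightarrow> p" for q p
  proof (rule ccontr)
    assume "\<not> (\<lambda>n. ?g (q n)) \<longlonglongrightarrow> ?g p"
    then obtain e where e: "e > 0" "\<not> (\<forall>\<^sub>F n in sequentially. dist (?g (q n)) (?g p) < e)"
      unfolding tendsto_iff by blast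
    then have fr: "\<exists>\<^sub>F n in sequentially. e \<le> dist (?g (q n)) (?g p)"
      by (simp add: not_eventually not_less)
    then have "infinite {n. e \<le> dist (?g (q n)) (?g p)}"
      by (simp add: frequently_cofinite[symmetric] cofinite_eq_sequentially)
    from infinite_enumerate[OF this]
    obtain r :: "nat \<Rightarrow> nat" where r: "strict_mono r" "\<And>n. e \<le> dist (?g (q (r n))) (?g p)"
      by blast
    have inC: "?g (q (r n)) \<in> closure \<Omega>" for n
      using q(1)[of "r n"] cD(4)[of "fst (q (r n))"] by (intro Diff_inv(2)) (auto intro: in_closure)
    then obtain l k where l: "l \<in> closure \<Omega>" "strict_mono k" "((\<lambda>n. ?g (q (r n))) \<circ> k) \<longlonglongrightarrow> l"
      using seq_compactE[OF compact_imp_seq_compact[OF compact_closure_domain], of "\<lambda>n. ?g (q (r n))"] by blast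
    let ?m = "\<lambda>n. r (k n)"
    have qm: "(\<lambda>n. q (?m n)) \<longlonglongrightarrow> p"
      using LIMSEQ_subseq_LIMSEQ[OF q(3) strict_mono_o[OF r(1) l(2)]] by (simp add: o_def)
    have lim: "(\<lambda>n. (fst (q (?m n)), ?g (q (?m n)))) \<longlonglongrightarrow> (fst p, l)"
      using tendsto_Pair[OF tendsto_fst[OF qm] l(3)] by (simp add: o_def)
    have "isCont F (fst p, l)"
      by (rule has_derivative_continuous[OF smooth_on_has_derivative[OF F(1)]]) (use q(2) in auto)
    then have "(\<lambda>n. F (fst (q (?m n)), ?g (q (?m n)))) \<longlonglongrightarrow> F (fst p, l)"
      by (rule isCont_tendsto_compose[OF _ lim])
    moreover have "F (fst (q n), ?g (q n)) = snd (q n)" for n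
      using q(1)[of n] cD(4)[of "fst (q n)"] Diff_inv[of "X (fst (q n))" "snd (q n)"]
      by (auto simp: F(2) in_closure)
    ultimately have "(\<lambda>n. snd (q (?m n))) \<longlonglongrightarrow> F (fst p, l)" by simp
    then have "F (fst p, l) = snd p" using tendsto_snd[OF qm] LIMSEQ_unique by blast
    then have "X (fst p) l = snd p" using F(2)[of "fst p" l] q(2) l(1) by auto
    then have "l = ?g p" using Diff_inv(3)[of "X (fst p)" l] cD(4)[of "fst p"] q(2) l(1) by auto
    moreover have "e \<le> dist l (?g p)"
    proof (rule tendsto_lowerbound[OF tendsto_dist[OF l(3) tendsto_const]])
      show "\<forall>\<^sub>F n in sequentially. e \<le> dist (((\<lambda>n. ?g (q (r n))) \<circ> k) n) (?g p)" using r(2) by simp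
    qed simp
    ultimately show False using e(1) by simp
  qed
  then show ?thesis by (auto simp: continuous_on_sequentially o_def)
qed

text \<open>The map (t, a) to (t, X t a) has the inverse (t, x) to (t, Inv (X t) x). The derivative
  of an inverse that is already known to be continuous is the inverse of the derivative.\<close>

lemma Inv_has_derivative:
  assumes c: "curve_in \<Omega> (Diff \<Omega>) J X" and q: "(t, x) \<in> J \<times> \<Omega>"
    and F: "smooth_on (J \<times> \<Omega>) F" "\<And>t x. t \<in> J \<Longrightarrow> x \<in> \<Omega> \<Longrightarrow> F (t, x) = X t x"
  defines "a \<equiv> Inv (X t) x"
  shows "((\<lambda>q. Inv (X (fst q)) (snd q)) has_derivative
    (\<lambda>h. frechet_derivative (Inv (X t)) (at x) (snd h - frechet_derivative F (at (t, a)) (fst h, 0)))) (at (t, x))"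
proof -
  note cD = curve_inD[OF c]
  let ?g = "\<lambda>q. (fst q, Inv (X (fst q)) (snd q))"
  let ?f = "\<lambda>q. (fst q, F q)"
  have X: "X t \<in> Diff \<Omega>" using cD(4) q by auto
  have a: "a \<in> \<Omega>" "X t a = x"
    using Diff_interior(2)[OF X] Diff_inv(4)[OF X] q in_closure by (auto simp: a_def)
  have ta: "(t, a) \<in> J \<times> \<Omega>" using q a by simp
  have op: "open (J \<times> \<Omega>)" using cD(1) open_domain by (rule open_Times)
  have FX: "frechet_derivative F (at (t, a)) (0, h) = frechet_derivative (X t) (at a) h" for h
    using slice_derivative(2)[OF F(1) ta, of h] frechet_derivative_cong_open[OF open_domain a(1), of "\<lambda>y. F (t, y)" "X t"] F(2) q
    by auto
  let ?N = "frechet_derivative (Inv (X t)) (at x)"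
  have lN: "bounded_linear ?N"
    by (rule has_derivative_bounded_linear[OF smooth_on_has_derivative[OF Diff_smooth(4)[OF X]]]) (use q in simp)
  have lF: "bounded_linear (frechet_derivative F (at (t, a)))"
    by (rule has_derivative_bounded_linear[OF smooth_on_has_derivative[OF F(1) ta]])
  let ?g' = "\<lambda>h. (fst h, ?N (snd h - frechet_derivative F (at (t, a)) (fst h, 0)))"
  have "(?g has_derivative ?g') (at (t, x))"
  proof (rule has_derivative_inverse_basic[where f = ?f and T = "J \<times> \<Omega>"])
    show "(?f has_derivative (\<lambda>h. (fst h, frechet_derivative F (at (t, a)) h))) (at (?g (t, x)))"
      using smooth_on_has_derivative[OF F(1) ta] unfolding a_def
      by (auto intro!: derivative_eq_intros)
    show "bounded_linear ?g'"
      by (intro bounded_linear_Pair bounded_linear_fst bounded_linear_compose[OF lN] bounded_linear_sub bounded_linear_snd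
        bounded_linear_compose[OF lF] bounded_linear_zero)
    show "?g' \<circ> (\<lambda>h. (fst h, frechet_derivative F (at (t, a)) h)) = id"
    proof
      fix h :: "real \<times> vec2"
      have "frechet_derivative F (at (t, a)) h - frechet_derivative F (at (t, a)) (fst h, 0) = frechet_derivative (X t) (at a) (snd h)"
        using linear_diff[OF bounded_linear.linear[OF lF], of h "(fst h, 0)"] FX[of "snd h"] by (cases h) simp
      then show "(?g' \<circ> (\<lambda>h. (fst h, frechet_derivative F (at (t, a)) h))) h = id h"
        using Diff_derivative_inverse(1)[OF X a(1)] a(2) by simp
    qed
    show "continuous (at (t, x)) ?g"
      using Inv_continuous[OF c] q op by (intro continuous_Pair continuous_intros) (simp add: continuous_on_eq_continuous_at)
    show "?f (?g z) = z" if "z \<in> J \<times> \<Omega>" for z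
    proof -
      have "X (fst z) \<in> Diff \<Omega>" using cD(4) that by auto
      then show ?thesis using F(2) Diff_interior(2) Diff_inv(4) in_closure that by (cases z) auto
    qed
  qed (use q op in auto)
  from has_derivative_snd[OF this] show ?thesis by simp
qed

text \<open>The derivative of the inverse is a smooth function \<open>R h\<close> evaluated at the
  inverse itself, so each class of regularity yields the next.\<close>

lemma Inv_smooth:
  assumes c: "curve_in \<Omega> (Diff \<Omega>) J X"
  shows "smooth_on (J \<times> \<Omega>) (\<lambda>q. Inv (X (fst q)) (snd q))"
proof -
  note cD = curve_inD[OF c]
  let ?S = "J \<times> \<Omega>" and ?a = "\<lambda>q. Inv (X (fst q)) (snd q)"
  have op: "open ?S" using cD(1) open_domain by (rule open_Times)
  obtain F0 where F0: "smooth_on (J \<times> UNIV) F0" "\<And>t x. t \<in> J \<Longrightarrow> x \<in> closure \<Omega> \<Longrightarrow> F0 (t, x) = X t x"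
    using cD(3) by (auto simp: smooth_time_upto_def)
  have "smooth_on ?S F0" by (rule smooth_on_subset[OF F0(1)]) auto
  note F = this F0(2)[OF _ in_closure]
  define m where "m j q = frechet_derivative F0 (at q) (0, axis j 1)" for j :: 2 and q
  have m: "smooth_on ?S (m j)" for j unfolding m_def by (rule smooth_on_derivative_dir[OF F(1)])
  define d where "d q = m 1 q $ 1 * m 2 q $ 2 - m 2 q $ 1 * m 1 q $ 2" for q
  define v where "v h q = snd h - frechet_derivative F0 (at q) (fst h, 0)" for h :: "real \<times> vec2" and q
  \<comment> \<open>Cramer's rule for the inverse of the Jacobian matrix with columns
    \<open>m 1\<close>, \<open>m 2\<close> and determinant \<open>d\<close>, applied to
    \<open>v h\<close>.\<close>
  define R where "R h q = ((m 2 q $ 2 * v h q $ 1 - m 2 q $ 1 * v h q $ 2) / d q) *\<^sub>R axis 1 1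
     + ((m 1 q $ 1 * v h q $ 2 - m 1 q $ 2 * v h q $ 1) / d q) *\<^sub>R (axis 2 1 :: vec2)" for h q
  have slice: "frechet_derivative F0 (at (t, y)) (0, h) = frechet_derivative (X t) (at y) h" if "t \<in> J" "y \<in> \<Omega>" for t y h
    using slice_derivative(2)[OF F(1), of t y h] frechet_derivative_cong_open[OF open_domain that(2), of "\<lambda>y. F0 (t, y)" "X t"] F(2) that
    by auto
  have dq: "d (t, y) \<noteq> 0" if "t \<in> J" "y \<in> \<Omega>" for t y
    using Diff_det_nonzero[OF cD(4)[OF that(1)] that(2)] by (simp add: d_def m_def slice[OF that] det_jacobian)
  have Rs: "smooth_on ?S (R h)" for h
  proof -
    have "smooth_on ?S (v h)" unfolding v_def by (intro smooth_on_diff smooth_on_const smooth_on_derivative_dir op F(1))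
    then show ?thesis unfolding R_def d_def[abs_def]
      using dq op by (intro smooth_on_add smooth_on_scaleR smooth_on_divide smooth_on_diff smooth_on_mult smooth_on_vec_nth m smooth_on_const)
        (auto simp: d_def)
  qed
  have der: "(?a has_derivative (\<lambda>h. R h (fst q, ?a q))) (at q)" if q: "q \<in> ?S" for q
  proof -
    obtain t x where tx: "q = (t, x)" "t \<in> J" "x \<in> \<Omega>" using q by auto
    define y where "y = Inv (X t) x"
    have XD: "X t \<in> Diff \<Omega>" by (rule cD(4)[OF tx(2)])
    have y: "y \<in> \<Omega>" "X t y = x" using Diff_interior(2)[OF XD tx(3)] Diff_inv(4)[OF XD in_closure[OF tx(3)]] by (auto simp: y_def)
    let ?N = "frechet_derivative (Inv (X t)) (at x)" and ?P = "frechet_derivative (X t) (at y)"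
    have lP: "linear ?P" by (rule has_derivative_linear[OF smooth_on_has_derivative[OF Diff_smooth(3)[OF XD] y(1)]])
    have "?N (v h (t, y)) = R h (t, y)" for h
    proof -
      have mm: "m j (t, y) = ?P (axis j 1)" for j unfolding m_def by (rule slice[OF tx(2) y(1)])
      have dd: "d (t, y) \<noteq> 0" by (rule dq[OF tx(2) y(1)])
      define z where "z = v h (t, y)"
      have RR: "R h (t, y) $ 1 = (m 2 (t, y) $ 2 * z $ 1 - m 2 (t, y) $ 1 * z $ 2) / d (t, y)"
        "R h (t, y) $ 2 = (m 1 (t, y) $ 1 * z $ 2 - m 1 (t, y) $ 2 * z $ 1) / d (t, y)"
        by (simp_all add: R_def axis_def z_def)
      have "?P (R h (t, y)) = R h (t, y) $ 1 *\<^sub>R m 1 (t, y) + R h (t, y) $ 2 *\<^sub>R m 2 (t, y)"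
        unfolding mm by (rule linear_vec2[OF lP])
      also have "\<dots> = z"
      proof -
        have "R h (t, y) $ 1 * m 1 (t, y) $ i + R h (t, y) $ 2 * m 2 (t, y) $ i = z $ i" for i
        proof -
          have "d (t, y) * (R h (t, y) $ 1 * m 1 (t, y) $ i + R h (t, y) $ 2 * m 2 (t, y) $ i) =
              (R h (t, y) $ 1 * d (t, y)) * m 1 (t, y) $ i + (R h (t, y) $ 2 * d (t, y)) * m 2 (t, y) $ i"
            by (simp add: algebra_simps)
          also have "\<dots> = (m 2 (t, y) $ 2 * z $ 1 - m 2 (t, y) $ 1 * z $ 2) * m 1 (t, y) $ i +
              (m 1 (t, y) $ 1 * z $ 2 - m 1 (t, y) $ 2 * z $ 1) * m 2 (t, y) $ i"
            unfolding RR using dd by simp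
          also have "\<dots> = d (t, y) * z $ i"
            using exhaust_2[of i] by (auto simp: d_def algebra_simps)
          finally have "d (t, y) * (R h (t, y) $ 1 * m 1 (t, y) $ i + R h (t, y) $ 2 * m 2 (t, y) $ i) = d (t, y) * z $ i" .
          then show ?thesis using dd by simp
        qed
        then show ?thesis by (simp add: vec_eq_iff)
      qed
      finally have "?P (R h (t, y)) = z" .
      then show ?thesis using Diff_derivative_inverse(1)[OF XD y(1), of "R h (t, y)"] y(2) by (simp add: z_def)
    qed
    then show ?thesis
      using Inv_has_derivative[OF c _ F, of t x] tx by (simp add: v_def y_def)
  qed
  have "Ck_on k ?S ?a" for k
  proof (induction k)
    case 0
    then show ?case using Inv_continuous[OF c] by simp
  next
    case (Suc k)
    have aS: "(fst q, ?a q) \<in> ?S" if "q \<in> ?S" for q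
      using that cD(4)[of "fst q"] Diff_interior(2) by auto
    have pair: "Ck_on k ?S (\<lambda>q. (fst q, ?a q))"
    proof -
      have "Ck_on k ?S (\<lambda>q. (fst q, 0::vec2))" "Ck_on k ?S (\<lambda>q. (0::real, ?a q))"
        using Ck_on_bounded_linear[OF bounded_linear_Pair[OF bounded_linear_ident bounded_linear_zero] op Ck_on_linear[OF bounded_linear_fst op]]
          Ck_on_bounded_linear[OF bounded_linear_Pair[OF bounded_linear_zero bounded_linear_ident] op Suc] by simp_all
      from Ck_on_add[OF op this] show ?thesis by simp
    qed
    show ?case
    proof (rule Ck_on_SucI[OF op der])
      show "Ck_on k ?S (\<lambda>q. R h (fst q, ?a q))" for h
        by (rule Ck_on_compose[OF op pair _ aS]) (use Rs in \<open>simp add: smooth_on_def\<close>)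
    qed
  qed
  then show ?thesis by (simp add: smooth_on_def)
qed

end

section \<open>The operator \<open>A\<^sub>\<rho>\<close>\<close>

lemma smooth_slice_space:
  fixes g :: "real \<times> vec2 \<Rightarrow> 'b::real_normed_vector"
  assumes "smooth_on (J \<times> S) g" "t \<in> J" "open S"
  shows "smooth_on S (\<lambda>y. g (t, y))"
  by (rule smooth_on_compose[OF assms(3) _ assms(1)]) (use assms in \<open>auto intro!: smooth_intros\<close>)

lemma smooth_slice_grad:
  fixes g :: "real \<times> vec2 \<Rightarrow> real"
  assumes "open J" "open S" "smooth_on (J \<times> S) g"
  shows "smooth_on (J \<times> S) (\<lambda>q. grad (\<lambda>y. g (fst q, y)) (snd q))"
proof (rule smooth_on_vec)
  show op: "open (J \<times> S)" using assms by (intro open_Times)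
  show "smooth_on (J \<times> S) (\<lambda>q. grad (\<lambda>y. g (fst q, y)) (snd q) $ i)" for i
    using smooth_on_cong[OF op, of "\<lambda>q. grad (\<lambda>y. g (fst q, y)) (snd q) $ i" "\<lambda>q. frechet_derivative g (at q) (0, axis i 1)"]
      slice_derivative(2)[OF assms(3)] smooth_on_derivative_dir[OF assms(3)] by (simp add: grad_nth)
qed

lemma smooth_slice_divg:
  fixes W :: "real \<times> vec2 \<Rightarrow> vec2"
  assumes "open J" "open S" "smooth_on (J \<times> S) W"
  shows "smooth_on (J \<times> S) (\<lambda>q. divg (\<lambda>y. W (fst q, y)) (snd q))"
proof -
  have op: "open (J \<times> S)" using assms by (intro open_Times)
  have "smooth_on (J \<times> S) (\<lambda>q. frechet_derivative W (at q) (0, axis 1 1) $ 1 + frechet_derivative W (at q) (0, axis 2 1) $ 2)"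
    by (intro smooth_on_add smooth_on_vec_nth smooth_on_derivative_dir assms op)
  then show ?thesis
    using smooth_on_cong[OF op, of "\<lambda>q. divg (\<lambda>y. W (fst q, y)) (snd q)"
        "\<lambda>q. frechet_derivative W (at q) (0, axis 1 1) $ 1 + frechet_derivative W (at q) (0, axis 2 1) $ 2"]
      slice_derivative(2)[OF assms(3)] by (simp add: divg_expand)
qed

lemma grad_add:
  assumes "f differentiable (at x)" "g differentiable (at x)"
  shows "grad (\<lambda>y. f y + g y) x = grad f x + grad g x"
  unfolding grad_def vec_eq_iff
  using frechet_derivativeI[OF has_derivative_add[OF assms[unfolded frechet_derivative_works]]] by simp

lemma grad_mult:
  assumes "f differentiable (at x)" "g differentiable (at x)"
  shows "grad (\<lambda>y. f y * g y) x = f x *\<^sub>R grad g x + g x *\<^sub>R grad f x"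
  unfolding grad_def vec_eq_iff
  using frechet_derivativeI[OF has_derivative_mult[OF assms[unfolded frechet_derivative_works]]] by simp

lemma grad_cmult:
  assumes "f differentiable (at x)"
  shows "grad (\<lambda>y. c * f y) x = c *\<^sub>R grad f x"
  unfolding grad_def vec_eq_iff
  using frechet_derivativeI[OF has_derivative_mult_right[OF assms[unfolded frechet_derivative_works]]] by simp

lemma grad_inner_fields:
  fixes v \<zeta> :: vmap
  assumes "v differentiable (at x)" "\<zeta> differentiable (at x)"
  shows "h \<bullet> grad (\<lambda>y. v y \<bullet> \<zeta> y) x = v x \<bullet> frechet_derivative \<zeta> (at x) h + frechet_derivative v (at x) h \<bullet> \<zeta> x"
proof -
  have D: "((\<lambda>y. v y \<bullet> \<zeta> y) has_derivative (\<lambda>h. v x \<bullet> frechet_derivative \<zeta> (at x) h + frechet_derivative v (at x) h \<bullet> \<zeta> x)) (at x)"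
    by (rule has_derivative_inner[OF assms[unfolded frechet_derivative_works]])
  show ?thesis
    using grad_inner[OF differentiableI[OF D], of h] unfolding frechet_derivativeI[OF D] .
qed

context lake
begin

lemma smooth_grad_b: "smooth_on \<Omega> (grad b)"
  by (rule smooth_on_grad[OF open_domain smooth_b])

lemma smooth_lift:
  assumes "open J" "smooth_on \<Omega> g" shows "smooth_on (J \<times> \<Omega>) (\<lambda>q. g (snd q))"
  by (rule smooth_on_compose[OF _ smooth_on_snd assms(2)]) (use assms open_domain in \<open>auto intro: open_Times\<close>)

lemma A_op_smooth_time:
  fixes W :: "real \<times> vec2 \<Rightarrow> vec2"
  assumes J: "open J" and W: "smooth_on (J \<times> \<Omega>) W" and nz: "\<And>x. x \<in> \<Omega> \<Longrightarrow> \<rho> x \<noteq> 0"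
  shows "smooth_on (J \<times> \<Omega>) (\<lambda>q. A_op b \<rho> (\<lambda>y. W (fst q, y)) (snd q))"
proof -
  have op: "open (J \<times> \<Omega>)" using J open_domain by (rule open_Times)
  note r = smooth_lift[OF J smooth_\<rho>] and gb = smooth_lift[OF J smooth_grad_b] and d = smooth_slice_divg[OF J open_domain W]
  have g1: "smooth_on (J \<times> \<Omega>) (\<lambda>q. grad (\<lambda>y. \<rho> y ^ 3 * divg (\<lambda>y. W (fst q, y)) y) (snd q))"
    using smooth_slice_grad[OF J open_domain smooth_on_mult[OF op smooth_on_power[OF op r] d], of 3] by simp
  have g2: "smooth_on (J \<times> \<Omega>) (\<lambda>q. grad (\<lambda>y. \<rho> y ^ 2 * (W (fst q, y) \<bullet> grad b y)) (snd q))"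
    using smooth_slice_grad[OF J open_domain smooth_on_mult[OF op smooth_on_power[OF op r] smooth_on_inner[OF op W gb]], of 2] by simp
  have c: "smooth_on (J \<times> \<Omega>) (\<lambda>q. c / \<rho> (snd q))" for c
    by (rule smooth_on_divide[OF op smooth_on_const[OF op] r]) (use nz in auto)
  show ?thesis
    unfolding A_op_def
    using smooth_on_add[OF op smooth_on_add[OF op smooth_on_diff[OF op smooth_on_diff[OF op W
        smooth_on_scaleR[OF op c g1]] smooth_on_scaleR[OF op c g2]]
        smooth_on_scaleR[OF op smooth_on_mult[OF op smooth_on_mult[OF op smooth_on_const[OF op] r] d] gb]]
        smooth_on_scaleR[OF op smooth_on_inner[OF op W gb] gb], of "1/3" "1/2" "1/2"] by simp
qed

lemma A_op_smooth:
  assumes \<eta>: "smooth_on \<Omega> \<eta>" and nz: "\<And>x. x \<in> \<Omega> \<Longrightarrow> \<rho> x \<noteq> 0"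
  shows "smooth_on \<Omega> (A_op b \<rho> \<eta>)"
  using smooth_slice_space[OF A_op_smooth_time[OF open_UNIV smooth_lift[OF open_UNIV \<eta>] nz], of 0] open_domain
  by simp

text \<open>Integration by parts in pointwise form: the terms of the metric containing div \<zeta>
  are written as a divergence minus the derivative of their coefficient, and the latter are the
  gradient terms of A.\<close>

lemma A_op_integrand:
  assumes \<eta>: "smooth_on \<Omega> \<eta>" and \<zeta>: "smooth_on \<Omega> \<zeta>" and x: "x \<in> \<Omega>" and nz: "\<rho> x \<noteq> 0"
  shows "gn_integrand b \<rho> \<eta> \<zeta> x = \<rho> x * (A_op b \<rho> \<eta> x \<bullet> \<zeta> x) +
    divg (\<lambda>y. (1/3 * (\<rho> y ^ 3 * divg \<eta> y) + 1/2 * (\<rho> y ^ 2 * (\<eta> y \<bullet> grad b y))) *\<^sub>R \<zeta> y) x"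
proof -
  let ?p1 = "\<lambda>y. \<rho> y ^ 3 * divg \<eta> y" and ?p2 = "\<lambda>y. \<rho> y ^ 2 * (\<eta> y \<bullet> grad b y)"
  have s1: "smooth_on \<Omega> ?p1" and s2: "smooth_on \<Omega> ?p2"
    by (intro smooth_on_mult smooth_on_power smooth_on_divg smooth_on_inner open_domain smooth_\<rho> \<eta> smooth_grad_b)+
  have c1: "smooth_on \<Omega> (\<lambda>y. 1/3 * ?p1 y)" and c2: "smooth_on \<Omega> (\<lambda>y. 1/2 * ?p2 y)"
    by (intro smooth_on_mult smooth_on_const open_domain s1 s2)+
  note dd = smooth_on_differentiable[OF _ x]
  have "divg (\<lambda>y. (1/3 * ?p1 y + 1/2 * ?p2 y) *\<^sub>R \<zeta> y) x =
      (1/3 * ?p1 x + 1/2 * ?p2 x) * divg \<zeta> x + \<zeta> x \<bullet> grad (\<lambda>y. 1/3 * ?p1 y + 1/2 * ?p2 y) x"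
    by (rule divg_scaleR[OF dd[OF smooth_on_add[OF open_domain c1 c2]] dd[OF \<zeta>]])
  also have "grad (\<lambda>y. 1/3 * ?p1 y + 1/2 * ?p2 y) x = (1/3) *\<^sub>R grad ?p1 x + (1/2) *\<^sub>R grad ?p2 x"
    using grad_add[OF dd[OF c1] dd[OF c2]] grad_cmult[OF dd[OF s1], of "1/3"] grad_cmult[OF dd[OF s2], of "1/2"] by simp
  finally show ?thesis
    using nz by (simp add: gn_integrand_def A_op_def inner_diff_left inner_add_left inner_add_right algebra_simps
      inner_commute power2_eq_square)
qed

text \<open>For a compactly supported test field the divergence part integrates to 0, so no boundary
  term arises.\<close>

lemma A_op_integral:
  assumes \<eta>: "smooth_on \<Omega> \<eta>" and \<zeta>: "smooth_on \<Omega> \<zeta>" and nz: "\<And>x. x \<in> \<Omega> \<Longrightarrow> \<rho> x \<noteq> 0"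
    and K: "compact K" "K \<subseteq> \<Omega>" and off: "\<And>x. x \<in> \<Omega> - K \<Longrightarrow> \<zeta> x = 0"
  shows "integral \<Omega> (gn_integrand b \<rho> \<eta> \<zeta>) = integral \<Omega> (\<lambda>x. \<rho> x * (A_op b \<rho> \<eta> x \<bullet> \<zeta> x))"
proof -
  let ?w = "\<lambda>y. (1/3 * (\<rho> y ^ 3 * divg \<eta> y) + 1/2 * (\<rho> y ^ 2 * (\<eta> y \<bullet> grad b y))) *\<^sub>R \<zeta> y"
  have w: "smooth_on \<Omega> ?w"
    by (intro smooth_on_scaleR smooth_on_add smooth_on_mult smooth_on_const smooth_on_power smooth_on_divg
      smooth_on_inner open_domain smooth_\<rho> \<eta> \<zeta> smooth_grad_b)
  have z: "(divg ?w has_integral 0) \<Omega>" by (rule integral_divergence_zero[OF w K]) (simp add: off)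
  have "(\<lambda>x. \<rho> x * (A_op b \<rho> \<eta> x \<bullet> \<zeta> x)) integrable_on \<Omega>"
    by (rule compact_support_integrable[OF smooth_on_continuous_on K(1) _ K(2)])
      (auto simp: off intro!: smooth_on_mult smooth_on_inner open_domain smooth_\<rho> \<zeta> A_op_smooth \<eta> nz)
  from has_integral_add[OF integrable_integral[OF this] z]
  have "((\<lambda>x. \<rho> x * (A_op b \<rho> \<eta> x \<bullet> \<zeta> x) + divg ?w x) has_integral
      integral \<Omega> (\<lambda>x. \<rho> x * (A_op b \<rho> \<eta> x \<bullet> \<zeta> x))) \<Omega>" by simp
  then show ?thesis
    using A_op_integrand[OF \<eta> \<zeta> _ nz] by (intro integral_unique) (simp cong: has_integral_cong)
qed

text \<open>Incompressibility replaces u . grad b by -\<rho> div u, so both gradient terms of A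
  involve the same function \<rho>^3 div u, with total coefficient (1/2 - 1/3)/\<rho>. Expanding its
  gradient gives \<rho>^2/6 in front of grad (div u), and the terms in grad b cancel: 3/6 + 1/2 - 1
  = 0.\<close>

lemma A_op_incompressible:
  assumes u: "smooth_on \<Omega> u" and x: "x \<in> \<Omega>" and nz: "\<rho> x \<noteq> 0"
    and inc: "\<And>y. y \<in> \<Omega> \<Longrightarrow> \<rho> y * divg u y + u y \<bullet> grad b y = 0"
  shows "A_op b \<rho> u x = u x + (1/6 * (\<rho> x)\<^sup>2) *\<^sub>R grad (divg u) x"
proof -
  let ?p1 = "\<lambda>y. \<rho> y ^ 3 * divg u y"
  note dd = smooth_on_differentiable[OF _ x]
  have w: "u y \<bullet> grad b y = - (\<rho> y * divg u y)" if "y \<in> \<Omega>" for y using inc[OF that] by linarith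
  have sd: "smooth_on \<Omega> (divg u)" by (rule smooth_on_divg[OF open_domain u])
  have s1: "smooth_on \<Omega> ?p1" by (intro smooth_on_mult smooth_on_power open_domain smooth_\<rho> sd)
  have "grad (\<lambda>y. \<rho> y ^ 2 * (u y \<bullet> grad b y)) x = grad (\<lambda>y. (-1) * ?p1 y) x"
    by (rule grad_cong[OF open_domain x]) (simp add: w power2_eq_square power3_eq_cube)
  also have "\<dots> = - grad ?p1 x" using grad_cmult[OF dd[OF s1], of "-1"] by simp
  finally have g2: "grad (\<lambda>y. \<rho> y ^ 2 * (u y \<bullet> grad b y)) x = - grad ?p1 x" .
  have "grad (\<lambda>y. \<rho> y ^ 3) x = (3 * \<rho> x ^ 2) *\<^sub>R grad b x"
  proof -
    have "grad (\<lambda>y. \<rho> y ^ 3) x = grad (\<lambda>y. \<rho> y * (\<rho> y * \<rho> y)) x" by (simp add: power3_eq_cube mult.assoc)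
    also have "\<dots> = (3 * \<rho> x ^ 2) *\<^sub>R grad \<rho> x"
      using grad_mult[OF dd[OF smooth_\<rho>] dd[OF smooth_on_mult[OF open_domain smooth_\<rho> smooth_\<rho>]]]
        grad_mult[OF dd[OF smooth_\<rho>] dd[OF smooth_\<rho>]]
      by (simp add: power2_eq_square algebra_simps flip: scaleR_add_left)
    finally show ?thesis by (simp add: grad_\<rho>[OF x])
  qed
  then have g1: "grad ?p1 x = \<rho> x ^ 3 *\<^sub>R grad (divg u) x + (divg u x * 3 * \<rho> x ^ 2) *\<^sub>R grad b x"
    using grad_mult[OF dd[OF smooth_on_power[OF open_domain smooth_\<rho>]] dd[OF sd], of 3] by (simp add: mult.assoc)
  have "A_op b \<rho> u x = u x + (1/2 / \<rho> x - 1/3 / \<rho> x) *\<^sub>R grad ?p1 x + (1/2 * \<rho> x * divg u x) *\<^sub>R grad b x - (\<rho> x * divg u x) *\<^sub>R grad b x"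
  proof -
    have "v - p *\<^sub>R G - q *\<^sub>R (- G) + r *\<^sub>R g + (- s) *\<^sub>R g = v + (q - p) *\<^sub>R G + r *\<^sub>R g - s *\<^sub>R g"
      for v G g :: vec2 and p q r s :: real by (simp add: algebra_simps)
    then show ?thesis unfolding A_op_def g2 w[OF x] .
  qed
  also have "\<dots> = u x + ((1/2 / \<rho> x - 1/3 / \<rho> x) * \<rho> x ^ 3) *\<^sub>R grad (divg u) x +
     ((1/2 / \<rho> x - 1/3 / \<rho> x) * (divg u x * 3 * \<rho> x ^ 2) + 1/2 * \<rho> x * divg u x - \<rho> x * divg u x) *\<^sub>R grad b x"
  proof -
    have "v + c *\<^sub>R (p *\<^sub>R G + q *\<^sub>R g) + r *\<^sub>R g - s *\<^sub>R g = v + (c * p) *\<^sub>R G + (c * q + r - s) *\<^sub>R g"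
      for v G g :: vec2 and c p q r s :: real by (simp add: algebra_simps)
    then show ?thesis unfolding g1 .
  qed
  also have "(1/2 / \<rho> x - 1/3 / \<rho> x) * \<rho> x ^ 3 = 1/6 * (\<rho> x)\<^sup>2"
    using nz by (simp add: field_simps power2_eq_square power3_eq_cube)
  also have "(1/2 / \<rho> x - 1/3 / \<rho> x) * (divg u x * 3 * \<rho> x ^ 2) + 1/2 * \<rho> x * divg u x - \<rho> x * divg u x = 0"
    using nz by (simp add: field_simps power2_eq_square)
  finally show ?thesis by simp
qed

text \<open>Joint smoothness in time and position rests on that of the inverse
  configuration.\<close>

lemma velocity_smooth:
  assumes c: "curve_in \<Omega> (Diff \<Omega>) J X"
  shows "smooth_on (J \<times> \<Omega>) (\<lambda>q. eul (X (fst q)) (time_deriv X (fst q)) (snd q))"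
proof -
  note cD = curve_inD[OF c]
  have op: "open (J \<times> \<Omega>)" using cD(1) open_domain by (rule open_Times)
  obtain F where F: "smooth_on (J \<times> UNIV) F" "\<And>t x. t \<in> J \<Longrightarrow> x \<in> closure \<Omega> \<Longrightarrow> F (t, x) = time_deriv X t x"
    using smooth_time_upto_time_deriv[OF cD(1,3)] by (auto simp: smooth_time_upto_def)
  have "smooth_on (J \<times> \<Omega>) (\<lambda>q. (fst q, Inv (X (fst q)) (snd q)))"
    by (rule smooth_on_Pair[OF op smooth_on_fst[OF op] Inv_smooth[OF c]])
  then have "smooth_on (J \<times> \<Omega>) (\<lambda>q. F (fst q, Inv (X (fst q)) (snd q)))"
    by (rule smooth_on_compose[OF op _ F(1)]) auto
  moreover have "F (fst q, Inv (X (fst q)) (snd q)) = eul (X (fst q)) (time_deriv X (fst q)) (snd q)" if "q \<in> J \<times> \<Omega>" for q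
  proof -
    have "fst q \<in> J" "Inv (X (fst q)) (snd q) \<in> closure \<Omega>"
      using that Diff_inv(2)[OF cD(4), of "fst q" "snd q"] in_closure[of "snd q"] by auto
    then show ?thesis by (simp add: F(2) eul_eq)
  qed
  ultimately show ?thesis by (rule smooth_on_cong[OF op, THEN iffD1, rotated])
qed

end

section \<open>First variation of the energy\<close>

context lake
begin

text \<open>The time derivative of \<open>gn_integrand b R U U\<close> at a moment when R = \<rho>
  and U = u, with rates \<open>r\<close> and \<open>k\<close>. It is kept unfolded to match the
  product rule.\<close>

definition energy_rate :: "vmap \<Rightarrow> vmap \<Rightarrow> real \<Rightarrow> vec2 \<Rightarrow> real" where
  "energy_rate u k r x = r * (u x \<bullet> u x) + 2 * \<rho> x * (u x \<bullet> k x)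
     + (\<rho> x ^ 2 * r * divg u x * divg u x + 2/3 * \<rho> x ^ 3 * divg u x * divg k x)
     + (2 * \<rho> x * r * divg u x * (u x \<bullet> grad b x) + \<rho> x ^ 2 * (divg k x * (u x \<bullet> grad b x) + divg u x * (k x \<bullet> grad b x)))
     + (r * (u x \<bullet> grad b x) * (u x \<bullet> grad b x) + 2 * \<rho> x * (u x \<bullet> grad b x) * (k x \<bullet> grad b x))"

text \<open>Incompressibility kills every term of the \<open>\<rho>\<close>-derivative of the energy density except \<open>|u|\<^sup>2\<close>.\<close>
lemma energy_rate_divergence:
  assumes u: "smooth_on \<Omega> u" and f: "smooth_on \<Omega> f" and x: "x \<in> \<Omega>" and nz: "\<And>y. y \<in> \<Omega> \<Longrightarrow> \<rho> y \<noteq> 0"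
    and inc: "\<And>y. y \<in> \<Omega> \<Longrightarrow> \<rho> y * divg u y + u y \<bullet> grad b y = 0"
  defines "v \<equiv> A_op b \<rho> u"
    and "k \<equiv> \<lambda>y. frechet_derivative f (at y) (u y) - frechet_derivative u (at y) (f y)"
  shows "1/2 * energy_rate u k (- (\<rho> x * divg f x + f x \<bullet> grad b x)) x =
    divg (\<lambda>y. (1/3 * (\<rho> y ^ 3 * divg u y) + 1/2 * (\<rho> y ^ 2 * (u y \<bullet> grad b y))) *\<^sub>R k y) x
    + divg (\<lambda>y. (- (1/2) * (u y \<bullet> u y)) *\<^sub>R (\<rho> y *\<^sub>R f y)) x
    + divg (\<lambda>y. (v y \<bullet> f y) *\<^sub>R (\<rho> y *\<^sub>R u y)) x
    + \<rho> x * (1/2 * (f x \<bullet> grad (\<lambda>y. u y \<bullet> u y) x) - frechet_derivative v (at x) (u x) \<bullet> f x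
        - v x \<bullet> frechet_derivative u (at x) (f x))"
proof -
  define r where "r = - (\<rho> x * divg f x + f x \<bullet> grad b x)"
  note op = open_domain and dd = smooth_on_differentiable[OF _ x]
  have ks: "smooth_on \<Omega> k" unfolding k_def
    by (intro smooth_on_diff smooth_on_derivative_apply op f u)
  have vs: "smooth_on \<Omega> v" unfolding v_def by (rule A_op_smooth[OF u nz])
  have w: "u x \<bullet> grad b x = - (\<rho> x * divg u x)" using inc[OF x] by linarith
  have 1: "gn_integrand b \<rho> u k x = \<rho> x * (v x \<bullet> k x) +
      divg (\<lambda>y. (1/3 * (\<rho> y ^ 3 * divg u y) + 1/2 * (\<rho> y ^ 2 * (u y \<bullet> grad b y))) *\<^sub>R k y) x"
    unfolding v_def by (rule A_op_integrand[OF u ks x nz[OF x]])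
  have "divg (\<lambda>y. (- (1/2) * (u y \<bullet> u y)) *\<^sub>R (\<rho> y *\<^sub>R f y)) x =
      (- (1/2) * (u x \<bullet> u x)) * divg (\<lambda>y. \<rho> y *\<^sub>R f y) x + (\<rho> x *\<^sub>R f x) \<bullet> grad (\<lambda>y. - (1/2) * (u y \<bullet> u y)) x"
    by (rule divg_scaleR) (intro dd smooth_on_mult smooth_on_const smooth_on_inner smooth_on_scaleR op u f smooth_\<rho>)+
  also have "grad (\<lambda>y. - (1/2) * (u y \<bullet> u y)) x = (- (1/2)) *\<^sub>R grad (\<lambda>y. u y \<bullet> u y) x"
    by (rule grad_cmult[OF dd[OF smooth_on_inner[OF op u u]]])
  also have "divg (\<lambda>y. \<rho> y *\<^sub>R f y) x = - r" using divg_\<rho>[OF f x] by (simp add: r_def)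
  finally have 2: "divg (\<lambda>y. (- (1/2) * (u y \<bullet> u y)) *\<^sub>R (\<rho> y *\<^sub>R f y)) x =
      1/2 * (u x \<bullet> u x) * r - 1/2 * \<rho> x * (f x \<bullet> grad (\<lambda>y. u y \<bullet> u y) x)" by simp
  have "divg (\<lambda>y. (v y \<bullet> f y) *\<^sub>R (\<rho> y *\<^sub>R u y)) x =
      (v x \<bullet> f x) * divg (\<lambda>y. \<rho> y *\<^sub>R u y) x + (\<rho> x *\<^sub>R u x) \<bullet> grad (\<lambda>y. v y \<bullet> f y) x"
    by (rule divg_scaleR) (intro dd smooth_on_inner smooth_on_scaleR op u vs f smooth_\<rho>)+
  also have "divg (\<lambda>y. \<rho> y *\<^sub>R u y) x = 0" using divg_\<rho>[OF u x] inc[OF x] by simp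
  finally have 3: "divg (\<lambda>y. (v y \<bullet> f y) *\<^sub>R (\<rho> y *\<^sub>R u y)) x =
      \<rho> x * (v x \<bullet> frechet_derivative f (at x) (u x) + frechet_derivative v (at x) (u x) \<bullet> f x)"
    using grad_inner_fields[OF dd[OF vs] dd[OF f], of "u x"] by simp
  have 4: "v x \<bullet> k x = v x \<bullet> frechet_derivative f (at x) (u x) - v x \<bullet> frechet_derivative u (at x) (f x)"
    by (simp add: k_def inner_diff_right)
  \<comment> \<open>Apart from |u|^2, the factor of \<open>r\<close> is (\<rho> div u + u . grad
    b)^2, which vanishes; the remaining terms are twice the metric integrand of \<open>u\<close> and
    \<open>k\<close>.\<close>
  have 5: "1/2 * energy_rate u k r x = 1/2 * r * (u x \<bullet> u x) + gn_integrand b \<rho> u k x"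
    unfolding energy_rate_def gn_integrand_def w by (simp add: algebra_simps power2_eq_square)
  show ?thesis
    unfolding r_def[symmetric] 5 1 2 3 4 by (simp add: algebra_simps)
qed

end

section \<open>Transport of density and velocity by a flow\<close>

context lake_flow
begin

abbreviation "\<Phi>\<Phi> \<equiv> \<lambda>q. \<Phi> (fst q) (snd q)"

lemma slice_\<Phi>: "\<bar>s\<bar> < \<delta> \<Longrightarrow> frechet_derivative (\<Phi> s) (at y) h = frechet_derivative \<Phi>\<Phi> (at (s, y)) (0, h)"
  using slice_derivative(2)[OF smooth_\<Phi>, of s y h] by (simp add: abs_less_iff)

lemma time_derivative_D\<Phi>:
  "((\<lambda>s. frechet_derivative \<Phi>\<Phi> (at (s, y)) (0, h)) has_vector_derivative frechet_derivative f (at y) h) (at 0)"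
proof -
  have op: "open ({-\<delta><..<\<delta>} \<times> (UNIV :: vec2 set))" by (intro open_Times) auto
  have "(\<lambda>z. frechet_derivative \<Phi>\<Phi> (at (0, z)) (1, 0)) = f"
    using time_derivative_\<Phi>[of 0] \<delta> \<Phi>_0 by auto
  then show ?thesis using mixed_time_derivative[OF op smooth_\<Phi>, of 0 y h] \<delta> by simp
qed

text \<open>The density of \<Phi> s composed with a configuration in \<open>M\<close>; it depends on
  the configuration only through the profile \<rho>.\<close>

definition flow_density :: "real \<times> vec2 \<Rightarrow> real" where
  "flow_density q = \<rho> (\<Phi> (- fst q) (snd q)) / det (jacobian (\<Phi> (fst q)) (at (\<Phi> (- fst q) (snd q))))"

text \<open>The push-forward of the field \<open>u\<close> under \<Phi> s, that is, the Eulerian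
  velocity after deforming a moving configuration by \<Phi> s.\<close>

definition flow_velocity :: "vmap \<Rightarrow> real \<times> vec2 \<Rightarrow> vec2" where
  "flow_velocity u q = frechet_derivative (\<Phi> (fst q)) (at (\<Phi> (- fst q) (snd q))) (u (\<Phi> (- fst q) (snd q)))"

abbreviation "IO \<equiv> {-\<delta><..<\<delta>} \<times> \<Omega>"

lemma open_IO: "open IO"
  using open_domain by (intro open_Times) auto

lemma smooth_pullback:
  assumes g: "smooth_on IO g"
  shows "smooth_on IO (\<lambda>q. g (fst q, \<Phi> (- fst q) (snd q)))"
proof (rule smooth_on_compose[OF open_IO _ g])
  have "smooth_on IO (\<lambda>q. (- fst q, snd q))"
    by (intro smooth_on_Pair smooth_on_minus smooth_on_fst smooth_on_snd open_IO)
  from smooth_on_compose[OF open_IO this smooth_\<Phi>]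
  have "smooth_on IO (\<lambda>q. \<Phi> (- fst q) (snd q))" by auto
  then show "smooth_on IO (\<lambda>q. (fst q, \<Phi> (- fst q) (snd q)))"
    by (intro smooth_on_Pair smooth_on_fst open_IO)
  show "(fst q, \<Phi> (- fst q) (snd q)) \<in> IO" if "q \<in> IO" for q
    using that \<Phi>_domain[of "- fst q" "snd q"] by (auto simp: abs_less_iff)
qed

lemma smooth_\<Phi>_IO: "smooth_on IO \<Phi>\<Phi>"
  by (rule smooth_on_subset[OF smooth_\<Phi>]) auto

lemma smooth_flow_velocity:
  assumes u: "smooth_on \<Omega> u" shows "smooth_on IO (flow_velocity u)"
proof -
  have "smooth_on IO (\<lambda>q. frechet_derivative \<Phi>\<Phi> (at q) (0, u (snd q)))"
    by (intro smooth_on_derivative_apply smooth_\<Phi>_IO smooth_on_Pair smooth_on_const open_IO smooth_lift u) simp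
  from smooth_pullback[OF this]
  show ?thesis
    by (rule smooth_on_cong[OF open_IO, THEN iffD1, rotated])
      (auto simp: flow_velocity_def slice_\<Phi> abs_less_iff)
qed

lemma det_\<Phi>_smooth: "smooth_on IO (\<lambda>q. det (jacobian (\<Phi> (fst q)) (at (snd q))))"
proof -
  have "smooth_on IO (\<lambda>q. frechet_derivative \<Phi>\<Phi> (at q) (0, axis 1 1) $ 1 * frechet_derivative \<Phi>\<Phi> (at q) (0, axis 2 1) $ 2
     - frechet_derivative \<Phi>\<Phi> (at q) (0, axis 2 1) $ 1 * frechet_derivative \<Phi>\<Phi> (at q) (0, axis 1 1) $ 2)"
    by (intro smooth_on_diff smooth_on_mult smooth_on_vec_nth smooth_on_derivative_dir smooth_\<Phi>_IO open_IO)
  then show ?thesis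
    by (rule smooth_on_cong[OF open_IO, THEN iffD1, rotated]) (auto simp: det_jacobian slice_\<Phi> abs_less_iff)
qed

lemma smooth_flow_density: "smooth_on IO flow_density"
proof -
  have "smooth_on IO (\<lambda>q. \<rho> (snd q) / det (jacobian (\<Phi> (fst q)) (at (snd q))))"
  proof (rule smooth_on_divide[OF open_IO smooth_lift[OF _ smooth_\<rho>] det_\<Phi>_smooth])
    show "det (jacobian (\<Phi> (fst q)) (at (snd q))) \<noteq> 0" if "q \<in> IO" for q
      using det_jacobian_\<Phi>_pos[of "fst q" "snd q"] that by (auto simp: abs_less_iff)
  qed simp
  from smooth_pullback[OF this] show ?thesis by (simp add: flow_density_def[abs_def])
qed

lemma \<Phi>_zero: "\<Phi> 0 = (\<lambda>x. x)"
  using \<Phi>_0 by auto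

lemma flow_density_0: "flow_density (0, x) = \<rho> x"
  by (simp add: flow_density_def \<Phi>_zero jacobian_def matrix_id_mat_1[unfolded id_def])

lemma flow_velocity_0: "flow_velocity u (0, x) = u x"
  by (simp add: flow_velocity_def \<Phi>_zero)

text \<open>Transported quantities are explicit at the moving point, where the inverse flow cancels.
  The derivative at a fixed point is recovered by subtracting the convective term.\<close>

lemma transported_derivative:
  fixes g :: "real \<times> vec2 \<Rightarrow> 'b::euclidean_space"
  assumes g: "smooth_on IO g" and y: "y \<in> \<Omega>"
    and d: "((\<lambda>s. g (s, \<Phi> s y)) has_vector_derivative D) (at 0)"
  shows "frechet_derivative g (at (0, y)) (1, 0) = D - frechet_derivative (\<lambda>z. g (0, z)) (at y) (f y)"
proof -
  have q: "(0, y) \<in> IO" using \<delta> y by simp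
  have "((\<lambda>s. \<Phi> s y) has_vector_derivative f y) (at 0)" using \<Phi>_deriv[of 0 y] \<delta> \<Phi>_0 by simp
  then have "((\<lambda>s. (s, \<Phi> s y)) has_vector_derivative (1, f y)) (at 0)"
    unfolding has_vector_derivative_def by (auto intro!: derivative_eq_intros)
  moreover have "(g has_derivative frechet_derivative g (at (0, y))) (at (0, \<Phi> 0 y) within (\<lambda>s. (s, \<Phi> s y)) ` UNIV)"
    using has_derivative_at_withinI[OF smooth_on_has_derivative[OF g q]] by (simp add: \<Phi>_0)
  ultimately have "((\<lambda>s. g (s, \<Phi> s y)) has_vector_derivative frechet_derivative g (at (0, y)) (1, f y)) (at 0)"
    using vector_derivative_diff_chain_within[of "\<lambda>s. (s, \<Phi> s y)" "(1, f y)" 0 UNIV g] by (simp add: o_def)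
  then have "frechet_derivative g (at (0, y)) (1, f y) = D" using d by (rule vector_derivative_unique_at)
  moreover have "frechet_derivative g (at (0, y)) (1, f y) =
      frechet_derivative g (at (0, y)) (1, 0) + frechet_derivative g (at (0, y)) (0, f y)"
    using linear_add[OF has_derivative_linear[OF smooth_on_has_derivative[OF g q]], of "(1, 0)" "(0, f y)"] by simp
  ultimately show ?thesis by (simp add: slice_derivative(2)[OF g q] eq_diff_eq)
qed

lemma flow_density_derivative:
  assumes y: "y \<in> \<Omega>"
  shows "frechet_derivative flow_density (at (0, y)) (1, 0) = - (\<rho> y * divg f y + f y \<bullet> grad b y)"
proof -
  have det0: "det (jacobian (\<Phi> 0) (at y)) = 1"
    by (simp add: \<Phi>_zero jacobian_def matrix_id_mat_1[unfolded id_def])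
  have "((\<lambda>s. \<rho> y / det (jacobian (\<Phi> s) (at y))) has_real_derivative - (\<rho> y * divg f y)) (at 0)"
    using DERIV_divide[OF DERIV_const[of "\<rho> y"] det_\<Phi>_deriv[of 0 y]] \<delta> det0 \<Phi>_0 by simp
  then have "((\<lambda>s. flow_density (s, \<Phi> s y)) has_real_derivative - (\<rho> y * divg f y)) (at 0)"
    by (rule has_field_derivative_transform_within_open[of _ _ _ "{-\<delta><..<\<delta>}"])
      (use \<delta> \<Phi>_inv in \<open>auto simp: flow_density_def abs_less_iff\<close>)
  from transported_derivative[OF smooth_flow_density y this[unfolded has_real_derivative_iff_has_vector_derivative]]
  show ?thesis
    using grad_inner[OF smooth_on_differentiable[OF smooth_b y], of "f y"] derivative_\<rho>[OF y]
    by (simp add: flow_density_0)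
qed

text \<open>A Lie bracket of the two fields arises, as expected for a push-forward by a
  flow.\<close>

lemma flow_velocity_derivative:
  assumes u: "smooth_on \<Omega> u" and y: "y \<in> \<Omega>"
  shows "frechet_derivative (flow_velocity u) (at (0, y)) (1, 0) =
    frechet_derivative f (at y) (u y) - frechet_derivative u (at y) (f y)"
proof -
  have "((\<lambda>s. flow_velocity u (s, \<Phi> s y)) has_vector_derivative frechet_derivative f (at y) (u y)) (at 0)"
    by (rule has_vector_derivative_transform_within_open[OF time_derivative_D\<Phi>, of "{-\<delta><..<\<delta>}"])
      (use \<delta> \<Phi>_inv in \<open>auto simp: flow_velocity_def slice_\<Phi> abs_less_iff\<close>)
  from transported_derivative[OF smooth_flow_velocity[OF u] y this] show ?thesis
    by (simp add: flow_velocity_0)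
qed

text \<open>Off \<open>K\<close> the flow is the identity on an open set, so its derivative is the
  identity there too and the energy density does not change. This is what permits differentiation
  under the integral.\<close>

lemma energy_variation:
  assumes u: "smooth_on \<Omega> u" and K: "compact K" "K \<subseteq> \<Omega>" and off: "\<And>x. x \<notin> K \<Longrightarrow> f x = 0"
    and int: "gn_integrand b \<rho> u u integrable_on \<Omega>"
  defines "k \<equiv> \<lambda>y. frechet_derivative f (at y) (u y) - frechet_derivative u (at y) (f y)"
  shows "((\<lambda>s. integral \<Omega> (gn_integrand b (\<lambda>x. flow_density (s, x)) (\<lambda>x. flow_velocity u (s, x)) (\<lambda>x. flow_velocity u (s, x))))
    has_real_derivative integral \<Omega> (\<lambda>x. energy_rate u k (- (\<rho> x * divg f x + f x \<bullet> grad b x)) x)) (at 0)"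
proof -
  define R where "R = flow_density"
  define U where "U = flow_velocity u"
  have R: "smooth_on IO R" and U: "smooth_on IO U"
    unfolding R_def U_def by (rule smooth_flow_density smooth_flow_velocity[OF u])+
  have R0: "R (0, x) = \<rho> x" and U0: "U (0, x) = u x" for x
    by (simp_all add: R_def U_def flow_density_0 flow_velocity_0)
  define d where "d q = divg (\<lambda>y. U (fst q, y)) (snd q)" for q
  have d: "smooth_on IO d" unfolding d_def by (rule smooth_slice_divg[OF _ open_domain U]) simp
  have d0: "d (0, x) = divg u x" for x by (simp add: d_def U0)
  have gb: "smooth_on IO (\<lambda>q. grad b (snd q))" by (rule smooth_lift[OF _ smooth_grad_b]) simp
  define e where "e q = gn_integrand b (\<lambda>y. R (fst q, y)) (\<lambda>y. U (fst q, y)) (\<lambda>y. U (fst q, y)) (snd q)" for q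
  have e_eq: "e q = R q * (U q \<bullet> U q) + 1/3 * R q ^ 3 * d q * d q + 1/2 * R q ^ 2 * d q * (U q \<bullet> grad b (snd q))
      + 1/2 * R q ^ 2 * d q * (U q \<bullet> grad b (snd q)) + R q * (U q \<bullet> grad b (snd q)) * (U q \<bullet> grad b (snd q))" for q
    by (simp add: e_def gn_integrand_def d_def)
  have es: "smooth_on IO e"
    unfolding e_eq[abs_def]
    by (intro smooth_on_add smooth_on_mult smooth_on_inner smooth_on_power smooth_on_const open_IO R U d gb)
  have e0: "e (0, x) = gn_integrand b \<rho> u u x" for x by (simp add: e_def R0 U0)
  have opK: "open (- K)" using K(1) by (simp add: open_Compl compact_imp_closed)
  have opOK: "open (\<Omega> - K)" using open_Int[OF open_domain opK] by (simp add: Diff_eq)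
  have still: "\<Phi> s y = y" if "y \<notin> K" "\<bar>s\<bar> < \<delta>" for s y using \<Phi>_fix[OF that(2)] off[OF that(1)] by simp
  have "e (s, x) = e (0, x)" if s: "s \<in> {-\<delta><..<\<delta>}" and x: "x \<in> \<Omega> - K" for s x
  proof -
    have s': "\<bar>s\<bar> < \<delta>" "\<bar>- s\<bar> < \<delta>" using s by auto
    have D: "frechet_derivative (\<Phi> s) (at y) = (\<lambda>h. h)" if "y \<notin> K" for y
      using frechet_derivative_cong_open[OF opK, of y "\<Phi> s" "\<lambda>x. x"] still[OF _ s'(1)] that by simp
    have Uy: "U (s, y) = u y" if "y \<in> \<Omega> - K" for y
      using that still[of y, OF _ s'(2)] D by (simp add: U_def flow_velocity_def)
    have Rx: "R (s, x) = \<rho> x"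
      using x still[of x, OF _ s'(2)] D by (simp add: R_def flow_density_def jacobian_def matrix_id_mat_1[unfolded id_def])
    show ?thesis unfolding e0 unfolding e_def fst_conv snd_conv
      by (rule gn_integrand_cong[OF opOK x]) (simp_all add: Uy Rx)
  qed
  then have L: "((\<lambda>s. integral \<Omega> (\<lambda>x. e (s, x))) has_real_derivative
      integral \<Omega> (\<lambda>x. frechet_derivative e (at (0, x)) (1, 0))) (at 0)"
    using \<delta> int by (intro leibniz_compact[OF _ _ es K]) (simp_all add: e0)
  have "frechet_derivative e (at (0, x)) (1, 0) = energy_rate u k (- (\<rho> x * divg f x + f x \<bullet> grad b x)) x" if x: "x \<in> \<Omega>" for x
  proof -
    define r where "r = - (\<rho> x * divg f x + f x \<bullet> grad b x)"
    have q: "(0, x) \<in> IO" using x \<delta> by simp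
    have k: "frechet_derivative U (at (0, y)) (1, 0) = k y" if "y \<in> \<Omega>" for y
      unfolding U_def k_def by (rule flow_velocity_derivative[OF u that])
    have dR: "((\<lambda>s. R (s, x)) has_real_derivative r) (at 0)"
      using time_slice_derivative[OF R q] flow_density_derivative[OF x]
      by (simp add: R_def r_def has_real_derivative_iff_has_vector_derivative)
    have dU: "((\<lambda>s. U (s, x)) has_vector_derivative k x) (at 0)"
      using time_slice_derivative[OF U q] k[OF x] by simp
    have dUi: "((\<lambda>s. U (s, x) \<bullet> w) has_real_derivative k x \<bullet> w) (at 0)" for w
      using bounded_linear.has_vector_derivative[OF bounded_linear_inner_left dU]
      by (simp add: has_real_derivative_iff_has_vector_derivative)
    have dUU: "((\<lambda>s. U (s, x) \<bullet> U (s, x)) has_real_derivative 2 * (u x \<bullet> k x)) (at 0)"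
      by (rule has_derivative_imp_has_field_derivative[OF
        has_derivative_inner[OF dU[unfolded has_vector_derivative_def] dU[unfolded has_vector_derivative_def]]])
        (simp add: U0 inner_commute algebra_simps)
    \<comment> \<open>Time and space derivatives of the transported velocity are interchanged, so
      that its divergence has time derivative div k.\<close>
    have m: "((\<lambda>s. frechet_derivative U (at (s, x)) (0, h)) has_vector_derivative frechet_derivative k (at x) h) (at 0)" for h
      using mixed_time_derivative[OF open_IO U q, of h]
        frechet_derivative_cong_open[OF open_domain x, of "\<lambda>y. frechet_derivative U (at (0, y)) (1, 0)" k] k by simp
    have mi: "((\<lambda>s. frechet_derivative U (at (s, x)) (0, h) $ i) has_real_derivative frechet_derivative k (at x) h $ i) (at 0)" for h i
      using bounded_linear.has_vector_derivative[OF bounded_linear_vec_nth m]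
      by (simp add: has_real_derivative_iff_has_vector_derivative)
    have dd: "((\<lambda>s. d (s, x)) has_real_derivative divg k x) (at 0)"
    proof -
      have "((\<lambda>s. frechet_derivative U (at (s, x)) (0, axis 1 1) $ 1 + frechet_derivative U (at (s, x)) (0, axis 2 1) $ 2)
          has_real_derivative divg k x) (at 0)"
        unfolding divg_expand[of k] by (rule DERIV_add[OF mi mi])
      then show ?thesis
        by (rule has_field_derivative_transform_within_open[of _ _ _ "{-\<delta><..<\<delta>}"])
          (use \<delta> x slice_derivative(2)[OF U] in \<open>auto simp: d_def divg_expand\<close>)
    qed
    have "((\<lambda>s. e (s, x)) has_real_derivative energy_rate u k r x) (at 0)"
      unfolding e_eq snd_conv
      by (rule derivative_eq_intros dR dUU dUi dd refl)+
        (simp add: R0 U0 d0 energy_rate_def algebra_simps power2_eq_square power3_eq_cube)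
    moreover have "((\<lambda>s. e (s, x)) has_real_derivative frechet_derivative e (at (0, x)) (1, 0)) (at 0)"
      using time_slice_derivative[OF es q] by (simp add: has_real_derivative_iff_has_vector_derivative)
    ultimately show ?thesis using DERIV_unique by (metis r_def)
  qed
  then have "integral \<Omega> (\<lambda>x. frechet_derivative e (at (0, x)) (1, 0)) =
      integral \<Omega> (\<lambda>x. energy_rate u k (- (\<rho> x * divg f x + f x \<bullet> grad b x)) x)" by (intro integral_cong)
  then show ?thesis using L by (simp add: e_def R_def U_def)
qed

end

section \<open>The momentum equation\<close>

text \<open>The transposed Jacobian moves the derivative of \<open>u\<close> onto the test
  direction, the form in which this term comes out of the energy variation.\<close>

lemma transpose_jacobian_inner:
  fixes u :: vmap
  assumes "u differentiable (at x)"
  shows "(transpose (jacobian u (at x)) *v v) \<bullet> h = v \<bullet> frechet_derivative u (at x) h"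
proof -
  have "frechet_derivative u (at x) h = jacobian u (at x) *v h"
    using jacobian_works[of u "at x"] assms frechet_derivativeI by metis
  then show ?thesis by (simp add: dot_lmul_matrix[symmetric] inner_commute)
qed

context lake
begin

definition momentum_rate :: "(real \<Rightarrow> vmap) \<Rightarrow> (real \<Rightarrow> vmap) \<Rightarrow> real \<Rightarrow> vmap" where
  "momentum_rate u v t x = time_deriv v t x + frechet_derivative (v t) (at x) (u t x)
     + transpose (jacobian (u t) (at x)) *v v t x - (1/2) *\<^sub>R grad (\<lambda>y. (norm (u t y))\<^sup>2) x"

abbreviation vel :: "(real \<Rightarrow> vmap) \<Rightarrow> real \<Rightarrow> vmap" where
  "vel X \<equiv> \<lambda>t. eul (X t) (time_deriv X t)"

abbreviation mom :: "(real \<Rightarrow> vmap) \<Rightarrow> real \<Rightarrow> vmap" where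
  "mom X \<equiv> \<lambda>t. A_op b \<rho> (vel X t)"

lemma momentum_smooth:
  assumes c: "curve_in \<Omega> M J X" and t: "t \<in> J"
  shows "smooth_on (J \<times> \<Omega>) (\<lambda>q. mom X (fst q) (snd q))"
  by (rule A_op_smooth_time[OF curve_inD(1)[OF c] velocity_smooth[OF curve_in_M_Diff[OF c]], unfolded fst_conv snd_conv])
    (rule \<rho>_nonzero[OF curve_inD(4)[OF c t]])

end

lemma time_deriv_slice:
  fixes g :: "real \<Rightarrow> vmap"
  assumes "smooth_on S (\<lambda>q. g (fst q) (snd q))" "(t, x) \<in> S"
  shows "time_deriv g t x = frechet_derivative (\<lambda>q. g (fst q) (snd q)) (at (t, x)) (1, 0)"
  using time_slice_derivative[OF assms] by (simp add: time_deriv_def vector_derivative_at)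

section \<open>The covariant acceleration tested against compactly supported fields\<close>

context lake_connection
begin

text \<open>Torsion-freeness exchanges the covariant derivative of the test field along \<open>X\<close> with the
  covariant derivative of the velocity along the flow of the test field.\<close>
lemma covariant_exchange:
  assumes c: "curve_in \<Omega> (Diff \<Omega>) J X" and t: "t \<in> J" and fl: "tangential_flow \<Omega> f \<delta> \<Phi>"
  defines "W \<equiv> \<lambda>s x. frechet_derivative (\<Phi> s) (at (X t x)) (time_deriv X t x)"
  shows "field_along \<Omega> J X (\<lambda>t x. f (X t x))"
    and "((\<lambda>s. GN (\<lambda>x. \<Phi> s (X t x)) (W s) (W s)) has_real_derivative
      2 * GN (X t) (time_deriv X t) (cov_deriv \<Gamma> X (\<lambda>t x. f (X t x)) t)) (at 0)"
proof -
  interpret tangential_flow \<Omega> f \<delta> \<Phi> by (rule fl)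
  interpret lake_flow \<Omega> b \<rho>0 f \<delta> \<Phi> by unfold_locales
  note cD = curve_inD[OF c]
  have Xt: "X t \<in> Diff \<Omega>" by (rule cD(4)[OF t])
  let ?Z = "\<lambda>t x. f (X t x)" and ?I = "{-\<delta><..<\<delta>}"
  obtain F where F: "smooth_on (J \<times> UNIV) F" "\<And>t x. t \<in> J \<Longrightarrow> x \<in> closure \<Omega> \<Longrightarrow> F (t, x) = X t x"
    using cD(3) by (auto simp: smooth_time_upto_def)
  have op: "open (J \<times> (UNIV :: vec2 set))" and opI: "open (?I \<times> (UNIV :: vec2 set))"
    using cD(1) by (auto intro!: open_Times)
  have "smooth_on (J \<times> UNIV) (\<lambda>q. f (F q))" by (rule smooth_on_compose[OF op F(1) f]) simp
  then have "smooth_time_upto J \<Omega> ?Z" unfolding smooth_time_upto_def using F(2) by (intro exI[of _ "\<lambda>q. f (F q)"]) simp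
  moreover have "?Z s \<in> T_Diff \<Omega> (X s)" for s
    unfolding T_Diff_def using smooth_on_UNIV_upto[OF f] tan by auto
  ultimately show fZ: "field_along \<Omega> J X ?Z" by (simp add: field_along_def)
  define \<gamma> where "\<gamma> s x = \<Phi> s (X t x)" for s x
  have c\<gamma>: "curve_in \<Omega> (Diff \<Omega>) ?I \<gamma>" unfolding \<gamma>_def[abs_def] by (rule curve_flow[OF Xt])
  have W: "W s x = frechet_derivative \<Phi>\<Phi> (at (s, X t x)) (0, time_deriv X t x)" if "\<bar>s\<bar> < \<delta>" for s x
    unfolding W_def by (rule slice_\<Phi>[OF that])
  have W0: "W 0 = time_deriv X t" by (simp add: W_def \<Phi>_zero)
  have \<gamma>0: "\<gamma> 0 = X t" by (rule ext) (simp add: \<gamma>_def \<Phi>_zero)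
  have \<gamma>'0: "time_deriv \<gamma> 0 = ?Z t"
    unfolding \<gamma>_def[abs_def] using time_deriv_flow[of 0 "X t"] \<delta> by (simp add: \<Phi>_zero)
  have fW: "field_along \<Omega> ?I \<gamma> W"
    unfolding field_along_def
  proof (intro conjI ballI)
    obtain V where V: "smooth_on UNIV V" "\<And>x. x \<in> closure \<Omega> \<Longrightarrow> V x = time_deriv X t x"
      using smooth_time_upto_slice[OF cD(1) t smooth_time_upto_time_deriv[OF cD(1,3)]] by (auto simp: smooth_upto_def)
    obtain Y where Y: "smooth_on UNIV Y" "\<And>x. x \<in> closure \<Omega> \<Longrightarrow> Y x = X t x"
      using Diff_smooth(1)[OF Xt] by (auto simp: smooth_upto_def)
    have sV: "smooth_on (?I \<times> UNIV) (\<lambda>q. (0::real, V (snd q)))"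
      by (intro smooth_on_Pair smooth_on_const opI smooth_on_compose[OF opI smooth_on_snd[OF opI] V(1)]) simp
    have sY: "smooth_on (?I \<times> UNIV) (\<lambda>q. (fst q, Y (snd q)))"
      by (intro smooth_on_Pair smooth_on_fst opI smooth_on_compose[OF opI smooth_on_snd[OF opI] Y(1)]) simp
    have "smooth_on (?I \<times> UNIV) (\<lambda>q. frechet_derivative \<Phi>\<Phi> (at (fst q, Y (snd q))) (0, V (snd q)))"
    proof (rule smooth_on_linear_apply[OF opI _ _ sV])
      show "linear (frechet_derivative \<Phi>\<Phi> (at (fst q, Y (snd q))))" if "q \<in> ?I \<times> UNIV" for q
        by (rule has_derivative_linear[OF smooth_on_has_derivative[OF smooth_\<Phi>]]) (use that in auto)
      show "smooth_on (?I \<times> UNIV) (\<lambda>q. frechet_derivative \<Phi>\<Phi> (at (fst q, Y (snd q))) v)" for v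
        by (rule smooth_on_compose[OF opI sY smooth_on_derivative_dir[OF smooth_\<Phi>]]) auto
    qed
    then show "smooth_time_upto ?I \<Omega> W"
      unfolding smooth_time_upto_def using V(2) Y(2) W
      by (intro exI[of _ "\<lambda>q. frechet_derivative \<Phi>\<Phi> (at (fst q, Y (snd q))) (0, V (snd q))"]) (auto simp: abs_less_iff)
    fix s assume "s \<in> ?I"
    then have s: "\<bar>s\<bar> < \<delta>" by (auto simp: abs_less_iff)
    have "smooth_on (J \<times> UNIV) (\<lambda>q. \<Phi> s (F q))" by (rule smooth_on_compose[OF op F(1) smooth_slice[OF s]]) simp
    then have "smooth_time_upto J \<Omega> (\<lambda>t x. \<Phi> s (X t x))"
      unfolding smooth_time_upto_def using F(2) by (intro exI[of _ "\<lambda>q. \<Phi> s (F q)"]) simp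
    \<comment> \<open>With \<open>s\<close> fixed, the flow applied to the curve is again a curve of
      diffeomorphisms, and \<open>W s\<close> is its velocity at time \<open>t\<close>; this gives
      the tangency of \<open>W s\<close>.\<close>
    then have c': "curve_in \<Omega> (Diff \<Omega>) J (\<lambda>t x. \<Phi> s (X t x))"
      using cD flow_Diff(1)[OF _ s] by (auto simp: curve_in_def)
    show "W s \<in> T_Diff \<Omega> (\<gamma> s)"
    proof (rule T_Diff_cong[OF time_deriv_T_Diff[OF c' t]])
      fix x assume x: "x \<in> closure \<Omega>"
      have "((\<lambda>t. \<Phi> s (X t x)) has_vector_derivative W s x) (at t)"
        using vector_derivative_diff_chain_within[OF time_deriv[OF cD(1) t cD(3) x]
          has_derivative_at_withinI[OF smooth_on_has_derivative[OF smooth_slice[OF s] UNIV_I]]]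
        by (simp add: o_def W_def)
      then show "time_deriv (\<lambda>t x. \<Phi> s (X t x)) t x = W s x" by (simp add: time_deriv_def vector_derivative_at)
      show "\<Phi> s (X t x) = \<gamma> s x" by (simp add: \<gamma>_def)
    qed
  qed
  have cov: "cov_deriv \<Gamma> \<gamma> W 0 x = cov_deriv \<Gamma> X ?Z t x" if x: "x \<in> closure \<Omega>" for x
  proof -
    \<comment> \<open>Both partial time derivatives equal the derivative of \<open>f\<close> in the
      direction of the velocity, so only the Christoffel terms have to be compared, and these agree
      by symmetry.\<close>
    have "((\<lambda>s. W s x) has_vector_derivative frechet_derivative f (at (X t x)) (time_deriv X t x)) (at 0)"
      by (rule has_vector_derivative_transform_within_open[OF time_derivative_D\<Phi>, of ?I])
        (use \<delta> W in \<open>auto simp: abs_less_iff\<close>)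
    then have 1: "time_deriv W 0 x = frechet_derivative f (at (X t x)) (time_deriv X t x)"
      by (simp add: time_deriv_def vector_derivative_at)
    have "((\<lambda>t. f (X t x)) has_vector_derivative frechet_derivative f (at (X t x)) (time_deriv X t x)) (at t)"
      using vector_derivative_diff_chain_within[OF time_deriv[OF cD(1) t cD(3) x]
        has_derivative_at_withinI[OF smooth_on_has_derivative[OF f UNIV_I]]] by (simp add: o_def)
    then have 2: "time_deriv ?Z t x = frechet_derivative f (at (X t x)) (time_deriv X t x)"
      by (simp add: time_deriv_def vector_derivative_at)
    have "\<Gamma> (X t) (?Z t) (time_deriv X t) x = \<Gamma> (X t) (time_deriv X t) (?Z t) x"
      using fZ t by (intro torsion_free[OF Xt _ time_deriv_T_Diff[OF c t] x]) (simp add: field_along_def)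
    then show ?thesis by (simp add: cov_deriv_def 1 2 W0 \<gamma>0 \<gamma>'0)
  qed
  have "((\<lambda>s. GN (\<gamma> s) (W s) (W s)) has_real_derivative
      GN (\<gamma> 0) (cov_deriv \<Gamma> \<gamma> W 0) (W 0) + GN (\<gamma> 0) (W 0) (cov_deriv \<Gamma> \<gamma> W 0)) (at 0)"
    by (rule metric_compatible[OF c\<gamma> fW fW]) (use \<delta> in simp)
  moreover have "GN (\<gamma> 0) (W 0) (cov_deriv \<Gamma> \<gamma> W 0) = GN (X t) (time_deriv X t) (cov_deriv \<Gamma> X ?Z t)"
    unfolding \<gamma>0 W0 by (rule GN_cong[OF Xt]) (simp_all add: cov)
  ultimately show "((\<lambda>s. GN (\<lambda>x. \<Phi> s (X t x)) (W s) (W s)) has_real_derivative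
      2 * GN (X t) (time_deriv X t) (cov_deriv \<Gamma> X ?Z t)) (at 0)"
    using GN_commute[of "\<gamma> 0" "cov_deriv \<Gamma> \<gamma> W 0" "W 0"] by (simp add: \<gamma>_def[abs_def])
qed

text \<open>The pairing of the velocity with \<open>f\<close> along the curve is differentiated in
  two ways, in Eulerian form and by metric compatibility; comparing the results isolates the
  covariant acceleration.\<close>

lemma weak_momentum_equation:
  assumes c: "curve_in \<Omega> M J X" and t: "t \<in> J"
    and f: "smooth_on UNIV f" and K: "compact K" "K \<subseteq> \<Omega>" and off: "\<And>x. x \<notin> K \<Longrightarrow> f x = 0"
  shows "integral \<Omega> (\<lambda>x. \<rho> x * (A_op b \<rho> (eul (X t) (cov_deriv \<Gamma> X (time_deriv X) t)) x \<bullet> f x)) =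
    integral \<Omega> (\<lambda>x. \<rho> x * (momentum_rate (vel X) (mom X) t x \<bullet> f x))"
proof -
  note cd = curve_in_M_Diff[OF c] and cD = curve_inD[OF c] and op = open_domain
  have XM: "X s \<in> M" if "s \<in> J" for s by (rule cD(4)[OF that])
  note XD = M_Diff[OF XM]
  have nz: "\<rho> y \<noteq> 0" if "y \<in> \<Omega>" for y by (rule \<rho>_nonzero[OF XM[OF t] that])
  have "tangent_to_boundary \<Omega> f"
    using off K(2) by (auto simp: tangent_to_boundary_def frontier_eq subset_iff) (metis inner_zero_left)
  then obtain \<delta> \<Phi> where fl: "tangential_flow \<Omega> f \<delta> \<Phi>" using tangential_flow_exists[OF f K(1) off] by blast
  interpret tangential_flow \<Omega> f \<delta> \<Phi> by (rule fl)
  interpret lake_flow \<Omega> b \<rho>0 f \<delta> \<Phi> by unfold_locales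
  have fO: "smooth_on \<Omega> f" by (rule smooth_on_subset[OF f]) simp
  have fz: "f x = 0" if "x \<in> \<Omega> - K" for x using off that by simp
  let ?Z = "\<lambda>t x. f (X t x)"
  let ?u = "vel X t" and ?v = "mom X t"
  have us: "smooth_on \<Omega> (vel X s)" if "s \<in> J" for s by (rule eul_smooth(2)[OF cd that])
  have uu: "smooth_upto \<Omega> ?u" by (rule eul_smooth(1)[OF cd t])
  have inc: "\<rho> y * divg ?u y + ?u y \<bullet> grad b y = 0" if "y \<in> \<Omega>" for y
    by (rule incompressible_M[OF c t that])
  have eZ: "eul (X s) (?Z s) x = f x" if "s \<in> J" "x \<in> \<Omega>" for s x
    using Diff_inv(4)[OF XD[OF that(1)] in_closure[OF that(2)]] by (simp add: eul_eq)
  have pair: "GN (X s) Y (?Z s) = integral \<Omega> (\<lambda>x. \<rho> x * (A_op b \<rho> (eul (X s) Y) x \<bullet> f x))"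
    if s: "s \<in> J" and Y: "smooth_on \<Omega> (eul (X s) Y)" for s Y
  proof -
    have "GN (X s) Y (?Z s) = integral \<Omega> (gn_integrand b \<rho> (eul (X s) Y) f)"
      unfolding GN_M[OF XM[OF s]] by (rule integral_cong) (rule gn_integrand_cong[OF op], simp_all add: eZ[OF s])
    also have "\<dots> = integral \<Omega> (\<lambda>x. \<rho> x * (A_op b \<rho> (eul (X s) Y) x \<bullet> f x))"
      by (rule A_op_integral[OF Y fO nz K fz])
    finally show ?thesis .
  qed
  have vs: "smooth_on (J \<times> \<Omega>) (\<lambda>q. mom X (fst q) (snd q))" by (rule momentum_smooth[OF c t])
  have opJ: "open (J \<times> \<Omega>)" using cD(1) op by (rule open_Times)
  \<comment> \<open>The pairing in Eulerian form, after all derivatives have been moved from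
    \<open>f\<close> to the velocity. Time then enters only through the momentum, as \<rho> and
    \<open>f\<close> are fixed in space.\<close>
  define e where "e q = \<rho> (snd q) * (mom X (fst q) (snd q) \<bullet> f (snd q))" for q
  have es: "smooth_on (J \<times> \<Omega>) e"
    unfolding e_def[abs_def]
    by (intro smooth_on_mult smooth_on_inner opJ vs smooth_lift[OF cD(1) smooth_\<rho>] smooth_lift[OF cD(1) fO])
  have tv: "time_deriv (mom X) t x = frechet_derivative (\<lambda>q. mom X (fst q) (snd q)) (at (t, x)) (1, 0)" if "x \<in> \<Omega>" for x
    by (rule time_deriv_slice[OF vs]) (use that t in simp)
  have e': "frechet_derivative e (at (t, x)) (1, 0) = \<rho> x * (time_deriv (mom X) t x \<bullet> f x)" if x: "x \<in> \<Omega>" for x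
  proof -
    have q: "(t, x) \<in> J \<times> \<Omega>" using t x by simp
    have "((\<lambda>s. mom X s x) has_vector_derivative time_deriv (mom X) t x) (at t)"
      using time_slice_derivative[OF vs q] by (simp add: tv[OF x])
    from bounded_linear.has_vector_derivative[OF bounded_linear_inner_left this, of "f x"]
    have "((\<lambda>s. \<rho> x * (mom X s x \<bullet> f x)) has_real_derivative \<rho> x * (time_deriv (mom X) t x \<bullet> f x)) (at t)"
      by (intro DERIV_cmult) (simp add: has_real_derivative_iff_has_vector_derivative)
    then have "((\<lambda>s. e (s, x)) has_vector_derivative \<rho> x * (time_deriv (mom X) t x \<bullet> f x)) (at t)"
      by (simp add: e_def has_real_derivative_iff_has_vector_derivative)
    with time_slice_derivative[OF es q] show ?thesis by (rule vector_derivative_unique_at)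
  qed
  have "((\<lambda>s. integral \<Omega> (\<lambda>x. e (s, x))) has_real_derivative
      integral \<Omega> (\<lambda>x. frechet_derivative e (at (t, x)) (1, 0))) (at t)"
  proof (rule leibniz_compact[OF cD(1) t es K])
    show "(\<lambda>x. e (t, x)) integrable_on \<Omega>"
      by (rule compact_support_integrable[OF smooth_on_continuous_on[OF smooth_slice_space[OF es t op]] K(1) _ K(2)])
        (simp add: e_def fz)
  qed (simp add: e_def fz)
  moreover have "integral \<Omega> (\<lambda>x. frechet_derivative e (at (t, x)) (1, 0)) =
      integral \<Omega> (\<lambda>x. \<rho> x * (time_deriv (mom X) t x \<bullet> f x))" by (rule integral_cong) (rule e')
  moreover have eGN: "integral \<Omega> (\<lambda>x. e (s, x)) = GN (X s) (time_deriv X s) (?Z s)" if "s \<in> J" for s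
    using pair[OF that us[OF that]] by (simp add: e_def)
  ultimately have T1: "((\<lambda>s. GN (X s) (time_deriv X s) (?Z s)) has_real_derivative
      integral \<Omega> (\<lambda>x. \<rho> x * (time_deriv (mom X) t x \<bullet> f x))) (at t)"
    using has_field_derivative_transform_within_open[OF _ cD(1) t eGN] by simp
  have T2: "((\<lambda>s. GN (X s) (time_deriv X s) (?Z s)) has_real_derivative
      GN (X t) (cov_deriv \<Gamma> X (time_deriv X) t) (?Z t) + GN (X t) (time_deriv X t) (cov_deriv \<Gamma> X ?Z t)) (at t)"
    by (rule metric_compatible[OF cd field_along_time_deriv[OF cd] covariant_exchange(1)[OF cd t fl] t])
  define k where "k = (\<lambda>y. frechet_derivative f (at y) (?u y) - frechet_derivative ?u (at y) (f y))"
  define D where "D = (\<lambda>x. energy_rate ?u k (- (\<rho> x * divg f x + f x \<bullet> grad b x)) x)"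
  let ?E = "\<lambda>s. GN (\<lambda>x. \<Phi> s (X t x)) (\<lambda>x. frechet_derivative (\<Phi> s) (at (X t x)) (time_deriv X t x))
      (\<lambda>x. frechet_derivative (\<Phi> s) (at (X t x)) (time_deriv X t x))"
  let ?e = "\<lambda>s. integral \<Omega> (gn_integrand b (\<lambda>x. flow_density (s, x)) (\<lambda>x. flow_velocity ?u (s, x)) (\<lambda>x. flow_velocity ?u (s, x)))"
  \<comment> \<open>The energy of the deformed configuration sees only the transported density and
    velocity, to which the computed variation applies.\<close>
  have EE: "?e s = ?E s" if "s \<in> {-\<delta><..<\<delta>}" for s
  proof -
    have s: "\<bar>s\<bar> < \<delta>" "\<bar>- s\<bar> < \<delta>" using that by auto
    have U: "eul (\<lambda>x. \<Phi> s (X t x)) (\<lambda>x. frechet_derivative (\<Phi> s) (at (X t x)) (time_deriv X t x)) x = flow_velocity ?u (s, x)"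
      if x: "x \<in> \<Omega>" for x
    proof -
      have "\<Phi> (- s) x \<in> closure \<Omega>" by (rule in_closure[OF \<Phi>_domain[OF s(2) x]])
      then show ?thesis
        using flow_Diff(2)[OF XD[OF t] s(1) in_closure[OF x]] Diff_inv(4)[OF XD[OF t]]
        by (simp add: eul_eq flow_velocity_def)
    qed
    have R: "dens (\<lambda>x. \<Phi> s (X t x)) x = flow_density (s, x)" if x: "x \<in> \<Omega>" for x
      using dens_flow[OF XD[OF t] s(1) x] dens_M[OF XM[OF t] \<Phi>_domain[OF s(2) x]] by (simp add: flow_density_def)
    show ?thesis
      unfolding GN_metric_integrand
      by (rule integral_cong, rule gn_integrand_cong[OF op]) (simp_all add: U R)
  qed
  have "(?e has_real_derivative integral \<Omega> D) (at 0)"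
    unfolding D_def k_def
    by (rule energy_variation[OF us[OF t] K off], assumption,
      rule set_lebesgue_integral_eq_integral(1)[OF gn_integrand_integrable[OF uu uu]])
  then have "(?E has_real_derivative integral \<Omega> D) (at 0)"
    by (rule has_field_derivative_transform_within_open[of _ _ _ "{-\<delta><..<\<delta>}"]) (use \<delta> EE in auto)
  from DERIV_unique[OF this covariant_exchange(2)[OF cd t fl]]
  have ED: "integral \<Omega> D = 2 * GN (X t) (time_deriv X t) (cov_deriv \<Gamma> X ?Z t)" .
  \<comment> \<open>Half of the energy rate splits into three divergences, which integrate to 0 by
    compact support, and this part, linear in \<open>f\<close>, which supplies all spatial terms of
    the momentum equation with opposite sign.\<close>
  let ?g = "\<lambda>x. \<rho> x * (1/2 * (f x \<bullet> grad (\<lambda>y. ?u y \<bullet> ?u y) x) - frechet_derivative ?v (at x) (?u x) \<bullet> f x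
        - ?v x \<bullet> frechet_derivative ?u (at x) (f x))"
  let ?w1 = "\<lambda>y. (1/3 * (\<rho> y ^ 3 * divg ?u y) + 1/2 * (\<rho> y ^ 2 * (?u y \<bullet> grad b y))) *\<^sub>R k y"
  let ?w2 = "\<lambda>y. (- (1/2) * (?u y \<bullet> ?u y)) *\<^sub>R (\<rho> y *\<^sub>R f y)"
  let ?w3 = "\<lambda>y. (?v y \<bullet> f y) *\<^sub>R (\<rho> y *\<^sub>R ?u y)"
  have vts: "smooth_on \<Omega> ?v" by (rule A_op_smooth[OF us[OF t] nz])
  have ks: "smooth_on \<Omega> k" unfolding k_def by (intro smooth_on_diff smooth_on_derivative_apply op fO us[OF t])
  have dz: "frechet_derivative f (at x) = (\<lambda>h. 0)" if "x \<in> \<Omega> - K" for x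
    using frechet_derivative_cong_open[of "- K" x f "\<lambda>x. 0"] K(1) off that by (simp add: open_Compl compact_imp_closed)
  have kz: "k x = 0" if "x \<in> \<Omega> - K" for x
    using linear_0[OF has_derivative_linear[OF smooth_on_has_derivative[OF us[OF t], of x]]] that
    by (simp add: k_def dz[OF that] fz[OF that])
  have z1: "(divg ?w1 has_integral 0) \<Omega>"
    by (rule integral_divergence_zero[OF _ K]) (intro smooth_on_scaleR smooth_on_add smooth_on_mult smooth_on_const smooth_on_power
      smooth_on_divg smooth_on_inner op smooth_\<rho> us[OF t] smooth_grad_b ks, simp add: kz)
  have z2: "(divg ?w2 has_integral 0) \<Omega>"
    by (rule integral_divergence_zero[OF _ K]) (intro smooth_on_scaleR smooth_on_mult smooth_on_const smooth_on_inner op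
      smooth_\<rho> us[OF t] fO, simp add: fz)
  have z3: "(divg ?w3 has_integral 0) \<Omega>"
    by (rule integral_divergence_zero[OF _ K]) (intro smooth_on_scaleR smooth_on_inner op smooth_\<rho> us[OF t] vts fO, simp add: fz)
  have gs: "smooth_on \<Omega> ?g"
    by (intro smooth_on_mult smooth_on_diff smooth_on_const smooth_on_inner smooth_on_grad smooth_on_derivative_apply op
      smooth_\<rho> us[OF t] vts fO)
  have gz: "?g x = 0" if "x \<in> \<Omega> - K" for x
    using linear_0[OF has_derivative_linear[OF smooth_on_has_derivative[OF us[OF t], of x]]] that
    by (simp add: fz[OF that])
  have gi: "?g integrable_on \<Omega>"
    by (rule compact_support_integrable[OF smooth_on_continuous_on[OF gs] K(1) gz K(2)])
  have "((\<lambda>x. 1/2 * D x) has_integral integral \<Omega> ?g) \<Omega>"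
  proof (rule has_integral_eq)
    show "((\<lambda>x. divg ?w1 x + divg ?w2 x + divg ?w3 x + ?g x) has_integral integral \<Omega> ?g) \<Omega>"
      using has_integral_add[OF has_integral_add[OF has_integral_add[OF z1 z2] z3] integrable_integral[OF gi]] by simp
    show "divg ?w1 x + divg ?w2 x + divg ?w3 x + ?g x = 1/2 * D x" if "x \<in> \<Omega>" for x
      unfolding D_def k_def by (rule energy_rate_divergence[OF us[OF t] fO that nz inc, symmetric])
  qed
  then have "integral \<Omega> (\<lambda>x. 1/2 * D x) = integral \<Omega> ?g" by (rule integral_unique)
  then have hD: "GN (X t) (time_deriv X t) (cov_deriv \<Gamma> X ?Z t) = integral \<Omega> ?g" using ED by simp
  have ti: "(\<lambda>x. \<rho> x * (time_deriv (mom X) t x \<bullet> f x)) integrable_on \<Omega>"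
  proof (rule compact_support_integrable[OF _ K(1) _ K(2)])
    have "smooth_on \<Omega> (\<lambda>x. frechet_derivative e (at (t, x)) (1, 0))"
      by (rule smooth_slice_space[OF smooth_on_derivative_dir[OF es] t op])
    from smooth_on_continuous_on[OF this] show "continuous_on \<Omega> (\<lambda>x. \<rho> x * (time_deriv (mom X) t x \<bullet> f x))"
      by (rule continuous_on_eq) (rule e')
  qed (simp add: fz)
  have eta: "smooth_on \<Omega> (eul (X t) (cov_deriv \<Gamma> X (time_deriv X) t))"
    using cov_deriv_field[OF cd field_along_time_deriv[OF cd]] t
    by (intro smooth_upto_smooth_on[OF op] T_Diff_smooth(1)[OF XD[OF t]]) (simp add: field_along_def)
  have "integral \<Omega> (\<lambda>x. \<rho> x * (A_op b \<rho> (eul (X t) (cov_deriv \<Gamma> X (time_deriv X) t)) x \<bullet> f x)) =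
      integral \<Omega> (\<lambda>x. \<rho> x * (time_deriv (mom X) t x \<bullet> f x)) - integral \<Omega> ?g"
    using DERIV_unique[OF T1 T2] hD pair[OF t eta] by simp
  also have "\<dots> = integral \<Omega> (\<lambda>x. \<rho> x * (time_deriv (mom X) t x \<bullet> f x) - ?g x)"
    by (rule integral_diff[OF ti gi, symmetric])
  also have "\<dots> = integral \<Omega> (\<lambda>x. \<rho> x * (momentum_rate (vel X) (mom X) t x \<bullet> f x))"
  proof (rule integral_cong)
    fix x assume x: "x \<in> \<Omega>"
    show "\<rho> x * (time_deriv (mom X) t x \<bullet> f x) - ?g x = \<rho> x * (momentum_rate (vel X) (mom X) t x \<bullet> f x)"
      using transpose_jacobian_inner[OF smooth_on_differentiable[OF us[OF t] x], of "?v x" "f x"]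
      by (simp add: momentum_rate_def power2_norm_eq_inner inner_add_left inner_diff_left inner_commute algebra_simps)
  qed
  finally show ?thesis .
qed

text \<open>Removing the test field requires continuity of both sides, hence smoothness of each term
  of the momentum rate. The weight \<rho> is cancelled at the end because it has no zero.\<close>

theorem momentum_equation:
  assumes c: "curve_in \<Omega> M J X" and t: "t \<in> J" and x: "x \<in> \<Omega>"
  shows "A_op b \<rho> (eul (X t) (cov_deriv \<Gamma> X (time_deriv X) t)) x = momentum_rate (vel X) (mom X) t x"
proof -
  note cd = curve_in_M_Diff[OF c] and cD = curve_inD[OF c] and op = open_domain
  note XD = M_Diff[OF cD(4)[OF t]]
  have nz: "\<rho> y \<noteq> 0" if "y \<in> \<Omega>" for y by (rule \<rho>_nonzero[OF cD(4)[OF t] that])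
  define \<eta> where "\<eta> = eul (X t) (cov_deriv \<Gamma> X (time_deriv X) t)"
  have \<eta>: "smooth_on \<Omega> \<eta>"
    unfolding \<eta>_def using cov_deriv_field[OF cd field_along_time_deriv[OF cd]] t
    by (intro smooth_upto_smooth_on[OF op] T_Diff_smooth(1)[OF XD]) (simp add: field_along_def)
  have us: "smooth_on \<Omega> (vel X t)" by (rule eul_smooth(2)[OF cd t])
  have vs: "smooth_on (J \<times> \<Omega>) (\<lambda>q. mom X (fst q) (snd q))" by (rule momentum_smooth[OF c t])
  have vts: "smooth_on \<Omega> (mom X t)" by (rule A_op_smooth[OF us nz])
  have As: "smooth_on \<Omega> (A_op b \<rho> \<eta>)" by (rule A_op_smooth[OF \<eta> nz])
  have tv: "smooth_on \<Omega> (time_deriv (mom X) t)"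
    by (rule smooth_on_cong[OF op, THEN iffD1, OF _ smooth_slice_space[OF smooth_on_derivative_dir[OF vs, of "(1, 0)"] t op]])
      (simp add: time_deriv_slice[OF vs] t)
  have tr: "smooth_on \<Omega> (\<lambda>y. transpose (jacobian (vel X t) (at y)) *v mom X t y)"
  proof (rule smooth_on_vec[OF op])
    show "smooth_on \<Omega> (\<lambda>y. (transpose (jacobian (vel X t) (at y)) *v mom X t y) $ i)" for i
      unfolding matrix_vector_mult_def transpose_def vec_lambda_beta sum_2 jacobian_nth
      by (intro smooth_on_add smooth_on_mult smooth_on_vec_nth smooth_on_derivative_dir op us vts)
  qed
  have ms: "smooth_on \<Omega> (momentum_rate (vel X) (mom X) t)"
    unfolding momentum_rate_def[abs_def] power2_norm_eq_inner
    by (intro smooth_on_add smooth_on_diff smooth_on_scaleR smooth_on_const smooth_on_grad smooth_on_inner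
      smooth_on_derivative_apply op us vts tv tr)
  define c where "c y = \<rho> y *\<^sub>R (A_op b \<rho> \<eta> y - momentum_rate (vel X) (mom X) t y)" for y
  have cs: "smooth_on \<Omega> c" unfolding c_def[abs_def] by (intro smooth_on_scaleR smooth_on_diff op smooth_\<rho> As ms)
  have "c x = 0"
  proof (rule fundamental_lemma[OF smooth_on_continuous_on[OF cs] x])
    fix \<zeta> K assume z: "smooth_on UNIV \<zeta>" "compact K" "K \<subseteq> \<Omega>" "\<And>x. x \<notin> K \<Longrightarrow> \<zeta> x = (0::vec2)"
    have zO: "smooth_on \<Omega> \<zeta>" by (rule smooth_on_subset[OF z(1)]) simp
    have i: "(\<lambda>y. \<rho> y * (g y \<bullet> \<zeta> y)) integrable_on \<Omega>" if "smooth_on \<Omega> g" for g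
      by (rule compact_support_integrable[OF smooth_on_continuous_on z(2) _ z(3)])
        (intro smooth_on_mult smooth_on_inner op smooth_\<rho> that zO, simp add: z(4))
    have "integral \<Omega> (\<lambda>y. c y \<bullet> \<zeta> y) =
        integral \<Omega> (\<lambda>y. \<rho> y * (A_op b \<rho> \<eta> y \<bullet> \<zeta> y) - \<rho> y * (momentum_rate (vel X) (mom X) t y \<bullet> \<zeta> y))"
      by (rule integral_cong) (simp add: c_def inner_diff_left right_diff_distrib)
    also have "\<dots> = 0"
      using integral_diff[OF i[OF As] i[OF ms]] weak_momentum_equation[OF assms(1) t z] by (simp add: \<eta>_def)
    finally show "integral \<Omega> (\<lambda>y. c y \<bullet> \<zeta> y) = 0" .
  qed
  then show ?thesis using nz[OF x] by (simp add: c_def \<eta>_def)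
qed

end

section \<open>The limit system\<close>

context lake_connection
begin

lemma cov_deriv_T_Diff:
  assumes "curve_in \<Omega> M J X" "t \<in> J"
  shows "cov_deriv \<Gamma> X (time_deriv X) t \<in> T_Diff \<Omega> (X t)"
  using cov_deriv_field[OF curve_in_M_Diff field_along_time_deriv[OF curve_in_M_Diff]] assms
  by (simp add: field_along_def)

lemma N_M_cong:
  assumes X: "X \<in> Diff \<Omega>" and Y: "Y \<in> N_M \<Omega> b \<rho>0 X" and eq: "\<And>x. x \<in> closure \<Omega> \<Longrightarrow> Y x = Y' x"
  shows "Y' \<in> N_M \<Omega> b \<rho>0 X"
proof -
  have "A_op b (dens X) (eul X Y) x = A_op b (dens X) (eul X Y') x" if "x \<in> \<Omega>" for x
    by (rule A_op_cong[OF open_domain that]) (simp_all add: eul_eq eq Diff_inv(2)[OF X in_closure])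
  moreover have "Y' \<in> T_Diff \<Omega> X" by (rule T_Diff_cong[of Y]) (use Y eq in \<open>auto simp: N_M_def\<close>)
  ultimately show ?thesis using Y by (auto simp: N_M_def)
qed

text \<open>Tangency of the covariant acceleration comes from the connection axioms, so membership
  in the normal space amounts to its image under A being a gradient.\<close>

lemma geodesic_iff_momentum:
  "geodesic_on_M \<Omega> b \<rho>0 \<Gamma> J X \<longleftrightarrow> curve_in \<Omega> M J X \<and>
    (\<forall>t\<in>J. \<exists>\<phi>. smooth_upto \<Omega> \<phi> \<and> (\<forall>x\<in>\<Omega>. momentum_rate (vel X) (mom X) t x = grad \<phi> x))"
proof (cases "curve_in \<Omega> M J X")
  case c: True
  have "A_op b (dens (X t)) (eul (X t) (cov_deriv \<Gamma> X (time_deriv X) t)) x = momentum_rate (vel X) (mom X) t x"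
    if t: "t \<in> J" and x: "x \<in> \<Omega>" for t x
    unfolding momentum_equation[OF c t x, symmetric]
    by (rule A_op_cong[OF open_domain x dens_M[OF curve_inD(4)[OF c t]]]) simp_all
  then show ?thesis
    using c cov_deriv_T_Diff[OF c] by (simp add: geodesic_on_M_def N_M_def)
qed (simp add: geodesic_on_M_def)

text \<open>For every curve in \<open>M\<close> the last three Great Lake equations and the
  smoothness requirements on u and v hold automatically; only the momentum equation distinguishes
  geodesics.\<close>

lemma geodesic_iff_great_lake:
  assumes c: "curve_in \<Omega> M J X"
  shows "geodesic_on_M \<Omega> b \<rho>0 \<Gamma> J X \<longleftrightarrow> solves_great_lake \<Omega> b \<rho>0 J X"
proof -
  have u: "smooth_on (J \<times> \<Omega>) (\<lambda>(t, x). vel X t x)"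
    using velocity_smooth[OF curve_in_M_Diff[OF c]] by (simp add: split_def)
  have v: "smooth_on (J \<times> \<Omega>) (\<lambda>(t, x). mom X t x)"
  \<comment> \<open>Smoothness of the momentum needs \<rho> without zeros, which is known only from
    a point of \<open>M\<close>. An empty time interval supplies none, but every function is smooth
    on the empty set.\<close>
  proof (cases "J = {}")
    case True
    have "Ck_on k {} (f :: real \<times> vec2 \<Rightarrow> vec2)" for k f by (induction k arbitrary: f) auto
    then show ?thesis using True by (simp add: smooth_on_def)
  next
    case False then show ?thesis using momentum_smooth[OF c] by (auto simp: split_def)
  qed
  have inc: "\<rho> x * divg (vel X t) x + vel X t x \<bullet> grad b x = 0" if "t \<in> J" "x \<in> \<Omega>" for t x
    using incompressible_M[OF c that] .
  have us: "smooth_on \<Omega> (vel X t)" if "t \<in> J" for t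
    by (rule eul_smooth(2)[OF curve_in_M_Diff[OF c] that])
  have A: "mom X t x = vel X t x + (1/6 * (\<rho> x)\<^sup>2) *\<^sub>R grad (divg (vel X t)) x" if "t \<in> J" "x \<in> \<Omega>" for t x
    by (rule A_op_incompressible[OF us[OF that(1)] that(2) \<rho>_nonzero[OF curve_inD(4)[OF c that(1)] that(2)] inc[OF that(1)]])
  have d: "divg (\<lambda>y. \<rho> y *\<^sub>R vel X t y) x = 0" if "t \<in> J" "x \<in> \<Omega>" for t x
    using divg_\<rho>[OF us[OF that(1)] that(2)] inc[OF that] by simp
  have P: "(time_deriv (mom X) t x + frechet_derivative (mom X t) (at x) (vel X t x)
        + transpose (jacobian (vel X t) (at x)) *v mom X t x - (1/2) *\<^sub>R grad (\<lambda>y. (norm (vel X t y))\<^sup>2) x = grad \<phi> x \<and>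
      mom X t x = vel X t x + (1/6 * (\<rho> x)\<^sup>2) *\<^sub>R grad (divg (vel X t)) x \<and>
      divg (\<lambda>y. \<rho> y *\<^sub>R vel X t y) x = 0 \<and> \<rho> x = H + b x) \<longleftrightarrow> momentum_rate (vel X) (mom X) t x = grad \<phi> x"
    if "t \<in> J" "x \<in> \<Omega>" for t x \<phi>
  proof -
    have "\<rho> x = H + b x" by (simp add: \<rho>_def)
    then show ?thesis unfolding momentum_rate_def using A[OF that] d[OF that] by blast
  qed
  have "solves_great_lake \<Omega> b \<rho>0 J X \<longleftrightarrow> great_lake \<Omega> b H J (vel X) \<rho> (mom X)"
    by (simp add: solves_great_lake_def Let_def H_def \<rho>_def)
  also have "\<dots> \<longleftrightarrow> (\<exists>\<phi>. (\<forall>t\<in>J. smooth_upto \<Omega> (\<phi> t)) \<and>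
      (\<forall>t\<in>J. \<forall>x\<in>\<Omega>. momentum_rate (vel X) (mom X) t x = grad (\<phi> t) x))"
    unfolding great_lake_def by (simp only: P u v simp_thms cong: ball_cong)
  \<comment> \<open>The potentials are chosen time by time; no regularity in time is claimed for
    them.\<close>
  also have "\<dots> \<longleftrightarrow> geodesic_on_M \<Omega> b \<rho>0 \<Gamma> J X"
    unfolding geodesic_iff_momentum using c by (auto simp: bchoice_iff; meson)
  finally show ?thesis ..
qed

text \<open>Any gradient of a constant function vanishes on the closure and can be removed from the
  normality condition; conversely, the zero field is a gradient and supplies the required
  \<open>G\<close>.\<close>

lemma takens_limit_iff_geodesic:
  assumes V: "\<And>Y Z. Y \<in> M \<Longrightarrow> Z \<in> M \<Longrightarrow> V Y = V Z"
  shows "takens_limit \<Omega> b \<rho>0 \<Gamma> V J X \<longleftrightarrow> geodesic_on_M \<Omega> b \<rho>0 \<Gamma> J X"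
proof
  assume l: "takens_limit \<Omega> b \<rho>0 \<Gamma> V J X"
  then have c: "curve_in \<Omega> M J X" by (simp add: takens_limit_def)
  have "cov_deriv \<Gamma> X (time_deriv X) t \<in> N_M \<Omega> b \<rho>0 (X t)" if t: "t \<in> J" for t
  proof -
    have Xt: "X t \<in> M" by (rule curve_inD(4)[OF c t])
    obtain G where G: "is_gradient \<Omega> b \<rho>0 M (T_M \<Omega> \<rho>0 (X t)) V (X t) G"
      "(\<lambda>x. cov_deriv \<Gamma> X (time_deriv X) t x + G x) \<in> N_M \<Omega> b \<rho>0 (X t)"
      using l t by (auto simp: takens_limit_def)
    show ?thesis
      by (rule N_M_cong[OF M_Diff[OF Xt] G(2)]) (simp add: gradient_constant_M[OF Xt V G(1)])
  qed
  with c show "geodesic_on_M \<Omega> b \<rho>0 \<Gamma> J X" by (simp add: geodesic_on_M_def)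
next
  assume g: "geodesic_on_M \<Omega> b \<rho>0 \<Gamma> J X"
  have "is_gradient \<Omega> b \<rho>0 M (T_M \<Omega> \<rho>0 (X t)) V (X t) (\<lambda>_. 0)" if Xt: "X t \<in> M" for t
    unfolding is_gradient_def
  proof (intro conjI allI impI)
    have "(\<lambda>_. 0) \<in> T_Diff \<Omega> (X t)"
      unfolding T_Diff_def
      by (intro CollectI exI[of _ "\<lambda>_. 0"])
        (auto simp: tangent_to_boundary_def smooth_upto_def intro!: exI[of _ "\<lambda>_. 0"] smooth_on_const)
    moreover have "divg (\<lambda>_. 0) x = 0" for x
      by (simp add: divg_def trace_def jacobian_def matrix_def)
    ultimately show "(\<lambda>_. 0) \<in> T_M \<Omega> \<rho>0 (X t)" by (simp add: T_M_def eul_eq)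
    fix J' \<gamma> assume J': "0 \<in> J' \<and> curve_in \<Omega> M J' \<gamma> \<and> (\<forall>x\<in>closure \<Omega>. \<gamma> 0 x = X t x)"
    then have cD: "open J'" "0 \<in> J'" "\<And>s. s \<in> J' \<Longrightarrow> \<gamma> s \<in> M" using curve_inD[of M J' \<gamma>] by blast+
    have "((\<lambda>s. V (\<gamma> s)) has_real_derivative 0) (at 0)"
      by (rule has_field_derivative_transform_within_open[OF DERIV_const[of "V (X t)"] cD(1,2)])
        (rule V[OF Xt cD(3)])
    then show "((\<lambda>s. V (\<gamma> s)) has_real_derivative GN (X t) (\<lambda>_. 0) (time_deriv \<gamma> 0)) (at 0)"
      using GN_zero_left[OF M_Diff[OF Xt]] by simp
  qed
  then show "takens_limit \<Omega> b \<rho>0 \<Gamma> V J X"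
    using g curve_inD(4)[of M J X] unfolding takens_limit_def geodesic_on_M_def
    by (intro conjI ballI exI[of _ "\<lambda>_. 0"]) auto
qed

text \<open>The labels follow a rule that depends on the multiplicity function alone, so equal
  multiplicities at two points give equal index sets and eigenvalues. The potentials then agree as
  formal sums, whether or not the series converges.\<close>

lemma labelling_constant_M:
  assumes "eigenvalue_labelling \<Omega> b \<rho>0 \<Gamma> I lam" "X \<in> M" "Y \<in> M"
  shows "I X = I Y \<and> (\<forall>i\<in>I X. lam X i = lam Y i) \<and>
    homogenized_potential I lam c X = homogenized_potential I lam c Y"
proof -
  have "eig_mult \<Omega> b \<rho>0 \<Gamma> X = eig_mult \<Omega> b \<rho>0 \<Gamma> Y"
    by (rule ext) (rule eig_mult_M[OF assms(2,3)])
  then have "I X = I Y" "\<forall>i\<in>I X. lam X i = lam Y i" using assms unfolding eigenvalue_labelling_def by blast+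
  then show ?thesis by (auto simp: homogenized_potential_def intro: infsum_cong)
qed

end

theorem proposition6p6:
  fixes \<Omega> :: "(real ^ 2) set"
    and b \<rho>0 :: "real ^ 2 \<Rightarrow> real"
    and \<Gamma> :: "vmap \<Rightarrow> vmap \<Rightarrow> vmap \<Rightarrow> vmap"
  assumes "smooth_bounded_domain \<Omega>"
    and "smooth_upto \<Omega> b" and "\<forall>x\<in>\<Omega>. 0 < b x"
    and "smooth_upto \<Omega> \<rho>0" and "\<forall>x\<in>\<Omega>. 0 < \<rho>0 x"
    and "levi_civita \<Omega> b \<rho>0 \<Gamma>"
  shows
    "(\<forall>J X. geodesic_on_M \<Omega> b \<rho>0 \<Gamma> J X \<longrightarrow> solves_great_lake \<Omega> b \<rho>0 J X) \<and>
     (\<forall>X\<in>M_crit \<Omega> b \<rho>0. \<forall>Y\<in>M_crit \<Omega> b \<rho>0. \<forall>\<mu>.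
        eig_mult \<Omega> b \<rho>0 \<Gamma> X \<mu> = eig_mult \<Omega> b \<rho>0 \<Gamma> Y \<mu>) \<and>
     (\<forall>(I :: vmap \<Rightarrow> nat set) (lam :: vmap \<Rightarrow> nat \<Rightarrow> real) (c :: nat \<Rightarrow> real).
        eigenvalue_labelling \<Omega> b \<rho>0 \<Gamma> I lam \<and> (\<forall>i. 0 \<le> c i) \<longrightarrow>
        (let V = homogenized_potential I lam c in
          (\<forall>X\<in>M_crit \<Omega> b \<rho>0. \<forall>Y\<in>M_crit \<Omega> b \<rho>0.
             I X = I Y \<and> (\<forall>i\<in>I X. lam X i = lam Y i) \<and> V X = V Y) \<and>
          (\<forall>J X. takens_limit \<Omega> b \<rho>0 \<Gamma> V J X \<longleftrightarrow> geodesic_on_M \<Omega> b \<rho>0 \<Gamma> J X) \<and>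
          (\<forall>J X. curve_in \<Omega> (M_crit \<Omega> b \<rho>0) J X \<longrightarrow>
             (takens_limit \<Omega> b \<rho>0 \<Gamma> V J X \<longleftrightarrow> solves_great_lake \<Omega> b \<rho>0 J X))))"
proof -
  interpret lake_connection \<Omega> b \<rho>0 \<Gamma>
    using assms by (intro lake_connection.intro lake.intro smooth_domain.intro lake_axioms.intro
      lake_connection_axioms.intro) auto
  show ?thesis
  proof (intro conjI allI ballI impI)
    show "solves_great_lake \<Omega> b \<rho>0 J X" if "geodesic_on_M \<Omega> b \<rho>0 \<Gamma> J X" for J X
      using that geodesic_iff_great_lake[of J X] by (simp add: geodesic_on_M_def)
    show "eig_mult \<Omega> b \<rho>0 \<Gamma> X \<mu> = eig_mult \<Omega> b \<rho>0 \<Gamma> Y \<mu>" if "X \<in> M" "Y \<in> M" for X Y \<mu>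
      by (rule eig_mult_M[OF that])
    fix I lam and c :: "nat \<Rightarrow> real"
    assume l: "eigenvalue_labelling \<Omega> b \<rho>0 \<Gamma> I lam \<and> (\<forall>i. 0 \<le> c i)"
    note const = labelling_constant_M[OF conjunct1[OF l]]
    have tk: "takens_limit \<Omega> b \<rho>0 \<Gamma> (homogenized_potential I lam c) J X \<longleftrightarrow> geodesic_on_M \<Omega> b \<rho>0 \<Gamma> J X" for J X
      by (rule takens_limit_iff_geodesic) (use const in blast)
    show "let V = homogenized_potential I lam c in
        (\<forall>X\<in>M. \<forall>Y\<in>M. I X = I Y \<and> (\<forall>i\<in>I X. lam X i = lam Y i) \<and> V X = V Y) \<and>
        (\<forall>J X. takens_limit \<Omega> b \<rho>0 \<Gamma> V J X \<longleftrightarrow> geodesic_on_M \<Omega> b \<rho>0 \<Gamma> J X) \<and>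
        (\<forall>J X. curve_in \<Omega> M J X \<longrightarrow> (takens_limit \<Omega> b \<rho>0 \<Gamma> V J X \<longleftrightarrow> solves_great_lake \<Omega> b \<rho>0 J X))"
      unfolding Let_def tk using const geodesic_iff_great_lake by blast
  qed
qed

end
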